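(* Let $d\ge1$, $n\in\mathbb{N}^d$, and let $\Lambda\subset\mathbb{R}^{2d}$ be a lattice with adjoint lattice $\Lambda^0$. Then $\Gamma_\Lambda$ is an interpolating sequence for $\mathbf{F}^n(\mathbb{C}^d)$ if and only if $\Gamma_{\Lambda^0}$ is a multiple sampling sequence of multiplicity $K_n$ for the Fock space $\mathcal{F}(\mathbb{C}^d)$.
   Context: Notation: $|m|=\sum m_j$, $m!=\prod m_j!$, $z^m=\prod z_j^{m_j}$, $\bar z^m=\prod\bar z_j^{m_j}$, $|z|^2=\sum|z_j|^2$, $\bar z\cdot\zeta=\sum\bar z_j\zeta_j$; $K_n=\{k\in\mathbb{N}_0^d:0\le k_j\le n_j-1\ \forall j\}$. Fock space $\mathcal{F}(\mathbb{C}^d)$: entire $F$ with $\|F\|^2=\int_{\mathbb{C}^d}|F|^2e^{-\pi|z|^2}dz<\infty$, inner product $\langle F,G\rangle=\int F\bar Ge^{-\pi|z|^2}dz$; $e_k(z)=(\pi^{|k|}/k!)^{1/2}z^k$; $\beta_zF(\zeta)=e^{\pi\bar z\cdot\zeta-\frac{\pi}{2}|z|^2}F(\zeta-z)$. Polyanalytic Fock space $\mathbf{F}^n(\mathbb{C}^d)$: functions $F(z)=\sum_{k\in K_n}\bar z^k\varphi_k(z)$, $\varphi_k$ entire, with $\int|F|^2e^{-\pi|z|^2}dz<\infty$. A lattice is $\Lambda=A\mathbb{Z}^{2d}$, $A$ invertible; with $\pi_{(x,\omega)}=M_\omega T_x$ ($T_xf(t)=f(t-x)$, $M_\omega f(t)=e^{2\pi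 i\omega\cdot t}f(t)$), the adjoint lattice is $\Lambda^0=\{\mu:\pi_\lambda\pi_\mu=\pi_\mu\pi_\lambda\ \forall\lambda\in\Lambda\}$. $\Gamma_\Lambda=\{x+i\omega:(x,\omega)\in\Lambda\}$. $\Gamma$ is an interpolating sequence for $\mathbf{F}^n(\mathbb{C}^d)$ if for every $(\alpha_z)_{z\in\Gamma}\in\ell^2$ there is $F\in\mathbf{F}^n(\mathbb{C}^d)$ with $e^{-\frac{\pi}{2}|z|^2}F(z)=\alpha_z$ for all $z\in\Gamma$. $\Gamma$ is a multiple sampling sequence of multiplicity $K_n$ for $\mathcal{F}(\mathbb{C}^d)$ if there are $A,B>0$ with $A\|F\|^2\le\sum_{z\in\Gamma}\sum_{k\in K_n}|\langle F,\beta_ze_k\rangle|^2\le B\|F\|^2$ for all $F\in\mathcal{F}(\mathbb{C}^d)$. *)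

theory Defs
  imports "HOL-Analysis.Analysis"
begin

definition entire_fun :: "(complex ^ 'd \<Rightarrow> complex) \<Rightarrow> bool" where
  "entire_fun F \<longleftrightarrow> (\<forall>z. \<exists>D. (F has_derivative D) (at z) \<and> (\<forall>c h. D (c *s h) = c * D h))"

definition gauss_L2 :: "(complex ^ 'd \<Rightarrow> complex) \<Rightarrow> bool" where
  "gauss_L2 F \<longleftrightarrow> integrable lborel (\<lambda>z. (cmod (F z))\<^sup>2 * exp (- pi * (norm z)\<^sup>2))"

definition fock_space :: "(complex ^ 'd \<Rightarrow> complex) set" where
  "fock_space = {F. entire_fun F \<and> gauss_L2 F}"

definition fock_inner :: "(complex ^ 'd \<Rightarrow> complex) \<Rightarrow> (complex ^ 'd \<Rightarrow> complex) \<Rightarrow> complex" where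
  "fock_inner F G = integral\<^sup>L lborel (\<lambda>z. F z * cnj (G z) * complex_of_real (exp (- pi * (norm z)\<^sup>2)))"

definition fock_norm2 :: "(complex ^ 'd \<Rightarrow> complex) \<Rightarrow> real" where
  "fock_norm2 F = integral\<^sup>L lborel (\<lambda>z. (cmod (F z))\<^sup>2 * exp (- pi * (norm z)\<^sup>2))"

definition Kset :: "nat ^ 'd \<Rightarrow> (nat ^ 'd) set" where
  "Kset n = {k. \<forall>j. k $ j < n $ j}"

definition mpow :: "complex ^ 'd \<Rightarrow> nat ^ 'd \<Rightarrow> complex" where
  "mpow z k = (\<Prod>j\<in>UNIV. (z $ j) ^ (k $ j))"

definition mconj :: "complex ^ 'd \<Rightarrow> complex ^ 'd" where
  "mconj z = (\<chi> j. cnj (z $ j))"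

definition mabs :: "nat ^ 'd \<Rightarrow> nat" where
  "mabs k = (\<Sum>j\<in>UNIV. k $ j)"

definition mfact :: "nat ^ 'd \<Rightarrow> nat" where
  "mfact k = (\<Prod>j\<in>UNIV. fact (k $ j))"

definition cdot_conj :: "complex ^ 'd \<Rightarrow> complex ^ 'd \<Rightarrow> complex" where
  "cdot_conj z w = (\<Sum>j\<in>UNIV. cnj (z $ j) * w $ j)"

text \<open>Monomial orthonormal basis e_k.\<close>
definition ek :: "nat ^ 'd \<Rightarrow> complex ^ 'd \<Rightarrow> complex" where
  "ek k z = complex_of_real (sqrt (pi ^ mabs k / real (mfact k))) * mpow z k"

definition beta_op :: "complex ^ 'd \<Rightarrow> (complex ^ 'd \<Rightarrow> complex) \<Rightarrow> complex ^ 'd \<Rightarrow> complex" where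
  "beta_op z F \<zeta> = exp (complex_of_real pi * cdot_conj z \<zeta> - complex_of_real (pi / 2 * (norm z)\<^sup>2)) * F (\<zeta> - z)"

definition polyfock :: "nat ^ 'd \<Rightarrow> (complex ^ 'd \<Rightarrow> complex) set" where
  "polyfock n = {F. (\<exists>\<phi>. (\<forall>k\<in>Kset n. entire_fun (\<phi> k)) \<and>
                       (\<forall>z. F z = (\<Sum>k\<in>Kset n. mpow (mconj z) k * \<phi> k z))) \<and> gauss_L2 F}"

definition lattice :: "((real ^ 'd) \<times> (real ^ 'd) \<Rightarrow> (real ^ 'd) \<times> (real ^ 'd)) \<Rightarrow> ((real ^ 'd) \<times> (real ^ 'd)) set" where
  "lattice A = A ` {(a, b). \<forall>j. a $ j \<in> \<int> \<and> b $ j \<in> \<int>}"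

definition tf_shift :: "(real ^ 'd) \<times> (real ^ 'd) \<Rightarrow> (real ^ 'd \<Rightarrow> complex) \<Rightarrow> real ^ 'd \<Rightarrow> complex" where
  "tf_shift l f t = exp (2 * pi * \<i> * complex_of_real (snd l \<bullet> t)) * f (t - fst l)"

definition adjoint_lattice :: "((real ^ 'd) \<times> (real ^ 'd)) set \<Rightarrow> ((real ^ 'd) \<times> (real ^ 'd)) set" where
  "adjoint_lattice \<Lambda> = {m. \<forall>l\<in>\<Lambda>. tf_shift l \<circ> tf_shift m = tf_shift m \<circ> tf_shift l}"

definition Gamma_set :: "((real ^ 'd) \<times> (real ^ 'd)) set \<Rightarrow> (complex ^ 'd) set" where
  "Gamma_set \<Lambda> = (\<lambda>(x, \<omega>). \<chi> j. Complex (x $ j) (\<omega> $ j)) ` \<Lambda>"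

definition interpolating :: "nat ^ 'd \<Rightarrow> (complex ^ 'd) set \<Rightarrow> bool" where
  "interpolating n \<Gamma> \<longleftrightarrow>
     (\<forall>\<alpha> :: complex ^ 'd \<Rightarrow> complex. (\<lambda>z. (cmod (\<alpha> z))\<^sup>2) summable_on \<Gamma> \<longrightarrow>
        (\<exists>F\<in>polyfock n. \<forall>z\<in>\<Gamma>. complex_of_real (exp (- pi / 2 * (norm z)\<^sup>2)) * F z = \<alpha> z))"

definition multiple_sampling :: "nat ^ 'd \<Rightarrow> (complex ^ 'd) set \<Rightarrow> bool" where
  "multiple_sampling n \<Gamma> \<longleftrightarrow>
     (\<exists>A B. A > 0 \<and> B > 0 \<and>
       (\<forall>F\<in>fock_space.
          (\<lambda>z. \<Sum>k\<in>Kset n. (cmod (fock_inner F (beta_op z (ek k))))\<^sup>2) summable_on \<Gamma> \<and>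
          A * fock_norm2 F \<le> (\<Sum>\<^sub>\<infinity>z\<in>\<Gamma>. \<Sum>k\<in>Kset n. (cmod (fock_inner F (beta_op z (ek k))))\<^sup>2) \<and>
          (\<Sum>\<^sub>\<infinity>z\<in>\<Gamma>. \<Sum>k\<in>Kset n. (cmod (fock_inner F (beta_op z (ek k))))\<^sup>2) \<le> B * fock_norm2 F))"

end

theory Submission
  imports Defs "HOL-Complex_Analysis.Complex_Analysis" "HOL-Probability.Distributions"
begin

text \<open>
  Multiplication by \<open>exp (-\<pi>|z|\<^sup>2/2)\<close> turns \<open>\<beta>\<^sub>z\<close> into the Weyl translation \<open>tau z\<close>, unitary on \<open>L\<^sup>2\<close>, and
  \<open>\<Lambda>\<^sup>0\<close> into the dual lattice of \<open>\<Lambda>\<close> for the symplectic form \<open>sy\<close>, so that translations by \<open>\<Lambda>\<close> and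
  \<open>\<Lambda>\<^sup>0\<close> commute. Both properties are equivalent to the Riesz bound
  \<open>c \<Sum>|a\<^sub>\<lambda>|\<^sup>2 \<le> \<Sum>\<^sub>k \<parallel>\<Sum> a\<^sub>\<lambda> \<tau>\<^sub>\<lambda> g\<^sub>k\<parallel>\<^sup>2\<close> over \<open>\<lambda> \<in> \<Lambda>\<close>, where \<open>g\<^sub>k\<close> is the weighted \<open>e\<^sub>k\<close>.

  Interpolation: the polyanalytic space has the reproducing kernel
  \<open>\<kappa>\<^sub>\<lambda>(z) = \<Sum>\<^sub>k \<langle>\<tau>\<^sub>\<lambda> g\<^sub>k, \<tau>\<^sub>z g\<^sub>k\<rangle>\<close>, so the quadratic form in the Riesz bound is the Gram form of the
  point evaluations. Its matrix has Gaussian decay, hence the bound makes it invertible on \<open>\<ell>\<^sup>2\<close> and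
  the interpolation problem solvable; without the bound a gliding hump yields data that cannot be
  interpolated.

  Sampling: if sampling holds on \<open>\<Lambda>\<^sup>0\<close>, apply it to \<open>\<Sum> a\<^sub>\<lambda> \<tau>\<^sub>\<lambda> \<tau>\<^sub>z g\<^sub>0\<close> and average over \<open>z\<close> in a cell of
  \<open>\<Lambda>\<^sup>0\<close>. Conversely apply the Riesz bound to the values of \<open>f\<close> on the translates \<open>z - \<Lambda>\<close> and average
  over \<open>z\<close> in a cell of \<open>\<Lambda>\<close>; by Parseval for periodic functions the right-hand side becomes a sum over
  \<open>\<Lambda>\<^sup>0\<close>, whose coefficients are the samples of \<open>f\<close> because \<open>f\<close> comes from an entire function.
\<close>

section \<open>Lebesgue measure and Gaussian integrals\<close>

text \<open>Averaging works because moving \<open>tau (B x)\<close> past \<open>tau z\<close> only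
  creates a character in \<open>z\<close>: the Gram entry of two distinct lattice points is
  multiplied by a nontrivial character and integrates to zero over a cell of the dual lattice, so
  that exactly the l2 norm of the coefficients is left. In the opposite direction the obstacle is
  that a Fourier coefficient modulates \<open>f\<close>, and the Fock space is not invariant under
  modulations. For holomorphic data the pairing of a modulated function with a window is
  nevertheless an ordinary sample times a Gaussian in the frequency. The extra shift parameter
  \<open>u\<close> moves the centre of this Gaussian, and since exp (-pi |u|^2) has integral 1,
  integrating over all \<open>u\<close> removes it without loss. The upper sampling bound never has
  to be transported between the lattices: it is a Bessel inequality, valid on every lattice because
  the windows have Gaussian decay. Finite sections of the Riesz bound are the common currency, since
  they raise no convergence question; each passage to infinite sequences rests on an explicit
  majorant.\<close>

lemma nn_integral_lborel_translate:
  fixes f :: "'a::euclidean_space \<Rightarrow> ennreal"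
  assumes [measurable]: "f \<in> borel_measurable borel"
  shows "(\<integral>\<^sup>+x. f (x + a) \<partial>lborel) = (\<integral>\<^sup>+x. f x \<partial>lborel)"
proof -
  have "(\<integral>\<^sup>+x. f x \<partial>lborel) = (\<integral>\<^sup>+x. f x \<partial>distr lborel borel ((+) a))"
    by (simp add: lborel_distr_plus)
  also have "\<dots> = (\<integral>\<^sup>+x. f (x + a) \<partial>lborel)"
    by (subst nn_integral_distr) (auto simp: add.commute)
  finally show ?thesis by simp
qed

lemma integral_lborel_translate:
  fixes f :: "'a::euclidean_space \<Rightarrow> 'b::{banach, second_countable_topology}"
  assumes [measurable]: "f \<in> borel_measurable borel"
  shows "integral\<^sup>L lborel (\<lambda>x. f (x + a)) = integral\<^sup>L lborel f"
proof -
  have "integral\<^sup>L lborel f = integral\<^sup>L (distr lborel borel ((+) a)) f"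
    by (simp add: lborel_distr_plus)
  also have "\<dots> = integral\<^sup>L lborel (\<lambda>x. f (x + a))"
    by (subst integral_distr) (auto simp: add.commute)
  finally show ?thesis by simp
qed

lemma integrable_lborel_translate:
  fixes f :: "'a::euclidean_space \<Rightarrow> 'b::{banach, second_countable_topology}"
  assumes "integrable lborel f"
  shows "integrable lborel (\<lambda>x. f (x + a))"
proof -
  have "integrable (distr lborel borel ((+) a)) f"
    using assms by (simp add: lborel_distr_plus)
  then have "integrable lborel (\<lambda>x. f (a + x))"
    using assms by (subst (asm) integrable_distr_eq) auto
  then show ?thesis by (simp add: add.commute)
qed

text \<open>The unit ball is invariant under an isometry \<open>R\<close>; comparing Lebesgue measure with its
  image under \<open>R\<close> through the uniqueness argument for Haar measure fixes the constant.\<close>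

lemma nn_integral_lborel_isometry:
  fixes f :: "'a::euclidean_space \<Rightarrow> ennreal" and R :: "'a \<Rightarrow> 'a"
  assumes R: "linear R" "\<And>x. norm (R x) = norm x" and [measurable]: "f \<in> borel_measurable borel"
  shows "(\<integral>\<^sup>+x. f (R x) \<partial>lborel) = (\<integral>\<^sup>+x. f x \<partial>lborel)"
proof -
  define g :: "'a \<Rightarrow> ennreal" where "g = indicator (ball 0 1)"
  have [measurable]: "g \<in> borel_measurable borel" unfolding g_def by (rule borel_measurable_indicator) simp
  have [measurable]: "R \<in> borel_measurable borel"
    by (intro borel_measurable_continuous_onI linear_continuous_on linear_conv_bounded_linear[THEN iffD1] R)
  have "inj R"
    using R by (metis linear_injective_0 norm_eq_zero)
  then have "surj R" using R(1) linear_injective_imp_surjective by blast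
  define I where "I = (\<integral>\<^sup>+x. g x \<partial>lborel)"
  have I: "I = emeasure lborel (ball (0::'a) 1)"
    by (simp add: I_def g_def)
  have "I \<noteq> 0"
  proof -
    have pos: "unit_ball_vol (real DIM('a)) > 0" by (rule unit_ball_vol_pos) simp
    have "I = ennreal (unit_ball_vol (real DIM('a)))"
      unfolding I using emeasure_ball[of 1 "0::'a"] by simp
    then show ?thesis using leD[of _ 0] pos by (metis ennreal_eq_0_iff)
  qed
  have "I \<noteq> \<infinity>"
    unfolding I using emeasure_bounded_finite[of "ball (0::'a) 1"] by auto
  have "(\<integral>\<^sup>+x. f (R x) \<partial>lborel) * I = (\<integral>\<^sup>+x. f (R x) * (\<integral>\<^sup>+y. g (y - R x) \<partial>lborel) \<partial>lborel)"
    unfolding diff_conv_add_uminus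
    by (subst nn_integral_lborel_translate) (auto simp: I_def nn_integral_multc)
  also have "\<dots> = (\<integral>\<^sup>+x. (\<integral>\<^sup>+y. f (R x) * g (y - R x) \<partial>lborel) \<partial>lborel)"
    by (simp add: nn_integral_cmult)
  also have "\<dots> = (\<integral>\<^sup>+y. (\<integral>\<^sup>+x. f (R x) * g (y - R x) \<partial>lborel) \<partial>lborel)"
    by (rule lborel_pair.Fubini'[symmetric]) measurable
  also have "\<dots> = (\<integral>\<^sup>+y. (\<integral>\<^sup>+x. f (R x + y) * g (- R x) \<partial>lborel) \<partial>lborel)"
  proof (rule nn_integral_cong)
    fix y
    obtain v where v: "y = R v" using \<open>surj R\<close> by auto
    have "(\<integral>\<^sup>+x. f (R x) * g (y - R x) \<partial>lborel) = (\<integral>\<^sup>+x. f (R (x + v)) * g (y - R (x + v)) \<partial>lborel)"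
      by (rule nn_integral_lborel_translate[symmetric, of "\<lambda>x. f (R x) * g (y - R x)"]) measurable
    also have "\<dots> = (\<integral>\<^sup>+x. f (R x + y) * g (- R x) \<partial>lborel)"
      by (simp add: v linear_add[OF R(1)])
    finally show "(\<integral>\<^sup>+x. f (R x) * g (y - R x) \<partial>lborel) = (\<integral>\<^sup>+x. f (R x + y) * g (- R x) \<partial>lborel)" .
  qed
  also have "\<dots> = (\<integral>\<^sup>+x. (\<integral>\<^sup>+y. f (R x + y) * g (- R x) \<partial>lborel) \<partial>lborel)"
    by (rule lborel_pair.Fubini') measurable
  also have "\<dots> = (\<integral>\<^sup>+x. (\<integral>\<^sup>+y. f (y + R x) \<partial>lborel) * g (- R x) \<partial>lborel)"
    by (simp add: nn_integral_multc add.commute)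
  also have "\<dots> = (\<integral>\<^sup>+x. (\<integral>\<^sup>+y. f y \<partial>lborel) * g x \<partial>lborel)"
    by (subst nn_integral_lborel_translate) (auto simp: g_def indicator_def R)
  also have "\<dots> = (\<integral>\<^sup>+y. f y \<partial>lborel) * I"
    by (simp add: nn_integral_cmult I_def)
  finally show ?thesis
    using \<open>I \<noteq> 0\<close> \<open>I \<noteq> \<infinity>\<close> by (metis ennreal_mult_divide_eq infinity_ennreal_def)
qed

lemma lborel_distr_isometry:
  fixes R :: "'a::euclidean_space \<Rightarrow> 'a"
  assumes R: "linear R" "\<And>x. norm (R x) = norm x"
  shows "distr lborel borel R = lborel"
proof (rule measure_eqI)
  have [measurable]: "R \<in> borel_measurable borel"
    by (intro borel_measurable_continuous_onI linear_continuous_on linear_conv_bounded_linear[THEN iffD1] R)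
  fix A assume "A \<in> sets (distr lborel borel R)"
  then have [measurable]: "A \<in> sets borel" by simp
  have "emeasure (distr lborel borel R) A = (\<integral>\<^sup>+x. indicator A x \<partial>distr lborel borel R)"
    by simp
  also have "\<dots> = (\<integral>\<^sup>+x. indicator A (R x) \<partial>lborel)"
    by (subst nn_integral_distr) auto
  also have "\<dots> = emeasure lborel A"
    by (subst nn_integral_lborel_isometry[OF R]) auto
  finally show "emeasure (distr lborel borel R) A = emeasure lborel A" .
qed auto

lemma integral_lborel_isometry:
  fixes f :: "'a::euclidean_space \<Rightarrow> 'b::{banach, second_countable_topology}" and R :: "'a \<Rightarrow> 'a"
  assumes R: "linear R" "\<And>x. norm (R x) = norm x" and [measurable]: "f \<in> borel_measurable borel"
  shows "integral\<^sup>L lborel (\<lambda>x. f (R x)) = integral\<^sup>L lborel f"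
proof -
  have [measurable]: "R \<in> borel_measurable borel"
    by (intro borel_measurable_continuous_onI linear_continuous_on linear_conv_bounded_linear[THEN iffD1] R)
  have "integral\<^sup>L lborel f = integral\<^sup>L (distr lborel borel R) f"
    by (simp add: lborel_distr_isometry[OF R])
  also have "\<dots> = integral\<^sup>L lborel (\<lambda>x. f (R x))"
    by (subst integral_distr) auto
  finally show ?thesis by simp
qed

text \<open>Both measures agree on open boxes, whose edges are indexed by pairs of a coordinate and
  a basis vector. The identification transfers Fubini to functions that factor over the
  coordinates.\<close>

lemma lborel_vec_eq_PiM:
  "distr (PiM UNIV (\<lambda>_. lborel)) borel (\<lambda>f. \<chi> j. f j) = (lborel :: ('a::euclidean_space ^ 'd) measure)"
proof (rule lborel_eqI[symmetric])
  interpret product_sigma_finite "\<lambda>_::'d. lborel :: 'a measure" ..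
  have [measurable]: "(\<lambda>f. \<chi> j. (f j :: 'a)) \<in> borel_measurable (PiM (UNIV :: 'd set) (\<lambda>_. lborel))"
  proof (rule borel_measurable_euclidean_space[THEN iffD2], rule ballI)
    fix b :: "'a ^ 'd" assume "b \<in> Basis"
    then obtain i c where "b = axis i c" by (auto simp: Basis_vec_def)
    then show "(\<lambda>f. (\<chi> j. f j) \<bullet> b) \<in> borel_measurable (PiM (UNIV :: 'd set) (\<lambda>_. lborel :: 'a measure))"
      by (simp add: inner_axis)
  qed
  fix l u :: "'a ^ 'd" assume le: "\<And>b. b \<in> Basis \<Longrightarrow> l \<bullet> b \<le> u \<bullet> b"
  have le': "l $ j \<bullet> b \<le> u $ j \<bullet> b" if "b \<in> Basis" for j b
    using le[of "axis j b"] that by (auto simp: Basis_vec_def inner_axis)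
  have mem: "(\<chi> j. f j) \<in> box l u \<longleftrightarrow> f \<in> PiE UNIV (\<lambda>j. box (l $ j) (u $ j))" for f
    by (auto simp: mem_box Basis_vec_def inner_axis PiE_iff) 
  have "emeasure (distr (PiM UNIV (\<lambda>_. lborel)) borel (\<lambda>f. \<chi> j. f j)) (box l u)
      = emeasure (PiM UNIV (\<lambda>_. lborel)) (PiE UNIV (\<lambda>j. box (l $ j) (u $ j)))"
    by (subst emeasure_distr) (auto simp: mem space_PiM vimage_def intro!: arg_cong[where f="emeasure _"])
  also have "\<dots> = (\<Prod>j\<in>UNIV. emeasure lborel (box (l $ j) (u $ j)))"
    by (rule emeasure_PiM) auto
  also have "\<dots> = (\<Prod>j\<in>UNIV. ennreal (\<Prod>b\<in>Basis. (u $ j - l $ j) \<bullet> b))"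
    by (intro prod.cong refl emeasure_lborel_box le')
  also have "\<dots> = ennreal (\<Prod>j\<in>UNIV. \<Prod>b\<in>Basis. (u $ j - l $ j) \<bullet> b)"
    by (intro prod_ennreal prod_nonneg) (auto simp: inner_diff_left le')
  also have "(\<Prod>j\<in>UNIV. \<Prod>b\<in>Basis. (u $ j - l $ j) \<bullet> b) = (\<Prod>b\<in>Basis. (u - l) \<bullet> b)"
  proof -
    have "(\<Prod>b\<in>Basis. (u - l) \<bullet> b) = (\<Prod>(j,b)\<in>UNIV \<times> Basis. (u - l) \<bullet> axis j b)"
    proof -
      have "inj_on (\<lambda>(j,b). axis j b) ((UNIV :: 'd set) \<times> (Basis :: 'a set))"
        by (auto simp: inj_on_def axis_eq_axis nonzero_Basis)
      moreover have "(Basis :: ('a ^ 'd) set) = (\<lambda>(j,b). axis j b) ` (UNIV \<times> Basis)"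
        by (auto simp: Basis_vec_def image_iff)
      ultimately show ?thesis
        by (metis (mono_tags, lifting) prod.cong prod.reindex comp_apply case_prod_unfold)
    qed
    also have "\<dots> = (\<Prod>j\<in>UNIV. \<Prod>b\<in>Basis. (u - l) \<bullet> axis j b)"
      by (simp add: prod.cartesian_product)
    finally show ?thesis by (simp add: inner_axis)
  qed
  finally show "emeasure (distr (PiM UNIV (\<lambda>_. lborel)) borel (\<lambda>f. \<chi> j. f j)) (box l u)
      = ennreal (\<Prod>b\<in>Basis. (u - l) \<bullet> b)" .
qed simp

lemma lborel_vec_prod:
  fixes h :: "'d::finite \<Rightarrow> 'a::euclidean_space \<Rightarrow> complex"
  assumes h: "\<And>j. integrable lborel (h j)"
  shows "integrable lborel (\<lambda>z :: 'a ^ 'd. \<Prod>j\<in>UNIV. h j (z $ j))"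
    and "integral\<^sup>L lborel (\<lambda>z :: 'a ^ 'd. \<Prod>j\<in>UNIV. h j (z $ j)) = (\<Prod>j\<in>UNIV. integral\<^sup>L lborel (h j))"
proof -
  interpret product_sigma_finite "\<lambda>_::'d. lborel :: 'a measure" ..
  have [measurable]: "h j \<in> borel_measurable borel" for j using h[of j] by auto
  have [measurable]: "(\<lambda>f. \<chi> j. (f j :: 'a)) \<in> borel_measurable (PiM (UNIV :: 'd set) (\<lambda>_. lborel))"
  proof (rule borel_measurable_euclidean_space[THEN iffD2], rule ballI)
    fix b :: "'a ^ 'd" assume "b \<in> Basis"
    then obtain i c where "b = axis i c" by (auto simp: Basis_vec_def)
    then show "(\<lambda>f. (\<chi> j. f j) \<bullet> b) \<in> borel_measurable (PiM (UNIV :: 'd set) (\<lambda>_. lborel :: 'a measure))"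
      by (simp add: inner_axis)
  qed
  have [measurable]: "(\<lambda>z :: 'a ^ 'd. z $ j) \<in> borel_measurable borel" for j
    by (intro borel_measurable_continuous_onI continuous_intros)
  have i: "integrable (PiM UNIV (\<lambda>_. lborel)) (\<lambda>f. \<Prod>j\<in>(UNIV :: 'd set). h j (f j))"
    by (rule product_integrable_prod) (auto simp: h)
  show "integrable lborel (\<lambda>z :: 'a ^ 'd. \<Prod>j\<in>UNIV. h j (z $ j))"
    unfolding lborel_vec_eq_PiM[symmetric] using i by (subst integrable_distr_eq) auto
  have "integral\<^sup>L lborel (\<lambda>z :: 'a ^ 'd. \<Prod>j\<in>UNIV. h j (z $ j)) = integral\<^sup>L (PiM UNIV (\<lambda>_. lborel)) (\<lambda>f. \<Prod>j\<in>(UNIV :: 'd set). h j (f j))"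
    unfolding lborel_vec_eq_PiM[symmetric] by (subst integral_distr) auto
  also have "\<dots> = (\<Prod>j\<in>UNIV. integral\<^sup>L lborel (h j))"
    by (rule product_integral_prod) (auto simp: h)
  finally show "integral\<^sup>L lborel (\<lambda>z :: 'a ^ 'd. \<Prod>j\<in>UNIV. h j (z $ j)) = (\<Prod>j\<in>UNIV. integral\<^sup>L lborel (h j))" .
qed

section \<open>Explicit Gaussian integrals and moments\<close>

lemma nn_integral_gauss_real:
  assumes "c > 0"
  shows "(\<integral>\<^sup>+(x::real). ennreal (exp (- c * x\<^sup>2)) \<partial>lborel) = ennreal (sqrt (pi / c))"
proof -
  define s where "s = sqrt (1 / (2 * c))"
  have s: "s > 0" "s\<^sup>2 = 1 / (2 * c)" using assms by (auto simp: s_def)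
  have eq: "exp (- c * x\<^sup>2) = sqrt (pi / c) * normal_density 0 s x" for x
    using assms by (simp add: normal_density_def s real_sqrt_divide)
  have "(\<integral>\<^sup>+(x::real). ennreal (exp (- c * x\<^sup>2)) \<partial>lborel) = ennreal (sqrt (pi / c)) * (\<integral>\<^sup>+(x::real). ennreal (normal_density 0 s x) \<partial>lborel)"
    unfolding eq using assms by (subst nn_integral_cmult[symmetric]) (auto simp: ennreal_mult')
  also have "(\<integral>\<^sup>+(x::real). ennreal (normal_density 0 s x) \<partial>lborel) = 1"
    using s by (subst nn_integral_eq_integral) (auto intro: integrable_normal_density simp: integral_normal_density)
  finally show ?thesis by simp
qed

lemma nn_integral_gauss:
  fixes c :: real
  assumes "c > 0"
  shows "(\<integral>\<^sup>+(x::'a::euclidean_space). ennreal (exp (- c * (norm x)\<^sup>2)) \<partial>lborel) = ennreal (sqrt (pi / c) ^ DIM('a))"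
proof -
  have "(norm x)\<^sup>2 = (\<Sum>b\<in>Basis. (x \<bullet> b)\<^sup>2)" for x :: 'a
    unfolding power2_norm_eq_inner by (subst euclidean_inner) (simp add: power2_eq_square)
  then have "exp (- c * (norm x)\<^sup>2) = (\<Prod>b\<in>Basis. exp (- c * (x \<bullet> b)\<^sup>2))" for x :: 'a
    by (simp add: exp_sum[symmetric] sum_distrib_left sum_negf)
  then have "(\<integral>\<^sup>+(x::'a). ennreal (exp (- c * (norm x)\<^sup>2)) \<partial>lborel) = (\<integral>\<^sup>+(x::'a). (\<Prod>b\<in>Basis. ennreal (exp (- c * (x \<bullet> b)\<^sup>2))) \<partial>lborel)"
    by (simp add: prod_ennreal)
  also have "\<dots> = (\<Prod>b\<in>(Basis::'a set). ennreal (sqrt (pi / c)))"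
    by (subst nn_integral_lborel_prod) (auto simp: nn_integral_gauss_real[OF assms, simplified])
  finally show ?thesis using assms by (simp add: ennreal_power)
qed

lemma integrable_gauss:
  assumes "c > 0"
  shows "integrable lborel (\<lambda>x::'a::euclidean_space. exp (- c * (norm x)\<^sup>2))"
  by (rule integrableI_nn_integral_finite[OF _ _ nn_integral_gauss[OF assms]]) (auto)

lemma integral_gauss:
  assumes "c > 0"
  shows "integral\<^sup>L lborel (\<lambda>x::'a::euclidean_space. exp (- c * (norm x)\<^sup>2)) = sqrt (pi / c) ^ DIM('a)"
  using assms by (subst integral_eq_nn_integral[of "\<lambda>x. exp (- c * (norm x)\<^sup>2)"]) (auto simp: nn_integral_gauss[simplified])

text \<open>Half of the Gaussian rate is spent on the power; the other half is left for
  integration.\<close>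

lemma power_times_gauss_le:
  assumes "c > 0"
  obtains C where "C > 0" "\<And>x::real. x \<ge> 0 \<Longrightarrow> x ^ N * exp (- c * x\<^sup>2) \<le> C * exp (- (c / 2) * x\<^sup>2)"
proof -
  \<comment> \<open>With \<open>M\<close> equal to N + 1, the inequality t/M <= exp (t/M), raised to
    the power \<open>M\<close>, gives (t/M)^M <= exp t; it is used for t = c x^2 / 2.\<close>
  define M where "M = real (Suc N)"
  define C where "C = 1 + (M * 2 / c) ^ Suc N"
  have "x ^ N * exp (- c * x\<^sup>2) \<le> C * exp (- (c / 2) * x\<^sup>2)" if "x \<ge> 0" for x
  proof -
    have "x ^ N \<le> 1 + x\<^sup>2 ^ Suc N"
    proof (cases "x \<le> 1")
      case True then show ?thesis using that power_le_one[of x N] by (simp add: add.commute add_increasing2)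
    next
      case False
      then have "x ^ N \<le> x ^ (2 * Suc N)" by (intro power_increasing) auto
      then show ?thesis by (simp only: power_mult)
    qed
    also have "\<dots> \<le> 1 + (M * 2 / c) ^ Suc N * exp (c / 2 * x\<^sup>2)"
    proof -
      have "(c / 2 * x\<^sup>2 / M) ^ Suc N \<le> exp (c / 2 * x\<^sup>2 / M) ^ Suc N"
        using assms by (intro power_mono) (auto simp: M_def intro: order_trans[OF _ exp_ge_add_one_self])
      also have "\<dots> = exp (c / 2 * x\<^sup>2)"
        unfolding M_def by (metis exp_of_nat_mult nonzero_mult_div_cancel_left of_nat_neq_0 times_divide_eq_right)
      finally have "(M * 2 / c) ^ Suc N * (c / 2 * x\<^sup>2 / M) ^ Suc N \<le> (M * 2 / c) ^ Suc N * exp (c / 2 * x\<^sup>2)"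
        using assms by (intro mult_left_mono) (auto simp: M_def)
      moreover have "M > 0" by (simp add: M_def)
      then have "(M * 2 / c) * (c / 2 * x\<^sup>2 / M) = x\<^sup>2"
        using assms by (simp add: field_simps)
      ultimately show ?thesis by (simp add: power_mult_distrib[symmetric] del: power_Suc)
    qed
    also have "\<dots> \<le> C * exp (c / 2 * x\<^sup>2)"
    proof -
      have "1 \<le> exp (c / 2 * x\<^sup>2)" using assms by simp
      then show ?thesis by (simp add: C_def algebra_simps del: power_Suc)
    qed
    finally have "x ^ N * exp (- c * x\<^sup>2) \<le> C * exp (c / 2 * x\<^sup>2) * exp (- c * x\<^sup>2)"
      by (intro mult_right_mono) auto
    also have "\<dots> = C * exp (- (c / 2) * x\<^sup>2)"
      by (simp add: mult.assoc exp_add[symmetric])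
    finally show ?thesis .
  qed
  moreover have "C > 0" using assms by (simp add: C_def M_def add_pos_nonneg)
  ultimately show ?thesis using that by blast
qed

lemma integrable_power_times_gauss:
  assumes "c > 0"
  shows "integrable lborel (\<lambda>x::'a::euclidean_space. norm x ^ N * exp (- c * (norm x)\<^sup>2))"
proof -
  obtain C where C: "C > 0" "\<And>x::real. x \<ge> 0 \<Longrightarrow> x ^ N * exp (- c * x\<^sup>2) \<le> C * exp (- (c / 2) * x\<^sup>2)"
    using power_times_gauss_le[OF assms] by blast
  show ?thesis
  proof (rule Bochner_Integration.integrable_bound)
    show "integrable lborel (\<lambda>x::'a. C * exp (- (c / 2) * (norm x)\<^sup>2))"
      using assms by (intro integrable_mult_right integrable_gauss) auto
  qed (use C in auto)
qed

text \<open>Differentiation under the integral with respect to \<open>c\<close>: each derivative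
  brings down a factor |z|^2, and the right-hand side obeys the same recursion. The base case is the
  plain Gaussian integral in the plane.\<close>

lemma integral_cmod_power_gauss:
  assumes "c > 0"
  shows "integral\<^sup>L lborel (\<lambda>z::complex. (cmod z) ^ (2 * m) * exp (- c * (cmod z)\<^sup>2)) = pi * fact m / c ^ Suc m"
  using assms
proof (induction m arbitrary: c)
  case 0
  then show ?case using integral_gauss[OF 0, where 'a=complex] by (simp add: power2_eq_square[symmetric])
next
  case (Suc m)
  define h where "h n = 1 / real (Suc n)" for n
  define q where "q n z = (cmod z ^ (2 * m) * exp (- c * (cmod z)\<^sup>2) - cmod z ^ (2 * m) * exp (- (c + h n) * (cmod z)\<^sup>2)) / h n" for n z
  have h0: "h n > 0" for n by (simp add: h_def)
  have hl: "h \<longlonglongrightarrow> 0" unfolding h_def using LIMSEQ_Suc[OF lim_1_over_n] by simp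
  have ha: "filterlim h (at 0) sequentially"
    using hl h0 by (auto simp: filterlim_at less_imp_neq[THEN not_sym])
  have int: "integral\<^sup>L lborel (q n) = (pi * fact m / c ^ Suc m - pi * fact m / (c + h n) ^ Suc m) / h n" for n
    unfolding q_def using Suc.prems h0[of n] Suc.IH[of c] Suc.IH[of "c + h n"]
      integrable_power_times_gauss[of c "2*m", where 'a=complex]
      integrable_power_times_gauss[of "c + h n" "2*m", where 'a=complex]
    by (simp add: Bochner_Integration.integral_diff add_pos_pos del: power_Suc)
  have der: "((\<lambda>x. - pi * fact m / x ^ Suc m) has_real_derivative pi * fact (Suc m) / c ^ Suc (Suc m)) (at c)"
  proof -
    have "((\<lambda>x. - pi * fact m * inverse (x ^ Suc m)) has_real_derivative
        - pi * fact m * - (inverse (c ^ Suc m) * (real (Suc m) * c ^ m) * inverse (c ^ Suc m))) (at c)"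
      using DERIV_cmult[OF DERIV_inverse'[OF DERIV_pow[of "Suc m" c UNIV]], of "- pi * fact m"] Suc.prems
      by simp
    moreover have "- pi * fact m * - (inverse (c ^ Suc m) * (real (Suc m) * c ^ m) * inverse (c ^ Suc m))
        = pi * fact (Suc m) / c ^ Suc (Suc m)"
      using Suc.prems by (simp add: field_simps)
    ultimately show ?thesis by (simp only: divide_inverse)
  qed
  have "((\<lambda>t. (- pi * fact m / (c + t) ^ Suc m - (- pi * fact m / c ^ Suc m)) / t) \<longlongrightarrow> pi * fact (Suc m) / c ^ Suc (Suc m)) (at 0)"
    using der unfolding DERIV_def .
  from filterlim_compose[OF this ha]
  have lim1: "(\<lambda>n. integral\<^sup>L lborel (q n)) \<longlonglongrightarrow> pi * fact (Suc m) / c ^ Suc (Suc m)"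
    unfolding int by (simp add: algebra_simps del: power_Suc)
  \<comment> \<open>Since 1 - exp (-t) <= t, the difference quotients stay below their own limit,
    which therefore serves as the dominating function.\<close>
  have lim2: "(\<lambda>n. integral\<^sup>L lborel (q n)) \<longlonglongrightarrow> integral\<^sup>L lborel (\<lambda>z::complex. (cmod z) ^ (2 * Suc m) * exp (- c * (cmod z)\<^sup>2))"
  proof (rule integral_dominated_convergence)
    show "integrable lborel (\<lambda>z::complex. (cmod z) ^ (2 * Suc m) * exp (- c * (cmod z)\<^sup>2))"
      using Suc.prems by (rule integrable_power_times_gauss)
    have qe: "q n z = cmod z ^ (2 * m) * exp (- c * (cmod z)\<^sup>2) * ((1 - exp (- h n * (cmod z)\<^sup>2)) / h n)" for n z
      by (simp add: q_def algebra_simps diff_divide_distrib exp_add[symmetric])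
    show "AE z in lborel. (\<lambda>n. q n z) \<longlonglongrightarrow> (cmod z) ^ (2 * Suc m) * exp (- c * (cmod z)\<^sup>2)"
    proof (rule AE_I2)
      fix z :: complex
      have "((\<lambda>x. - exp (- x * (cmod z)\<^sup>2)) has_real_derivative (cmod z)\<^sup>2) (at 0)"
        by (auto intro!: derivative_eq_intros)
      then have "((\<lambda>t. (1 - exp (- t * (cmod z)\<^sup>2)) / t) \<longlongrightarrow> (cmod z)\<^sup>2) (at 0)"
        unfolding DERIV_def by simp
      from filterlim_compose[OF this ha]
      have "(\<lambda>n. q n z) \<longlonglongrightarrow> cmod z ^ (2 * m) * exp (- c * (cmod z)\<^sup>2) * (cmod z)\<^sup>2"
        unfolding qe by (intro tendsto_mult tendsto_const)
      then show "(\<lambda>n. q n z) \<longlonglongrightarrow> (cmod z) ^ (2 * Suc m) * exp (- c * (cmod z)\<^sup>2)"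
        by (simp add: mult_ac power2_eq_square)
    qed
    show "AE z in lborel. norm (q n z) \<le> (cmod z) ^ (2 * Suc m) * exp (- c * (cmod z)\<^sup>2)" for n
    proof (rule AE_I2)
      fix z :: complex
      have "(1 - exp (- h n * (cmod z)\<^sup>2)) / h n \<le> (cmod z)\<^sup>2"
        using exp_ge_add_one_self[of "- h n * (cmod z)\<^sup>2"] h0[of n] by (simp add: field_simps)
      moreover have "0 \<le> (1 - exp (- h n * (cmod z)\<^sup>2)) / h n"
        using h0[of n] by simp
      ultimately have "\<bar>q n z\<bar> \<le> cmod z ^ (2 * m) * exp (- c * (cmod z)\<^sup>2) * (cmod z)\<^sup>2"
        unfolding qe abs_mult by (intro mult_mono) auto
      then show "norm (q n z) \<le> (cmod z) ^ (2 * Suc m) * exp (- c * (cmod z)\<^sup>2)"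
        by (simp add: mult_ac power2_eq_square)
    qed
  qed (auto simp: q_def[abs_def])
  from LIMSEQ_unique[OF lim1 lim2] show ?case by simp
qed

section \<open>Lattices and periodic functions\<close>

definition int_points :: "'v::euclidean_space set" where
  "int_points = {x. \<forall>b\<in>Basis. x \<bullet> b \<in> \<int>}"

lemma int_points_0 [simp]: "0 \<in> int_points"
  and int_points_minus: "x \<in> int_points \<Longrightarrow> - x \<in> int_points"
  and int_points_add: "x \<in> int_points \<Longrightarrow> y \<in> int_points \<Longrightarrow> x + y \<in> int_points"
  and int_points_diff: "x \<in> int_points \<Longrightarrow> y \<in> int_points \<Longrightarrow> x - y \<in> int_points"
  by (auto simp: int_points_def inner_add_left inner_diff_left)

lemma int_points_inner: "x \<in> int_points \<Longrightarrow> y \<in> int_points \<Longrightarrow> x \<bullet> y \<in> \<int>"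
  unfolding int_points_def by (subst euclidean_inner) (auto intro!: Ints_sum Ints_mult)

text \<open>The coordinate space is kept apart from the ambient space, because later the coordinates
  are pairs of real vectors while the lattice lies in a complex space. The enumeration
  \<open>l\<close> turns lattice sums into ordinary series.\<close>

locale euclidean_lattice =
  fixes B :: "'v::euclidean_space \<Rightarrow> 'a::euclidean_space" and l :: "nat \<Rightarrow> 'a"
  assumes linB: "linear B" and bijB: "bij B" and bij_l: "bij_betw l UNIV (B ` int_points)"
begin

definition cell :: "'a set" where
  "cell = B ` {x. \<forall>b\<in>Basis. 0 \<le> x \<bullet> b \<and> x \<bullet> b < 1}"

definition covol :: real where
  "covol = measure lborel cell"

lemma inv_B [simp]: "inv B (B x) = x"
  using bijB by (simp add: bij_is_inj)

lemma B_inv [simp]: "B (inv B z) = z"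
  using bijB by (simp add: bij_is_surj surj_f_inv_f)

lemma lin_inv: "linear (inv B)"
proof (rule linearI)
  show "inv B (x + y) = inv B x + inv B y" for x y
    using arg_cong[OF linear_add[OF linB, of "inv B x" "inv B y"], of "inv B"] by simp
  show "inv B (r *\<^sub>R x) = r *\<^sub>R inv B x" for r x
    using arg_cong[OF linear_cmul[OF linB, of r "inv B x"], of "inv B"] by simp
qed

lemma continuous_on_inv: "continuous_on A (inv B)"
  by (intro linear_continuous_on linear_conv_bounded_linear[THEN iffD1] lin_inv)

lemma cell_iff: "z \<in> cell \<longleftrightarrow> (\<forall>b\<in>Basis. 0 \<le> inv B z \<bullet> b \<and> inv B z \<bullet> b < 1)"
proof
  assume "z \<in> cell"
  then show "\<forall>b\<in>Basis. 0 \<le> inv B z \<bullet> b \<and> inv B z \<bullet> b < 1" unfolding cell_def by auto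
next
  assume "\<forall>b\<in>Basis. 0 \<le> inv B z \<bullet> b \<and> inv B z \<bullet> b < 1"
  then have "B (inv B z) \<in> cell" unfolding cell_def by (intro imageI) simp
  then show "z \<in> cell" by simp
qed

lemma sets_cell [measurable]: "cell \<in> sets borel"
proof -
  have [measurable]: "inv B \<in> borel_measurable borel"
    by (intro borel_measurable_continuous_onI continuous_on_inv)
  have "cell = {z \<in> space borel. \<forall>b\<in>Basis. 0 \<le> inv B z \<bullet> b \<and> inv B z \<bullet> b < 1}"
    by (auto simp: cell_iff)
  also have "\<dots> \<in> sets borel"
    by measurable
  finally show ?thesis .
qed

lemma bounded_cell: "bounded cell"
proof -
  have "{x. \<forall>b\<in>Basis. 0 \<le> x \<bullet> b \<and> x \<bullet> b < 1} \<subseteq> cbox 0 (One :: 'v)"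
    by (auto simp: mem_box less_imp_le)
  then have "bounded {x::'v. \<forall>b\<in>Basis. 0 \<le> x \<bullet> b \<and> x \<bullet> b < 1}"
    using bounded_cbox bounded_subset by blast
  then show ?thesis
    unfolding cell_def by (intro bounded_linear_image linear_conv_bounded_linear[THEN iffD1] linB)
qed

lemma emeasure_cell_finite: "emeasure lborel cell < \<infinity>"
  using bounded_cell by (rule emeasure_bounded_finite)

lemma emeasure_cell: "emeasure lborel cell = ennreal covol"
  unfolding covol_def using emeasure_cell_finite by (intro emeasure_eq_ennreal_measure) auto

text \<open>The cell contains the image under \<open>B\<close> of the open unit cube, which is
  nonempty and open.\<close>

lemma covol_pos: "covol > 0"
proof -
  have "box 0 (One::'v) \<noteq> {}" by (simp add: box_ne_empty)
  have "open (inv B -` box 0 One)"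
    by (rule continuous_open_vimage[OF open_box]) (use continuous_on_inv[of UNIV] in \<open>simp add: continuous_on_eq_continuous_at\<close>)
  moreover have "inv B -` box 0 One \<noteq> {}"
    using \<open>box 0 (One::'v) \<noteq> {}\<close> by (metis all_not_in_conv inv_B vimageI)
  ultimately have "emeasure lborel (inv B -` box 0 One) \<noteq> 0"
    using open_not_negligible[of "inv B -` box 0 One"]
    by (auto simp: negligible_iff_null_sets null_sets_def)
  moreover have "inv B -` box 0 One \<subseteq> cell"
    by (auto simp: cell_iff mem_box less_imp_le)
  then have "emeasure lborel (inv B -` box 0 One) \<le> emeasure lborel cell"
    by (intro emeasure_mono) auto
  ultimately have "emeasure lborel cell \<noteq> 0"
    by (metis le_zero_eq)
  then show ?thesis
    by (simp add: emeasure_cell ennreal_eq_0_iff not_le)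
qed

lemma lattice_point: "inv B (l n) \<in> int_points" "l n = B (inv B (l n))"
proof -
  have "l n \<in> B ` int_points" using bij_l by (metis bij_betwE UNIV_I)
  then show "inv B (l n) \<in> int_points" "l n = B (inv B (l n))" by auto
qed

lemma lattice_ex: "x \<in> int_points \<Longrightarrow> \<exists>n. l n = B x"
  using bij_l by (metis bij_betw_imp_surj_on image_eqI imageE)

text \<open>Existence subtracts the integer part from every coordinate; uniqueness is the uniqueness
  of the floor.\<close>

lemma tile_unique: "\<exists>!n. z + l n \<in> cell"
proof -
  define x where "x = inv B z"
  define y where "y = (\<Sum>b\<in>Basis. - of_int \<lfloor>x \<bullet> b\<rfloor> *\<^sub>R b)"
  have yb: "y \<bullet> b = - of_int \<lfloor>x \<bullet> b\<rfloor>" if "b \<in> Basis" for b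
    unfolding y_def using that by (subst inner_sum_left_Basis) auto
  then have "y \<in> int_points" by (auto simp: int_points_def)
  then obtain n where n: "l n = B y" using lattice_ex by blast
  have "z + l n \<in> cell"
    by (auto simp: cell_iff n linear_add[OF lin_inv] inner_add_left yb x_def[symmetric]) linarith
  moreover have "m = n" if "z + l m \<in> cell" for m
  proof -
    define w where "w = inv B (l m)"
    have w: "w \<in> int_points" using lattice_point by (simp add: w_def)
    have "w \<bullet> b = y \<bullet> b" if b: "b \<in> Basis" for b
    proof -
      from \<open>z + l m \<in> cell\<close> b have "0 \<le> x \<bullet> b + w \<bullet> b" "x \<bullet> b + w \<bullet> b < 1"
        by (auto simp: cell_iff linear_add[OF lin_inv] inner_add_left w_def x_def)
      moreover obtain k where k: "w \<bullet> b = of_int k" using w b by (auto simp: int_points_def elim: Ints_cases)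
      ultimately have "\<lfloor>x \<bullet> b\<rfloor> = - k" by (intro floor_unique) auto
      then show ?thesis using k b by (simp add: yb)
    qed
    then have "w = y" by (rule euclidean_eqI)
    then have "l m = l n" using n B_inv[of "l m"] unfolding w_def by metis
    then show "m = n" using bij_l by (auto simp: bij_betw_def inj_def)
  qed
  ultimately show ?thesis by blast
qed

lemma suminf_tile:
  fixes c :: "'b::real_normed_vector"
  shows "(\<lambda>n. indicator cell (z + l n) *\<^sub>R c) sums c"
proof -
  obtain k where k: "z + l k \<in> cell" "\<And>n. z + l n \<in> cell \<Longrightarrow> n = k" using tile_unique[of z] by blast
  have "(\<lambda>n. indicator cell (z + l n) *\<^sub>R c) sums (\<Sum>n\<in>{k}. indicator cell (z + l n) *\<^sub>R c)"
    by (rule sums_finite) (auto simp: indicator_def dest: k(2))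
  then show ?thesis using k(1) by simp
qed

lemma suminf_tile_ennreal: "(\<Sum>n. indicator cell (z + l n)) = (1::ennreal)"
proof -
  obtain k where k: "z + l k \<in> cell" "\<And>n. z + l n \<in> cell \<Longrightarrow> n = k" using tile_unique[of z] by blast
  have "(\<Sum>n. indicator cell (z + l n)) = (\<Sum>n\<in>{k}. indicator cell (z + l n) :: ennreal)"
    by (rule suminf_finite) (auto simp: indicator_def dest: k(2))
  then show ?thesis using k(1) by simp
qed

text \<open>Unfolding: the translates of the cell form a partition of unity, which is inserted into
  the integral, and each piece is translated back to the cell.\<close>

lemma nn_integral_tiling:
  fixes f :: "'a \<Rightarrow> ennreal"
  assumes [measurable]: "f \<in> borel_measurable borel"
  shows "(\<integral>\<^sup>+z. f z \<partial>lborel) = (\<integral>\<^sup>+z. (\<Sum>n. f (z - l n)) * indicator cell z \<partial>lborel)"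
proof -
  have "(\<integral>\<^sup>+z. f z \<partial>lborel) = (\<integral>\<^sup>+z. (\<Sum>n. f z * indicator cell (z + l n)) \<partial>lborel)"
    by (simp add: suminf_tile_ennreal ennreal_suminf_cmult)
  also have "\<dots> = (\<Sum>n. \<integral>\<^sup>+z. f z * indicator cell (z + l n) \<partial>lborel)"
    by (rule nn_integral_suminf) measurable
  also have "\<dots> = (\<Sum>n. \<integral>\<^sup>+z. f (z - l n) * indicator cell z \<partial>lborel)"
  proof (intro suminf_cong)
    fix n
    have "(\<integral>\<^sup>+z. f z * indicator cell (z + l n) \<partial>lborel) = (\<integral>\<^sup>+z. f (z + - l n) * indicator cell (z + - l n + l n) \<partial>lborel)"
      by (rule nn_integral_lborel_translate[symmetric, of "\<lambda>z. f z * indicator cell (z + l n)"]) measurable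
    then show "(\<integral>\<^sup>+z. f z * indicator cell (z + l n) \<partial>lborel) = (\<integral>\<^sup>+z. f (z - l n) * indicator cell z \<partial>lborel)"
      by simp
  qed
  also have "\<dots> = (\<integral>\<^sup>+z. (\<Sum>n. f (z - l n) * indicator cell z) \<partial>lborel)"
    by (rule nn_integral_suminf[symmetric]) measurable
  finally show ?thesis by (simp add: ennreal_suminf_multc)
qed

lemma integral_tiling:
  fixes f :: "'a \<Rightarrow> 'b::{banach, second_countable_topology}"
  assumes f: "integrable lborel f"
  shows "integral\<^sup>L lborel f = integral\<^sup>L lborel (\<lambda>z. indicator cell z *\<^sub>R (\<Sum>n. f (z - l n)))"
proof -
  have [measurable]: "f \<in> borel_measurable borel" using f by auto
  define F where "F n z = indicator cell (z + l n) *\<^sub>R f z" for n z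
  define G where "G n z = indicator cell z *\<^sub>R f (z - l n)" for n z
  have [measurable]: "F n \<in> borel_measurable borel" "G n \<in> borel_measurable borel" for n
    unfolding F_def[abs_def] G_def[abs_def] by measurable
  have GF: "G n z = F n (z + - l n)" for n z by (simp add: F_def G_def)
  have iF: "integrable lborel (F n)" for n
    by (rule Bochner_Integration.integrable_bound[OF f]) (auto simp: F_def indicator_def)
  have iG: "integrable lborel (G n)" for n
    unfolding GF[abs_def] by (rule integrable_lborel_translate[OF iF])
  have IG: "integral\<^sup>L lborel (G n) = integral\<^sup>L lborel (F n)" for n
    unfolding GF[abs_def] by (rule integral_lborel_translate) measurable
  have IGn: "integral\<^sup>L lborel (\<lambda>z. norm (G n z)) = integral\<^sup>L lborel (\<lambda>z. norm (F n z))" for n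
    unfolding GF by (rule integral_lborel_translate[of "\<lambda>z. norm (F n z)"]) measurable
  have nF: "(\<lambda>n. norm (F n z)) sums norm (f z)" for z
    using suminf_tile[of z "norm (f z)"] by (simp add: F_def)
  have sumF: "summable (\<lambda>n. integral\<^sup>L lborel (\<lambda>z. norm (F n z)))"
  proof (rule summableI_nonneg_bounded)
    fix n
    have "(\<Sum>i<n. integral\<^sup>L lborel (\<lambda>z. norm (F i z))) = integral\<^sup>L lborel (\<lambda>z. \<Sum>i<n. norm (F i z))"
      by (rule Bochner_Integration.integral_sum[symmetric]) (simp add: iF)
    also have "\<dots> \<le> integral\<^sup>L lborel (\<lambda>z. norm (f z))"
    proof (rule integral_mono)
      show "(\<Sum>i<n. norm (F i z)) \<le> norm (f z)" for z
        using nF[of z] sum_le_suminf[of "\<lambda>n. norm (F n z)" "{..<n}"] by (auto simp: sums_iff)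
    qed (auto simp: iF f)
    finally show "(\<Sum>i<n. integral\<^sup>L lborel (\<lambda>z. norm (F i z))) \<le> integral\<^sup>L lborel (\<lambda>z. norm (f z))" .
  qed (auto intro: integral_nonneg_AE)
  have "integral\<^sup>L lborel f = integral\<^sup>L lborel (\<lambda>z. \<Sum>n. F n z)"
    by (simp add: F_def suminf_tile[THEN sums_unique, symmetric])
  also have "\<dots> = (\<Sum>n. integral\<^sup>L lborel (F n))"
    by (rule integral_suminf) (use iF nF sumF in \<open>auto simp: sums_iff\<close>)
  also have "\<dots> = (\<Sum>n. integral\<^sup>L lborel (G n))"
    by (simp add: IG)
  also have "\<dots> = integral\<^sup>L lborel (\<lambda>z. \<Sum>n. G n z)"
  \<comment> \<open>Absolute summability for almost every \<open>z\<close> comes from the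
    nonnegative unfolding applied to the norm of \<open>f\<close>: the total is finite, so the
    series is finite almost everywhere.\<close>
  proof (rule integral_suminf[symmetric])
    have "(\<integral>\<^sup>+z. (\<Sum>n. ennreal (norm (G n z))) \<partial>lborel)
        = (\<integral>\<^sup>+z. (\<Sum>n. ennreal (norm (f (z - l n)))) * indicator cell z \<partial>lborel)"
    proof (rule nn_integral_cong)
      fix z
      show "(\<Sum>n. ennreal (norm (G n z))) = (\<Sum>n. ennreal (norm (f (z - l n)))) * indicator cell z"
        by (cases "z \<in> cell") (simp_all add: G_def)
    qed
    also have "\<dots> = (\<integral>\<^sup>+z. ennreal (norm (f z)) \<partial>lborel)"
      by (rule nn_integral_tiling[symmetric, of "\<lambda>z. ennreal (norm (f z))"]) measurable
    also have "\<dots> < \<infinity>" using f by (simp add: integrable_iff_bounded)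
    finally have "AE z in lborel. (\<Sum>n. ennreal (norm (G n z))) \<noteq> \<infinity>"
      by (intro nn_integral_PInf_AE) auto
    then show "AE z in lborel. summable (\<lambda>n. norm (G n z))"
      by eventually_elim (auto intro: summable_suminf_not_top)
    show "summable (\<lambda>n. integral\<^sup>L lborel (\<lambda>z. norm (G n z)))"
      using sumF by (simp add: IGn)
  qed (rule iG)
  also have "(\<lambda>z. \<Sum>n. G n z) = (\<lambda>z. indicator cell z *\<^sub>R (\<Sum>n. f (z - l n)))"
    by (auto simp: G_def indicator_def)
  finally show ?thesis .
qed

section \<open>Periodic functions and characters of the torus\<close>

definition periodic :: "('a \<Rightarrow> complex) \<Rightarrow> bool" where
  "periodic f \<longleftrightarrow> (\<forall>z. \<forall>x\<in>int_points. f (z + B x) = f z)"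

lemma periodic_l: "periodic f \<Longrightarrow> f (z - l n) = f z"
proof -
  assume p: "periodic f"
  have "f (z + B (- inv B (l n))) = f z"
    using p lattice_point(1)[of n] unfolding periodic_def by (blast intro: int_points_minus)
  then show ?thesis by (simp add: linear_neg[OF linB])
qed

text \<open>The translated cell is again a fundamental domain. Restricting \<open>f\<close> to it
  and unfolding gives back \<open>f\<close> under the integral over the original cell, because the
  restriction periodizes to \<open>f\<close>.\<close>

lemma integral_cell_shift:
  fixes f :: "'a \<Rightarrow> complex"
  assumes p: "periodic f" and [measurable]: "f \<in> borel_measurable borel" and bd: "\<And>z. norm (f z) \<le> C"
  shows "integral\<^sup>L lborel (\<lambda>z. indicator cell z *\<^sub>R f (z + v)) = integral\<^sup>L lborel (\<lambda>z. indicator cell z *\<^sub>R f z)"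
proof -
  have i1: "integrable lborel (\<lambda>z. indicator cell z *\<^sub>R f (z + v))"
  proof (rule Bochner_Integration.integrable_bound)
    show "integrable lborel (\<lambda>z. indicator cell z *\<^sub>R C)"
      using emeasure_cell_finite by simp
    show "AE z in lborel. norm (indicator cell z *\<^sub>R f (z + v)) \<le> norm (indicator cell z *\<^sub>R C)"
      using bd by (auto simp: indicator_def intro: order_trans[OF _ abs_ge_self])
  qed measurable
  define F where "F z = indicator cell (z + - v) *\<^sub>R f z" for z
  have iF: "integrable lborel F"
    using integrable_lborel_translate[OF i1, of "- v"] by (simp add: F_def[abs_def])
  have [measurable]: "F \<in> borel_measurable borel" using iF by auto
  have "integral\<^sup>L lborel (\<lambda>z. indicator cell z *\<^sub>R f (z + v)) = integral\<^sup>L lborel (\<lambda>z. F (z + v))"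
    by (simp add: F_def)
  also have "\<dots> = integral\<^sup>L lborel F"
    by (rule integral_lborel_translate) measurable
  also have "\<dots> = integral\<^sup>L lborel (\<lambda>z. indicator cell z *\<^sub>R (\<Sum>n. F (z - l n)))"
    by (rule integral_tiling[OF iF])
  also have "(\<lambda>z. \<Sum>n. F (z - l n)) = f"
  proof
    fix z
    obtain k where k: "z - v - l k \<in> cell" "\<And>n. z - v - l n \<in> cell \<Longrightarrow> n = k"
    proof -
      obtain j where j: "z - v + l j \<in> cell" "\<And>n. z - v + l n \<in> cell \<Longrightarrow> n = j"
        using tile_unique[of "z - v"] by blast
      \<comment> \<open>Unfolding subtracts lattice points whereas \<open>tile_unique\<close> adds
        them; symmetry of the lattice under negation translates between the two.\<close>
      have neg: "\<exists>m. l m = - l n" for n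
        using lattice_ex[OF int_points_minus[OF lattice_point(1)[of n]]] by (simp add: linear_neg[OF linB])
      obtain k where k: "l k = - l j" using neg by blast
      show ?thesis
      proof (rule that[of k])
        show "z - v - l k \<in> cell" using j(1) k by simp
        fix n assume n: "z - v - l n \<in> cell"
        obtain m where m: "l m = - l n" using neg by blast
        then have "m = j" using j(2)[of m] n by simp
        then have "l n = l k" using m k by simp
        then show "n = k" using bij_l by (auto simp: bij_betw_def inj_def)
      qed
    qed
    have "(\<Sum>n. F (z - l n)) = (\<Sum>n\<in>{k}. F (z - l n))"
      by (rule suminf_finite) (auto simp: F_def indicator_def diff_diff_eq add.commute dest: k(2)[unfolded diff_diff_eq])
    also have "\<dots> = f z"
      using k(1) periodic_l[OF p] by (simp add: F_def algebra_simps)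
    finally show "(\<Sum>n. F (z - l n)) = f z" .
  qed
  finally show ?thesis .
qed

definition character :: "'v \<Rightarrow> 'a \<Rightarrow> complex" where
  "character m z = cis (2 * pi * (m \<bullet> inv B z))"

lemma character_simps:
  "character m (z + w) = character m z * character m w"
  "character (m + k) z = character m z * character k z"
  "character (- m) z = cnj (character m z)"
  "norm (character m z) = 1"
  by (simp_all add: character_def cis_mult cis_cnj linear_add[OF lin_inv] inner_add_right inner_add_left algebra_simps)

lemma character_0 [simp]: "character 0 z = 1"
  by (simp add: character_def)

lemma continuous_on_character: "continuous_on A (character m)"
  unfolding character_def[abs_def] cis_conv_exp
  by (intro continuous_intros continuous_on_inv)

lemma character_measurable [measurable]: "character m \<in> borel_measurable borel"
  by (intro borel_measurable_continuous_onI continuous_on_character)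

lemma periodic_character: "m \<in> int_points \<Longrightarrow> periodic (character m)"
  unfolding periodic_def
proof (intro allI ballI)
  fix z and x :: 'v assume mx: "m \<in> int_points" "x \<in> int_points"
  have "m \<bullet> x \<in> \<int>" using mx by (rule int_points_inner)
  then have "character m (B x) = 1" by (auto simp: character_def cis_multiple_2pi)
  then show "character m (z + B x) = character m z" by (simp add: character_simps)
qed

text \<open>For nonzero \<open>m\<close> the vector \<open>v\<close> is chosen with m . inv B v =
  1/2, so translation by \<open>v\<close> changes the sign of the character; as it does not change
  the integral over the cell, the integral is zero.\<close>

lemma integral_character:
  assumes "m \<in> int_points"
  shows "integral\<^sup>L lborel (\<lambda>z. indicator cell z *\<^sub>R character m z) = (if m = 0 then of_real covol else 0)"
proof (cases "m = 0")
  case True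
  then show ?thesis
    by (simp add: scaleR_conv_of_real covol_def)
next
  case False
  then obtain b where b: "b \<in> Basis" "m \<bullet> b \<noteq> 0" by (metis euclidean_all_zero_iff)
  define v where "v = B ((1 / (2 * (m \<bullet> b))) *\<^sub>R b)"
  have v: "character m v = -1" using b by (simp add: v_def character_def)
  have "integral\<^sup>L lborel (\<lambda>z. indicator cell z *\<^sub>R character m (z + v)) = integral\<^sup>L lborel (\<lambda>z. indicator cell z *\<^sub>R character m z)"
    by (rule integral_cell_shift[OF periodic_character[OF assms], where C=1]) (auto simp: character_simps)
  then show ?thesis using False by (simp add: character_simps v)
qed

text \<open>The sum is compared with an integral. For \<open>v\<close> in the cell |v + z - l n|^2
  is at most 2 R^2 + 2 |z - l n|^2, so a constant times each summand lies below a Gaussian of half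
  the rate at the displaced point. Integrating over \<open>v\<close> in the cell and unfolding gives
  one integral over the whole space, which no longer depends on \<open>z\<close>.\<close>

lemma gauss_sum_bounded:
  assumes c: "c > 0"
  obtains M where "M > 0" "\<And>z. summable (\<lambda>n. exp (- c * (norm (z - l n))\<^sup>2))"
    "\<And>z. (\<Sum>n. exp (- c * (norm (z - l n))\<^sup>2)) \<le> M"
proof -
  obtain R where R: "R > 0" "\<And>v. v \<in> cell \<Longrightarrow> norm v \<le> R" using bounded_cell bounded_pos by blast
  define K where "K = sqrt (pi / (c / 2)) ^ DIM('a)"
  define M where "M = K / (exp (- c * R\<^sup>2) * covol) + 1"
  have K: "K > 0" using c by (simp add: K_def)
  have M: "M > 0" using K covol_pos by (auto simp: M_def intro!: add_nonneg_pos)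
  have main: "(\<Sum>n. ennreal (exp (- c * (norm (z - l n))\<^sup>2))) \<le> ennreal M" for z
  proof -
    let ?S = "(\<Sum>n. ennreal (exp (- c * (norm (z - l n))\<^sup>2)))"
    have le: "exp (- c * R\<^sup>2) * exp (- c * (norm (z - l n))\<^sup>2) \<le> exp (- (c / 2) * (norm (v - l n + z))\<^sup>2)"
      if "v \<in> cell" for v n
    proof -
      have "norm (v - l n + z) \<le> norm v + norm (z - l n)"
        using norm_triangle_ineq[of v "z - l n"] by (simp add: algebra_simps)
      also have "\<dots> \<le> R + norm (z - l n)" using R that by simp
      finally have "(norm (v - l n + z))\<^sup>2 \<le> (R + norm (z - l n))\<^sup>2" by (rule power_mono) simp
      also have "\<dots> \<le> 2 * R\<^sup>2 + 2 * (norm (z - l n))\<^sup>2"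
        using sum_squares_bound[of R "norm (z - l n)"] by (simp add: power2_sum)
      finally have "(c / 2) * (norm (v - l n + z))\<^sup>2 \<le> (c / 2) * (2 * R\<^sup>2 + 2 * (norm (z - l n))\<^sup>2)"
        using c by (intro mult_left_mono) auto
      then show ?thesis by (simp add: exp_add[symmetric] algebra_simps)
    qed
    have "ennreal (exp (- c * R\<^sup>2)) * ?S * ennreal covol
        = (\<integral>\<^sup>+v. (ennreal (exp (- c * R\<^sup>2)) * ?S) * indicator cell v \<partial>lborel)"
      by (subst nn_integral_cmult_indicator) (auto simp: emeasure_cell)
    also have "\<dots> \<le> (\<integral>\<^sup>+v. (\<Sum>n. ennreal (exp (- (c / 2) * (norm (v - l n + z))\<^sup>2))) * indicator cell v \<partial>lborel)"
    proof (intro nn_integral_mono)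
      fix v
      show "(ennreal (exp (- c * R\<^sup>2)) * ?S) * indicator cell v \<le> (\<Sum>n. ennreal (exp (- (c / 2) * (norm (v - l n + z))\<^sup>2))) * indicator cell v"
      proof (cases "v \<in> cell")
        case True
        have "ennreal (exp (- c * R\<^sup>2)) * ?S = (\<Sum>n. ennreal (exp (- c * R\<^sup>2) * exp (- c * (norm (z - l n))\<^sup>2)))"
          by (simp add: ennreal_suminf_cmult ennreal_mult')
        also have "\<dots> \<le> (\<Sum>n. ennreal (exp (- (c / 2) * (norm (v - l n + z))\<^sup>2)))"
          by (intro suminf_le ennreal_leI le[OF True] summableI)
        finally show ?thesis using True by simp
      qed simp
    qed
    also have "\<dots> = (\<integral>\<^sup>+v. ennreal (exp (- (c / 2) * (norm (v + z))\<^sup>2)) \<partial>lborel)"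
      by (rule nn_integral_tiling[symmetric, of "\<lambda>v. ennreal (exp (- (c / 2) * (norm (v + z))\<^sup>2))"]) measurable
    also have "\<dots> = (\<integral>\<^sup>+(v::'a). ennreal (exp (- (c / 2) * (norm v)\<^sup>2)) \<partial>lborel)"
      by (rule nn_integral_lborel_translate[of "\<lambda>v. ennreal (exp (- (c / 2) * (norm v)\<^sup>2))"]) measurable
    also have "\<dots> = ennreal K"
      using c unfolding K_def by (intro nn_integral_gauss) simp
    finally have bound: "ennreal (exp (- c * R\<^sup>2)) * ?S * ennreal covol \<le> ennreal K" .
    have "?S = (ennreal (exp (- c * R\<^sup>2)) * ?S * ennreal covol) / ennreal (exp (- c * R\<^sup>2) * covol)"
    proof -
      define q where "q = exp (- c * R\<^sup>2) * covol"
      have q: "q > 0" using covol_pos by (simp add: q_def)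
      have "ennreal (exp (- c * R\<^sup>2)) * ?S * ennreal covol = ?S * ennreal q"
        unfolding q_def using covol_pos by (simp add: ennreal_mult mult_ac)
      then show ?thesis
        unfolding q_def[symmetric] using q by (simp add: ennreal_mult_divide_eq)
    qed
    also have "\<dots> \<le> ennreal K / ennreal (exp (- c * R\<^sup>2) * covol)"
      using bound by (rule divide_right_mono_ennreal)
    also have "\<dots> = ennreal (K / (exp (- c * R\<^sup>2) * covol))"
      using K covol_pos by (intro divide_ennreal) auto
    also have "\<dots> \<le> ennreal M" by (intro ennreal_leI) (simp add: M_def)
    finally show ?thesis .
  qed
  have s: "summable (\<lambda>n. exp (- c * (norm (z - l n))\<^sup>2))" for z
    by (rule summable_suminf_not_top) (use main[of z] in \<open>auto simp: top_unique\<close>)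
  have "(\<Sum>n. exp (- c * (norm (z - l n))\<^sup>2)) \<le> M" for z
  proof -
    have "(\<Sum>n. ennreal (exp (- c * (norm (z - l n))\<^sup>2))) = ennreal (\<Sum>n. exp (- c * (norm (z - l n))\<^sup>2))"
      by (rule suminf_ennreal2[OF _ s]) simp
    with main[of z] M show ?thesis by (metis ennreal_le_iff less_imp_le)
  qed
  with M s that show ?thesis by blast
qed

end

section \<open>Trigonometric polynomials and Parseval\<close>

text \<open>Generated by addition from single exponentials, so that closure under products is a
  double induction; the explicit finite sum is extracted afterwards by
  \<open>trig_poly_sum\<close>.\<close>

inductive trig_poly :: "('v::euclidean_space \<Rightarrow> complex) \<Rightarrow> bool" where
  trig_char: "m \<in> int_points \<Longrightarrow> trig_poly (\<lambda>x. c * cis (2 * pi * (m \<bullet> x)))"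
| trig_add: "trig_poly f \<Longrightarrow> trig_poly g \<Longrightarrow> trig_poly (\<lambda>x. f x + g x)"

lemma trig_const: "trig_poly (\<lambda>x. c)"
  using trig_char[of 0 c] by simp

lemma trig_sum: "finite S \<Longrightarrow> (\<And>i. i \<in> S \<Longrightarrow> trig_poly (f i)) \<Longrightarrow> trig_poly (\<lambda>x. \<Sum>i\<in>S. f i x)"
  by (induction S rule: finite_induct) (auto intro: trig_const trig_add)

lemma trig_mult:
  assumes "trig_poly f" "trig_poly g"
  shows "trig_poly (\<lambda>x. f x * g x)"
  using assms
proof (induction f rule: trig_poly.induct)
  case (trig_char m c)
  note m = \<open>m \<in> int_points\<close>
  from \<open>trig_poly g\<close> show ?case
  proof (induction g rule: trig_poly.induct)
    case (trig_char k e)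
    have "(\<lambda>x. c * cis (2 * pi * (m \<bullet> x)) * (e * cis (2 * pi * (k \<bullet> x))))
        = (\<lambda>x. (c * e) * cis (2 * pi * ((m + k) \<bullet> x)))"
      by (simp add: fun_eq_iff inner_add_left distrib_left cis_mult[symmetric] mult_ac)
    then show ?case using m trig_char by (auto intro!: trig_poly.trig_char int_points_add)
  next
    case (trig_add f g)
    then show ?case by (auto simp: distrib_left intro: trig_poly.trig_add)
  qed
next
  case (trig_add f h)
  then show ?case by (auto simp: distrib_right intro: trig_poly.trig_add)
qed

lemma trig_poly_sum:
  assumes "trig_poly f"
  obtains S t where "finite S" "S \<subseteq> int_points" "f = (\<lambda>x. \<Sum>m\<in>S. t m * cis (2 * pi * (m \<bullet> x)))"
proof -
  have "\<exists>S t. finite S \<and> S \<subseteq> int_points \<and> f = (\<lambda>x. \<Sum>m\<in>S. t m * cis (2 * pi * (m \<bullet> x)))"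
    using assms
  proof (induction f rule: trig_poly.induct)
    case (trig_char m c)
    then show ?case by (intro exI[of _ "{m}"] exI[of _ "\<lambda>_. c"]) auto
  next
    case (trig_add f g)
    then obtain S t S' t' where S: "finite S" "S \<subseteq> int_points" "f = (\<lambda>x. \<Sum>m\<in>S. t m * cis (2 * pi * (m \<bullet> x)))"
      and S': "finite S'" "S' \<subseteq> int_points" "g = (\<lambda>x. \<Sum>m\<in>S'. t' m * cis (2 * pi * (m \<bullet> x)))" by blast
    have ext: "(\<Sum>m\<in>X. r m * cis (2 * pi * (m \<bullet> x))) = (\<Sum>m\<in>X \<union> Y. (if m \<in> X then r m else 0) * cis (2 * pi * (m \<bullet> x)))"
      if "finite X" "finite Y" for X Y r and x :: 'a
      using that by (intro sum.mono_neutral_cong_left) auto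
    show ?case
      by (rule exI[of _ "S \<union> S'"], rule exI[of _ "\<lambda>m. (if m \<in> S then t m else 0) + (if m \<in> S' then t' m else 0)"])
         (use S S' ext[OF S(1) S'(1), of t] ext[OF S'(1) S(1), of t'] in
           \<open>simp add: fun_eq_iff distrib_right sum.distrib Un_commute[of S' S]\<close>)
  qed
  then show ?thesis using that by blast
qed

text \<open>Embeds the torus as a compact subset of a Euclidean space. Polynomials in the cosine and
  sine coordinates pull back to trigonometric polynomials, which makes polynomial Stone-Weierstrass
  applicable.\<close>

definition torus_map :: "'v::euclidean_space \<Rightarrow> 'v \<times> 'v" where
  "torus_map x = (\<Sum>b\<in>Basis. cos (2 * pi * (x \<bullet> b)) *\<^sub>R b, \<Sum>b\<in>Basis. sin (2 * pi * (x \<bullet> b)) *\<^sub>R b)"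

lemma continuous_on_torus_map: "continuous_on A torus_map"
  unfolding torus_map_def[abs_def] by (intro continuous_intros)

lemma trig_poly_cos: "b \<in> Basis \<Longrightarrow> trig_poly (\<lambda>x. complex_of_real (cos (2 * pi * (x \<bullet> b))))"
  and trig_poly_sin: "b \<in> Basis \<Longrightarrow> trig_poly (\<lambda>x. complex_of_real (sin (2 * pi * (x \<bullet> b))))"
proof -
  assume b: "b \<in> Basis"
  then have bi: "b \<in> int_points" "- b \<in> int_points" by (auto simp: int_points_def inner_Basis)
  have c: "complex_of_real (cos t) = (1/2) * cis t + (1/2) * cis (- t)" for t
    by (simp add: complex_eq_iff)
  have s: "complex_of_real (sin t) = (- \<i> / 2) * cis t + (\<i> / 2) * cis (- t)" for t
    by (simp add: complex_eq_iff)
  have "trig_poly (\<lambda>x. (1/2) * cis (2 * pi * (b \<bullet> x)) + (1/2) * cis (2 * pi * (- b \<bullet> x)))"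
    by (intro trig_add trig_char bi)
  then show "trig_poly (\<lambda>x. complex_of_real (cos (2 * pi * (x \<bullet> b))))"
    by (simp add: c inner_commute)
  have "trig_poly (\<lambda>x. (- \<i> / 2) * cis (2 * pi * (b \<bullet> x)) + (\<i> / 2) * cis (2 * pi * (- b \<bullet> x)))"
    by (intro trig_add trig_char bi)
  then show "trig_poly (\<lambda>x. complex_of_real (sin (2 * pi * (x \<bullet> b))))"
    by (simp add: s inner_commute)
qed

lemma trig_poly_real_polynomial:
  assumes "real_polynomial_function p"
  shows "trig_poly (\<lambda>x. complex_of_real (p (torus_map x)))"
  using assms
proof (induction p rule: real_polynomial_function.induct)
  case (linear f)
  then have lin: "linear f" by (simp add: bounded_linear.linear)
  have "f (torus_map x) = (\<Sum>b\<in>Basis. cos (2 * pi * (x \<bullet> b)) * f (b, 0)) + (\<Sum>b\<in>Basis. sin (2 * pi * (x \<bullet> b)) * f (0, b))" for x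
  proof -
    have "torus_map x = (\<Sum>b\<in>Basis. cos (2 * pi * (x \<bullet> b)) *\<^sub>R (b, 0)) + (\<Sum>b\<in>Basis. sin (2 * pi * (x \<bullet> b)) *\<^sub>R (0, b))"
      by (simp add: torus_map_def prod_eq_iff fst_sum snd_sum)
    then show ?thesis
      by (simp only: linear_add[OF lin] linear_sum[OF lin] linear_cmul[OF lin] real_scaleR_def)
  qed
  then have "(\<lambda>x. complex_of_real (f (torus_map x)))
      = (\<lambda>x. (\<Sum>b\<in>Basis. complex_of_real (cos (2 * pi * (x \<bullet> b))) * complex_of_real (f (b, 0)))
           + (\<Sum>b\<in>Basis. complex_of_real (sin (2 * pi * (x \<bullet> b))) * complex_of_real (f (0, b))))"
    by simp
  then show ?case
    by (auto intro!: trig_add trig_sum trig_mult trig_poly_cos trig_poly_sin trig_const)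
next
  case (const c) then show ?case by (rule trig_const)
next
  case (add f g) then show ?case by (simp add: trig_add)
next
  case (mult f g) then show ?case by (simp add: trig_mult)
qed

lemma torus_map_eqD:
  assumes "torus_map x = torus_map y"
  shows "x - y \<in> int_points"
proof -
  have "(x - y) \<bullet> b \<in> \<int>" if b: "b \<in> Basis" for b
  proof -
    have "fst (torus_map x) \<bullet> b = fst (torus_map y) \<bullet> b" "snd (torus_map x) \<bullet> b = snd (torus_map y) \<bullet> b"
      using assms by simp_all
    then have "cos (2 * pi * (x \<bullet> b)) = cos (2 * pi * (y \<bullet> b)) \<and> sin (2 * pi * (x \<bullet> b)) = sin (2 * pi * (y \<bullet> b))"
      using b by (simp add: torus_map_def)
    then obtain n :: int where "2 * pi * (x \<bullet> b) = 2 * pi * (y \<bullet> b) + 2 * pi * n"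
      using sin_cos_eq_iff[of "2 * pi * (x \<bullet> b)" "2 * pi * (y \<bullet> b)"] by auto
    then have "2 * pi * (x \<bullet> b) = 2 * pi * (y \<bullet> b + n)" by (simp add: distrib_left)
    then have "x \<bullet> b = y \<bullet> b + n" by simp
    then show ?thesis by (simp add: inner_diff_left)
  qed
  then show ?thesis by (simp add: int_points_def)
qed

lemma torus_map_periodic: "y \<in> int_points \<Longrightarrow> torus_map (x + y) = torus_map x"
proof -
  assume y: "y \<in> int_points"
  have "cos (2 * pi * ((x + y) \<bullet> b)) = cos (2 * pi * (x \<bullet> b)) \<and> sin (2 * pi * ((x + y) \<bullet> b)) = sin (2 * pi * (x \<bullet> b))"
    if "b \<in> Basis" for b
  proof -
    obtain n :: int where "y \<bullet> b = n" using y \<open>b \<in> Basis\<close> by (auto simp: int_points_def elim: Ints_cases)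
    then have "2 * pi * ((x + y) \<bullet> b) = 2 * pi * (x \<bullet> b) + 2 * pi * n"
      by (simp add: inner_add_left distrib_left)
    then show ?thesis by (simp add: cos_add sin_add)
  qed
  then show ?thesis by (simp add: torus_map_def)
qed

lemma reduce_to_cube:
  obtains y :: "'v::euclidean_space" where "y \<in> int_points" "x + y \<in> cbox 0 One"
proof
  define y where "y = (\<Sum>b\<in>Basis. (- of_int \<lfloor>x \<bullet> b\<rfloor>) *\<^sub>R b)"
  have yb: "y \<bullet> b = - of_int \<lfloor>x \<bullet> b\<rfloor>" if "b \<in> Basis" for b
    unfolding y_def using that by (subst inner_sum_left_Basis) auto
  show "y \<in> int_points" using yb by (auto simp: int_points_def)
  show "x + y \<in> cbox 0 One"
    using yb by (auto simp: mem_box inner_add_left) linarith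
qed

text \<open>A periodic function descends to a continuous function on the compact image of
  \<open>torus_map\<close>; a polynomial approximation there pulls back to a trigonometric
  polynomial, and periodicity carries the estimate from the unit cube to the whole space.\<close>

lemma trig_poly_dense:
  fixes g :: "'v::euclidean_space \<Rightarrow> complex"
  assumes cont: "continuous_on UNIV g" and per: "\<And>x y. y \<in> int_points \<Longrightarrow> g (x + y) = g x" and e: "e > 0"
  obtains T where "trig_poly T" "\<And>x. norm (g x - T x) < e"
proof -
  \<comment> \<open>An arbitrary section of \<open>torus_map\<close> is used; points with equal
    image differ by an integer point, so periodicity of \<open>g\<close> makes the choice
    harmless.\<close>
  define Q where "Q w = g (inv_into (cbox 0 One) torus_map w)" for w
  define S where "S = torus_map ` cbox 0 (One :: 'v)"
  have Q: "Q (torus_map x) = g x" if "x \<in> cbox 0 One" for x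
  proof -
    have "torus_map (inv_into (cbox 0 One) torus_map (torus_map x)) = torus_map x"
      using that by (intro f_inv_into_f) auto
    from per[OF torus_map_eqD[OF this], of x] show ?thesis by (simp add: Q_def)
  qed
  have S: "compact S"
    unfolding S_def by (intro compact_continuous_image continuous_on_torus_map compact_cbox)
  \<comment> \<open>Continuity follows without a local inverse: the preimage of a closed set is the
    \<open>torus_map\<close> image of a compact subset of the cube.\<close>
  have "continuous_on S Q"
    unfolding continuous_on_closed_vimage[OF compact_imp_closed[OF S]]
  proof (intro allI impI)
    fix C :: "complex set" assume C: "closed C"
    have "Q -` C \<inter> S = torus_map ` (cbox 0 One \<inter> g -` C)"
      unfolding S_def using Q by (auto simp: image_iff)
    moreover have "compact (cbox 0 One \<inter> g -` C)"
      using cont C by (intro compact_Int_closed compact_cbox closed_vimage) (auto)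
    ultimately show "closed (Q -` C \<inter> S)"
      by (auto intro!: compact_imp_closed compact_continuous_image continuous_on_torus_map)
  qed
  from Stone_Weierstrass_polynomial_function[OF S this e]
  obtain q where q: "polynomial_function q" "\<And>w. w \<in> S \<Longrightarrow> norm (Q w - q w) < e" by blast
  define T where "T x = q (torus_map x)" for x :: 'v
  have "real_polynomial_function (Re \<circ> q)" "real_polynomial_function (Im \<circ> q)"
    using q(1) by (auto simp: polynomial_function_def bounded_linear_Re bounded_linear_Im)
  then have "trig_poly (\<lambda>x. complex_of_real (Re (T x)) + \<i> * complex_of_real (Im (T x)))"
    by (intro trig_add trig_mult trig_const) (auto simp: T_def dest!: trig_poly_real_polynomial)
  then have "trig_poly T" by (simp add: complex_eq[symmetric])
  moreover have "norm (g x - T x) < e" for x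
  proof -
    obtain y where y: "y \<in> int_points" "x + y \<in> cbox 0 One" using reduce_to_cube by blast
    have "norm (Q (torus_map (x + y)) - q (torus_map (x + y))) < e"
      using y by (intro q(2)) (auto simp: S_def)
    then show ?thesis
      using y(1) Q[OF y(2)] by (simp add: per torus_map_periodic T_def)
  qed
  ultimately show ?thesis using that by blast
qed

context euclidean_lattice
begin

lemma periodic_bounded:
  assumes P: "continuous_on UNIV P" "periodic P"
  obtains C where "C > 0" "\<And>z. norm (P z) \<le> C"
proof -
  have "compact (B ` cbox 0 One)"
    by (intro compact_continuous_image compact_cbox linear_continuous_on linear_conv_bounded_linear[THEN iffD1] linB)
  then have "bounded (P ` B ` cbox 0 One)"
    using continuous_on_subset[OF P(1)] by (intro compact_imp_bounded compact_continuous_image[of "B ` cbox 0 One"]) auto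
  then obtain C where C: "C > 0" "\<And>x. x \<in> cbox 0 One \<Longrightarrow> norm (P (B x)) \<le> C"
    by (auto simp: bounded_pos)
  have "norm (P z) \<le> C" for z
  proof -
    obtain y where y: "y \<in> int_points" "inv B z + y \<in> cbox 0 One" using reduce_to_cube by blast
    then have "P (B (inv B z + y)) = P z" using P(2) by (simp add: linear_add[OF linB] periodic_def)
    then show ?thesis using C(2)[OF y(2)] by simp
  qed
  with C that show ?thesis by blast
qed

lemma integrable_cell:
  assumes "continuous_on UNIV P" "periodic P"
  shows "integrable lborel (\<lambda>z. indicator cell z *\<^sub>R P z)"
proof -
  have [measurable]: "P \<in> borel_measurable borel" using assms by (intro borel_measurable_continuous_onI)
  obtain C where C: "C > 0" "\<And>z. norm (P z) \<le> C" using periodic_bounded[OF assms] by blast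
  show ?thesis
  proof (rule Bochner_Integration.integrable_bound)
    show "integrable lborel (\<lambda>z. indicator cell z *\<^sub>R C)"
      using emeasure_cell_finite by simp
    show "AE z in lborel. norm (indicator cell z *\<^sub>R P z) \<le> norm (indicator cell z *\<^sub>R C)"
      using C by (auto simp: indicator_def)
  qed measurable
qed

text \<open>This is the completeness half of Parseval's identity. The squared distance from
  \<open>P\<close> to a uniformly close trigonometric polynomial is expanded by orthogonality of the
  characters. The arithmetic-geometric inequality on the cross terms then eliminates the unknown
  coefficients of the approximant and leaves only coefficients of \<open>P\<close>.\<close>

lemma parseval_le:
  assumes P: "continuous_on UNIV P" "periodic P"
    and e: "bij_betw e (UNIV :: nat set) int_points"
  shows "ennreal (covol * integral\<^sup>L lborel (\<lambda>z. indicator cell z *\<^sub>R (norm (P z))\<^sup>2))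
    \<le> (\<Sum>n. ennreal ((norm (integral\<^sup>L lborel (\<lambda>z. indicator cell z *\<^sub>R (P z * character (e n) z))))\<^sup>2))"
proof -
  define ch where "ch m = integral\<^sup>L lborel (\<lambda>z. indicator cell z *\<^sub>R (P z * character m z))" for m
  define N where "N = integral\<^sup>L lborel (\<lambda>z. indicator cell z *\<^sub>R (norm (P z))\<^sup>2)"
  let ?K = "\<Sum>n. ennreal ((norm (ch (e n)))\<^sup>2)"
  have per_mult: "periodic (\<lambda>z. f z * g z)" if "periodic f" "periodic g" for f g
    using that by (simp add: periodic_def)
  have per_cnj: "periodic (\<lambda>z. cnj (f z))" if "periodic f" for f
    using that by (simp add: periodic_def)
  have per_sum: "periodic (\<lambda>z. \<Sum>i\<in>S. f i z)" if "\<And>i. i \<in> S \<Longrightarrow> periodic (f i)" for f :: "'v \<Rightarrow> 'a \<Rightarrow> complex" and S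
    using that by (auto simp: periodic_def intro!: sum.cong)
  have step: "covol * N \<le> covol\<^sup>2 * \<epsilon>\<^sup>2 + (\<Sum>m\<in>S. (norm (ch (- m)))\<^sup>2)"
    if S: "finite S" "S \<subseteq> int_points" and close: "\<And>z. norm (P z - (\<Sum>m\<in>S. t m * character m z)) < \<epsilon>" for S t \<epsilon>
  proof -
    define T where "T z = (\<Sum>m\<in>S. t m * character m z)" for z
    have cT: "continuous_on UNIV T" unfolding T_def by (intro continuous_intros continuous_on_character)
    have pT: "periodic T" unfolding T_def using S
      by (intro per_sum per_mult periodic_character) (auto simp: periodic_def)
    have iPP: "integrable lborel (\<lambda>z. indicator cell z *\<^sub>R (P z * cnj (P z)))"
      by (intro integrable_cell continuous_intros P per_mult per_cnj)
    have iPT: "integrable lborel (\<lambda>z. indicator cell z *\<^sub>R (P z * cnj (T z)))"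
      by (intro integrable_cell continuous_intros P cT pT per_mult per_cnj)
    have iTT: "integrable lborel (\<lambda>z. indicator cell z *\<^sub>R (T z * cnj (T z)))"
      by (intro integrable_cell continuous_intros P cT pT per_mult per_cnj)
    have ic: "integrable lborel (\<lambda>z. indicator cell z *\<^sub>R (P z * character m z))" if "m \<in> int_points" for m
      using that by (intro integrable_cell continuous_intros P continuous_on_character per_mult periodic_character)
    have icc: "integrable lborel (\<lambda>z. indicator cell z *\<^sub>R character m z)" if "m \<in> int_points" for m
      using that by (intro integrable_cell continuous_on_character periodic_character)
    have PP: "integral\<^sup>L lborel (\<lambda>z. indicator cell z *\<^sub>R (P z * cnj (P z))) = of_real N"
    proof -
      have "(\<lambda>z. indicator cell z *\<^sub>R (P z * cnj (P z))) = (\<lambda>z. complex_of_real (indicator cell z *\<^sub>R (norm (P z))\<^sup>2))"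
        by (auto simp: fun_eq_iff indicator_def complex_norm_square[symmetric] simp del: of_real_power)
      then show ?thesis unfolding N_def by (simp only: integral_complex_of_real)
    qed
    have PT: "integral\<^sup>L lborel (\<lambda>z. indicator cell z *\<^sub>R (P z * cnj (T z))) = (\<Sum>m\<in>S. cnj (t m) * ch (- m))"
    proof -
      have eq: "(\<lambda>z. indicator cell z *\<^sub>R (P z * cnj (T z))) = (\<lambda>z. \<Sum>m\<in>S. cnj (t m) * (indicator cell z *\<^sub>R (P z * character (- m) z)))"
        by (simp add: T_def fun_eq_iff scaleR_conv_of_real sum_distrib_left character_simps mult_ac)
      have "integral\<^sup>L lborel (\<lambda>z. indicator cell z *\<^sub>R (P z * cnj (T z)))
          = (\<Sum>m\<in>S. integral\<^sup>L lborel (\<lambda>z. cnj (t m) * (indicator cell z *\<^sub>R (P z * character (- m) z))))"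
        unfolding eq using S by (intro Bochner_Integration.integral_sum integrable_mult_right ic int_points_minus) auto
      then show ?thesis by (simp only: ch_def integral_mult_right_zero)
    qed
    have PTc: "integral\<^sup>L lborel (\<lambda>z. cnj (indicator cell z *\<^sub>R (P z * cnj (T z)))) = cnj (\<Sum>m\<in>S. cnj (t m) * ch (- m))"
      unfolding PT[symmetric] by (rule Bochner_Integration.integral_cnj)
    have TT: "integral\<^sup>L lborel (\<lambda>z. indicator cell z *\<^sub>R (T z * cnj (T z))) = of_real (covol * (\<Sum>m\<in>S. (norm (t m))\<^sup>2))"
    proof -
      have ch': "character (m + - k) z = character m z * cnj (character k z)" for m k z
        by (simp only: character_simps)
      have eq: "(\<lambda>z. indicator cell z *\<^sub>R (T z * cnj (T z)))
          = (\<lambda>z. \<Sum>m\<in>S. \<Sum>k\<in>S. (t m * cnj (t k)) * (indicator cell z *\<^sub>R character (m + - k) z))"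
        unfolding T_def cnj_sum sum_product scaleR_sum_right complex_cnj_mult ch'
        by (intro ext sum.cong refl) (simp add: scaleR_conv_of_real mult_ac)
      have mk: "m + - k \<in> int_points" if "m \<in> S" "k \<in> S" for m k
        using that S(2) int_points_diff[of m k] by auto
      have "integral\<^sup>L lborel (\<lambda>z. indicator cell z *\<^sub>R (T z * cnj (T z)))
          = (\<Sum>m\<in>S. integral\<^sup>L lborel (\<lambda>z. \<Sum>k\<in>S. (t m * cnj (t k)) * (indicator cell z *\<^sub>R character (m + - k) z)))"
        unfolding eq by (intro Bochner_Integration.integral_sum Bochner_Integration.integrable_sum integrable_mult_right icc mk)
      also have "\<dots> = (\<Sum>m\<in>S. \<Sum>k\<in>S. integral\<^sup>L lborel (\<lambda>z. (t m * cnj (t k)) * (indicator cell z *\<^sub>R character (m + - k) z)))"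
        by (intro sum.cong refl Bochner_Integration.integral_sum integrable_mult_right icc mk)
      also have "\<dots> = (\<Sum>m\<in>S. \<Sum>k\<in>S. (t m * cnj (t k)) * integral\<^sup>L lborel (\<lambda>z. indicator cell z *\<^sub>R character (m + - k) z))"
        by (simp only: integral_mult_right_zero)
      also have "\<dots> = (\<Sum>m\<in>S. \<Sum>k\<in>S. if m = k then of_real covol * (t m * cnj (t k)) else 0)"
        using S by (intro sum.cong refl) (auto simp: integral_character int_points_diff subset_eq)
      also have "\<dots> = (\<Sum>m\<in>S. of_real covol * (t m * cnj (t m)))"
        using S by simp
      finally show ?thesis
        by (simp add: complex_norm_square[symmetric] sum_distrib_left del: of_real_power)
    qed
    have "integral\<^sup>L lborel (\<lambda>z. indicator cell z *\<^sub>R (norm (P z - T z))\<^sup>2)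
        = Re (integral\<^sup>L lborel (\<lambda>z. indicator cell z *\<^sub>R ((P z - T z) * cnj (P z - T z))))"
    proof -
      have "(\<lambda>z. indicator cell z *\<^sub>R ((P z - T z) * cnj (P z - T z))) = (\<lambda>z. complex_of_real (indicator cell z *\<^sub>R (norm (P z - T z))\<^sup>2))"
        unfolding complex_norm_square[symmetric] by (auto simp: fun_eq_iff indicator_def simp del: of_real_power)
      then show ?thesis by (simp only: integral_complex_of_real Re_complex_of_real)
    qed
    also have "(\<lambda>z. indicator cell z *\<^sub>R ((P z - T z) * cnj (P z - T z)))
        = (\<lambda>z. (indicator cell z *\<^sub>R (P z * cnj (P z)) - indicator cell z *\<^sub>R (P z * cnj (T z)))
            - (cnj (indicator cell z *\<^sub>R (P z * cnj (T z))) - indicator cell z *\<^sub>R (T z * cnj (T z))))"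
      by (simp add: fun_eq_iff algebra_simps)
    also have "integral\<^sup>L lborel \<dots> = (of_real N - (\<Sum>m\<in>S. cnj (t m) * ch (- m)))
        - (cnj (\<Sum>m\<in>S. cnj (t m) * ch (- m)) - of_real (covol * (\<Sum>m\<in>S. (norm (t m))\<^sup>2)))"
      using iPP iPT iTT integrable_cnj[OF iPT]
      by (simp only: Bochner_Integration.integral_diff Bochner_Integration.integrable_diff PP PT TT PTc)
    finally have eq: "integral\<^sup>L lborel (\<lambda>z. indicator cell z *\<^sub>R (norm (P z - T z))\<^sup>2)
        = N - 2 * (\<Sum>m\<in>S. Re (cnj (t m) * ch (- m))) + covol * (\<Sum>m\<in>S. (norm (t m))\<^sup>2)"
      by (simp add: Re_sum)
    \<comment> \<open>The weights are arranged so that the terms with |t m|^2 cancel exactly against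
      the norm of the approximant.\<close>
    have am: "2 * covol * Re (cnj (t m) * ch (- m)) \<le> covol\<^sup>2 * (norm (t m))\<^sup>2 + (norm (ch (- m)))\<^sup>2" for m
    proof -
      have "Re (cnj (t m) * ch (- m)) \<le> norm (t m) * norm (ch (- m))"
        using complex_Re_le_cmod[of "cnj (t m) * ch (- m)"] by (simp add: norm_mult)
      then have "2 * covol * Re (cnj (t m) * ch (- m)) \<le> 2 * covol * (norm (t m) * norm (ch (- m)))"
        using covol_pos by (intro mult_left_mono) auto
      also have "\<dots> \<le> (covol * norm (t m))\<^sup>2 + (norm (ch (- m)))\<^sup>2"
        using sum_squares_bound[of "covol * norm (t m)" "norm (ch (- m))"] by (simp add: mult_ac)
      finally show ?thesis by (simp add: power_mult_distrib)
    qed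
    have "integral\<^sup>L lborel (\<lambda>z. indicator cell z *\<^sub>R (norm (P z - T z))\<^sup>2) \<le> integral\<^sup>L lborel (\<lambda>z. indicator cell z *\<^sub>R \<epsilon>\<^sup>2)"
    proof (rule integral_mono')
      show "integrable lborel (\<lambda>z. indicator cell z *\<^sub>R \<epsilon>\<^sup>2)" using emeasure_cell_finite by simp
      show "indicator cell z *\<^sub>R (norm (P z - T z))\<^sup>2 \<le> indicator cell z *\<^sub>R \<epsilon>\<^sup>2" for z
        using close[of z] by (auto simp: indicator_def T_def[symmetric] intro!: power_mono)
    qed auto
    also have "\<dots> = covol * \<epsilon>\<^sup>2" by (simp add: covol_def)
    finally have "covol * (N - 2 * (\<Sum>m\<in>S. Re (cnj (t m) * ch (- m))) + covol * (\<Sum>m\<in>S. (norm (t m))\<^sup>2)) \<le> covol * (covol * \<epsilon>\<^sup>2)"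
      unfolding eq using covol_pos by (intro mult_left_mono) auto
    moreover have "(\<Sum>m\<in>S. 2 * covol * Re (cnj (t m) * ch (- m))) \<le> (\<Sum>m\<in>S. covol\<^sup>2 * (norm (t m))\<^sup>2 + (norm (ch (- m)))\<^sup>2)"
      by (intro sum_mono am)
    then have "2 * covol * (\<Sum>m\<in>S. Re (cnj (t m) * ch (- m)))
        \<le> covol\<^sup>2 * (\<Sum>m\<in>S. (norm (t m))\<^sup>2) + (\<Sum>m\<in>S. (norm (ch (- m)))\<^sup>2)"
      by (simp only: sum.distrib sum_distrib_left)
    ultimately show ?thesis
      by (simp only: distrib_left right_diff_distrib power2_eq_square mult_ac)
  qed
  show ?thesis
  proof (cases "?K = \<infinity>")
    case True
    then show ?thesis by (simp add: ch_def)
  next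
    case False
    then have sm: "summable (\<lambda>n. (norm (ch (e n)))\<^sup>2)"
      by (intro summable_suminf_not_top) auto
    define K where "K = (\<Sum>n. (norm (ch (e n)))\<^sup>2)"
    have K: "?K = ennreal K" unfolding K_def by (rule suminf_ennreal2[OF _ sm]) simp
    \<comment> \<open>The conjugate in the inner product produces the frequency -m. Negation
      permutes the integer points, so these terms still form a finite subfamily of the full
      series.\<close>
    have Sle: "(\<Sum>m\<in>S. (norm (ch (- m)))\<^sup>2) \<le> K" if "finite S" "S \<subseteq> int_points" for S
    proof -
      define I where "I = (\<lambda>m. inv_into UNIV e (- m)) ` S"
      have inv: "e (inv_into UNIV e (- m)) = - m" if "m \<in> S" for m
        using e that \<open>S \<subseteq> int_points\<close> by (intro f_inv_into_f) (auto simp: bij_betw_def intro: int_points_minus)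
      have inj: "inj_on (\<lambda>m. inv_into UNIV e (- m)) S"
      proof (rule inj_onI)
        fix x y assume xy: "x \<in> S" "y \<in> S" "inv_into UNIV e (- x) = inv_into UNIV e (- y)"
        then have "- x = - y" by (metis inv)
        then show "x = y" by simp
      qed
      have "(\<Sum>m\<in>S. (norm (ch (- m)))\<^sup>2) = (\<Sum>n\<in>I. (norm (ch (e n)))\<^sup>2)"
        unfolding I_def by (simp add: sum.reindex[OF inj] inv)
      also have "\<dots> \<le> K"
        unfolding K_def using \<open>finite S\<close> by (intro sum_le_suminf sm) (auto simp: I_def)
      finally show ?thesis .
    qed
    have "covol * N \<le> K"
    proof (rule field_le_epsilon)
      fix d :: real assume d: "d > 0"
      \<comment> \<open>This value turns the error covol^2 \<epsilon>^2 into exactly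
        \<open>d\<close>.\<close>
      define \<epsilon> where "\<epsilon> = sqrt d / covol"
      have \<epsilon>: "\<epsilon> > 0" using d covol_pos by (simp add: \<epsilon>_def)
      have cPB: "continuous_on UNIV (\<lambda>x. P (B x))"
        by (rule continuous_on_compose2[OF P(1) linear_continuous_on[OF linear_conv_bounded_linear[THEN iffD1, OF linB]]]) simp
      have pPB: "P (B (x + y)) = P (B x)" if "y \<in> int_points" for x y
        using P(2) that by (simp add: linear_add[OF linB] periodic_def)
      obtain T where T: "trig_poly T" "\<And>x. norm (P (B x) - T x) < \<epsilon>"
        using trig_poly_dense[OF cPB pPB \<epsilon>] by blast
      obtain S t where S: "finite S" "S \<subseteq> int_points" "T = (\<lambda>x. \<Sum>m\<in>S. t m * cis (2 * pi * (m \<bullet> x)))"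
        using trig_poly_sum[OF T(1)] by blast
      have "norm (P z - (\<Sum>m\<in>S. t m * character m z)) < \<epsilon>" for z
        using T(2)[of "inv B z"] by (simp add: S(3) character_def)
      from step[OF S(1,2) this] Sle[OF S(1,2)]
      have "covol * N \<le> covol\<^sup>2 * \<epsilon>\<^sup>2 + K" by simp
      also have "covol\<^sup>2 * \<epsilon>\<^sup>2 = d"
        using d covol_pos by (simp add: \<epsilon>_def power_divide)
      finally show "covol * N \<le> K + d" by simp
    qed
    then show ?thesis unfolding N_def[symmetric] ch_def[symmetric] K by (rule ennreal_leI)
  qed
qed

end

section \<open>Square summable sequences\<close>

abbreviation l2_seq :: "(nat \<Rightarrow> complex) \<Rightarrow> bool" where
  "l2_seq r \<equiv> summable (\<lambda>i. (cmod (r i))\<^sup>2)"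

lemma l2_seq_bounded_L2_set:
  assumes "\<And>N. L2_set (\<lambda>i. cmod (r i)) {..<N} \<le> m"
  shows "l2_seq r" "(\<Sum>i. (cmod (r i))\<^sup>2) \<le> m\<^sup>2"
proof -
  have m: "0 \<le> m" using assms[of 0] by simp
  have le: "(\<Sum>i<N. (cmod (r i))\<^sup>2) \<le> m\<^sup>2" for N
    using assms[of N] m unfolding L2_set_def by (simp add: real_le_lsqrt sum_nonneg real_sqrt_le_iff sqrt_le_D)
  show "l2_seq r" by (rule summableI_nonneg_bounded[OF _ le]) simp
  then show "(\<Sum>i. (cmod (r i))\<^sup>2) \<le> m\<^sup>2" by (intro suminf_le_const le)
qed

lemma L2_set_le_l2:
  assumes "l2_seq r"
  shows "L2_set (\<lambda>i. cmod (r i)) {..<N} \<le> sqrt (\<Sum>i. (cmod (r i))\<^sup>2)"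
  unfolding L2_set_def using assms by (intro real_sqrt_le_mono sum_le_suminf) auto

text \<open>Completeness of l2 in the form needed later: a series of sequences with summable norm
  bounds converges pointwise to a square summable sequence. Minkowski's inequality is applied on
  finite sections, where the limit may be taken.\<close>

lemma l2_seq_series:
  fixes r :: "nat \<Rightarrow> nat \<Rightarrow> complex"
  assumes r: "\<And>k N. L2_set (\<lambda>i. cmod (r k i)) {..<N} \<le> m k" and m: "summable m"
  shows "summable (\<lambda>k. r k i)" "l2_seq (\<lambda>i. \<Sum>k. r k i)"
proof -
  have le: "cmod (r k i) \<le> m k" for k i
    using member_le_L2_set[of "{..<Suc i}" i "\<lambda>i. cmod (r k i)"] r[of k "Suc i"] by simp
  show s: "summable (\<lambda>k. r k i)" for i
    by (rule summable_comparison_test'[OF m, of 0]) (rule le)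
  show "l2_seq (\<lambda>i. \<Sum>k. r k i)"
  proof (rule l2_seq_bounded_L2_set(1))
    fix N
    have m0: "0 \<le> m k" for k using le[of k 0] norm_ge_zero order_trans by blast
    have "L2_set (\<lambda>i. cmod (\<Sum>k<K. r k i)) {..<N} \<le> suminf m" for K
    proof -
      have "L2_set (\<lambda>i. cmod (\<Sum>k<K. r k i)) {..<N} \<le> (\<Sum>k<K. m k)"
      proof (induction K)
        case 0 then show ?case by (simp add: L2_set_def)
      next
        case (Suc K)
        have "L2_set (\<lambda>i. cmod (\<Sum>k<Suc K. r k i)) {..<N} \<le> L2_set (\<lambda>i. cmod (\<Sum>k<K. r k i) + cmod (r K i)) {..<N}"
          by (intro L2_set_mono) (auto intro: norm_triangle_ineq)
        also have "\<dots> \<le> L2_set (\<lambda>i. cmod (\<Sum>k<K. r k i)) {..<N} + L2_set (\<lambda>i. cmod (r K i)) {..<N}"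
          by (rule L2_set_triangle_ineq)
        finally show ?case using Suc r[of K N] by simp
      qed
      also have "\<dots> \<le> suminf m" by (intro sum_le_suminf m) (auto simp: m0)
      finally show ?thesis .
    qed
    moreover have "(\<lambda>K. L2_set (\<lambda>i. cmod (\<Sum>k<K. r k i)) {..<N}) \<longlonglongrightarrow> L2_set (\<lambda>i. cmod (\<Sum>k. r k i)) {..<N}"
      unfolding L2_set_def by (intro tendsto_intros summable_LIMSEQ s)
    ultimately show "L2_set (\<lambda>i. cmod (\<Sum>k. r k i)) {..<N} \<le> suminf m"
      by (intro LIMSEQ_le_const2) auto
  qed
qed

section \<open>Schur's test and coercive systems on l2\<close>

locale schur_matrix =
  fixes G :: "nat \<Rightarrow> nat \<Rightarrow> complex" and g :: "nat \<Rightarrow> nat \<Rightarrow> real" and M :: real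
  assumes Gg: "\<And>i j. cmod (G i j) \<le> g i j"
    and row: "\<And>i. summable (\<lambda>j. g i j)" "\<And>i. (\<Sum>j. g i j) \<le> M"
    and col: "\<And>j. summable (\<lambda>i. g i j)" "\<And>j. (\<Sum>i. g i j) \<le> M"
begin

definition app :: "(nat \<Rightarrow> complex) \<Rightarrow> nat \<Rightarrow> complex" where
  "app r i = (\<Sum>j. G i j * r j)"

lemma g_nonneg: "0 \<le> g i j"
  using Gg[of i j] norm_ge_zero order_trans by blast

lemma g_le: "g i j \<le> M"
  using sum_le_suminf[OF row(1)[of i], of "{j}"] row(2)[of i] g_nonneg by simp

lemma M_nonneg: "0 \<le> M"
  using g_nonneg g_le order_trans by blast

lemma summable_bounded:
  assumes "\<And>j. cmod (r j) \<le> C"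
  shows "summable (\<lambda>j. G i j * r j)" "cmod (app r i) \<le> M * C"
proof -
  have C: "0 \<le> C" using assms[of 0] norm_ge_zero order_trans by blast
  have le: "cmod (G i j * r j) \<le> g i j * C" for j
    unfolding norm_mult using Gg assms g_nonneg by (intro mult_mono) auto
  have s: "summable (\<lambda>j. g i j * C)" by (intro summable_mult2 row)
  show "summable (\<lambda>j. G i j * r j)" by (rule summable_comparison_test'[OF s, of 0]) (rule le)
  have sn: "summable (\<lambda>j. cmod (G i j * r j))" by (rule summable_comparison_test'[OF s, of 0]) (use le in auto)
  have "cmod (app r i) \<le> (\<Sum>j. cmod (G i j * r j))" unfolding app_def by (rule summable_norm[OF sn])
  also have "\<dots> \<le> (\<Sum>j. g i j * C)" by (intro suminf_le le sn s)
  also have "\<dots> = (\<Sum>j. g i j) * C" using row(1)[of i] by (rule suminf_mult2[symmetric])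
  also have "\<dots> \<le> M * C" using row(2) C by (intro mult_right_mono)
  finally show "cmod (app r i) \<le> M * C" .
qed

lemma l2_seq_le:
  assumes "l2_seq r"
  shows "cmod (r j) \<le> sqrt (\<Sum>i. (cmod (r i))\<^sup>2)"
  using member_le_L2_set[of "{..<Suc j}" j "\<lambda>i. cmod (r i)"] L2_set_le_l2[OF assms, of "Suc j"] by simp

lemma summable_app: "l2_seq r \<Longrightarrow> summable (\<lambda>j. G i j * r j)"
  by (rule summable_bounded(1)[OF l2_seq_le])

text \<open>Schur's test: the majorant \<open>g\<close> is split into two square roots before
  Cauchy-Schwarz, so that one factor is controlled by the row sums and, after summation over the
  rows, the other by the column sums.\<close>

lemma app_l2:
  assumes r: "l2_seq r"
  shows "l2_seq (app r)" "(\<Sum>i. (cmod (app r i))\<^sup>2) \<le> M\<^sup>2 * (\<Sum>i. (cmod (r i))\<^sup>2)"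
proof -
  define h where "h i j = g i j * (cmod (r j))\<^sup>2" for i j
  have h0: "0 \<le> h i j" for i j by (simp add: h_def g_nonneg)
  have hs: "summable (h i)" for i
    unfolding h_def using g_nonneg g_le
    by (intro summable_comparison_test'[OF summable_mult[OF r, of M], of 0]) (auto intro: mult_right_mono)
  have cs: "(cmod (app r i))\<^sup>2 \<le> M * (\<Sum>j. h i j)" for i
  proof (rule LIMSEQ_le_const2)
    show "(\<lambda>n. (cmod (\<Sum>j<n. G i j * r j))\<^sup>2) \<longlonglongrightarrow> (cmod (app r i))\<^sup>2"
      unfolding app_def by (intro tendsto_intros summable_LIMSEQ summable_app r)
    have "(cmod (\<Sum>j<n. G i j * r j))\<^sup>2 \<le> M * (\<Sum>j. h i j)" for n
    proof -
      have "cmod (\<Sum>j<n. G i j * r j) \<le> (\<Sum>j<n. sqrt (g i j) * (sqrt (g i j) * cmod (r j)))"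
      proof (rule sum_norm_le)
        fix j
        have "sqrt (g i j) * (sqrt (g i j) * cmod (r j)) = g i j * cmod (r j)"
          using g_nonneg by (simp add: mult.assoc[symmetric])
        then show "cmod (G i j * r j) \<le> sqrt (g i j) * (sqrt (g i j) * cmod (r j))"
          using Gg[of i j] by (simp only: norm_mult) (rule mult_right_mono, auto)
      qed
      then have "(cmod (\<Sum>j<n. G i j * r j))\<^sup>2 \<le> (\<Sum>j<n. sqrt (g i j) * (sqrt (g i j) * cmod (r j)))\<^sup>2"
        by (intro power_mono) auto
      also have "\<dots> \<le> (\<Sum>j<n. (sqrt (g i j))\<^sup>2) * (\<Sum>j<n. (sqrt (g i j) * cmod (r j))\<^sup>2)"
        by (rule Cauchy_Schwarz_ineq_sum)
      also have "\<dots> = (\<Sum>j<n. g i j) * (\<Sum>j<n. h i j)"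
        by (simp add: g_nonneg h_def power_mult_distrib)
      also have "\<dots> \<le> M * (\<Sum>j. h i j)"
      proof (intro mult_mono)
        show "(\<Sum>j<n. g i j) \<le> M"
          using sum_le_suminf[OF row(1)[of i], of "{..<n}"] row(2)[of i] g_nonneg by auto
        show "(\<Sum>j<n. h i j) \<le> (\<Sum>j. h i j)" using hs h0 by (intro sum_le_suminf) auto
      qed (auto simp: M_nonneg sum_nonneg h0)
      finally show ?thesis .
    qed
    then show "\<exists>N. \<forall>n\<ge>N. (cmod (\<Sum>j<n. G i j * r j))\<^sup>2 \<le> M * (\<Sum>j. h i j)" by blast
  qed
  have le: "(\<Sum>i<N. (cmod (app r i))\<^sup>2) \<le> M\<^sup>2 * (\<Sum>i. (cmod (r i))\<^sup>2)" for N
  proof -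
    have "(\<Sum>i<N. (cmod (app r i))\<^sup>2) \<le> (\<Sum>i<N. M * (\<Sum>j. h i j))" by (intro sum_mono cs)
    also have "\<dots> = M * (\<Sum>j. \<Sum>i<N. h i j)"
      using hs by (simp add: sum_distrib_left[symmetric] suminf_sum)
    also have "\<dots> \<le> M * (\<Sum>j. M * (cmod (r j))\<^sup>2)"
    proof (intro mult_left_mono suminf_le summable_sum hs summable_mult r M_nonneg)
      fix j
      have "(\<Sum>i<N. g i j) \<le> M"
        using sum_le_suminf[OF col(1)[of j], of "{..<N}"] col(2)[of j] g_nonneg by auto
      then show "(\<Sum>i<N. h i j) \<le> M * (cmod (r j))\<^sup>2"
        unfolding h_def sum_distrib_right[symmetric] by (intro mult_right_mono) auto
    qed
    finally show ?thesis using r by (simp add: suminf_mult power2_eq_square)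
  qed
  show "l2_seq (app r)" by (rule summableI_nonneg_bounded[OF _ le]) simp
  then show "(\<Sum>i. (cmod (app r i))\<^sup>2) \<le> M\<^sup>2 * (\<Sum>i. (cmod (r i))\<^sup>2)"
    by (rule suminf_le_const) (rule le)
qed

lemma app_diff:
  assumes "l2_seq r" "l2_seq s"
  shows "app (\<lambda>j. r j - c * s j) i = app r i - c * app s i"
proof -
  have "(\<lambda>j. G i j * (r j - c * s j)) = (\<lambda>j. G i j * r j - c * (G i j * s j))"
    by (simp add: fun_eq_iff algebra_simps)
  then show ?thesis unfolding app_def
    using summable_app[OF assms(1), of i] summable_app[OF assms(2), of i]
    by (simp add: suminf_diff[symmetric] suminf_mult[symmetric] summable_mult)
qed

lemma summable_inner:
  assumes "l2_seq r" "l2_seq s"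
  shows "summable (\<lambda>i. cmod (cnj (r i) * s i))"
proof (rule summable_comparison_test'[OF summable_add[OF assms], of 0])
  fix i
  have "2 * (cmod (r i) * cmod (s i)) \<le> (cmod (r i))\<^sup>2 + (cmod (s i))\<^sup>2"
    using sum_squares_bound[of "cmod (r i)" "cmod (s i)"] by simp
  then show "norm (cmod (cnj (r i) * s i)) \<le> (cmod (r i))\<^sup>2 + (cmod (s i))\<^sup>2"
    using mult_nonneg_nonneg[OF norm_ge_zero norm_ge_zero, of "r i" "s i"]
    unfolding norm_mult real_norm_def abs_mult abs_norm_cancel complex_mod_cnj by linarith
qed

text \<open>Passing from finite sections to l2 costs the image under the matrix of the tail
  \<open>t N\<close>; by Schur's test this error is bounded by the norm of the tail, which tends to
  zero.\<close>

lemma coercive_l2: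
  assumes coer: "\<And>N a. c * (\<Sum>i<N. (cmod (a i))\<^sup>2) \<le> Re (\<Sum>i<N. cnj (a i) * (\<Sum>j<N. G i j * a j))"
    and r: "l2_seq r"
  shows "c * (\<Sum>i. (cmod (r i))\<^sup>2) \<le> Re (\<Sum>i. cnj (r i) * app r i)"
proof -
  define R where "R = (\<Sum>i. (cmod (r i))\<^sup>2)"
  define t where "t N j = (if j < N then 0 else r j)" for N j
  have tl2: "l2_seq (t N)" for N
    by (rule summable_comparison_test'[OF r, of 0]) (auto simp: t_def)
  have tsum: "(\<Sum>j. (cmod (t N j))\<^sup>2) = R - (\<Sum>j<N. (cmod (r j))\<^sup>2)" for N
  proof -
    have "(\<lambda>j. (cmod (t N j))\<^sup>2) = (\<lambda>j. (cmod (r j))\<^sup>2 - (if j \<in> {..<N} then (cmod (r j))\<^sup>2 else 0))"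
      by (auto simp: t_def fun_eq_iff)
    then show ?thesis
      using suminf_diff[OF r sums_summable[OF sums_If_finite_set[of "{..<N}" "\<lambda>j. (cmod (r j))\<^sup>2"]], symmetric]
        sums_unique[OF sums_If_finite_set[of "{..<N}" "\<lambda>j. (cmod (r j))\<^sup>2"]]
      by (simp add: R_def)
  qed
  have tlim: "(\<lambda>N. \<Sum>j. (cmod (t N j))\<^sup>2) \<longlonglongrightarrow> 0"
    unfolding tsum using tendsto_diff[OF tendsto_const summable_LIMSEQ[OF r], of R] by (simp add: R_def)
  have fin: "(\<Sum>j<N. G i j * r j) = app r i - app (t N) i" for i N
  proof -
    have "app r i - app (t N) i = (\<Sum>j. G i j * r j - G i j * t N j)"
      unfolding app_def by (intro suminf_diff summable_app r tl2)
    also have "(\<lambda>j. G i j * r j - G i j * t N j) = (\<lambda>j. if j \<in> {..<N} then G i j * r j else 0)"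
      by (auto simp: t_def fun_eq_iff)
    also have "suminf \<dots> = (\<Sum>j<N. G i j * r j)"
      using sums_If_finite_set[of "{..<N}" "\<lambda>j. G i j * r j"] by (simp add: sums_iff)
    finally show ?thesis by simp
  qed
  have err: "cmod (\<Sum>i<N. cnj (r i) * app (t N) i) \<le> sqrt R * (M * sqrt (\<Sum>j. (cmod (t N j))\<^sup>2))" for N
  proof -
    have "cmod (\<Sum>i<N. cnj (r i) * app (t N) i) \<le> (\<Sum>i<N. cmod (r i) * cmod (app (t N) i))"
      by (rule sum_norm_le) (simp add: norm_mult)
    also have "\<dots> \<le> L2_set (\<lambda>i. cmod (r i)) {..<N} * L2_set (\<lambda>i. cmod (app (t N) i)) {..<N}"
      using L2_set_mult_ineq[of "\<lambda>i. cmod (r i)" "\<lambda>i. cmod (app (t N) i)" "{..<N}"] by simp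
    also have "\<dots> \<le> sqrt R * sqrt (\<Sum>i. (cmod (app (t N) i))\<^sup>2)"
      unfolding R_def by (intro mult_mono L2_set_le_l2 r app_l2 tl2) (auto intro!: suminf_nonneg r L2_set_nonneg)
    also have "\<dots> \<le> sqrt R * sqrt (M\<^sup>2 * (\<Sum>j. (cmod (t N j))\<^sup>2))"
      unfolding R_def by (intro mult_left_mono real_sqrt_le_mono app_l2 tl2) (auto intro!: suminf_nonneg r)
    finally show ?thesis using M_nonneg by (simp add: real_sqrt_mult)
  qed
  have "(\<lambda>N. sqrt R * (M * sqrt (\<Sum>j. (cmod (t N j))\<^sup>2))) \<longlonglongrightarrow> sqrt R * (M * sqrt 0)"
    by (intro tendsto_intros tlim)
  then have "(\<lambda>N. \<Sum>i<N. cnj (r i) * app (t N) i) \<longlonglongrightarrow> 0"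
    by (intro Lim_null_comparison[OF always_eventually[OF allI[OF err]]]) simp
  moreover have "(\<lambda>N. \<Sum>i<N. cnj (r i) * app r i) \<longlonglongrightarrow> (\<Sum>i. cnj (r i) * app r i)"
    by (intro summable_LIMSEQ summable_norm_cancel[OF summable_inner] r app_l2)
  ultimately have "(\<lambda>N. (\<Sum>i<N. cnj (r i) * app r i) - (\<Sum>i<N. cnj (r i) * app (t N) i)) \<longlonglongrightarrow> (\<Sum>i. cnj (r i) * app r i) - 0"
    by (intro tendsto_diff)
  then have "(\<lambda>N. \<Sum>i<N. cnj (r i) * (\<Sum>j<N. G i j * r j)) \<longlonglongrightarrow> (\<Sum>i. cnj (r i) * app r i)"
    by (simp add: fin right_diff_distrib sum_subtractf)
  then have "(\<lambda>N. Re (\<Sum>i<N. cnj (r i) * (\<Sum>j<N. G i j * r j))) \<longlonglongrightarrow> Re (\<Sum>i. cnj (r i) * app r i)"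
    by (rule tendsto_Re)
  moreover have "(\<lambda>N. c * (\<Sum>i<N. (cmod (r i))\<^sup>2)) \<longlonglongrightarrow> c * (\<Sum>i. (cmod (r i))\<^sup>2)"
    by (intro tendsto_intros summable_LIMSEQ r)
  ultimately show ?thesis
    using coer[where a=r] by (intro LIMSEQ_le) auto
qed

text \<open>Richardson iteration: coercivity and boundedness make the map sending r to r - t G r a
  contraction of l2, so the residuals decay geometrically and their sum, multiplied by
  \<open>t\<close>, solves the system.\<close>

theorem coercive_solvable:
  assumes c: "c > 0"
    and coer: "\<And>N a. c * (\<Sum>i<N. (cmod (a i))\<^sup>2) \<le> Re (\<Sum>i<N. cnj (a i) * (\<Sum>j<N. G i j * a j))"
    and \<alpha>: "l2_seq \<alpha>"
  obtains b where "l2_seq b" "\<And>i. app b i = \<alpha> i"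
proof -
  have "c \<le> Re (G 0 0)" using coer[where N=1 and a="\<lambda>_. 1"] by simp
  also have "\<dots> \<le> M" using complex_Re_le_cmod[of "G 0 0"] Gg[of 0 0] g_le[of 0 0] by linarith
  finally have cM: "c \<le> M" .
  then have M: "M > 0" using c by simp
  \<comment> \<open>This is the minimiser of 1 - 2 t c + t^2 M^2, the factor by which one step
    changes the squared norm; the minimum is \<open>\<rho>\<close>, nonnegative because c <=
    M.\<close>
  define t where "t = c / M\<^sup>2"
  have t: "t > 0" using c M by (simp add: t_def)
  define \<rho> where "\<rho> = 1 - c\<^sup>2 / M\<^sup>2"
  define q where "q = sqrt \<rho>"
  have "c\<^sup>2 / M\<^sup>2 \<le> 1" using cM c M by (simp add: power_mono)
  then have \<rho>: "0 \<le> \<rho>" "\<rho> < 1" using c M by (auto simp: \<rho>_def)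
  then have q: "0 \<le> q" "q < 1" "q\<^sup>2 = \<rho>" by (auto simp: q_def)
  define n2 where "n2 r = (\<Sum>i. (cmod (r i))\<^sup>2)" for r :: "nat \<Rightarrow> complex"
  have contr: "l2_seq (\<lambda>i. r i - t * app r i) \<and> n2 (\<lambda>i. r i - t * app r i) \<le> \<rho> * n2 r" if r: "l2_seq r" for r
  proof -
    have eq: "(cmod (r i - t * app r i))\<^sup>2 = (cmod (r i))\<^sup>2 - 2 * t * Re (cnj (r i) * app r i) + t\<^sup>2 * (cmod (app r i))\<^sup>2" for i
      unfolding cmod_power2 by (simp add: power2_eq_square algebra_simps)
    have si: "summable (\<lambda>i. cnj (r i) * app r i)"
      by (intro summable_norm_cancel[OF summable_inner] r app_l2)
    then have siR: "summable (\<lambda>i. Re (cnj (r i) * app r i))" "(\<Sum>i. Re (cnj (r i) * app r i)) = Re (\<Sum>i. cnj (r i) * app r i)"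
      by (rule summable_Re) (rule Re_suminf[symmetric, OF si])
    have S: "(\<lambda>i. (cmod (r i))\<^sup>2 - 2 * t * Re (cnj (r i) * app r i) + t\<^sup>2 * (cmod (app r i))\<^sup>2)
        sums (n2 r - 2 * t * Re (\<Sum>i. cnj (r i) * app r i) + t\<^sup>2 * n2 (app r))"
      unfolding n2_def siR(2)[symmetric]
      by (intro sums_add sums_diff sums_mult summable_sums r siR app_l2)
    then have s1: "l2_seq (\<lambda>i. r i - t * app r i)" unfolding eq by (rule sums_summable)
    have "n2 (\<lambda>i. r i - t * app r i) = n2 r - 2 * t * Re (\<Sum>i. cnj (r i) * app r i) + t\<^sup>2 * n2 (app r)"
      using sums_unique[OF S] unfolding n2_def eq by simp
    also have "\<dots> \<le> n2 r - 2 * t * (c * n2 r) + t\<^sup>2 * (M\<^sup>2 * n2 r)"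
      using coercive_l2[OF coer r] app_l2(2)[OF r] t unfolding n2_def
      by (intro add_mono diff_mono mult_left_mono) auto
    also have "\<dots> = \<rho> * n2 r"
      using M unfolding t_def \<rho>_def by (simp add: field_simps power2_eq_square)
    finally show ?thesis using s1 by simp
  qed
  \<comment> \<open>The sequence \<open>r k\<close> is the residual left after \<open>k\<close>
    corrections; the partial sums \<open>bK\<close> below satisfy
    \<open>app (bK K) i = \<alpha> i - r K i\<close>.\<close>
  define r where "r = rec_nat \<alpha> (\<lambda>_ r i. r i - t * app r i)"
  have r0: "r 0 = \<alpha>" and rS: "r (Suc k) = (\<lambda>i. r k i - t * app (r k) i)" for k
    by (simp_all add: r_def)
  have rl2: "l2_seq (r k) \<and> n2 (r k) \<le> \<rho> ^ k * n2 \<alpha>" for k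
  proof (induction k)
    case 0 then show ?case using \<alpha> by (simp add: r0)
  next
    case (Suc k)
    then have "l2_seq (r (Suc k))" "n2 (r (Suc k)) \<le> \<rho> * n2 (r k)" using contr by (auto simp: rS)
    moreover have "\<rho> * n2 (r k) \<le> \<rho> * (\<rho> ^ k * n2 \<alpha>)" using Suc \<rho> by (intro mult_left_mono) auto
    ultimately show ?case by (simp add: mult.assoc)
  qed
  define s where "s = sqrt (n2 \<alpha>)"
  have s0: "0 \<le> s" unfolding s_def n2_def using \<alpha> by (simp add: suminf_nonneg)
  have rle: "L2_set (\<lambda>i. cmod (r k i)) {..<N} \<le> q ^ k * s" for k N
  proof -
    have "L2_set (\<lambda>i. cmod (r k i)) {..<N} \<le> sqrt (n2 (r k))"
      unfolding n2_def using rl2 by (intro L2_set_le_l2) blast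
    also have "\<dots> \<le> sqrt (\<rho> ^ k * n2 \<alpha>)" using rl2 by (intro real_sqrt_le_mono) blast
    finally show ?thesis by (simp add: q_def s_def real_sqrt_mult real_sqrt_power)
  qed
  have tr: "L2_set (\<lambda>i. cmod (t * r k i)) {..<N} \<le> t * (q ^ k * s)" for k N
  proof -
    have "L2_set (\<lambda>i. cmod (t * r k i)) {..<N} = t * L2_set (\<lambda>i. cmod (r k i)) {..<N}"
      using t by (simp add: norm_mult L2_set_right_distrib)
    then show ?thesis using rle t by (simp add: mult_left_mono)
  qed
  have ms: "summable (\<lambda>k. t * (q ^ k * s))"
    using q by (intro summable_mult summable_mult2 summable_geometric) auto
  define b where "b i = (\<Sum>k. t * r k i)" for i
  have bs: "summable (\<lambda>k. t * r k i)" for i by (rule l2_seq_series(1)[OF tr ms])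
  have bl2: "l2_seq b" unfolding b_def by (rule l2_seq_series(2)[OF tr ms])
  define bK where "bK K i = (\<Sum>k<K. t * r k i)" for K i
  have bK: "l2_seq (bK K) \<and> (\<forall>i. app (bK K) i = \<alpha> i - r K i)" for K
  proof (induction K)
    case 0
    then show ?case by (simp add: bK_def app_def r0)
  next
    case (Suc K)
    have e: "bK (Suc K) = (\<lambda>i. bK K i - (- t) * r K i)" by (simp add: bK_def fun_eq_iff)
    have "l2_seq (bK (Suc K))"
    proof (rule l2_seq_bounded_L2_set(1))
      fix N
      have "L2_set (\<lambda>i. cmod (bK (Suc K) i)) {..<N} \<le> L2_set (\<lambda>i. cmod (bK K i) + cmod (t * r K i)) {..<N}"
        by (intro L2_set_mono) (auto simp: bK_def intro: norm_triangle_ineq)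
      also have "\<dots> \<le> L2_set (\<lambda>i. cmod (bK K i)) {..<N} + L2_set (\<lambda>i. cmod (t * r K i)) {..<N}"
        by (rule L2_set_triangle_ineq)
      finally show "L2_set (\<lambda>i. cmod (bK (Suc K) i)) {..<N} \<le> sqrt (n2 (bK K)) + t * (q ^ K * s)"
        using L2_set_le_l2[of "bK K" N] Suc tr[of K N] unfolding n2_def by simp
    qed
    moreover have "app (bK (Suc K)) i = \<alpha> i - r (Suc K) i" for i
      unfolding e using app_diff[of "bK K" "r K" "- t" i] Suc rl2[of K] by (simp add: rS)
    ultimately show ?case by blast
  qed
  have "app b i = \<alpha> i" for i
  proof -
    have rk: "cmod (t * r k j) \<le> t * (q ^ k * s)" for k j
      using member_le_L2_set[of "{..<Suc j}" j "\<lambda>i. cmod (t * r k i)"] tr[of k "Suc j"] by simp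
    have tail: "cmod (b j - bK K j) \<le> t * s / (1 - q) * q ^ K" for j K
    proof -
      have "b j - bK K j = (\<Sum>k. t * r (k + K) j)"
        unfolding b_def bK_def using suminf_split_initial_segment[OF bs, of j K] by simp
      also have "cmod \<dots> \<le> (\<Sum>k. t * (q ^ (k + K) * s))"
      proof (rule norm_suminf_le)
        show "norm (t * r (k + K) j) \<le> t * (q ^ (k + K) * s)" for k by (rule rk)
        show "summable (\<lambda>k. t * (q ^ (k + K) * s))" using ms by (rule summable_ignore_initial_segment)
      qed
      also have "\<dots> = t * s * q ^ K * (\<Sum>k. q ^ k)"
        using q by (subst suminf_mult[symmetric]) (auto simp: power_add mult_ac intro!: summable_geometric)
      also have "\<dots> = t * s / (1 - q) * q ^ K" using q by (simp add: suminf_geometric)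
      finally show ?thesis .
    qed
    \<comment> \<open>The geometric tail bounds b - bK K uniformly in the index, and every row of
      the matrix has absolute sum at most \<open>M\<close>.\<close>
    have bd: "cmod (app b i - app (bK K) i) \<le> M * (t * s / (1 - q) * q ^ K)" for K
      using summable_bounded(2)[where r="\<lambda>j. b j - bK K j" and i=i, OF tail] app_diff[OF bl2, of "bK K" 1 i] bK[of K] by simp
    have "(\<lambda>K. M * (t * s / (1 - q) * q ^ K)) \<longlonglongrightarrow> M * (t * s / (1 - q) * 0)"
      using q by (intro tendsto_intros LIMSEQ_power_zero) auto
    then have lim: "(\<lambda>K. M * (t * s / (1 - q) * q ^ K)) \<longlonglongrightarrow> 0" by simp
    have "(\<lambda>K. app b i - app (bK K) i) \<longlonglongrightarrow> 0"
      by (rule Lim_null_comparison[OF always_eventually[OF allI[OF bd]] lim])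
    then have "(\<lambda>K. app b i - (\<alpha> i - r K i)) \<longlonglongrightarrow> 0" using bK by simp
    moreover have "(\<lambda>K. r K i) \<longlonglongrightarrow> 0"
    proof -
      have "(\<lambda>K. t * r K i) \<longlonglongrightarrow> 0"
        by (rule Lim_null_comparison[OF always_eventually[OF allI[OF rk]] summable_LIMSEQ_zero[OF ms]])
      from tendsto_mult[OF tendsto_const this, of "1 / complex_of_real t"] show ?thesis using t by simp
    qed
    ultimately have "(\<lambda>K. app b i - (\<alpha> i - r K i) - r K i) \<longlonglongrightarrow> 0 - 0" by (rule tendsto_diff)
    then have "(\<lambda>K::nat. app b i - \<alpha> i) \<longlonglongrightarrow> 0" by simp
    then show ?thesis by (simp add: LIMSEQ_const_iff)
  qed
  with bl2 that show ?thesis by blast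
qed

end

text \<open>Sokal's form of the gliding hump: the sign of each summand is chosen so that the next
  inner product does not decrease, and geometric weights control the tail.\<close>

lemma gliding_hump:
  fixes b :: "nat \<Rightarrow> nat \<Rightarrow> complex"
  assumes fin: "\<And>j i. i \<ge> N j \<Longrightarrow> b j i = 0" and nrm: "\<And>j. (\<Sum>i<N j. (cmod (b j i))\<^sup>2) = 1"
  obtains \<alpha> where "l2_seq \<alpha>" "\<And>j. (1/2) * (1/4) ^ j \<le> cmod (\<Sum>i<N j. \<alpha> i * cnj (b j i))"
proof -
  define ip where "ip x j = (\<Sum>i<N j. x i * cnj (b j i))" for x j
  \<comment> \<open>If the plus sign leaves a small value, the minus sign cannot: the two candidates
    differ by twice the weight (1/4)^j.\<close>
  define sg where "sg j x = (if (1/4) ^ j \<le> cmod (ip x j + (1/4) ^ j) then 1 else -1 :: complex)" for j x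
  define x where "x = rec_nat (\<lambda>_. 0) (\<lambda>j x i. x i + sg j x * (1/4) ^ j * b j i)"
  have x0: "x 0 = (\<lambda>_. 0)" and xS: "x (Suc j) = (\<lambda>i. x j i + sg j (x j) * (1/4) ^ j * b j i)" for j
    by (simp_all add: x_def)
  define r where "r k i = sg k (x k) * (1/4) ^ k * b k i" for k i
  have nsg: "cmod (sg j y) = 1" for j y by (simp add: sg_def)
  have xr: "x j i = (\<Sum>k<j. r k i)" for j i
    by (induction j) (simp_all add: x0 xS r_def)
  have bL: "L2_set (\<lambda>i. cmod (b k i)) {..<n} \<le> 1" for k n
  proof -
    have "(\<Sum>i<n. (cmod (b k i))\<^sup>2) \<le> (\<Sum>i<max n (N k). (cmod (b k i))\<^sup>2)"
      by (intro sum_mono2) auto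
    also have "\<dots> = (\<Sum>i<N k. (cmod (b k i))\<^sup>2)"
      using fin by (intro sum.mono_neutral_right) auto
    finally show ?thesis by (simp add: nrm L2_set_def)
  qed
  have rL: "L2_set (\<lambda>i. cmod (r k i)) {..<n} \<le> (1/4) ^ k" for k n
  proof -
    have "L2_set (\<lambda>i. cmod (r k i)) {..<n} = (1/4) ^ k * L2_set (\<lambda>i. cmod (b k i)) {..<n}"
      by (simp add: r_def norm_mult norm_power nsg L2_set_right_distrib)
    then show ?thesis using bL[of k n] by (simp add: mult_left_le)
  qed
  have ms: "summable (\<lambda>k. (1/4::real) ^ k)" by (intro summable_geometric) simp
  define \<alpha> where "\<alpha> i = (\<Sum>k. r k i)" for i
  have rs: "summable (\<lambda>k. r k i)" for i by (rule l2_seq_series(1)[OF rL ms])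
  have "l2_seq \<alpha>" unfolding \<alpha>_def by (rule l2_seq_series(2)[OF rL ms])
  moreover have "(1/2) * (1/4) ^ j \<le> cmod (\<Sum>i<N j. \<alpha> i * cnj (b j i))" for j
  proof -
    have ipr: "cmod (ip (r k) j) \<le> (1/4) ^ k" for k
    proof -
      have "cmod (ip (r k) j) \<le> (\<Sum>i<N j. cmod (r k i) * cmod (b j i))"
        unfolding ip_def by (rule sum_norm_le) (simp add: norm_mult)
      also have "\<dots> \<le> L2_set (\<lambda>i. cmod (r k i)) {..<N j} * L2_set (\<lambda>i. cmod (b j i)) {..<N j}"
        using L2_set_mult_ineq[of "\<lambda>i. cmod (r k i)" "\<lambda>i. cmod (b j i)" "{..<N j}"] by simp
      also have "\<dots> \<le> (1/4) ^ k * 1" by (intro mult_mono rL bL) (auto intro: L2_set_nonneg)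
      finally show ?thesis by simp
    qed
    have sip: "summable (\<lambda>k. ip (r k) j)"
      by (rule summable_comparison_test'[OF ms, of 0]) (use ipr in auto)
    have "ip \<alpha> j = (\<Sum>k. ip (r k) j)"
      unfolding ip_def \<alpha>_def
      using rs by (subst suminf_sum) (auto intro!: sum.cong summable_mult2 simp: suminf_mult2)
    also have "\<dots> = (\<Sum>k. ip (r (k + Suc j)) j) + (\<Sum>k<Suc j. ip (r k) j)"
      by (rule suminf_split_initial_segment[OF sip])
    also have "(\<Sum>k<Suc j. ip (r k) j) = ip (x (Suc j)) j"
      unfolding ip_def xr by (subst sum.swap) (simp only: sum_distrib_right)
    finally have split: "ip \<alpha> j = (\<Sum>k. ip (r (k + Suc j)) j) + ip (x (Suc j)) j" .
    \<comment> \<open>All later humps together contribute at most a third of the j-th weight, so at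
      least two thirds survive, which covers the claimed half.\<close>
    have "cmod (\<Sum>k. ip (r (k + Suc j)) j) \<le> (\<Sum>k. (1/4) ^ (k + Suc j))"
      by (rule norm_suminf_le[OF ipr summable_ignore_initial_segment[OF ms]])
    also have "\<dots> = (1/4) ^ j * (1/3)"
      using suminf_mult[OF ms, of "(1/4) ^ Suc j"] by (simp add: power_add mult_ac suminf_geometric)
    finally have tail: "cmod (\<Sum>k. ip (r (k + Suc j)) j) \<le> (1/4) ^ j * (1/3)" .
    have ipb: "ip (b j) j = 1"
    proof -
      have "ip (b j) j = of_real (\<Sum>i<N j. (cmod (b j i))\<^sup>2)"
        unfolding ip_def by (simp add: complex_norm_square[symmetric])
      then show ?thesis by (simp add: nrm)
    qed
    have "ip (x (Suc j)) j = ip (x j) j + sg j (x j) * (1/4) ^ j * ip (b j) j"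
      unfolding ip_def xS by (simp add: sum.distrib[symmetric] sum_distrib_left algebra_simps)
    then have xSj: "ip (x (Suc j)) j = ip (x j) j + sg j (x j) * (1/4) ^ j" by (simp add: ipb)
    have "(1/4) ^ j \<le> cmod (ip (x (Suc j)) j)"
    proof (cases "(1/4) ^ j \<le> cmod (ip (x j) j + (1/4) ^ j)")
      case True then show ?thesis by (simp add: xSj sg_def)
    next
      case False
      have "2 * (1/4) ^ j = cmod ((ip (x j) j + (1/4) ^ j) - (ip (x j) j - (1/4) ^ j))"
        by (simp add: norm_mult norm_power norm_divide)
      also have "\<dots> \<le> cmod (ip (x j) j + (1/4) ^ j) + cmod (ip (x j) j - (1/4) ^ j)"
        by (rule norm_triangle_ineq4)
      finally show ?thesis using False by (simp add: xSj sg_def)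
    qed
    moreover have "cmod (ip (x (Suc j)) j) \<le> cmod (ip \<alpha> j) + cmod (\<Sum>k. ip (r (k + Suc j)) j)"
      using norm_triangle_ineq4[of "ip \<alpha> j" "\<Sum>k. ip (r (k + Suc j)) j"] by (simp add: split)
    ultimately have "(1/2) * (1/4) ^ j \<le> cmod (ip \<alpha> j)"
      using tail zero_le_power[of "1/4 :: real" j] by linarith
    then show ?thesis by (simp add: ip_def)
  qed
  ultimately show ?thesis using that by blast
qed

section \<open>Weyl translations in the weighted picture\<close>

definition sy :: "complex ^ 'd \<Rightarrow> complex ^ 'd \<Rightarrow> real" where
  "sy z w = Im (cdot_conj z w)"

definition tau :: "complex ^ 'd \<Rightarrow> (complex ^ 'd \<Rightarrow> complex) \<Rightarrow> complex ^ 'd \<Rightarrow> complex" where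
  "tau z g x = cis (pi * sy z x) * g (x - z)"

definition wt :: "(complex ^ 'd \<Rightarrow> complex) \<Rightarrow> complex ^ 'd \<Rightarrow> complex" where
  "wt F z = complex_of_real (exp (- pi / 2 * (norm z)\<^sup>2)) * F z"

definition ip :: "(complex ^ 'd \<Rightarrow> complex) \<Rightarrow> (complex ^ 'd \<Rightarrow> complex) \<Rightarrow> complex" where
  "ip g h = integral\<^sup>L lborel (\<lambda>x. g x * cnj (h x))"

lemma cdot_conj_add_right: "cdot_conj z (w + x) = cdot_conj z w + cdot_conj z x"
  and cdot_conj_diff_right: "cdot_conj z (w - x) = cdot_conj z w - cdot_conj z x"
  and cdot_conj_commute: "cdot_conj w z = cnj (cdot_conj z w)"
  by (simp_all add: cdot_conj_def algebra_simps sum.distrib sum_negf sum_subtractf cnj_sum)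

lemma cdot_conj_eq: "cdot_conj z w = Complex (z \<bullet> w) (sy z w)"
  by (simp add: complex_eq_iff sy_def cdot_conj_def inner_vec_def inner_complex_def Re_sum)

lemma sy_add_left: "sy (z + w) x = sy z x + sy w x"
  and sy_add_right: "sy z (w + x) = sy z w + sy z x"
  and sy_minus_left: "sy (- z) x = - sy z x"
  and sy_minus_right: "sy z (- x) = - sy z x"
  and sy_diff_left: "sy (z - w) x = sy z x - sy w x"
  and sy_diff_right: "sy z (w - x) = sy z w - sy z x"
  by (simp_all add: sy_def cdot_conj_def algebra_simps sum.distrib sum_negf sum_subtractf)

lemma sy_commute: "sy w z = - sy z w"
  by (simp add: sy_def cdot_conj_commute[of w z])

lemma sy_self [simp]: "sy z z = 0"
  using sy_commute[of z z] by simp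

lemma sy_0 [simp]: "sy 0 z = 0" "sy z 0 = 0"
  by (simp_all add: sy_def cdot_conj_def)

lemma linear_sy: "linear (sy z)"
proof (rule linearI)
  show "sy z (r *\<^sub>R x) = r *\<^sub>R sy z x" for r x
    by (simp add: sy_def cdot_conj_def sum_distrib_left algebra_simps)
qed (rule sy_add_right)

lemma continuous_on_sy [continuous_intros]:
  assumes "continuous_on A f" "continuous_on A g"
  shows "continuous_on A (\<lambda>x. sy (f x) (g x))"
  unfolding sy_def cdot_conj_def using assms by (intro continuous_intros)

lemma sy_measurable [measurable]:
  assumes [measurable]: "f \<in> borel_measurable M" "g \<in> borel_measurable M"
  shows "(\<lambda>x. sy (f x) (g x)) \<in> borel_measurable M"
proof -
  have "continuous_on UNIV (\<lambda>p. sy (fst p) (snd p))"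
    by (intro continuous_intros)
  then have [measurable]: "(\<lambda>p. sy (fst p) (snd p)) \<in> borel_measurable borel"
    by (rule borel_measurable_continuous_onI)
  have "(\<lambda>x. (f x, g x)) \<in> borel_measurable M" by measurable
  from measurable_compose[OF this \<open>(\<lambda>p. sy (fst p) (snd p)) \<in> borel_measurable borel\<close>]
  show ?thesis by simp
qed

lemma cis_measurable [measurable]: "cis \<in> borel_measurable borel"
  by (intro borel_measurable_continuous_onI) (simp add: cis_conv_exp continuous_intros)

lemma cnj_measurable [measurable]: "cnj \<in> borel_measurable borel"
  by (intro borel_measurable_continuous_onI continuous_intros)

lemma continuous_on_cis_compose [continuous_intros]:
  "continuous_on A f \<Longrightarrow> continuous_on A (\<lambda>x. cis (f x))"
  unfolding cis_conv_exp by (intro continuous_intros)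

lemma tau_measurable [measurable]:
  assumes [measurable]: "g \<in> borel_measurable borel"
  shows "tau z g \<in> borel_measurable borel"
  unfolding tau_def[abs_def] by measurable

lemma continuous_on_tau:
  assumes "continuous_on UNIV g"
  shows "continuous_on A (tau z g)"
proof -
  have "continuous_on A (\<lambda>x. g (x - z))"
    by (rule continuous_on_compose2[OF assms]) (intro continuous_intros, simp)
  then show ?thesis unfolding tau_def[abs_def] by (intro continuous_intros)
qed

lemma norm_tau: "norm (tau z g x) = norm (g (x - z))"
  by (simp add: tau_def norm_mult)

text \<open>The phase is the cocycle of the projective representation \<open>tau\<close>; the later
  commutation rules are read off from it.\<close>

lemma tau_tau: "tau z (tau w g) x = cis (pi * sy z w) * tau (z + w) g x"
proof -
  have "sy z x + sy w (x - z) = sy z w + sy (z + w) x"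
    by (simp add: sy_diff_right sy_add_left sy_commute[of w z])
  then have "pi * sy z x + pi * sy w (x - z) = pi * sy z w + pi * sy (z + w) x"
    by (simp only: distrib_left[symmetric])
  then show ?thesis
    by (simp add: tau_def mult.assoc[symmetric] cis_mult diff_diff_eq)
qed

lemma tau_0 [simp]: "tau 0 g = g"
  by (simp add: tau_def fun_eq_iff)

lemma ip_tau_tau:
  assumes [measurable]: "g \<in> borel_measurable borel" "h \<in> borel_measurable borel"
  shows "ip (tau z g) (tau z h) = ip g h"
proof -
  have "ip (tau z g) (tau z h) = integral\<^sup>L lborel (\<lambda>x. (\<lambda>y. g y * cnj (h y)) (x + - z))"
  proof -
    have key: "cis a * u * cnj (cis a * v) = u * cnj v" for a u v
    proof -
      have "cis a * u * cnj (cis a * v) = (cis a * cnj (cis a)) * (u * cnj v)" by simp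
      then show ?thesis by (simp add: cis_cnj cis_mult)
    qed
    show ?thesis unfolding ip_def tau_def key by simp
  qed
  also have "\<dots> = ip g h"
    unfolding ip_def by (rule integral_lborel_translate) measurable
  finally show ?thesis .
qed

lemma ip_cmult_left: "ip (\<lambda>x. c * g x) h = c * ip g h"
  by (simp add: ip_def mult.assoc)

lemma ip_cmult_right: "ip g (\<lambda>x. c * h x) = cnj c * ip g h"
proof -
  have "(\<lambda>x. g x * cnj (c * h x)) = (\<lambda>x. cnj c * (g x * cnj (h x)))" by (simp add: fun_eq_iff mult_ac)
  then show ?thesis by (simp add: ip_def)
qed

lemma ip_commute: "ip h g = cnj (ip g h)"
proof -
  have eq: "(\<lambda>x. h x * cnj (g x)) = (\<lambda>x. cnj (g x * cnj (h x)))" by (simp add: fun_eq_iff mult.commute)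
  show ?thesis unfolding ip_def eq by (rule Bochner_Integration.integral_cnj)
qed

lemma ip_tau_right:
  assumes [measurable]: "g \<in> borel_measurable borel" "h \<in> borel_measurable borel"
  shows "ip g (tau z h) = ip (tau (- z) g) h"
proof -
  have "tau z (tau (- z) g) = g"
    by (rule ext) (simp add: tau_tau sy_minus_right)
  then show ?thesis
    using ip_tau_tau[of "tau (- z) g" h z] by simp
qed

text \<open>Completing the square: the real part of the exponent of \<open>beta_op\<close> moves the
  Gaussian from \<open>x\<close> to x - z, and its imaginary part is the phase of
  \<open>tau\<close>.\<close>

lemma wt_beta: "wt (beta_op z F) = tau z (wt F)"
proof
  fix x
  have n: "(norm (x - z))\<^sup>2 = (norm x)\<^sup>2 + (norm z)\<^sup>2 - 2 * (z \<bullet> x)"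
    by (simp add: power2_norm_eq_inner inner_diff_left inner_diff_right inner_commute)
  have e: "exp (complex_of_real pi * cdot_conj z x - complex_of_real (pi / 2 * (norm z)\<^sup>2))
      = of_real (exp (pi * (z \<bullet> x) - pi / 2 * (norm z)\<^sup>2)) * cis (pi * sy z x)"
    by (simp add: exp_eq_polar cdot_conj_eq)
  have "exp (- pi / 2 * (norm x)\<^sup>2) * exp (pi * (z \<bullet> x) - pi / 2 * (norm z)\<^sup>2) = exp (- pi / 2 * (norm (x - z))\<^sup>2)"
    by (simp add: n exp_add[symmetric] algebra_simps)
  then have "complex_of_real (exp (- pi / 2 * (norm x)\<^sup>2)) * of_real (exp (pi * (z \<bullet> x) - pi / 2 * (norm z)\<^sup>2))
      = of_real (exp (- pi / 2 * (norm (x - z))\<^sup>2))"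
    by (metis of_real_mult)
  then show "wt (beta_op z F) x = tau z (wt F) x"
    unfolding wt_def tau_def beta_op_def e by (simp only: mult.assoc[symmetric]) (simp only: mult_ac)
qed

lemma wt_cnj_wt: "wt F z * cnj (wt G z) = F z * cnj (G z) * complex_of_real (exp (- pi * (norm z)\<^sup>2))"
proof -
  have "exp (- pi / 2 * (norm z)\<^sup>2) * exp (- pi / 2 * (norm z)\<^sup>2) = exp (- pi * (norm z)\<^sup>2)"
    by (simp add: exp_add[symmetric])
  then have "complex_of_real (exp (- pi / 2 * (norm z)\<^sup>2)) * complex_of_real (exp (- pi / 2 * (norm z)\<^sup>2)) = of_real (exp (- pi * (norm z)\<^sup>2))"
    by (metis of_real_mult)
  moreover have "wt F z * cnj (wt G z) = F z * cnj (G z) * (complex_of_real (exp (- pi / 2 * (norm z)\<^sup>2)) * complex_of_real (exp (- pi / 2 * (norm z)\<^sup>2)))"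
    unfolding wt_def complex_cnj_mult complex_cnj_complex_of_real by (simp only: mult_ac)
  ultimately show ?thesis by (simp only:)
qed

lemma norm_wt: "(norm (wt F z))\<^sup>2 = (cmod (F z))\<^sup>2 * exp (- pi * (norm z)\<^sup>2)"
  by (simp add: wt_def norm_mult power_mult_distrib power2_eq_square[of "exp _"] exp_add[symmetric])

lemma fock_inner_ip: "fock_inner F G = ip (wt F) (wt G)"
  unfolding fock_inner_def ip_def wt_cnj_wt ..

lemma gauss_L2_wt: "gauss_L2 F \<longleftrightarrow> integrable lborel (\<lambda>z. (norm (wt F z))\<^sup>2)"
  unfolding gauss_L2_def norm_wt ..

lemma fock_norm2_wt: "fock_norm2 F = integral\<^sup>L lborel (\<lambda>z. (norm (wt F z))\<^sup>2)"
  unfolding fock_norm2_def norm_wt ..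

section \<open>Torus averages\<close>

definition upd :: "complex ^ 'd \<Rightarrow> 'd \<Rightarrow> complex \<Rightarrow> complex ^ 'd" where
  "upd z j w = (\<chi> i. if i = j then w else z $ i)"

lemma upd_nth: "upd z j w $ i = (if i = j then w else z $ i)"
  by (simp add: upd_def)

lemma upd_upd_same: "upd (upd z j v) j w = upd z j w"
  and upd_commute: "i \<noteq> j \<Longrightarrow> upd (upd z i v) j w = upd (upd z j w) i v"
  and upd_id [simp]: "upd z j (z $ j) = z"
  by (auto simp: vec_eq_iff upd_nth)

lemma continuous_on_upd [continuous_intros]:
  assumes "continuous_on A f" "continuous_on A g"
  shows "continuous_on A (\<lambda>x. upd (f x) j (g x))"
proof -
  have "continuous_on A (\<lambda>x. if i = j then g x else f x $ i)" for i
    using assms by (cases "i = j") (auto intro: continuous_intros)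
  then show ?thesis unfolding upd_def by (intro continuous_on_vec_lambda)
qed

text \<open>The m-th Fourier coefficient over the unit circle in coordinate \<open>j\<close>. The
  value does not depend on \<open>z $ j\<close>; for entire functions it is the m-th Taylor
  coefficient in that variable.\<close>

definition avg :: "'d \<Rightarrow> nat \<Rightarrow> (complex ^ 'd \<Rightarrow> complex) \<Rightarrow> complex ^ 'd \<Rightarrow> complex" where
  "avg j m \<phi> z = integral (cbox 0 1) (\<lambda>t::real. \<phi> (upd z j (cis (2 * pi * t))) * cis (- (2 * pi * m * t)))"

text \<open>All that is retained of holomorphy: the \<open>m\<close>-th Fourier coefficient on a circle of any radius
  scales like the \<open>m\<close>-th power. Unlike holomorphy, this passes to averages by Fubini alone.\<close>

definition circ :: "(complex ^ 'd \<Rightarrow> complex) \<Rightarrow> bool" where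
  "circ \<phi> \<longleftrightarrow> continuous_on UNIV \<phi> \<and>
    (\<forall>j m z. integral (cbox 0 1) (\<lambda>t::real. \<phi> (upd z j (z $ j * cis (2 * pi * t))) * cis (- (2 * pi * m * t)))
        = (z $ j) ^ m * avg j m \<phi> z)"

text \<open>Rescaling the argument by \<open>w\<close> moves every circle, including the degenerate
  one at w = 0, to the unit circle, where Cauchy's formula for derivatives applies.\<close>

lemma circle_coefficient:
  assumes g: "g holomorphic_on UNIV"
  shows "integral (cbox 0 1) (\<lambda>t::real. g (w * cis (2 * pi * t)) * cis (- (2 * pi * m * t))) = w ^ m * ((deriv ^^ m) g 0 / fact m)"
proof -
  define h where "h s = g (w * s)" for s
  have h: "h holomorphic_on UNIV"
    unfolding h_def using holomorphic_on_compose_gen[OF _ g, of "\<lambda>s. w * s" UNIV] by (simp add: o_def holomorphic_intros)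
  have hc: "continuous_on (cball 0 1) h" "h holomorphic_on ball 0 1"
    using h holomorphic_on_imp_continuous_on[OF h] by (auto intro: continuous_on_subset holomorphic_on_subset)
  have "((\<lambda>u. h u / (u - 0) ^ Suc m) has_contour_integral (2 * pi * \<i> / fact m * (deriv ^^ m) h 0)) (circlepath 0 1)"
    by (rule Cauchy_has_contour_integral_higher_derivative_circlepath[OF hc]) simp
  then have ci: "((\<lambda>t. h (circlepath 0 1 t) / (circlepath 0 1 t - 0) ^ Suc m * vector_derivative (circlepath 0 1) (at t within {0..1}))
      has_integral (2 * pi * \<i> / fact m * (deriv ^^ m) h 0)) {0..1}"
    unfolding has_contour_integral_def .
  have "((\<lambda>t. (2 * pi * \<i>) * (h (cis (2 * pi * t)) * cis (- (2 * pi * m * t)))) has_integral (2 * pi * \<i> / fact m * (deriv ^^ m) h 0)) {0..1}"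
  proof (rule has_integral_eq[OF _ ci])
    fix t :: real assume t: "t \<in> {0..1}"
    have e: "circlepath 0 1 t = cis (2 * pi * t)" by (simp add: circlepath cis_conv_exp mult_ac)
    have v: "vector_derivative (circlepath 0 1) (at t within {0..1}) = 2 * pi * \<i> * cis (2 * pi * t)"
      using t by (simp add: vector_derivative_circlepath01 cis_conv_exp mult_ac)
    have c: "cis (- (2 * pi * m * t)) = inverse (cis (2 * pi * t) ^ m)"
    proof -
      have "2 * pi * real m * t = real m * (2 * pi * t)" by simp
      then show ?thesis by (simp only: Complex.DeMoivre cis_inverse)
    qed
    show "h (circlepath 0 1 t) / (circlepath 0 1 t - 0) ^ Suc m * vector_derivative (circlepath 0 1) (at t within {0..1})
        = (2 * pi * \<i>) * (h (cis (2 * pi * t)) * cis (- (2 * pi * m * t)))"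
      unfolding e v c by (simp add: field_simps)
  qed
  then have "((\<lambda>t. (1 / (2 * pi * \<i>)) * ((2 * pi * \<i>) * (h (cis (2 * pi * t)) * cis (- (2 * pi * m * t)))))
      has_integral ((1 / (2 * pi * \<i>)) * (2 * pi * \<i> / fact m * (deriv ^^ m) h 0))) {0..1}"
    by (rule has_integral_mult_right)
  then have "((\<lambda>t. h (cis (2 * pi * t)) * cis (- (2 * pi * m * t))) has_integral ((deriv ^^ m) h 0 / fact m)) {0..1}"
    by simp
  moreover have "(deriv ^^ m) h 0 = w ^ m * (deriv ^^ m) g 0"
    unfolding h_def using higher_deriv_compose_linear[OF g open_UNIV open_UNIV, of 0 w m] by simp
  ultimately show ?thesis
    by (simp add: h_def integral_unique cbox_interval)
qed

text \<open>Freezing the other coordinates leaves an entire function of one variable, and both sides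
  are expressed through the same Taylor coefficient, on circles of radius |z $ j| and 1.\<close>

lemma circ_entire:
  assumes "entire_fun \<phi>"
  shows "circ \<phi>"
  unfolding circ_def
proof (intro conjI allI)
  show "continuous_on UNIV \<phi>"
    using assms unfolding entire_fun_def
    by (metis continuous_at_imp_continuous_on has_derivative_continuous)
  fix j and m :: nat and z :: "complex ^ 'a"
  define g where "g w = \<phi> (upd z j w)" for w
  have "g field_differentiable (at w)" for w
  proof -
    obtain D where D: "(\<phi> has_derivative D) (at (upd z j w))" "\<And>c h. D (c *s h) = c * D h"
      using assms unfolding entire_fun_def by blast
    have "upd z j = (\<lambda>w. upd z j 0 + w *s axis j 1)"
      by (auto simp: fun_eq_iff vec_eq_iff upd_nth axis_def)
    moreover have "bounded_linear (\<lambda>h::complex. h *s (axis j 1 :: complex ^ 'a))"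
      by (intro linear_conv_bounded_linear[THEN iffD1] linearI) (auto simp: vec_eq_iff algebra_simps)
    moreover from this have "((\<lambda>w. upd z j 0 + w *s axis j 1) has_derivative (\<lambda>h. 0 + h *s axis j 1)) (at w)"
      by (intro has_derivative_add has_derivative_const bounded_linear_imp_has_derivative)
    ultimately have "(upd z j has_derivative (\<lambda>h. h *s axis j 1)) (at w)" by simp
    from has_derivative_compose[OF this D(1)]
    have "(g has_derivative (\<lambda>h. D (axis j 1) * h)) (at w)"
      by (simp add: g_def[abs_def] D(2) mult.commute)
    then show ?thesis by (auto simp: field_differentiable_def has_field_derivative_def)
  qed
  then have g: "g holomorphic_on UNIV" by (simp add: holomorphic_on_def field_differentiable_at_within)
  have "(\<lambda>t. \<phi> (upd z j (c * cis (2 * pi * t))) * cis (- (2 * pi * m * t))) = (\<lambda>t. g (c * cis (2 * pi * t)) * cis (- (2 * pi * m * t)))" for c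
    by (simp add: g_def)
  note circle_coefficient[OF g, of "z $ j" m] circle_coefficient[OF g, of 1 m]
  then show "integral (cbox 0 1) (\<lambda>t::real. \<phi> (upd z j (z $ j * cis (2 * pi * t))) * cis (- (2 * pi * m * t)))
        = (z $ j) ^ m * avg j m \<phi> z"
    by (simp add: avg_def g_def)
qed

lemma continuous_avg:
  assumes "continuous_on UNIV \<phi>"
  shows "continuous_on UNIV (avg j m \<phi>)"
  unfolding avg_def[abs_def]
proof (rule integral_continuous_on_param)
  show "continuous_on (UNIV \<times> cbox 0 1) (\<lambda>(z, t::real). \<phi> (upd z j (cis (2 * pi * t))) * cis (- (2 * pi * m * t)))"
    unfolding case_prod_unfold by (intro continuous_intros continuous_on_compose2[OF assms]) auto
qed

text \<open>In the averaged coordinate the function has become constant, so only the zeroth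
  coefficient survives on either side. In any other coordinate the two circle integrals are
  exchanged.\<close>

lemma circ_avg:
  fixes \<phi> :: "complex ^ 'd \<Rightarrow> complex"
  assumes "circ \<phi>"
  shows "circ (avg i k \<phi>)"
  unfolding circ_def
proof (intro conjI allI)
  have cont: "continuous_on UNIV \<phi>" using assms by (simp add: circ_def)
  show "continuous_on UNIV (avg i k \<phi>)" by (rule continuous_avg[OF cont])
  fix j and m :: nat and z :: "complex ^ 'd"
  let ?I = "\<lambda>f. integral (cbox 0 (1::real)) f"
  show "?I (\<lambda>t. avg i k \<phi> (upd z j (z $ j * cis (2 * pi * t))) * cis (- (2 * pi * m * t))) = (z $ j) ^ m * avg j m (avg i k \<phi>) z"
  proof (cases "i = j")
    case True
    have const: "avg i k \<phi> (upd z j w) = avg i k \<phi> z" for w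
      by (simp add: avg_def True upd_upd_same)
    have "?I (\<lambda>t. cis (- (2 * pi * m * t))) = (if m = 0 then 1 else 0)"
      using circle_coefficient[of "\<lambda>_. 1" 1 m] by (cases m) (auto simp: higher_deriv_const)
    then have "?I (\<lambda>t. avg i k \<phi> z * cis (- (2 * pi * m * t))) = (if m = 0 then avg i k \<phi> z else 0)"
      by (simp add: integral_mult_right)
    then show ?thesis
      by (simp add: const) (simp add: avg_def[of j] const)
  next
    case False
    have swap: "?I (\<lambda>t. ?I (\<lambda>s. \<phi> (upd (upd z j (c * cis (2 * pi * t))) i (cis (2 * pi * s))) * cis (- (2 * pi * k * s))) * cis (- (2 * pi * m * t)))
        = ?I (\<lambda>s. ?I (\<lambda>t. \<phi> (upd (upd z i (cis (2 * pi * s))) j (c * cis (2 * pi * t))) * cis (- (2 * pi * m * t))) * cis (- (2 * pi * k * s)))" for c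
    proof -
      have "?I (\<lambda>t. ?I (\<lambda>s. \<phi> (upd (upd z j (c * cis (2 * pi * t))) i (cis (2 * pi * s))) * cis (- (2 * pi * k * s))) * cis (- (2 * pi * m * t)))
         = ?I (\<lambda>t. ?I (\<lambda>s. \<phi> (upd (upd z j (c * cis (2 * pi * t))) i (cis (2 * pi * s))) * cis (- (2 * pi * k * s)) * cis (- (2 * pi * m * t))))"
        by (simp add: integral_mult_left)
      also have "\<dots> = ?I (\<lambda>s. ?I (\<lambda>t. \<phi> (upd (upd z j (c * cis (2 * pi * t))) i (cis (2 * pi * s))) * cis (- (2 * pi * k * s)) * cis (- (2 * pi * m * t))))"
        by (rule integral_swap_continuous)
           (unfold case_prod_unfold, intro continuous_intros continuous_on_compose2[OF cont], auto)
      also have "\<dots> = ?I (\<lambda>s. ?I (\<lambda>t. \<phi> (upd (upd z i (cis (2 * pi * s))) j (c * cis (2 * pi * t))) * cis (- (2 * pi * m * t)) * cis (- (2 * pi * k * s))))"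
        using False by (simp add: upd_commute[of j i] mult_ac)
      finally show ?thesis by (simp add: integral_mult_left)
    qed
    have "?I (\<lambda>t. avg i k \<phi> (upd z j (z $ j * cis (2 * pi * t))) * cis (- (2 * pi * m * t)))
        = ?I (\<lambda>s. ?I (\<lambda>t. \<phi> (upd (upd z i (cis (2 * pi * s))) j (z $ j * cis (2 * pi * t))) * cis (- (2 * pi * m * t))) * cis (- (2 * pi * k * s)))"
      unfolding avg_def by (rule swap)
    also have "\<dots> = ?I (\<lambda>s. (z $ j) ^ m * avg j m \<phi> (upd z i (cis (2 * pi * s))) * cis (- (2 * pi * k * s)))"
    proof -
      have "?I (\<lambda>t. \<phi> (upd w j (w $ j * cis (2 * pi * t))) * cis (- (2 * pi * m * t))) = (w $ j) ^ m * avg j m \<phi> w" for w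
        using assms unfolding circ_def by blast
      from this[of "upd z i _"] show ?thesis using False by (simp add: upd_nth)
    qed
    also have "\<dots> = (z $ j) ^ m * ?I (\<lambda>s. avg j m \<phi> (upd z i (cis (2 * pi * s))) * cis (- (2 * pi * k * s)))"
      by (simp add: mult.assoc integral_mult_right)
    also have "?I (\<lambda>s. avg j m \<phi> (upd z i (cis (2 * pi * s))) * cis (- (2 * pi * k * s))) = avg j m (avg i k \<phi>) z"
      using swap[of 1] by (simp add: avg_def)
    finally show ?thesis .
  qed
qed

section \<open>Averaging against torus-invariant weights\<close>

lemma linear_rotation: "linear (\<lambda>z. upd z j (z $ j * c))"
  by (rule linearI) (auto simp: vec_eq_iff upd_nth algebra_simps)

lemma norm_rotation: "norm c = 1 \<Longrightarrow> norm (upd z j (z $ j * c)) = norm z"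
  unfolding norm_vec_def by (rule L2_set_cong) (auto simp: upd_nth norm_mult)

lemma upd_measurable [measurable]:
  assumes [measurable]: "f \<in> borel_measurable M" "g \<in> borel_measurable M"
  shows "(\<lambda>x. upd (f x) j (g x)) \<in> borel_measurable M"
proof -
  have "continuous_on UNIV (\<lambda>p. upd (fst p) j (snd p))" by (intro continuous_intros)
  then have c: "(\<lambda>p. upd (fst p) j (snd p)) \<in> borel_measurable borel"
    by (rule borel_measurable_continuous_onI)
  have "(\<lambda>x. (f x, g x)) \<in> borel_measurable M" by measurable
  from measurable_compose[OF this c] show ?thesis by simp
qed

lemma vec_nth_measurable [measurable]:
  "(f :: 'a \<Rightarrow> complex ^ 'd) \<in> borel_measurable M \<Longrightarrow> (\<lambda>x. f x $ j) \<in> borel_measurable M"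
  by (rule measurable_compose[of f M borel "\<lambda>x. x $ j"])
     (auto intro!: borel_measurable_continuous_onI continuous_intros)

text \<open>Rotating coordinate \<open>j\<close> is an isometry and multiplies \<open>W\<close> by
  the character of weight -m. Averaging the invariant integral over the angle therefore replaces
  \<open>\<phi>\<close> by its angular component of weight m, which \<open>circ\<close> identifies.
  Bounded support of \<open>W\<close> makes Fubini available however fast \<open>\<phi>\<close>
  grows.\<close>

lemma torus_step:
  fixes \<phi> W :: "complex ^ 'd \<Rightarrow> complex"
  assumes \<phi>: "circ \<phi>" and W[measurable]: "W \<in> borel_measurable borel"
    and bd: "\<And>z. cmod (W z) \<le> C" and supp: "\<And>z. norm z > r \<Longrightarrow> W z = 0"
    and weight: "\<And>t z. W (upd z j (z $ j * cis t)) = cis (- (m * t)) * W z"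
  shows "integral\<^sup>L lborel (\<lambda>z. \<phi> z * W z) = integral\<^sup>L lborel (\<lambda>z. (z $ j) ^ m * avg j m \<phi> z * W z)"
proof -
  have cont: "continuous_on UNIV \<phi>" using \<phi> by (simp add: circ_def)
  have [measurable]: "\<phi> \<in> borel_measurable borel" using cont by (rule borel_measurable_continuous_onI)
  define I where "I = integral\<^sup>L lborel (\<lambda>z. \<phi> z * W z)"
  define F where "F t z = indicator {0..1} t *\<^sub>R (\<phi> (upd z j (z $ j * cis (2 * pi * t))) * cis (- (2 * pi * m * t)) * W z)" for t :: real and z
  have "compact (\<phi> ` cball 0 r)" using cont by (intro compact_continuous_image) (auto intro: continuous_on_subset)
  then obtain D where D: "D > 0" "\<And>z. norm z \<le> r \<Longrightarrow> cmod (\<phi> z) \<le> D"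
    using compact_imp_bounded by (force simp: bounded_pos)
  have C0: "C \<ge> 0" using bd[of 0] norm_ge_zero order_trans by blast
  have Fint: "integrable (lborel \<Otimes>\<^sub>M lborel) (\<lambda>(t, z). F t z)"
  proof (rule Bochner_Integration.integrable_bound)
    have "emeasure (lborel \<Otimes>\<^sub>M lborel) ({0..1::real} \<times> cball (0 :: complex ^ 'd) r) < \<infinity>"
      using emeasure_bounded_finite[of "cball (0 :: complex ^ 'd) r"]
      by (simp add: lborel.emeasure_pair_measure_Times ennreal_mult_less_top)
    then show "integrable (lborel \<Otimes>\<^sub>M lborel) (\<lambda>p. indicator ({0..1::real} \<times> cball (0 :: complex ^ 'd) r) p *\<^sub>R (D * C))"
      by (intro integrable_scaleR_left integrable_real_indicator) auto
    show "(\<lambda>(t, z). F t z) \<in> borel_measurable (lborel \<Otimes>\<^sub>M lborel)"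
      unfolding F_def by measurable
    show "AE p in lborel \<Otimes>\<^sub>M lborel. norm ((\<lambda>(t, z). F t z) p) \<le> norm (indicator ({0..1::real} \<times> cball (0 :: complex ^ 'd) r) p *\<^sub>R (D * C))"
    proof (intro AE_I2, clarify)
      fix t :: real and z :: "complex ^ 'd"
      show "norm (F t z) \<le> norm (indicator ({0..1::real} \<times> cball (0 :: complex ^ 'd) r) (t, z) *\<^sub>R (D * C))"
      proof (cases "t \<in> {0..1} \<and> norm z \<le> r")
        case True
        then have "cmod (\<phi> (upd z j (z $ j * cis (2 * pi * t)))) \<le> D"
          by (intro D) (simp add: norm_rotation)
        then show ?thesis
          using True bd[of z] D(1) C0 by (simp add: F_def norm_mult mult_mono)
      next
        case False
        then show ?thesis using supp[of z] by (auto simp: F_def indicator_def)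
      qed
    qed
  qed
  have inner1: "integral\<^sup>L lborel (\<lambda>z. F t z) = indicator {0..1} t *\<^sub>R I" for t
  proof -
    have "F t z = indicator {0..1} t *\<^sub>R (\<lambda>z. \<phi> z * W z) (upd z j (z $ j * cis (2 * pi * t)))" for z
      using weight[of z "2 * pi * t"] by (simp add: F_def mult_ac)
    then have "integral\<^sup>L lborel (\<lambda>z. F t z) = indicator {0..1} t *\<^sub>R integral\<^sup>L lborel (\<lambda>z. (\<lambda>z. \<phi> z * W z) (upd z j (z $ j * cis (2 * pi * t))))"
      by (simp only: integral_scaleR_right)
    also have "integral\<^sup>L lborel (\<lambda>z. (\<lambda>z. \<phi> z * W z) (upd z j (z $ j * cis (2 * pi * t)))) = I"
      unfolding I_def by (rule integral_lborel_isometry) (auto intro: linear_rotation norm_rotation)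
    finally show ?thesis .
  qed
  have inner2: "integral\<^sup>L lborel (\<lambda>t. F t z) = (z $ j) ^ m * avg j m \<phi> z * W z" for z
  proof -
    let ?f = "\<lambda>t::real. \<phi> (upd z j (z $ j * cis (2 * pi * t))) * cis (- (2 * pi * m * t))"
    have "continuous_on {0..1} ?f"
      by (intro continuous_intros continuous_on_compose2[OF cont]) auto
    then have "set_integrable lborel {0..1} ?f" by (rule borel_integrable_atLeastAtMost')
    then have "(LINT t:{0..1}|lborel. ?f t) = integral {0..1} ?f" by (rule set_borel_integral_eq_integral(2))
    also have "\<dots> = (z $ j) ^ m * avg j m \<phi> z"
      using \<phi> unfolding circ_def cbox_interval by blast
    finally have *: "integral\<^sup>L lborel (\<lambda>t. indicator {0..1} t *\<^sub>R ?f t) = (z $ j) ^ m * avg j m \<phi> z"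
      unfolding set_lebesgue_integral_def .
    have "(\<lambda>t. F t z) = (\<lambda>t. (indicator {0..1} t *\<^sub>R ?f t) * W z)"
      by (simp add: F_def fun_eq_iff)
    then show ?thesis by (simp only: integral_mult_left_zero *)
  qed
  have "I = integral\<^sup>L lborel (\<lambda>t. integral\<^sup>L lborel (\<lambda>z. F t z))"
    unfolding inner1 by simp
  also have "\<dots> = integral\<^sup>L lborel (\<lambda>z. integral\<^sup>L lborel (\<lambda>t. F t z))"
    using lborel_pair.Fubini_integral[OF Fint] by simp
  also have "\<dots> = integral\<^sup>L lborel (\<lambda>z. (z $ j) ^ m * avg j m \<phi> z * W z)"
    by (simp only: inner2)
  finally show ?thesis by (simp only: I_def)
qed

lemma mpow_mconj_rotation: "mpow (mconj (upd z j (z $ j * c))) k = cnj c ^ (k $ j) * mpow (mconj z) k"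
proof -
  have "mpow (mconj (upd z j (z $ j * c))) k = (\<Prod>i\<in>UNIV. (if i = j then cnj c ^ (k $ j) else 1) * cnj (z $ i) ^ (k $ i))"
    unfolding mpow_def mconj_def by (intro prod.cong) (auto simp: upd_nth power_mult_distrib)
  also have "\<dots> = (\<Prod>i\<in>UNIV. if i = j then cnj c ^ (k $ j) else 1) * mpow (mconj z) k"
    by (simp add: prod.distrib mpow_def mconj_def)
  finally show ?thesis by simp
qed

lemma continuous_on_mpow [continuous_intros]: "continuous_on A f \<Longrightarrow> continuous_on A (\<lambda>x. mpow (f x) k)"
  unfolding mpow_def by (intro continuous_intros)

lemma continuous_on_mconj [continuous_intros]: "continuous_on A f \<Longrightarrow> continuous_on A (\<lambda>x. mconj (f x))"
  unfolding mconj_def by (intro continuous_on_vec_lambda continuous_intros)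

lemma mpow_0 [simp]: "mpow z 0 = 1"
  by (simp add: mpow_def)

text \<open>Invariance under the torus that rotates each coordinate separately, weaker than
  dependence on \<open>norm z\<close> alone; the kernel depends on the individual moduli.\<close>

definition radial :: "(complex ^ 'd \<Rightarrow> complex) \<Rightarrow> bool" where
  "radial \<Psi> \<longleftrightarrow> (\<forall>j t z. \<Psi> (upd z j (z $ j * cis t)) = \<Psi> z)"

definition tame :: "(complex ^ 'd \<Rightarrow> complex) \<Rightarrow> bool" where
  "tame \<Psi> \<longleftrightarrow> radial \<Psi> \<and> \<Psi> \<in> borel_measurable borel \<and> (\<exists>C. \<forall>z. cmod (\<Psi> z) \<le> C) \<and> (\<exists>r. \<forall>z. norm z > r \<longrightarrow> \<Psi> z = 0)"

lemma const_if_upd_invariant: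
  fixes f :: "complex ^ 'd \<Rightarrow> complex"
  assumes "\<And>j z w. f (upd z j w) = f z"
  shows "f z = f z'"
proof -
  have "f (\<chi> i. if i \<in> S then z' $ i else z $ i) = f z" if "finite S" for S :: "'d set"
    using that
  proof (induction S rule: finite_induct)
    case (insert j S)
    have "(\<chi> i. if i \<in> insert j S then z' $ i else z $ i) = upd (\<chi> i. if i \<in> S then z' $ i else z $ i) j (z' $ j)"
      by (auto simp: vec_eq_iff upd_nth)
    then show ?case using insert assms by simp
  qed simp
  from this[of UNIV] show ?thesis by simp
qed

text \<open>Each average removes the dependence on one coordinate and preserves the independence
  already gained, so after all coordinates only a constant is left. That a single \<open>c\<close>
  serves every tame \<open>\<Psi>\<close> is what permits the truncation radius to vary
  later.\<close>

lemma torus_average: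
  fixes \<phi> :: "complex ^ 'd \<Rightarrow> complex"
  assumes \<phi>: "circ \<phi>"
  obtains c where "k = 0 \<Longrightarrow> c = \<phi> 0"
    "\<And>\<Psi>. tame \<Psi> \<Longrightarrow> integral\<^sup>L lborel (\<lambda>z. \<phi> z * (mpow (mconj z) k * \<Psi> z))
      = c * integral\<^sup>L lborel (\<lambda>z. mpow z k * (mpow (mconj z) k * \<Psi> z))"
proof -
  have "\<exists>\<phi>'. circ \<phi>' \<and> (\<forall>j\<in>J. \<forall>z w. \<phi>' (upd z j w) = \<phi>' z) \<and> (k = 0 \<longrightarrow> \<phi>' 0 = \<phi> 0) \<and>
      (\<forall>\<Psi>. tame \<Psi> \<longrightarrow> integral\<^sup>L lborel (\<lambda>z. \<phi> z * (mpow (mconj z) k * \<Psi> z))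
        = integral\<^sup>L lborel (\<lambda>z. \<phi>' z * ((\<Prod>i\<in>J. (z $ i) ^ (k $ i)) * (mpow (mconj z) k * \<Psi> z))))" if "finite J" for J :: "'d set"
    using that
  proof (induction J rule: finite_induct)
    case empty
    show ?case using \<phi> by (intro exI[of _ \<phi>]) simp
  next
    case (insert j J)
    then obtain \<phi>' where p: "circ \<phi>'" "\<And>i z w. i \<in> J \<Longrightarrow> \<phi>' (upd z i w) = \<phi>' z" "k = 0 \<Longrightarrow> \<phi>' 0 = \<phi> 0"
      "\<And>\<Psi>. tame \<Psi> \<Longrightarrow> integral\<^sup>L lborel (\<lambda>z. \<phi> z * (mpow (mconj z) k * \<Psi> z))
        = integral\<^sup>L lborel (\<lambda>z. \<phi>' z * ((\<Prod>i\<in>J. (z $ i) ^ (k $ i)) * (mpow (mconj z) k * \<Psi> z)))"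
      by blast
    show ?case
    proof (rule exI[of _ "avg j (k $ j) \<phi>'"], intro conjI ballI allI impI)
      show "circ (avg j (k $ j) \<phi>')" by (rule circ_avg[OF p(1)])
      show "avg j (k $ j) \<phi>' (upd z i w) = avg j (k $ j) \<phi>' z" if "i \<in> insert j J" for i z w
      proof (cases "i = j")
        case True then show ?thesis by (simp add: avg_def upd_upd_same)
      next
        case False
        then have "i \<in> J" using that by simp
        then show ?thesis using False p(2) by (simp add: avg_def upd_commute[of i j])
      qed
      \<comment> \<open>At the origin the circle degenerates to a point and 0^0 is 1, so averaging
        with weight zero preserves the value there.\<close>
      show "avg j (k $ j) \<phi>' 0 = \<phi> 0" if k: "k = 0"
      proof -
        have "integral (cbox 0 1) (\<lambda>t::real. \<phi>' (upd 0 j ((0 :: complex ^ 'd) $ j * cis (2 * pi * t))) * cis (- (2 * pi * (0::nat) * t)))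
            = ((0 :: complex ^ 'd) $ j) ^ 0 * avg j 0 \<phi>' 0"
          using p(1) unfolding circ_def by blast
        moreover have "upd 0 j 0 = (0 :: complex ^ 'd)" by (simp add: vec_eq_iff upd_nth)
        ultimately show ?thesis using p(3) k by simp
      qed
      fix \<Psi> :: "complex ^ 'd \<Rightarrow> complex" assume t: "tame \<Psi>"
      then have [measurable]: "\<Psi> \<in> borel_measurable borel" and rad: "radial \<Psi>" by (auto simp: tame_def)
      obtain C where C: "\<And>z. cmod (\<Psi> z) \<le> C" using t by (auto simp: tame_def)
      obtain r where r: "\<And>z. norm z > r \<Longrightarrow> \<Psi> z = 0" using t by (auto simp: tame_def)
      define W where "W z = (\<Prod>i\<in>J. (z $ i) ^ (k $ i)) * (mpow (mconj z) k * \<Psi> z)" for z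
      define q where "q z = (\<Prod>i\<in>J. (z $ i) ^ (k $ i)) * mpow (mconj z) k" for z :: "complex ^ 'd"
      have qc: "continuous_on UNIV q" unfolding q_def by (intro continuous_intros)
      have [measurable]: "q \<in> borel_measurable borel" using qc by (rule borel_measurable_continuous_onI)
      have Wq: "W z = q z * \<Psi> z" for z by (simp add: W_def q_def mult_ac)
      have "compact (q ` cball 0 r)" using qc by (intro compact_continuous_image) (auto intro: continuous_on_subset)
      then obtain D where D: "D > 0" "\<And>z. norm z \<le> r \<Longrightarrow> cmod (q z) \<le> D"
        using compact_imp_bounded by (force simp: bounded_pos)
      have C0: "C \<ge> 0" using C[of 0] norm_ge_zero order_trans by blast
      have "integral\<^sup>L lborel (\<lambda>z. \<phi>' z * W z) = integral\<^sup>L lborel (\<lambda>z. (z $ j) ^ (k $ j) * avg j (k $ j) \<phi>' z * W z)"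
      proof (rule torus_step[OF p(1)])
        show "W \<in> borel_measurable borel" unfolding Wq[abs_def] by measurable
        show "cmod (W z) \<le> D * C" for z
          using D(2)[of z] r[of z] C[of z] D(1) C0 by (cases "norm z \<le> r") (auto simp: Wq norm_mult intro!: mult_mono)
        show "W z = 0" if "norm z > r" for z using r that by (simp add: Wq)
        show "W (upd z j (z $ j * cis t)) = cis (- (real (k $ j) * t)) * W z" for t z
        proof -
          have "(\<Prod>i\<in>J. (upd z j (z $ j * cis t) $ i) ^ (k $ i)) = (\<Prod>i\<in>J. (z $ i) ^ (k $ i))"
            using insert by (intro prod.cong) (auto simp: upd_nth)
          moreover have "cnj (cis t) ^ (k $ j) = cis (- (real (k $ j) * t))"
            by (simp add: cis_cnj Complex.DeMoivre)
          ultimately show ?thesis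
            using rad by (simp add: W_def mpow_mconj_rotation radial_def)
        qed
      qed
      then show "integral\<^sup>L lborel (\<lambda>z. \<phi> z * (mpow (mconj z) k * \<Psi> z))
          = integral\<^sup>L lborel (\<lambda>z. avg j (k $ j) \<phi>' z * ((\<Prod>i\<in>insert j J. (z $ i) ^ (k $ i)) * (mpow (mconj z) k * \<Psi> z)))"
        using p(4)[OF t] insert by (simp add: W_def mult_ac)
    qed
  qed
  from this[OF finite[of UNIV]]
  obtain \<phi>' where p: "\<And>j z w. \<phi>' (upd z j w) = \<phi>' z" "k = 0 \<Longrightarrow> \<phi>' 0 = \<phi> 0"
      "\<And>\<Psi>. tame \<Psi> \<Longrightarrow> integral\<^sup>L lborel (\<lambda>z. \<phi> z * (mpow (mconj z) k * \<Psi> z))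
        = integral\<^sup>L lborel (\<lambda>z. \<phi>' z * ((\<Prod>i\<in>UNIV. (z $ i) ^ (k $ i)) * (mpow (mconj z) k * \<Psi> z)))"
    by auto
  have "\<phi>' = (\<lambda>_. \<phi>' 0)" using const_if_upd_invariant[of \<phi>'] p(1) by blast
  then obtain c where c: "\<And>z. \<phi>' z = c" by metis
  show ?thesis
  proof (rule that[of c])
    fix \<Psi> :: "complex ^ 'd \<Rightarrow> complex" assume "tame \<Psi>"
    from p(3)[OF this] show "integral\<^sup>L lborel (\<lambda>z. \<phi> z * (mpow (mconj z) k * \<Psi> z))
      = c * integral\<^sup>L lborel (\<lambda>z. mpow z k * (mpow (mconj z) k * \<Psi> z))"
      by (simp add: c mpow_def)
  qed (use p(2) c in simp)
qed

lemma integral_truncate_tendsto: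
  fixes g :: "'a::euclidean_space \<Rightarrow> complex"
  assumes g: "integrable lborel g"
  shows "(\<lambda>n. integral\<^sup>L lborel (\<lambda>z. indicator (cball 0 (real n)) z *\<^sub>R g z)) \<longlonglongrightarrow> integral\<^sup>L lborel g"
proof (rule integral_dominated_convergence)
  show "integrable lborel (\<lambda>z. norm (g z))" using g by simp
  show "AE z in lborel. (\<lambda>n. indicator (cball 0 (real n)) z *\<^sub>R g z) \<longlonglongrightarrow> g z"
  proof (rule AE_I2)
    fix z :: 'a
    obtain N where N: "norm z \<le> real N" using real_arch_simple by blast
    have "eventually (\<lambda>n. indicator (cball 0 (real n)) z *\<^sub>R g z = g z) sequentially"
      using eventually_ge_at_top[of N]
    proof eventually_elim
      case (elim n)
      then have "norm z \<le> real n" using N by (meson of_nat_le_iff order_trans)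
      then show ?case by simp
    qed
    then show "(\<lambda>n. indicator (cball 0 (real n)) z *\<^sub>R g z) \<longlonglongrightarrow> g z" by (rule tendsto_eventually)
  qed
  show "AE z in lborel. norm (indicator (cball 0 (real n)) z *\<^sub>R g z) \<le> norm (g z)" for n
    by (auto simp: indicator_def)
next
  have [measurable]: "g \<in> borel_measurable borel" "cball (0::'a) r \<in> sets borel" for r using g by auto
  show "g \<in> borel_measurable lborel" by simp
  show "(\<lambda>z. indicator (cball 0 (real n)) z *\<^sub>R g z) \<in> borel_measurable lborel" for n by measurable
qed

text \<open>Only the product \<open>F \<Psi>\<close> is integrable, not the individual terms of \<open>F\<close>; truncating to
  balls keeps every term integrable and respects the torus action.\<close>

lemma polyanalytic_mean:
  fixes \<phi> :: "nat ^ 'd \<Rightarrow> complex ^ 'd \<Rightarrow> complex"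
  assumes K: "finite K" "0 \<in> K" and \<phi>: "\<And>k. k \<in> K \<Longrightarrow> circ (\<phi> k)"
    and F: "\<And>z. F z = (\<Sum>k\<in>K. mpow (mconj z) k * \<phi> k z)"
    and \<Psi>: "continuous_on UNIV \<Psi>" "radial \<Psi>"
    and F\<Psi>: "integrable lborel (\<lambda>z. F z * \<Psi> z)"
    and mom: "\<And>k. k \<in> K \<Longrightarrow> integrable lborel (\<lambda>z. mpow z k * (mpow (mconj z) k * \<Psi> z))"
      "\<And>k. k \<in> K \<Longrightarrow> integral\<^sup>L lborel (\<lambda>z. mpow z k * (mpow (mconj z) k * \<Psi> z)) = (if k = 0 then 1 else 0)"
  shows "integral\<^sup>L lborel (\<lambda>z. F z * \<Psi> z) = \<phi> 0 0"
proof -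
  define T where "T n z = indicator (cball 0 (real n)) z *\<^sub>R \<Psi> z" for n and z :: "complex ^ 'd"
  have T: "tame (T n)" for n
    unfolding tame_def
  proof (intro conjI)
    show "radial (T n)" using \<Psi>(2) by (simp add: radial_def T_def norm_rotation indicator_def)
    have [measurable]: "\<Psi> \<in> borel_measurable borel" using \<Psi>(1) by (rule borel_measurable_continuous_onI)
    have [measurable]: "cball (0 :: complex ^ 'd) r \<in> sets borel" for r by simp
    show "T n \<in> borel_measurable borel" unfolding T_def[abs_def] by measurable
    have "compact (\<Psi> ` cball 0 (real n))" using \<Psi>(1) by (intro compact_continuous_image) (auto intro: continuous_on_subset)
    then obtain D where D: "D > 0" "\<And>z. norm z \<le> real n \<Longrightarrow> cmod (\<Psi> z) \<le> D"
      using compact_imp_bounded by (force simp: bounded_pos)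
    then show "\<exists>C. \<forall>z. cmod (T n z) \<le> C" by (intro exI[of _ D]) (auto simp: T_def indicator_def)
    show "\<exists>r. \<forall>z. norm z > r \<longrightarrow> T n z = 0" by (intro exI[of _ "real n"]) (auto simp: T_def)
  qed
  have "\<exists>c. \<forall>k\<in>K. (k = 0 \<longrightarrow> c k = \<phi> k 0) \<and> (\<forall>\<Psi>. tame \<Psi> \<longrightarrow> integral\<^sup>L lborel (\<lambda>z. \<phi> k z * (mpow (mconj z) k * \<Psi> z))
      = c k * integral\<^sup>L lborel (\<lambda>z. mpow z k * (mpow (mconj z) k * \<Psi> z)))"
  proof (intro bchoice ballI)
    fix k assume k: "k \<in> K"
    obtain c where "k = 0 \<Longrightarrow> c = \<phi> k 0" "\<And>\<Psi>. tame \<Psi> \<Longrightarrow> integral\<^sup>L lborel (\<lambda>z. \<phi> k z * (mpow (mconj z) k * \<Psi> z))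
      = c * integral\<^sup>L lborel (\<lambda>z. mpow z k * (mpow (mconj z) k * \<Psi> z))"
      by (rule torus_average[OF \<phi>[OF k], where k=k]) (rule that)
    then show "\<exists>c. (k = 0 \<longrightarrow> c = \<phi> k 0) \<and> (\<forall>\<Psi>. tame \<Psi> \<longrightarrow> integral\<^sup>L lborel (\<lambda>z. \<phi> k z * (mpow (mconj z) k * \<Psi> z))
      = c * integral\<^sup>L lborel (\<lambda>z. mpow z k * (mpow (mconj z) k * \<Psi> z)))" by blast
  qed
  then obtain c where c: "0 \<in> K \<Longrightarrow> c 0 = \<phi> 0 0" "\<And>k n. k \<in> K \<Longrightarrow> integral\<^sup>L lborel (\<lambda>z. \<phi> k z * (mpow (mconj z) k * T n z))
      = c k * integral\<^sup>L lborel (\<lambda>z. mpow z k * (mpow (mconj z) k * T n z))"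
    using T by blast
  have int: "integrable lborel (\<lambda>z. \<phi> k z * (mpow (mconj z) k * T n z))" if "k \<in> K" for k n
  proof -
    have "continuous_on UNIV (\<phi> k)" using \<phi>[OF that] by (simp add: circ_def)
    then have "integrable lborel (\<lambda>z. indicator (cball 0 (real n)) z *\<^sub>R (\<phi> k z * (mpow (mconj z) k * \<Psi> z)))"
      using \<Psi>(1) by (intro borel_integrable_compact compact_cball continuous_intros) (auto intro: continuous_on_subset)
    moreover have "(\<lambda>z. indicator (cball 0 (real n)) z *\<^sub>R (\<phi> k z * (mpow (mconj z) k * \<Psi> z))) = (\<lambda>z. \<phi> k z * (mpow (mconj z) k * T n z))"
      by (simp add: T_def fun_eq_iff)
    ultimately show ?thesis by simp
  qed
  \<comment> \<open>After truncation every component can be integrated alone. The constants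
    \<open>c k\<close> do not depend on the radius, so the limit is taken only in the
    moments.\<close>
  have eq: "integral\<^sup>L lborel (\<lambda>z. indicator (cball 0 (real n)) z *\<^sub>R (F z * \<Psi> z))
      = (\<Sum>k\<in>K. c k * integral\<^sup>L lborel (\<lambda>z. indicator (cball 0 (real n)) z *\<^sub>R (mpow z k * (mpow (mconj z) k * \<Psi> z))))" for n
  proof -
    have "(\<lambda>z. indicator (cball 0 (real n)) z *\<^sub>R (F z * \<Psi> z)) = (\<lambda>z. \<Sum>k\<in>K. \<phi> k z * (mpow (mconj z) k * T n z))"
      unfolding F T_def sum_distrib_right scaleR_sum_right by (intro ext sum.cong refl) (simp add: mult_ac)
    then have "integral\<^sup>L lborel (\<lambda>z. indicator (cball 0 (real n)) z *\<^sub>R (F z * \<Psi> z)) = (\<Sum>k\<in>K. integral\<^sup>L lborel (\<lambda>z. \<phi> k z * (mpow (mconj z) k * T n z)))"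
      using int by (simp only: Bochner_Integration.integral_sum)
    also have "\<dots> = (\<Sum>k\<in>K. c k * integral\<^sup>L lborel (\<lambda>z. mpow z k * (mpow (mconj z) k * T n z)))"
      by (intro sum.cong refl c(2))
    finally show ?thesis by (simp add: T_def)
  qed
  have "(\<lambda>n. \<Sum>k\<in>K. c k * integral\<^sup>L lborel (\<lambda>z. indicator (cball 0 (real n)) z *\<^sub>R (mpow z k * (mpow (mconj z) k * \<Psi> z))))
      \<longlonglongrightarrow> (\<Sum>k\<in>K. c k * integral\<^sup>L lborel (\<lambda>z. mpow z k * (mpow (mconj z) k * \<Psi> z)))"
    by (intro tendsto_intros integral_truncate_tendsto mom)
  moreover have "(\<Sum>k\<in>K. c k * integral\<^sup>L lborel (\<lambda>z. mpow z k * (mpow (mconj z) k * \<Psi> z))) = (\<Sum>k\<in>K. if k = 0 then c k else 0)"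
    by (intro sum.cong refl) (simp add: mom)
  moreover have "\<dots> = \<phi> 0 0" using K c(1) by simp
  ultimately have "(\<lambda>n. integral\<^sup>L lborel (\<lambda>z. indicator (cball 0 (real n)) z *\<^sub>R (F z * \<Psi> z))) \<longlonglongrightarrow> \<phi> 0 0"
    unfolding eq by simp
  with integral_truncate_tendsto[OF F\<Psi>] show ?thesis by (rule LIMSEQ_unique)
qed

section \<open>Gaussian moments and Laguerre polynomials\<close>

lemma exp_times_gauss_le:
  fixes x c D :: real
  assumes "c > 0"
  shows "exp (D * x) * exp (- c * x\<^sup>2) \<le> exp (D\<^sup>2 / (2 * c)) * exp (- (c / 2) * x\<^sup>2)"
proof -
  have "0 \<le> (c * x - D)\<^sup>2 / (2 * c)" using assms by simp
  also have "\<dots> = c / 2 * x\<^sup>2 - D * x + D\<^sup>2 / (2 * c)"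
    using assms by (simp add: power2_eq_square field_simps)
  finally show ?thesis by (simp add: exp_add[symmetric] algebra_simps)
qed

lemma integrable_exp_type_gauss:
  fixes f :: "'a::euclidean_space \<Rightarrow> complex"
  assumes c: "c > 0" and [measurable]: "f \<in> borel_measurable borel" and f: "\<And>z. norm (f z) \<le> C * exp (D * norm z)"
  shows "integrable lborel (\<lambda>z. f z * complex_of_real (exp (- c * (norm z)\<^sup>2)))"
proof (rule Bochner_Integration.integrable_bound)
  show "integrable lborel (\<lambda>z::'a. (C * exp (D\<^sup>2 / (2 * c))) * exp (- (c / 2) * (norm z)\<^sup>2))"
    using c by (intro integrable_mult_right integrable_gauss) simp
  have C: "C \<ge> 0" using f[of 0] order_trans[OF norm_ge_zero] by simp
  show "AE z in lborel. norm (f z * complex_of_real (exp (- c * (norm z)\<^sup>2))) \<le> norm ((C * exp (D\<^sup>2 / (2 * c))) * exp (- (c / 2) * (norm z)\<^sup>2))"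
  proof (rule AE_I2)
    fix z
    have "norm (f z * complex_of_real (exp (- c * (norm z)\<^sup>2))) = norm (f z) * exp (- c * (norm z)\<^sup>2)"
      by (simp add: norm_mult)
    also have "\<dots> \<le> C * exp (D * norm z) * exp (- c * (norm z)\<^sup>2)"
      by (intro mult_right_mono f) simp
    also have "\<dots> \<le> C * (exp (D\<^sup>2 / (2 * c)) * exp (- (c / 2) * (norm z)\<^sup>2))"
      unfolding mult.assoc by (intro mult_left_mono exp_times_gauss_le c C)
    finally show "norm (f z * complex_of_real (exp (- c * (norm z)\<^sup>2))) \<le> norm ((C * exp (D\<^sup>2 / (2 * c))) * exp (- (c / 2) * (norm z)\<^sup>2))"
      using C by (simp add: abs_mult)
  qed
qed measurable

lemma power_le_exp_mult: "0 \<le> x \<Longrightarrow> x ^ k \<le> exp (real k * x)" for x :: real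
proof -
  assume x: "0 \<le> x"
  have "x \<le> exp x" using exp_ge_add_one_self[of x] by linarith
  then have "x ^ k \<le> exp x ^ k" using x by (intro power_mono)
  then show ?thesis by (simp add: exp_of_nat_mult)
qed

lemma integral_monomial_gauss:
  "integrable lborel (\<lambda>z. z ^ a * cnj z ^ b * complex_of_real (exp (- pi * (cmod z)\<^sup>2)))"
  "integral\<^sup>L lborel (\<lambda>z. z ^ a * cnj z ^ b * complex_of_real (exp (- pi * (cmod z)\<^sup>2))) = (if a = b then fact a / of_real pi ^ a else 0)"
proof -
  show "integrable lborel (\<lambda>z. z ^ a * cnj z ^ b * complex_of_real (exp (- pi * (cmod z)\<^sup>2)))"
  proof (rule integrable_exp_type_gauss[where C=1 and D="real (a + b)"])
    show "norm (z ^ a * cnj z ^ b) \<le> 1 * exp (real (a + b) * norm z)" for z :: complex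
      using power_le_exp_mult[of "norm z" "a + b"] by (simp add: norm_mult norm_power power_add)
  qed auto
  show "integral\<^sup>L lborel (\<lambda>z. z ^ a * cnj z ^ b * complex_of_real (exp (- pi * (cmod z)\<^sup>2))) = (if a = b then fact a / of_real pi ^ a else 0)"
  proof (cases "a = b")
    case True
    have "z ^ a * cnj z ^ a * complex_of_real (exp (- pi * (cmod z)\<^sup>2)) = complex_of_real ((cmod z) ^ (2 * a) * exp (- pi * (cmod z)\<^sup>2))" for z
      by (simp add: power_mult_distrib[symmetric] complex_norm_square[symmetric] power_mult)
    then have "integral\<^sup>L lborel (\<lambda>z. z ^ a * cnj z ^ a * complex_of_real (exp (- pi * (cmod z)\<^sup>2)))
        = of_real (pi * fact a / pi ^ Suc a)"
      by (simp only: integral_complex_of_real integral_cmod_power_gauss[OF pi_gt_zero])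
    then show ?thesis using True by simp
  next
    case False
    \<comment> \<open>With this angle the rotation multiplies the integrand by cis ((a - b)
      \<theta>) = -1, while it preserves the integral.\<close>
    define \<theta> where "\<theta> = pi / (real a - real b)"
    let ?f = "\<lambda>z. z ^ a * cnj z ^ b * complex_of_real (exp (- pi * (cmod z)\<^sup>2))"
    have ph: "cis \<theta> ^ a * cnj (cis \<theta>) ^ b = -1"
    proof -
      have "real a * \<theta> + - (real b * \<theta>) = (real a - real b) * \<theta>" by (simp add: algebra_simps)
      also have "\<dots> = pi" using False by (simp add: \<theta>_def)
      finally have "real a * \<theta> + - (real b * \<theta>) = pi" .
      then show ?thesis by (simp add: cis_cnj Complex.DeMoivre cis_mult)
    qed
    have "?f (cis \<theta> * z) = - ?f z" for z
    proof -
      have "?f (cis \<theta> * z) = (cis \<theta> ^ a * cnj (cis \<theta>) ^ b) * ?f z"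
        by (simp add: power_mult_distrib norm_mult mult_ac)
      then show ?thesis by (simp add: ph)
    qed
    then have "integral\<^sup>L lborel (\<lambda>z. ?f (cis \<theta> * z)) = - integral\<^sup>L lborel ?f" by simp
    moreover have "integral\<^sup>L lborel (\<lambda>z. ?f (cis \<theta> * z)) = integral\<^sup>L lborel ?f"
      by (rule integral_lborel_isometry) (auto simp: norm_mult intro!: linearI simp: algebra_simps)
    ultimately show ?thesis using False by simp
  qed
qed

definition laguerre :: "nat \<Rightarrow> real \<Rightarrow> real" where
  "laguerre k x = (\<Sum>i\<le>k. real (k choose i) * (- x) ^ i / fact i)"

text \<open>The one-variable matrix coefficient of a translation at a monomial. The exponential is
  expanded in its power series; dominated convergence applies because all partial sums obey the same
  exponential bound, and orthogonality of monomials leaves finitely many terms, which add up to a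
  Laguerre polynomial.\<close>

lemma integral_exp_monomial:
  fixes w :: complex
  shows "integrable lborel (\<lambda>z. exp (of_real pi * cnj w * z) * (z - w) ^ k * cnj z ^ k * complex_of_real (exp (- pi * (cmod z)\<^sup>2)))" (is "integrable lborel ?F")
    and "integral\<^sup>L lborel (\<lambda>z. exp (of_real pi * cnj w * z) * (z - w) ^ k * cnj z ^ k * complex_of_real (exp (- pi * (cmod z)\<^sup>2)))
      = fact k / of_real pi ^ k * of_real (laguerre k (pi * (cmod w)\<^sup>2))"
proof -
  define D where "D = pi * cmod w + 2 * real k"
  define h where "h z = (z - w) ^ k * cnj z ^ k" for z
  have hb: "cmod (h z) \<le> exp (real k * cmod w) * exp (2 * real k * cmod z)" for z
  proof -
    have "cmod (z - w) ^ k \<le> exp (real k * cmod (z - w))" by (rule power_le_exp_mult) simp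
    also have "\<dots> \<le> exp (real k * (cmod z + cmod w))"
      by (simp add: mult_left_mono norm_triangle_ineq4)
    finally have "cmod (z - w) ^ k * cmod z ^ k \<le> exp (real k * (cmod z + cmod w)) * exp (real k * cmod z)"
      by (intro mult_mono power_le_exp_mult) auto
    also have "\<dots> = exp (real k * cmod w) * exp (2 * real k * cmod z)"
      by (simp add: exp_add[symmetric] algebra_simps)
    finally show ?thesis by (simp add: h_def norm_mult norm_power)
  qed
  have eb: "cmod e * cmod (h z) \<le> exp (real k * cmod w) * exp (D * norm z)" if "cmod e \<le> exp (pi * cmod w * cmod z)" for e z
  proof -
    have "cmod e * cmod (h z) \<le> exp (pi * cmod w * cmod z) * (exp (real k * cmod w) * exp (2 * real k * cmod z))"
      using that hb by (intro mult_mono) auto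
    also have "\<dots> = exp (real k * cmod w) * exp (D * norm z)"
      by (simp add: D_def exp_add[symmetric] algebra_simps)
    finally show ?thesis .
  qed
  have [measurable]: "h \<in> borel_measurable borel"
    unfolding h_def by (intro borel_measurable_continuous_onI continuous_intros)
  have expb: "cmod (exp (of_real pi * cnj w * z)) \<le> exp (pi * cmod w * cmod z)" for z
    using norm_exp[of "of_real pi * cnj w * z"] by (simp add: norm_mult)
  have F: "?F = (\<lambda>z. (exp (of_real pi * cnj w * z) * h z) * complex_of_real (exp (- pi * (norm z)\<^sup>2)))"
    by (simp add: h_def mult_ac fun_eq_iff)
  show "integrable lborel ?F"
    unfolding F
  proof (rule integrable_exp_type_gauss[where C="exp (real k * cmod w)" and D=D])
    show "norm (exp (of_real pi * cnj w * z) * h z) \<le> exp (real k * cmod w) * exp (D * norm z)" for z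
      using eb[OF expb] by (simp add: norm_mult)
  qed auto
  define s where "s N z = (\<Sum>n<N. (of_real pi * cnj w * z) ^ n /\<^sub>R fact n)" for N and z :: complex
  have [measurable]: "s N \<in> borel_measurable borel" for N
    unfolding s_def by (intro borel_measurable_continuous_onI continuous_intros)
  have sb: "cmod (s N z) \<le> exp (pi * cmod w * cmod z)" for N z
  proof -
    have "cmod (s N z) \<le> (\<Sum>n<N. (pi * cmod w * cmod z) ^ n /\<^sub>R fact n)"
      unfolding s_def by (rule sum_norm_le) (simp add: norm_mult norm_power)
    also have "\<dots> \<le> (\<Sum>n. (pi * cmod w * cmod z) ^ n /\<^sub>R fact n)"
      by (intro sum_le_suminf summable_exp_generic) auto
    also have "\<dots> = exp (pi * cmod w * cmod z)" by (simp add: exp_def)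
    finally show ?thesis .
  qed
  have l1: "(\<lambda>N. integral\<^sup>L lborel (\<lambda>z. (s N z * h z) * complex_of_real (exp (- pi * (norm z)\<^sup>2)))) \<longlonglongrightarrow> integral\<^sup>L lborel ?F"
    unfolding F
  proof (rule integral_dominated_convergence)
    show "integrable lborel (\<lambda>z::complex. norm (complex_of_real (exp (real k * cmod w) * exp (D * norm z)) * complex_of_real (exp (- pi * (norm z)\<^sup>2))))"
      by (intro integrable_norm integrable_exp_type_gauss[where C="exp (real k * cmod w)" and D=D]) (auto simp: norm_mult)
    show "AE z in lborel. (\<lambda>N. s N z * h z * complex_of_real (exp (- pi * (norm z)\<^sup>2))) \<longlonglongrightarrow> exp (of_real pi * cnj w * z) * h z * complex_of_real (exp (- pi * (norm z)\<^sup>2))"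
    proof (rule AE_I2)
      fix z
      have "(\<lambda>N. s N z) \<longlonglongrightarrow> exp (of_real pi * cnj w * z)"
        unfolding s_def using exp_converges[of "of_real pi * cnj w * z"] by (simp add: sums_def)
      then show "(\<lambda>N. s N z * h z * complex_of_real (exp (- pi * (norm z)\<^sup>2))) \<longlonglongrightarrow> exp (of_real pi * cnj w * z) * h z * complex_of_real (exp (- pi * (norm z)\<^sup>2))"
        by (intro tendsto_intros)
    qed
    show "AE z in lborel. norm (s N z * h z * complex_of_real (exp (- pi * (norm z)\<^sup>2))) \<le> norm (complex_of_real (exp (real k * cmod w) * exp (D * norm z)) * complex_of_real (exp (- pi * (norm z)\<^sup>2)))" for N
    proof (rule AE_I2)
      fix z
      show "norm (s N z * h z * complex_of_real (exp (- pi * (norm z)\<^sup>2))) \<le> norm (complex_of_real (exp (real k * cmod w) * exp (D * norm z)) * complex_of_real (exp (- pi * (norm z)\<^sup>2)))"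
        using mult_right_mono[OF eb[OF sb[of N z]], of "exp (- pi * (norm z)\<^sup>2)"] by (simp add: norm_mult)
    qed
  qed auto
  \<comment> \<open>Against z^n and conj(z)^k only the coefficient of z^(k-n) in the expansion of (z
    - w)^k contributes, and there is none when n > k.\<close>
  define v where "v n = (if n \<le> k then of_nat (k choose n) * (- w) ^ n * (fact k / of_real pi ^ k) else 0)" for n
  have iv: "integrable lborel (\<lambda>z. z ^ n * h z * complex_of_real (exp (- pi * (norm z)\<^sup>2)))"
    "integral\<^sup>L lborel (\<lambda>z. z ^ n * h z * complex_of_real (exp (- pi * (norm z)\<^sup>2))) = v n" for n
  proof -
    have e: "z ^ n * h z * complex_of_real (exp (- pi * (norm z)\<^sup>2))
        = (\<Sum>i\<le>k. (of_nat (k choose i) * (- w) ^ (k - i)) * (z ^ (n + i) * cnj z ^ k * complex_of_real (exp (- pi * (norm z)\<^sup>2))))" for z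
    proof -
      have "(z - w) ^ k = (\<Sum>i\<le>k. of_nat (k choose i) * z ^ i * (- w) ^ (k - i))"
        using binomial_ring[of z "- w" k] by simp
      then show ?thesis
        unfolding h_def by (simp add: sum_distrib_left sum_distrib_right power_add mult_ac)
    qed
    show "integrable lborel (\<lambda>z. z ^ n * h z * complex_of_real (exp (- pi * (norm z)\<^sup>2)))"
      unfolding e by (intro Bochner_Integration.integrable_sum integrable_mult_right integral_monomial_gauss(1))
    have "integral\<^sup>L lborel (\<lambda>z. z ^ n * h z * complex_of_real (exp (- pi * (norm z)\<^sup>2)))
        = (\<Sum>i\<le>k. (of_nat (k choose i) * (- w) ^ (k - i)) * (if n + i = k then fact (n + i) / of_real pi ^ (n + i) else 0))"
      unfolding e
      by (subst Bochner_Integration.integral_sum)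
         (auto intro!: integrable_mult_right integral_monomial_gauss(1) sum.cong simp only: integral_mult_right_zero integral_monomial_gauss(2))
    also have "\<dots> = (\<Sum>i\<le>k. if i = k - n \<and> n \<le> k then of_nat (k choose i) * (- w) ^ (k - i) * (fact k / of_real pi ^ k) else 0)"
      by (intro sum.cong refl) auto
    also have "\<dots> = v n"
      by (cases "n \<le> k") (auto simp: v_def binomial_symmetric[of n k])
    finally show "integral\<^sup>L lborel (\<lambda>z. z ^ n * h z * complex_of_real (exp (- pi * (norm z)\<^sup>2))) = v n" .
  qed
  have sN: "integral\<^sup>L lborel (\<lambda>z. (s N z * h z) * complex_of_real (exp (- pi * (norm z)\<^sup>2))) = (\<Sum>n<N. (of_real pi * cnj w) ^ n / fact n * v n)" for N
  proof -
    have e: "s N z * h z * complex_of_real (exp (- pi * (norm z)\<^sup>2))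
        = (\<Sum>n<N. ((of_real pi * cnj w) ^ n / fact n) * (z ^ n * h z * complex_of_real (exp (- pi * (norm z)\<^sup>2))))" for z
      unfolding s_def sum_distrib_right
      by (intro sum.cong refl) (simp add: scaleR_conv_of_real power_mult_distrib field_simps)
    show ?thesis
      unfolding e by (subst Bochner_Integration.integral_sum) (auto intro!: integrable_mult_right iv(1) simp only: integral_mult_right_zero iv(2))
  qed
  have "(\<lambda>N. \<Sum>n<N. (of_real pi * cnj w) ^ n / fact n * v n) \<longlonglongrightarrow> (\<Sum>n\<in>{..k}. (of_real pi * cnj w) ^ n / fact n * v n)"
    using sums_finite[of "{..k}" "\<lambda>n. (of_real pi * cnj w) ^ n / fact n * v n"] by (simp add: sums_def v_def)
  with l1[unfolded sN] have "integral\<^sup>L lborel ?F = (\<Sum>n\<in>{..k}. (of_real pi * cnj w) ^ n / fact n * v n)"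
    by (rule LIMSEQ_unique)
  also have "\<dots> = fact k / of_real pi ^ k * of_real (laguerre k (pi * (cmod w)\<^sup>2))"
  proof -
    have "(of_real pi * cnj w) ^ n / fact n * v n = fact k / of_real pi ^ k * of_real (real (k choose n) * (- (pi * (cmod w)\<^sup>2)) ^ n / fact n)" if "n \<le> k" for n
    proof -
      have "complex_of_real (- (pi * (cmod w)\<^sup>2)) = (of_real pi * cnj w) * (- w)"
        by (simp add: complex_norm_square mult_ac del: of_real_power)
      then have "complex_of_real ((- (pi * (cmod w)\<^sup>2)) ^ n) = (of_real pi * cnj w) ^ n * (- w) ^ n"
        by (metis of_real_power power_mult_distrib)
      then show ?thesis using that by (simp add: v_def mult_ac del: of_real_power)
    qed
    then show ?thesis
      unfolding laguerre_def of_real_sum sum_distrib_left by (intro sum.cong) auto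
  qed
  finally show "integral\<^sup>L lborel ?F = fact k / of_real pi ^ k * of_real (laguerre k (pi * (cmod w)\<^sup>2))" .
qed

text \<open>Upper negation turns the alternating product into a Vandermonde convolution, and a
  second upper negation returns the result to an ordinary binomial coefficient.\<close>

lemma alternating_binomial_convolution:
  "(\<Sum>i\<le>k. (-1) ^ i * real (k choose i) * real ((m + i) choose i)) = (-1) ^ k * real (m choose k)"
proof -
  have neg: "((- real m - 1) gchoose i) = (-1) ^ i * real ((m + i) choose i)" for i
  proof -
    have "((- real m - 1) gchoose i) = (-1) ^ i * ((real i - (- real m - 1) - 1) gchoose i)"
      by (rule gbinomial_negated_upper)
    also have "real i - (- real m - 1) - 1 = real (m + i)" by simp
    finally show ?thesis by (simp add: binomial_gbinomial)
  qed
  have "(\<Sum>i\<le>k. (-1) ^ i * real (k choose i) * real ((m + i) choose i))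
      = (\<Sum>i\<le>k. ((- real m - 1) gchoose i) * (real k gchoose (k - i)))"
    by (intro sum.cong refl) (simp add: neg binomial_gbinomial[symmetric] binomial_symmetric[symmetric] mult_ac)
  also have "\<dots> = ((- real m - 1 + real k) gchoose k)"
    using gbinomial_Vandermonde[of "- real m - 1" "real k" k] by (simp add: atLeast0AtMost)
  also have "\<dots> = (-1) ^ k * ((real k - (- real m - 1 + real k) - 1) gchoose k)"
    by (rule gbinomial_negated_upper)
  also have "real k - (- real m - 1 + real k) - 1 = real m" by simp
  finally show ?thesis by (simp add: binomial_gbinomial)
qed

text \<open>The Laguerre sum is the one-variable reproducing kernel at the origin: against |z|^(2m)
  with m < n it detects only m = 0. The moments reduce to alternating binomial sums, and since m < n
  the outer sum contains the complete alternating row of order m.\<close>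

lemma laguerre_moment:
  assumes "m < n"
  shows "integrable lborel (\<lambda>z. z ^ m * cnj z ^ m * complex_of_real (exp (- pi * (cmod z)\<^sup>2) * (\<Sum>k<n. laguerre k (pi * (cmod z)\<^sup>2))))"
    and "integral\<^sup>L lborel (\<lambda>z. z ^ m * cnj z ^ m * complex_of_real (exp (- pi * (cmod z)\<^sup>2) * (\<Sum>k<n. laguerre k (pi * (cmod z)\<^sup>2)))) = (if m = 0 then 1 else 0)"
proof -
  have e: "z ^ m * cnj z ^ m * complex_of_real (exp (- pi * (cmod z)\<^sup>2) * (\<Sum>k<n. laguerre k (pi * (cmod z)\<^sup>2)))
      = (\<Sum>k<n. \<Sum>i\<le>k. of_real (real (k choose i) * (- pi) ^ i / fact i) * (z ^ (m + i) * cnj z ^ (m + i) * complex_of_real (exp (- pi * (cmod z)\<^sup>2))))" for z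
  proof -
    have c: "complex_of_real ((- (pi * (cmod z)\<^sup>2)) ^ i) = of_real ((- pi) ^ i) * (z ^ i * cnj z ^ i)" for i
    proof -
      have "complex_of_real (- (pi * (cmod z)\<^sup>2)) = of_real (- pi) * (z * cnj z)"
        by (simp add: complex_norm_square del: of_real_power)
      then show ?thesis by (metis of_real_power power_mult_distrib)
    qed
    show ?thesis
      unfolding laguerre_def of_real_mult of_real_sum of_real_divide c sum_distrib_left
      by (intro sum.cong refl) (simp add: power_add mult_ac)
  qed
  show "integrable lborel (\<lambda>z. z ^ m * cnj z ^ m * complex_of_real (exp (- pi * (cmod z)\<^sup>2) * (\<Sum>k<n. laguerre k (pi * (cmod z)\<^sup>2))))"
    unfolding e by (intro Bochner_Integration.integrable_sum integrable_mult_right integral_monomial_gauss(1))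
  have "integral\<^sup>L lborel (\<lambda>z. z ^ m * cnj z ^ m * complex_of_real (exp (- pi * (cmod z)\<^sup>2) * (\<Sum>k<n. laguerre k (pi * (cmod z)\<^sup>2))))
      = (\<Sum>k<n. integral\<^sup>L lborel (\<lambda>z. \<Sum>i\<le>k. of_real (real (k choose i) * (- pi) ^ i / fact i) * (z ^ (m + i) * cnj z ^ (m + i) * complex_of_real (exp (- pi * (cmod z)\<^sup>2)))))"
    unfolding e by (intro Bochner_Integration.integral_sum Bochner_Integration.integrable_sum integrable_mult_right integral_monomial_gauss(1))
  also have "\<dots> = (\<Sum>k<n. \<Sum>i\<le>k. integral\<^sup>L lborel (\<lambda>z. of_real (real (k choose i) * (- pi) ^ i / fact i) * (z ^ (m + i) * cnj z ^ (m + i) * complex_of_real (exp (- pi * (cmod z)\<^sup>2)))))"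
    by (intro sum.cong refl Bochner_Integration.integral_sum integrable_mult_right integral_monomial_gauss(1))
  also have "\<dots> = (\<Sum>k<n. \<Sum>i\<le>k. of_real (real (k choose i) * (- pi) ^ i / fact i) * (fact (m + i) / of_real pi ^ (m + i)))"
    by (simp only: integral_mult_right_zero integral_monomial_gauss(2) refl if_True)
  also have "\<dots> = of_real (fact m / pi ^ m * (\<Sum>k<n. \<Sum>i\<le>k. (-1) ^ i * real (k choose i) * real ((m + i) choose i)))"
  proof -
    have "of_real (real (k choose i) * (- pi) ^ i / fact i) * (fact (m + i) / of_real pi ^ (m + i))
        = complex_of_real (fact m / pi ^ m * ((-1) ^ i * real (k choose i) * real ((m + i) choose i)))" for k i
    proof -
      have "real ((m + i) choose i) = fact (m + i) / (fact i * fact m)"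
        using binomial_fact[of i "m + i", where 'a=real] by simp
      moreover have "(- pi) ^ i = (-1) ^ i * pi ^ i" by (rule power_minus)
      ultimately have "real (k choose i) * (- pi) ^ i / fact i * (fact (m + i) / pi ^ (m + i))
          = fact m / pi ^ m * ((-1) ^ i * real (k choose i) * real ((m + i) choose i))"
        by (simp add: power_add field_simps)
      moreover have "of_real x * (fact (m + i) / of_real pi ^ (m + i)) = complex_of_real (x * (fact (m + i) / pi ^ (m + i)))" for x
        by (simp only: of_real_mult of_real_divide of_real_fact of_real_power)
      ultimately show ?thesis by (simp only:)
    qed
    then show ?thesis unfolding of_real_mult of_real_sum sum_distrib_left by (intro sum.cong refl) (simp only: of_real_mult)
  qed
  also have "(\<Sum>k<n. \<Sum>i\<le>k. (-1) ^ i * real (k choose i) * real ((m + i) choose i)) = (\<Sum>k<n. (-1) ^ k * real (m choose k))"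
    by (simp only: alternating_binomial_convolution)
  also have "\<dots> = (\<Sum>k\<le>m. (-1) ^ k * real (m choose k))"
    using assms by (intro sum.mono_neutral_right) auto
  also have "\<dots> = (if m = 0 then 1 else 0)"
    using choose_alternating_sum[of m, where 'a=real] by (cases "m = 0") auto
  finally show "integral\<^sup>L lborel (\<lambda>z. z ^ m * cnj z ^ m * complex_of_real (exp (- pi * (cmod z)\<^sup>2) * (\<Sum>k<n. laguerre k (pi * (cmod z)\<^sup>2)))) = (if m = 0 then 1 else 0)"
    by simp
qed

section \<open>Sums over the box of multi-indices\<close>

lemma Kset_eq_PiE: "Kset n = vec_lambda ` PiE UNIV (\<lambda>j. {..<n $ j})"
proof -
  have "k \<in> vec_lambda ` PiE UNIV (\<lambda>j. {..<n $ j})" if "k \<in> Kset n" for k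
    using that by (intro image_eqI[of _ _ "\<lambda>j. k $ j"]) (auto simp: Kset_def)
  then show ?thesis by (auto simp: Kset_def PiE_iff)
qed

lemma finite_Kset [simp]: "finite (Kset n)"
  unfolding Kset_eq_PiE by (intro finite_imageI finite_PiE) auto

text \<open>Here the box shape of \<open>Kset n\<close> enters: a sum over multi-indices factors
  into one-variable sums, so the kernel becomes a product over coordinates.\<close>

lemma prod_sum_Kset:
  fixes f :: "'d::finite \<Rightarrow> nat \<Rightarrow> 'a::comm_semiring_1"
  shows "(\<Prod>j\<in>UNIV. \<Sum>i<n $ j. f j i) = (\<Sum>k\<in>Kset n. \<Prod>j\<in>UNIV. f j (k $ j))"
proof -
  have inj: "inj_on vec_lambda (PiE UNIV (\<lambda>j. {..<n $ j}))"
    by (rule inj_onI) (metis ext vec_lambda_inject UNIV_I)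
  have "(\<Prod>j\<in>UNIV. \<Sum>i<n $ j. f j i) = (\<Sum>g\<in>PiE UNIV (\<lambda>j. {..<n $ j}). \<Prod>j\<in>UNIV. f j (g j))"
    by (rule prod_sum_PiE) auto
  then show ?thesis unfolding Kset_eq_PiE by (simp add: sum.reindex[OF inj])
qed

text \<open>The sum runs over the whole box rather than over the indices below \<open>k\<close>; the
  surplus terms vanish through the binomial coefficients, and a summation range independent of
  \<open>k\<close> allows sums to be exchanged.\<close>

lemma mpow_diff:
  assumes "k \<in> Kset n"
  shows "mpow (x - y) k = (\<Sum>i\<in>Kset n. (\<Prod>j\<in>UNIV. of_nat ((k $ j) choose (i $ j))) * (\<Prod>j\<in>UNIV. (- (y $ j)) ^ (k $ j - i $ j)) * mpow x i)"
proof -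
  have "(u - v) ^ m = (\<Sum>i<N. of_nat (m choose i) * (- v) ^ (m - i) * u ^ i)" if "m < N" for u v :: complex and m N
  proof -
    have "(u - v) ^ m = (\<Sum>i\<le>m. of_nat (m choose i) * u ^ i * (- v) ^ (m - i))"
      using binomial_ring[of u "- v" m] by simp
    also have "\<dots> = (\<Sum>i<N. of_nat (m choose i) * u ^ i * (- v) ^ (m - i))"
      using that by (intro sum.mono_neutral_left) auto
    finally show ?thesis by (simp add: mult_ac)
  qed
  then have "mpow (x - y) k = (\<Prod>j\<in>UNIV. \<Sum>i<n $ j. of_nat ((k $ j) choose i) * (- (y $ j)) ^ (k $ j - i) * (x $ j) ^ i)"
    using assms unfolding mpow_def Kset_def by (intro prod.cong refl) simp
  then show ?thesis
    unfolding prod_sum_Kset by (simp add: mpow_def prod.distrib)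
qed

lemma mconj_diff: "mconj (x - y) = mconj x - mconj y"
  by (simp add: mconj_def vec_eq_iff)

section \<open>Entire functions\<close>

lemma entire_const: "entire_fun (\<lambda>z. c)"
  unfolding entire_fun_def by (auto intro!: exI[of _ "\<lambda>_. 0"])

lemma entire_nth: "entire_fun (\<lambda>z. z $ j)"
  unfolding entire_fun_def
  by (intro allI exI[of _ "\<lambda>h. h $ j"] conjI bounded_linear_imp_has_derivative bounded_linear_vec_nth) simp

lemma entire_add: "entire_fun F \<Longrightarrow> entire_fun G \<Longrightarrow> entire_fun (\<lambda>z. F z + G z)"
  unfolding entire_fun_def
proof
  fix z
  assume F: "\<forall>z. \<exists>D. (F has_derivative D) (at z) \<and> (\<forall>c h. D (c *s h) = c * D h)"
    and G: "\<forall>z. \<exists>D. (G has_derivative D) (at z) \<and> (\<forall>c h. D (c *s h) = c * D h)"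
  obtain D where D: "(F has_derivative D) (at z)" "\<forall>c h. D (c *s h) = c * D h" using F by blast
  obtain E where E: "(G has_derivative E) (at z)" "\<forall>c h. E (c *s h) = c * E h" using G by blast
  show "\<exists>D. ((\<lambda>z. F z + G z) has_derivative D) (at z) \<and> (\<forall>c h. D (c *s h) = c * D h)"
    using has_derivative_add[OF D(1) E(1)] D(2) E(2) by (intro exI[of _ "\<lambda>h. D h + E h"]) (simp add: distrib_left)
qed

lemma entire_mult: "entire_fun F \<Longrightarrow> entire_fun G \<Longrightarrow> entire_fun (\<lambda>z. F z * G z)"
  unfolding entire_fun_def
proof
  fix z
  assume F: "\<forall>z. \<exists>D. (F has_derivative D) (at z) \<and> (\<forall>c h. D (c *s h) = c * D h)"
    and G: "\<forall>z. \<exists>D. (G has_derivative D) (at z) \<and> (\<forall>c h. D (c *s h) = c * D h)"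
  obtain D where D: "(F has_derivative D) (at z)" "\<forall>c h. D (c *s h) = c * D h" using F by blast
  obtain E where E: "(G has_derivative E) (at z)" "\<forall>c h. E (c *s h) = c * E h" using G by blast
  show "\<exists>D. ((\<lambda>z. F z * G z) has_derivative D) (at z) \<and> (\<forall>c h. D (c *s h) = c * D h)"
    using has_derivative_mult[OF D(1) E(1)] D(2) E(2)
    by (intro exI[of _ "\<lambda>h. F z * E h + D h * G z"]) (simp add: algebra_simps)
qed

lemma entire_sum: "finite S \<Longrightarrow> (\<And>i. i \<in> S \<Longrightarrow> entire_fun (F i)) \<Longrightarrow> entire_fun (\<lambda>z. \<Sum>i\<in>S. F i z)"
  by (induction S rule: finite_induct) (auto intro: entire_const entire_add)

lemma entire_power: "entire_fun F \<Longrightarrow> entire_fun (\<lambda>z. F z ^ m)"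
  by (induction m) (auto intro: entire_const entire_mult)

lemma entire_prod: "finite S \<Longrightarrow> (\<And>i. i \<in> S \<Longrightarrow> entire_fun (F i)) \<Longrightarrow> entire_fun (\<lambda>z. \<Prod>i\<in>S. F i z)"
  by (induction S rule: finite_induct) (auto intro: entire_const entire_mult)

lemma entire_mpow: "entire_fun (\<lambda>z. mpow z k)"
  unfolding mpow_def by (intro entire_prod entire_power entire_nth) auto

lemma entire_cdot: "entire_fun (\<lambda>z. cdot_conj a z)"
  unfolding cdot_conj_def by (intro entire_sum entire_mult entire_const entire_nth) auto

lemma entire_exp: "entire_fun F \<Longrightarrow> entire_fun (\<lambda>z. exp (F z))"
  unfolding entire_fun_def
proof
  fix z
  assume F: "\<forall>z. \<exists>D. (F has_derivative D) (at z) \<and> (\<forall>c h. D (c *s h) = c * D h)"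
  obtain D where D: "(F has_derivative D) (at z)" "\<forall>c h. D (c *s h) = c * D h" using F by blast
  have "(exp has_derivative (\<lambda>h. exp (F z) * h)) (at (F z))"
    using DERIV_exp[of "F z"] by (simp add: has_field_derivative_def)
  from has_derivative_compose[OF D(1) this] D(2)
  show "\<exists>D. ((\<lambda>z. exp (F z)) has_derivative D) (at z) \<and> (\<forall>c h. D (c *s h) = c * D h)"
    by (intro exI[of _ "\<lambda>h. exp (F z) * D h"]) simp
qed

lemma entire_translate: "entire_fun F \<Longrightarrow> entire_fun (\<lambda>z. F (z + a))"
  unfolding entire_fun_def
proof
  fix z
  assume F: "\<forall>z. \<exists>D. (F has_derivative D) (at z) \<and> (\<forall>c h. D (c *s h) = c * D h)"
  obtain D where D: "(F has_derivative D) (at (z + a))" "\<forall>c h. D (c *s h) = c * D h" using F by blast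
  have "((\<lambda>z. z + a) has_derivative (\<lambda>h. h)) (at z)" by (auto intro!: derivative_eq_intros)
  from has_derivative_compose[OF this D(1)] D(2)
  show "\<exists>D. ((\<lambda>z. F (z + a)) has_derivative D) (at z) \<and> (\<forall>c h. D (c *s h) = c * D h)" by blast
qed

lemma entire_ek: "entire_fun (ek k)"
  unfolding ek_def[abs_def] by (intro entire_mult entire_const entire_mpow)

lemma entire_beta: "entire_fun F \<Longrightarrow> entire_fun (beta_op a F)"
proof -
  assume F: "entire_fun F"
  have "entire_fun (\<lambda>x. exp (of_real pi * cdot_conj a x + - complex_of_real (pi / 2 * (norm a)\<^sup>2)) * F (x + - a))"
    by (intro entire_mult entire_exp entire_add entire_const entire_cdot entire_translate F)
  then show ?thesis by (simp add: beta_op_def[abs_def])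
qed

lemma entire_continuous: "entire_fun F \<Longrightarrow> continuous_on UNIV F"
  using circ_entire[of F] by (simp add: circ_def)

lemma continuous_on_wt: "continuous_on UNIV F \<Longrightarrow> continuous_on UNIV (wt F)"
  unfolding wt_def[abs_def] by (intro continuous_intros)

section \<open>Square integrable and Gaussian bounded functions\<close>

definition l2f :: "(complex ^ 'd \<Rightarrow> complex) \<Rightarrow> bool" where
  "l2f f \<longleftrightarrow> f \<in> borel_measurable borel \<and> integrable lborel (\<lambda>x. (cmod (f x))\<^sup>2)"

text \<open>Short for Gaussian bounded. The constants are existential because operations such as
  translation worsen them; windows and kernels all lie in this class, and it is what makes lattice
  sums converge.\<close>

definition gb :: "(complex ^ 'd \<Rightarrow> complex) \<Rightarrow> bool" where
  "gb g \<longleftrightarrow> continuous_on UNIV g \<and> (\<exists>C c. C \<ge> 0 \<and> c > 0 \<and> (\<forall>x. cmod (g x) \<le> C * exp (- c * (norm x)\<^sup>2)))"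

lemma gbI: "continuous_on UNIV g \<Longrightarrow> C \<ge> 0 \<Longrightarrow> c > 0 \<Longrightarrow> (\<And>x. cmod (g x) \<le> C * exp (- c * (norm x)\<^sup>2)) \<Longrightarrow> gb g"
  unfolding gb_def by blast

lemma l2f_measurable: "l2f f \<Longrightarrow> f \<in> borel_measurable borel"
  by (simp add: l2f_def)

lemma gb_measurable: "gb g \<Longrightarrow> g \<in> borel_measurable borel"
  by (simp add: gb_def borel_measurable_continuous_onI)

lemma gb_exp_integrable:
  assumes "gb g"
  shows "integrable lborel (\<lambda>x. exp (D * norm x) * cmod (g x))"
proof -
  have [measurable]: "g \<in> borel_measurable borel" by (rule gb_measurable[OF assms])
  obtain C c where C: "C \<ge> 0" "c > 0" "\<And>x. cmod (g x) \<le> C * exp (- c * (norm x)\<^sup>2)" using assms by (auto simp: gb_def)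
  show ?thesis
  proof (rule Bochner_Integration.integrable_bound)
    show "integrable lborel (\<lambda>x::complex ^ 'a. (C * exp (D\<^sup>2 / (2 * c))) * exp (- (c / 2) * (norm x)\<^sup>2))"
      using C by (intro integrable_mult_right integrable_gauss) simp
    show "AE x in lborel. norm (exp (D * norm x) * cmod (g x)) \<le> norm ((C * exp (D\<^sup>2 / (2 * c))) * exp (- (c / 2) * (norm x)\<^sup>2))"
    proof (rule AE_I2)
      fix x :: "complex ^ 'a"
      have "exp (D * norm x) * cmod (g x) \<le> exp (D * norm x) * (C * exp (- c * (norm x)\<^sup>2))"
        by (intro mult_left_mono C) simp
      also have "\<dots> = C * (exp (D * norm x) * exp (- c * (norm x)\<^sup>2))" by (simp add: mult_ac)
      also have "\<dots> \<le> C * (exp (D\<^sup>2 / (2 * c)) * exp (- (c / 2) * (norm x)\<^sup>2))"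
        by (intro mult_left_mono exp_times_gauss_le C)
      finally show "norm (exp (D * norm x) * cmod (g x)) \<le> norm ((C * exp (D\<^sup>2 / (2 * c))) * exp (- (c / 2) * (norm x)\<^sup>2))"
        using C by (simp add: abs_mult)
    qed
  qed measurable
qed

lemma gb_integrable: "gb g \<Longrightarrow> integrable lborel (\<lambda>x. cmod (g x))"
  using gb_exp_integrable[of g 0] by simp

lemma gb_square: "gb g \<Longrightarrow> gb (\<lambda>x. complex_of_real ((cmod (g x))\<^sup>2))"
proof -
  assume g: "gb g"
  obtain C c where C: "C \<ge> 0" "c > 0" "\<And>x. cmod (g x) \<le> C * exp (- c * (norm x)\<^sup>2)" using g by (auto simp: gb_def)
  have "(cmod (g x))\<^sup>2 \<le> C\<^sup>2 * exp (- (2 * c) * (norm x)\<^sup>2)" for x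
    using power_mono[OF C(3)[of x], of 2] by (simp add: power_mult_distrib exp_of_nat_mult[symmetric] mult_ac)
  moreover have "continuous_on UNIV (\<lambda>x. complex_of_real ((cmod (g x))\<^sup>2))"
    using g unfolding gb_def by (intro continuous_intros) auto
  ultimately show ?thesis
    using C(1,2) by (intro gbI[of _ "C\<^sup>2" "2 * c"]) (simp_all add: norm_power)
qed

lemma gb_l2f: "gb g \<Longrightarrow> l2f g"
proof -
  assume g: "gb g"
  show ?thesis
    using gb_integrable[OF gb_square[OF g]] gb_measurable[OF g] by (simp add: l2f_def norm_power)
qed

lemma gb_tau: "gb g \<Longrightarrow> gb (tau a g)"
proof -
  assume g: "gb g"
  obtain C c where C: "C \<ge> 0" "c > 0" "\<And>x. cmod (g x) \<le> C * exp (- c * (norm x)\<^sup>2)" using g by (auto simp: gb_def)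
  have "cmod (tau a g x) \<le> (C * exp (c * (norm a)\<^sup>2)) * exp (- (c / 2) * (norm x)\<^sup>2)" for x
  proof -
    have "norm x \<le> norm (x - a) + norm a" using norm_triangle_ineq[of "x - a" a] by simp
    then have "(norm x)\<^sup>2 \<le> (norm (x - a) + norm a)\<^sup>2" by (intro power_mono) auto
    also have "\<dots> \<le> 2 * (norm (x - a))\<^sup>2 + 2 * (norm a)\<^sup>2"
      using sum_squares_bound[of "norm (x - a)" "norm a"] by (simp add: power2_sum)
    finally have "(c / 2) * (norm x)\<^sup>2 \<le> (c / 2) * (2 * (norm (x - a))\<^sup>2 + 2 * (norm a)\<^sup>2)"
      using C by (intro mult_left_mono) auto
    then have "exp (- c * (norm (x - a))\<^sup>2) \<le> exp (c * (norm a)\<^sup>2) * exp (- (c / 2) * (norm x)\<^sup>2)"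
      by (simp add: exp_add[symmetric] algebra_simps)
    then have "C * exp (- c * (norm (x - a))\<^sup>2) \<le> C * (exp (c * (norm a)\<^sup>2) * exp (- (c / 2) * (norm x)\<^sup>2))"
      using C by (intro mult_left_mono) auto
    with C(3)[of "x - a"] show ?thesis unfolding norm_tau by (simp add: mult.assoc)
  qed
  moreover have "continuous_on UNIV (tau a g)" using g by (intro continuous_on_tau) (simp add: gb_def)
  ultimately show ?thesis
    unfolding gb_def using C by (intro conjI exI[of _ "C * exp (c * (norm a)\<^sup>2)"] exI[of _ "c / 2"]) auto
qed

lemma l2f_tau: "l2f f \<Longrightarrow> l2f (tau a f)"
  unfolding l2f_def norm_tau
  using integrable_lborel_translate[of "\<lambda>x. (cmod (f x))\<^sup>2" "- a"] by auto

lemma l2f_cmult: "l2f f \<Longrightarrow> l2f (\<lambda>x. c * f x)"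
  unfolding l2f_def by (auto simp: norm_mult power_mult_distrib)

lemma l2f_add:
  assumes "l2f f" "l2f g"
  shows "l2f (\<lambda>x. f x + g x)"
proof -
  have [measurable]: "f \<in> borel_measurable borel" "g \<in> borel_measurable borel" using assms by (auto simp: l2f_def)
  have "integrable lborel (\<lambda>x. (cmod (f x + g x))\<^sup>2)"
  proof (rule Bochner_Integration.integrable_bound)
    show "integrable lborel (\<lambda>x. 2 * (cmod (f x))\<^sup>2 + 2 * (cmod (g x))\<^sup>2)" using assms by (auto simp: l2f_def)
    show "AE x in lborel. norm ((cmod (f x + g x))\<^sup>2) \<le> norm (2 * (cmod (f x))\<^sup>2 + 2 * (cmod (g x))\<^sup>2)"
    proof (rule AE_I2)
      fix x
      have "(cmod (f x + g x))\<^sup>2 \<le> (cmod (f x) + cmod (g x))\<^sup>2" by (intro power_mono norm_triangle_ineq) simp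
      also have "\<dots> \<le> 2 * (cmod (f x))\<^sup>2 + 2 * (cmod (g x))\<^sup>2"
        using sum_squares_bound[of "cmod (f x)" "cmod (g x)"] by (simp add: power2_sum)
      finally show "norm ((cmod (f x + g x))\<^sup>2) \<le> norm (2 * (cmod (f x))\<^sup>2 + 2 * (cmod (g x))\<^sup>2)" by simp
    qed
  qed measurable
  then show ?thesis by (simp add: l2f_def)
qed

lemma l2f_0: "l2f (\<lambda>x. 0)"
  by (simp add: l2f_def)

lemma l2f_sum: "finite S \<Longrightarrow> (\<And>i. i \<in> S \<Longrightarrow> l2f (f i)) \<Longrightarrow> l2f (\<lambda>x. \<Sum>i\<in>S. f i x)"
  by (induction S rule: finite_induct) (auto intro: l2f_0 l2f_add)

lemma l2f_mult_integrable:
  assumes "l2f f" "l2f g"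
  shows "integrable lborel (\<lambda>x. f x * cnj (g x))"
proof (rule Bochner_Integration.integrable_bound)
  have [measurable]: "f \<in> borel_measurable borel" "g \<in> borel_measurable borel" using assms by (auto simp: l2f_def)
  show "(\<lambda>x. f x * cnj (g x)) \<in> borel_measurable lborel" by measurable
  show "integrable lborel (\<lambda>x. (cmod (f x))\<^sup>2 + (cmod (g x))\<^sup>2)" using assms by (auto simp: l2f_def)
  show "AE x in lborel. norm (f x * cnj (g x)) \<le> norm ((cmod (f x))\<^sup>2 + (cmod (g x))\<^sup>2)"
  proof (rule AE_I2)
    fix x
    have "2 * (cmod (f x) * cmod (g x)) \<le> (cmod (f x))\<^sup>2 + (cmod (g x))\<^sup>2"
      using sum_squares_bound[of "cmod (f x)" "cmod (g x)"] by simp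
    moreover have "0 \<le> cmod (f x) * cmod (g x)" by simp
    ultimately have "cmod (f x) * cmod (g x) \<le> (cmod (f x))\<^sup>2 + (cmod (g x))\<^sup>2" by linarith
    then show "norm (f x * cnj (g x)) \<le> norm ((cmod (f x))\<^sup>2 + (cmod (g x))\<^sup>2)"
      by (simp add: norm_mult)
  qed
qed

lemma ip_sum_left:
  assumes "finite S" "\<And>i. i \<in> S \<Longrightarrow> l2f (f i)" "l2f h"
  shows "ip (\<lambda>x. \<Sum>i\<in>S. a i * f i x) h = (\<Sum>i\<in>S. a i * ip (f i) h)"
proof -
  have "ip (\<lambda>x. \<Sum>i\<in>S. a i * f i x) h = (\<Sum>i\<in>S. integral\<^sup>L lborel (\<lambda>x. a i * (f i x * cnj (h x))))"
    unfolding ip_def sum_distrib_right mult.assoc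
    by (intro Bochner_Integration.integral_sum integrable_mult_right l2f_mult_integrable assms)
  then show ?thesis by (simp add: ip_def)
qed

lemma ip_sum_right:
  assumes "finite S" "\<And>i. i \<in> S \<Longrightarrow> l2f (f i)" "l2f h"
  shows "ip h (\<lambda>x. \<Sum>i\<in>S. a i * f i x) = (\<Sum>i\<in>S. cnj (a i) * ip h (f i))"
  unfolding ip_commute[of h] by (simp add: ip_sum_left[OF assms])

lemma ip_self: "ip f f = of_real (integral\<^sup>L lborel (\<lambda>x. (cmod (f x))\<^sup>2))"
  unfolding ip_def complex_norm_square[symmetric] by (simp only: integral_complex_of_real)

lemma ip_Cauchy_Schwarz:
  assumes f: "l2f f" and g: "l2f g"
  shows "(cmod (ip f g))\<^sup>2 \<le> integral\<^sup>L lborel (\<lambda>x. (cmod (f x))\<^sup>2) * integral\<^sup>L lborel (\<lambda>x. (cmod (g x))\<^sup>2)"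
proof -
  have [measurable]: "f \<in> borel_measurable borel" "g \<in> borel_measurable borel" using assms by (auto simp: l2f_def)
  have e: "(\<integral>\<^sup>+x. (ennreal (cmod (h x)))\<^sup>2 \<partial>lborel) = ennreal (integral\<^sup>L lborel (\<lambda>x. (cmod (h x))\<^sup>2))" if "l2f h" for h :: "complex ^ 'a \<Rightarrow> complex"
    using that by (subst nn_integral_eq_integral[symmetric]) (auto simp: l2f_def ennreal_power)
  have "ennreal (cmod (ip f g)) \<le> (\<integral>\<^sup>+x. ennreal (cmod (f x)) * ennreal (cmod (g x)) \<partial>lborel)"
    unfolding ip_def using integral_norm_bound_ennreal[OF l2f_mult_integrable[OF f g]] by (simp add: norm_mult ennreal_mult)
  then have "(ennreal (cmod (ip f g)))\<^sup>2 \<le> (\<integral>\<^sup>+x. ennreal (cmod (f x)) * ennreal (cmod (g x)) \<partial>lborel)\<^sup>2"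
    by (rule power_mono) simp
  also have "\<dots> \<le> (\<integral>\<^sup>+x. (ennreal (cmod (f x)))\<^sup>2 \<partial>lborel) * (\<integral>\<^sup>+x. (ennreal (cmod (g x)))\<^sup>2 \<partial>lborel)"
    by (rule Cauchy_Schwarz_nn_integral) measurable
  also have "\<dots> = ennreal (integral\<^sup>L lborel (\<lambda>x. (cmod (f x))\<^sup>2) * integral\<^sup>L lborel (\<lambda>x. (cmod (g x))\<^sup>2))"
    by (simp add: e f g ennreal_mult integral_nonneg_AE)
  finally show ?thesis
    by (simp add: ennreal_power integral_nonneg_AE ennreal_le_iff mult_nonneg_nonneg)
qed

section \<open>The windows and the kernel\<close>

abbreviation gk :: "nat ^ 'd \<Rightarrow> complex ^ 'd \<Rightarrow> complex" where
  "gk k \<equiv> wt (ek k)"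

lemma norm_mpow_le: "cmod (mpow z k) \<le> norm z ^ mabs k"
proof -
  have "cmod (mpow z k) = (\<Prod>j\<in>UNIV. cmod (z $ j) ^ (k $ j))"
    by (simp add: mpow_def prod_norm[symmetric] norm_power)
  also have "\<dots> \<le> (\<Prod>j\<in>UNIV. norm z ^ (k $ j))"
    by (intro prod_mono conjI power_mono Finite_Cartesian_Product.norm_nth_le) auto
  finally show ?thesis by (simp add: mabs_def power_sum)
qed

lemma gb_wt:
  assumes "continuous_on UNIV F" and F: "\<And>z. cmod (F z) \<le> C * exp (D * norm z)"
  shows "gb (wt F)"
proof -
  have C: "C \<ge> 0" using F[of 0] order_trans[OF norm_ge_zero] by simp
  have "cmod (wt F z) \<le> (C * exp (D\<^sup>2 / (2 * (pi / 2)))) * exp (- (pi / 2 / 2) * (norm z)\<^sup>2)" for z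
  proof -
    have "cmod (wt F z) = cmod (F z) * exp (- (pi / 2) * (norm z)\<^sup>2)" by (simp add: wt_def norm_mult)
    also have "\<dots> \<le> C * exp (D * norm z) * exp (- (pi / 2) * (norm z)\<^sup>2)" by (intro mult_right_mono F) simp
    also have "\<dots> \<le> C * (exp (D\<^sup>2 / (2 * (pi / 2))) * exp (- (pi / 2 / 2) * (norm z)\<^sup>2))"
      unfolding mult.assoc by (intro mult_left_mono exp_times_gauss_le C) simp
    finally show ?thesis by (simp only: mult.assoc)
  qed
  then show ?thesis unfolding gb_def using C continuous_on_wt[OF assms(1)]
    by (intro conjI exI[of _ "C * exp (D\<^sup>2 / (2 * (pi / 2)))"] exI[of _ "pi / 2 / 2"]) auto
qed

lemma gb_gk: "gb (gk k)"
proof (rule gb_wt)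
  show "continuous_on UNIV (ek k)" by (rule entire_continuous[OF entire_ek])
  show "cmod (ek k z) \<le> sqrt (pi ^ mabs k / real (mfact k)) * exp (real (mabs k) * norm z)" for z
  proof -
    have "cmod (mpow z k) \<le> exp (real (mabs k) * norm z)"
      using norm_mpow_le[of z k] power_le_exp_mult[of "norm z" "mabs k"] by simp
    then have "sqrt (pi ^ mabs k / real (mfact k)) * cmod (mpow z k) \<le> sqrt (pi ^ mabs k / real (mfact k)) * exp (real (mabs k) * norm z)"
      by (intro mult_left_mono) auto
    then show ?thesis by (simp add: ek_def norm_mult)
  qed
qed

lemma norm_vec_square: "(norm z)\<^sup>2 = (\<Sum>j\<in>UNIV. (cmod (z $ j))\<^sup>2)" for z :: "complex ^ 'd"
  by (simp add: norm_vec_def L2_set_def sum_nonneg)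

lemma exp_norm_vec: "exp (- pi * (norm z)\<^sup>2) = (\<Prod>j\<in>UNIV. exp (- pi * (cmod (z $ j))\<^sup>2))" for z :: "complex ^ 'd"
  by (simp add: norm_vec_square exp_sum[symmetric] sum_distrib_left sum_negf)

lemma mfact_pos: "mfact k > 0"
  by (simp add: mfact_def prod_pos)

text \<open>In the unweighted picture the integrand is a product over the coordinates, each factor
  being an instance of \<open>integral_exp_monomial\<close>; the normalisation of \<open>ek\<close>
  cancels the factors k! / pi^|k|.\<close>

lemma ip_tau_gk: "ip (tau z (gk k)) (gk k) = of_real (exp (- pi / 2 * (norm z)\<^sup>2) * (\<Prod>j\<in>UNIV. laguerre (k $ j) (pi * (cmod (z $ j))\<^sup>2)))"
proof -
  define h where "h j \<zeta> = exp (of_real pi * cnj (z $ j) * \<zeta>) * (\<zeta> - z $ j) ^ (k $ j) * cnj \<zeta> ^ (k $ j) * complex_of_real (exp (- pi * (cmod \<zeta>)\<^sup>2))" for j \<zeta>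
  define c where "c = complex_of_real (exp (- pi / 2 * (norm z)\<^sup>2)) * of_real (pi ^ mabs k / real (mfact k))"
  have int: "integrable lborel (h j)" for j unfolding h_def by (rule integral_exp_monomial(1))
  have e: "beta_op z (ek k) x * cnj (ek k x) * complex_of_real (exp (- pi * (norm x)\<^sup>2)) = c * (\<Prod>j\<in>UNIV. h j (x $ j))" for x
  proof -
    have "exp (complex_of_real pi * cdot_conj z x - complex_of_real (pi / 2 * (norm z)\<^sup>2))
        = of_real (exp (- pi / 2 * (norm z)\<^sup>2)) * (\<Prod>j\<in>UNIV. exp (of_real pi * cnj (z $ j) * (x $ j)))"
    proof -
      have "exp (A - complex_of_real b) = of_real (exp (- b)) * exp A" for A b
        by (simp add: exp_diff exp_minus exp_of_real[symmetric] field_simps)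
      moreover have "exp (complex_of_real pi * cdot_conj z x) = (\<Prod>j\<in>UNIV. exp (of_real pi * cnj (z $ j) * (x $ j)))"
        by (simp add: exp_sum[symmetric] cdot_conj_def sum_distrib_left mult.assoc)
      moreover have "- (pi / 2 * (norm z)\<^sup>2) = - pi / 2 * (norm z)\<^sup>2" by simp
      ultimately show ?thesis by (simp only:)
    qed
    moreover have "complex_of_real (sqrt (pi ^ mabs k / real (mfact k))) * complex_of_real (sqrt (pi ^ mabs k / real (mfact k))) = of_real (pi ^ mabs k / real (mfact k))"
    proof -
      have "sqrt (pi ^ mabs k / real (mfact k)) * sqrt (pi ^ mabs k / real (mfact k)) = pi ^ mabs k / real (mfact k)" by simp
      then show ?thesis by (metis of_real_mult)
    qed
    moreover have "complex_of_real (exp (- pi * (norm x)\<^sup>2)) = (\<Prod>j\<in>UNIV. complex_of_real (exp (- pi * (cmod (x $ j))\<^sup>2)))"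
      unfolding exp_norm_vec by (rule of_real_prod)
    ultimately show ?thesis
      unfolding beta_op_def ek_def c_def h_def mpow_def prod.distrib
      by (simp del: of_real_divide of_real_power of_real_exp add: mult_ac)
  qed
  have "ip (tau z (gk k)) (gk k) = fock_inner (beta_op z (ek k)) (ek k)"
    by (simp add: fock_inner_ip wt_beta)
  also have "\<dots> = c * integral\<^sup>L lborel (\<lambda>x :: complex ^ 'a. \<Prod>j\<in>UNIV. h j (x $ j))"
    unfolding fock_inner_def e by simp
  also have "integral\<^sup>L lborel (\<lambda>x :: complex ^ 'a. \<Prod>j\<in>UNIV. h j (x $ j)) = (\<Prod>j\<in>UNIV. integral\<^sup>L lborel (h j))"
    by (rule lborel_vec_prod(2)[OF int])
  also have "\<dots> = (\<Prod>j\<in>UNIV. fact (k $ j) / of_real pi ^ (k $ j) * of_real (laguerre (k $ j) (pi * (cmod (z $ j))\<^sup>2)))"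
    unfolding h_def by (simp only: integral_exp_monomial(2))
  also have "\<dots> = of_real (real (mfact k) / pi ^ mabs k) * of_real (\<Prod>j\<in>UNIV. laguerre (k $ j) (pi * (cmod (z $ j))\<^sup>2))"
    by (simp add: prod.distrib prod_dividef mfact_def mabs_def power_sum)
  finally show ?thesis
    using mfact_pos[of k] by (simp add: c_def)
qed

definition kap :: "nat ^ 'd \<Rightarrow> complex ^ 'd \<Rightarrow> complex ^ 'd \<Rightarrow> complex" where
  "kap n l x = (\<Sum>k\<in>Kset n. ip (tau l (gk k)) (tau x (gk k)))"

lemma ip_tau_tau_shift:
  assumes [measurable]: "g \<in> borel_measurable borel"
  shows "ip (tau l g) (tau x g) = cis (pi * sy l x) * ip g (tau (x - l) g)"
proof -
  have "ip (tau l g) (tau x g) = ip g (tau (- l) (tau x g))"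
    using ip_tau_right[of g "tau x g" "- l"] by simp
  also have "tau (- l) (tau x g) = (\<lambda>y. cis (- pi * sy l x) * tau (x - l) g y)"
    by (rule ext) (simp add: tau_tau sy_minus_left)
  finally show ?thesis by (simp add: ip_cmult_right cis_cnj)
qed

lemma kap_shift: "kap n l x = cis (pi * sy l x) * kap n 0 (x - l)"
  unfolding kap_def by (simp add: ip_tau_tau_shift[OF gb_measurable[OF gb_gk]] sum_distrib_left)

text \<open>Summing over the box factors the Laguerre polynomials coordinatewise, and the result is
  exactly the torus-invariant weight whose moments are computed by \<open>laguerre_moment\<close>,
  up to a further Gaussian.\<close>

lemma kap_0: "cnj (kap n 0 z) = of_real (exp (- pi / 2 * (norm z)\<^sup>2) * (\<Prod>j\<in>UNIV. \<Sum>k<n $ j. laguerre k (pi * (cmod (z $ j))\<^sup>2)))"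
proof -
  have "cnj (kap n 0 z) = (\<Sum>k\<in>Kset n. ip (tau z (gk k)) (gk k))"
    by (simp add: kap_def ip_commute[of "gk _" "tau z _"])
  also have "\<dots> = of_real (exp (- pi / 2 * (norm z)\<^sup>2) * (\<Sum>k\<in>Kset n. \<Prod>j\<in>UNIV. laguerre (k $ j) (pi * (cmod (z $ j))\<^sup>2)))"
    by (simp only: ip_tau_gk of_real_sum of_real_mult sum_distrib_left)
  finally show ?thesis by (simp only: prod_sum_Kset)
qed

text \<open>Since |z|^2 <= 2 |x|^2 + 2 |x - z|^2, the product of Gaussians centred at 0 and at
  \<open>z\<close> contains decay in \<open>z\<close>. The minimum with c1/2 reserves half of the
  rate of \<open>g\<close> for integration in \<open>x\<close>.\<close>

lemma ip_decay:
  assumes "gb g" "gb h"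
  obtains C c where "C \<ge> 0" "c > 0" "\<And>z. cmod (ip g (tau z h)) \<le> C * exp (- c * (norm z)\<^sup>2)"
proof -
  obtain C1 c1 where 1: "C1 \<ge> 0" "c1 > 0" "\<And>x. cmod (g x) \<le> C1 * exp (- c1 * (norm x)\<^sup>2)" using assms(1) by (auto simp: gb_def)
  obtain C2 c2 where 2: "C2 \<ge> 0" "c2 > 0" "\<And>x. cmod (h x) \<le> C2 * exp (- c2 * (norm x)\<^sup>2)" using assms(2) by (auto simp: gb_def)
  define c where "c = min (c1 / 2) c2"
  have c: "c > 0" "c \<le> c1 / 2" "c \<le> c2" using 1 2 by (auto simp: c_def)
  define I where "I = integral\<^sup>L lborel (\<lambda>x::complex ^ 'a. exp (- c * (norm x)\<^sup>2))"
  have I: "I \<ge> 0" unfolding I_def by (intro integral_nonneg_AE) auto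
  have pt: "cmod (g x * cnj (tau z h x)) \<le> C1 * C2 * exp (- (c / 2) * (norm z)\<^sup>2) * exp (- c * (norm x)\<^sup>2)" for x z
  proof -
    have "norm z \<le> norm x + norm (x - z)" using norm_triangle_ineq4[of x "x - z"] by simp
    then have "(norm z)\<^sup>2 \<le> (norm x + norm (x - z))\<^sup>2" by (intro power_mono) auto
    also have "\<dots> \<le> 2 * (norm x)\<^sup>2 + 2 * (norm (x - z))\<^sup>2"
      using sum_squares_bound[of "norm x" "norm (x - z)"] by (simp add: power2_sum)
    finally have "(c / 2) * (norm z)\<^sup>2 \<le> (c / 2) * (2 * (norm x)\<^sup>2 + 2 * (norm (x - z))\<^sup>2)"
      using c by (intro mult_left_mono) auto
    moreover have "c * (norm x)\<^sup>2 \<le> (c1 / 2) * (norm x)\<^sup>2" "c * (norm (x - z))\<^sup>2 \<le> c2 * (norm (x - z))\<^sup>2"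
      by (intro mult_right_mono c zero_le_power2)+
    ultimately have le: "(c / 2) * (norm z)\<^sup>2 + c * (norm x)\<^sup>2 \<le> c1 * (norm x)\<^sup>2 + c2 * (norm (x - z))\<^sup>2"
      by (simp add: algebra_simps)
    have "cmod (g x * cnj (tau z h x)) \<le> (C1 * exp (- c1 * (norm x)\<^sup>2)) * (C2 * exp (- c2 * (norm (x - z))\<^sup>2))"
      unfolding norm_mult complex_mod_cnj norm_tau using 1 2 by (intro mult_mono) auto
    also have "\<dots> = C1 * C2 * exp (- (c1 * (norm x)\<^sup>2 + c2 * (norm (x - z))\<^sup>2))"
      by (simp add: exp_add[symmetric] exp_diff exp_minus field_simps)
    also have "\<dots> \<le> C1 * C2 * exp (- ((c / 2) * (norm z)\<^sup>2 + c * (norm x)\<^sup>2))"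
      using 1 2 le by (intro mult_left_mono) auto
    finally show ?thesis by (simp add: exp_add[symmetric] mult.assoc)
  qed
  have "cmod (ip g (tau z h)) \<le> (C1 * C2 * I) * exp (- (c / 2) * (norm z)\<^sup>2)" for z
  proof -
    have "cmod (ip g (tau z h)) \<le> integral\<^sup>L lborel (\<lambda>x. cmod (g x * cnj (tau z h x)))"
      unfolding ip_def by (rule integral_norm_bound)
    also have "\<dots> \<le> integral\<^sup>L lborel (\<lambda>x :: complex ^ 'a. C1 * C2 * exp (- (c / 2) * (norm z)\<^sup>2) * exp (- c * (norm x)\<^sup>2))"
    proof (rule integral_mono)
      show "integrable lborel (\<lambda>x. cmod (g x * cnj (tau z h x)))"
        by (intro integrable_norm l2f_mult_integrable gb_l2f gb_tau assms)
      show "integrable lborel (\<lambda>x::complex ^ 'a. C1 * C2 * exp (- (c / 2) * (norm z)\<^sup>2) * exp (- c * (norm x)\<^sup>2))"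
        by (intro integrable_mult_right integrable_gauss c)
    qed (rule pt)
    also have "\<dots> = (C1 * C2 * I) * exp (- (c / 2) * (norm z)\<^sup>2)" by (simp add: I_def mult_ac)
    finally show ?thesis .
  qed
  then show ?thesis using 1 2 c I by (intro that[of "C1 * C2 * I" "c / 2"]) auto
qed

section \<open>Reproducing formulas\<close>

lemma polyfockD:
  assumes "F \<in> polyfock n"
  obtains \<phi> where "\<And>k. k \<in> Kset n \<Longrightarrow> entire_fun (\<phi> k)" "\<And>z. F z = (\<Sum>k\<in>Kset n. mpow (mconj z) k * \<phi> k z)"
    "gauss_L2 F"
  using assms unfolding polyfock_def by blast

lemma polyanalytic_continuous:
  assumes "\<And>k. k \<in> Kset n \<Longrightarrow> entire_fun (\<phi> k)" "\<And>z. F z = (\<Sum>k\<in>Kset n. mpow (mconj z) k * \<phi> k z)"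
  shows "continuous_on UNIV F"
proof -
  have "continuous_on UNIV (\<lambda>z. \<Sum>k\<in>Kset n. mpow (mconj z) k * \<phi> k z)"
    using assms(1) by (intro continuous_intros entire_continuous)
  then show ?thesis using assms(2) by (simp add: fun_eq_iff[symmetric] cong: continuous_on_cong)
qed

lemma polyfock_wt_l2f: "F \<in> polyfock n \<Longrightarrow> l2f (wt F) \<and> continuous_on UNIV (wt F)"
proof -
  assume F: "F \<in> polyfock n"
  obtain \<phi> where \<phi>: "\<And>k. k \<in> Kset n \<Longrightarrow> entire_fun (\<phi> k)" "\<And>z. F z = (\<Sum>k\<in>Kset n. mpow (mconj z) k * \<phi> k z)" "gauss_L2 F"
    using polyfockD[OF F] by blast
  have "continuous_on UNIV (wt F)" by (rule continuous_on_wt[OF polyanalytic_continuous[OF \<phi>(1,2)]])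
  then show ?thesis using \<phi>(3) by (simp add: l2f_def gauss_L2_wt borel_measurable_continuous_onI)
qed

text \<open>Expanding the powers of conj(x) - conj(a) creates only exponents that are coordinatewise
  at most the old ones, so the box is preserved; the exponential factor and the translated
  coefficients remain entire.\<close>

lemma polyfock_beta:
  assumes "F \<in> polyfock n"
  shows "beta_op a F \<in> polyfock n"
proof -
  obtain \<phi> where \<phi>: "\<And>k. k \<in> Kset n \<Longrightarrow> entire_fun (\<phi> k)" "\<And>z. F z = (\<Sum>k\<in>Kset n. mpow (mconj z) k * \<phi> k z)" "gauss_L2 F"
    using polyfockD[OF assms] by blast
  define co where "co k i = (\<Prod>j\<in>UNIV. of_nat ((k $ j) choose (i $ j))) * (\<Prod>j\<in>UNIV. (- (mconj a $ j)) ^ (k $ j - i $ j))" for k i :: "nat ^ 'a"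
  define E where "E x = exp (complex_of_real pi * cdot_conj a x + - complex_of_real (pi / 2 * (norm a)\<^sup>2))" for x
  have E: "entire_fun E" unfolding E_def by (intro entire_exp entire_add entire_mult entire_const entire_cdot)
  define \<psi> where "\<psi> i x = (\<Sum>k\<in>Kset n. co k i * (E x * \<phi> k (x + - a)))" for i x
  have "entire_fun (\<psi> i)" for i
    unfolding \<psi>_def by (intro entire_sum entire_mult entire_const E entire_translate \<phi>(1)) auto
  moreover have "beta_op a F x = (\<Sum>i\<in>Kset n. mpow (mconj x) i * \<psi> i x)" for x
  proof -
    have "beta_op a F x = (\<Sum>k\<in>Kset n. E x * (mpow (mconj x - mconj a) k * \<phi> k (x + - a)))"
      by (simp add: beta_op_def E_def \<phi>(2) mconj_diff sum_distrib_left)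
    also have "\<dots> = (\<Sum>k\<in>Kset n. \<Sum>i\<in>Kset n. E x * (co k i * mpow (mconj x) i * \<phi> k (x + - a)))"
      by (intro sum.cong refl) (simp add: mpow_diff[of _ n] co_def sum_distrib_left sum_distrib_right)
    also have "\<dots> = (\<Sum>i\<in>Kset n. \<Sum>k\<in>Kset n. E x * (co k i * mpow (mconj x) i * \<phi> k (x + - a)))"
      by (rule sum.swap)
    finally show ?thesis by (simp add: \<psi>_def sum_distrib_left mult_ac)
  qed
  moreover have "gauss_L2 (beta_op a F)"
    using l2f_tau[of "wt F" a] polyfock_wt_l2f[OF assms] by (simp add: gauss_L2_wt wt_beta l2f_def)
  ultimately show ?thesis unfolding polyfock_def by blast
qed

lemma radial_norm: "radial (\<lambda>z. f (\<lambda>j. cmod (z $ j)))"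
proof -
  have "(\<lambda>i. cmod (upd z j (z $ j * cis t) $ i)) = (\<lambda>i. cmod (z $ i))" for z :: "complex ^ 'a" and j t
    by (auto simp: upd_nth norm_mult)
  then show ?thesis by (simp add: radial_def)
qed

lemma gb_kap_0:
  fixes n :: "nat ^ 'd"
  shows "gb (kap n 0)"
proof -
  have kc: "continuous_on UNIV (kap n 0)"
  proof -
    have "kap n 0 = (\<lambda>z. cnj (of_real (exp (- pi / 2 * (norm z)\<^sup>2) * (\<Prod>j\<in>UNIV. \<Sum>k<n $ j. laguerre k (pi * (cmod (z $ j))\<^sup>2)))))"
      by (rule ext) (simp only: kap_0[symmetric] complex_cnj_cnj)
    then show ?thesis unfolding laguerre_def by (auto intro!: continuous_intros)
  qed
  show ?thesis
  proof -
    have "\<exists>C c. C \<ge> 0 \<and> c > 0 \<and> (\<forall>z. cmod (ip (gk k) (tau z (gk k))) \<le> C * exp (- c * (norm z)\<^sup>2))" for k :: "nat ^ 'd"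
      using ip_decay[OF gb_gk[of k] gb_gk[of k]] by metis
    then obtain C c where C: "\<And>k. C k \<ge> 0" "\<And>k. c k > 0" "\<And>k z. cmod (ip (gk k) (tau z (gk k))) \<le> C k * exp (- c k * (norm (z :: complex ^ 'd))\<^sup>2)"
      by metis
    define m where "m = Min (insert 1 (c ` Kset n))"
    have m: "m > 0" "\<And>k. k \<in> Kset n \<Longrightarrow> m \<le> c k" unfolding m_def using C(2) by (auto simp: Min_gr_iff)
    have "cmod (kap n 0 z) \<le> (\<Sum>k\<in>Kset n. C k) * exp (- m * (norm z)\<^sup>2)" for z
    proof -
      have "cmod (kap n 0 z) \<le> (\<Sum>k\<in>Kset n. C k * exp (- m * (norm z)\<^sup>2))"
        unfolding kap_def tau_0
      proof (rule sum_norm_le)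
        fix k assume k: "k \<in> Kset n"
        have "C k * exp (- c k * (norm z)\<^sup>2) \<le> C k * exp (- m * (norm z)\<^sup>2)"
          using m(2)[OF k] C(1)[of k] by (intro mult_left_mono) (auto intro: mult_right_mono)
        with C(3)[of k z] show "cmod (ip (gk k) (tau z (gk k))) \<le> C k * exp (- m * (norm z)\<^sup>2)" by linarith
      qed
      then show ?thesis by (simp add: sum_distrib_right)
    qed
    then show ?thesis unfolding gb_def using kc m(1) C(1)
      by (intro conjI exI[of _ "\<Sum>k\<in>Kset n. C k"] exI[of _ m]) (auto intro: sum_nonneg)
  qed
qed

text \<open>The two Gaussian weights combine so that the integrand is F times the torus-invariant
  \<open>\<Psi>\<close>. Its moments on the box vanish except at k = 0, hence the mean value is the
  value at the origin of the holomorphic component with k = 0, which is also F 0.\<close>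

lemma wt_reproducing_0:
  fixes n :: "nat ^ 'd"
  assumes n: "\<forall>j. n $ j \<ge> 1" and F: "F \<in> polyfock n"
  shows "wt F 0 = ip (wt F) (kap n 0)"
proof -
  obtain \<phi> where \<phi>: "\<And>k. k \<in> Kset n \<Longrightarrow> entire_fun (\<phi> k)" "\<And>z. F z = (\<Sum>k\<in>Kset n. mpow (mconj z) k * \<phi> k z)" "gauss_L2 F"
    using polyfockD[OF F] by blast
  define \<Psi> where "\<Psi> z = complex_of_real (exp (- pi * (norm z)\<^sup>2) * (\<Prod>j\<in>UNIV. \<Sum>k<n $ j. laguerre k (pi * (cmod (z $ j))\<^sup>2)))" for z :: "complex ^ 'd"
  note kgb = gb_kap_0[of n]
  have eq: "wt F z * cnj (kap n 0 z) = F z * \<Psi> z" for z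
  proof -
    have "exp (- pi / 2 * (norm z)\<^sup>2) * exp (- pi / 2 * (norm z)\<^sup>2) = exp (- pi * (norm z)\<^sup>2)" by (simp add: exp_add[symmetric])
    then have "complex_of_real (exp (- pi / 2 * (norm z)\<^sup>2)) * complex_of_real (exp (- pi / 2 * (norm z)\<^sup>2)) = of_real (exp (- pi * (norm z)\<^sup>2))"
      by (metis of_real_mult)
    moreover have "wt F z * cnj (kap n 0 z) = F z * ((complex_of_real (exp (- pi / 2 * (norm z)\<^sup>2)) * complex_of_real (exp (- pi / 2 * (norm z)\<^sup>2)))
        * of_real (\<Prod>j\<in>UNIV. \<Sum>k<n $ j. laguerre k (pi * (cmod (z $ j))\<^sup>2)))"
      unfolding kap_0 wt_def of_real_mult by (simp only: mult_ac)
    ultimately show ?thesis unfolding \<Psi>_def of_real_mult by (simp only:)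
  qed
  have "integral\<^sup>L lborel (\<lambda>z. F z * \<Psi> z) = \<phi> 0 0"
  proof (rule polyanalytic_mean[OF finite_Kset _ circ_entire[OF \<phi>(1)] \<phi>(2)])
    show "0 \<in> Kset n" using n by (auto simp: Kset_def Suc_le_eq)
    show "continuous_on UNIV \<Psi>" unfolding \<Psi>_def laguerre_def by (intro continuous_intros) auto
    show "radial \<Psi>"
      unfolding \<Psi>_def exp_norm_vec
      by (rule radial_norm[of "\<lambda>r. complex_of_real ((\<Prod>j\<in>UNIV. exp (- pi * (r j)\<^sup>2)) * (\<Prod>j\<in>UNIV. \<Sum>k<n $ j. laguerre k (pi * (r j)\<^sup>2)))"])
    show "integrable lborel (\<lambda>z. F z * \<Psi> z)"
      unfolding eq[symmetric] using polyfock_wt_l2f[OF F] gb_l2f[OF kgb] by (intro l2f_mult_integrable) auto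
    fix k assume k: "k \<in> Kset n"
    define h where "h j \<zeta> = \<zeta> ^ (k $ j) * cnj \<zeta> ^ (k $ j) * complex_of_real (exp (- pi * (cmod \<zeta>)\<^sup>2) * (\<Sum>i<n $ j. laguerre i (pi * (cmod \<zeta>)\<^sup>2)))" for j \<zeta>
    have kj: "k $ j < n $ j" for j using k by (simp add: Kset_def)
    have e: "mpow z k * (mpow (mconj z) k * \<Psi> z) = (\<Prod>j\<in>UNIV. h j (z $ j))" for z
      unfolding h_def \<Psi>_def mpow_def mconj_def exp_norm_vec by (simp add: prod.distrib mult_ac)
    have hi: "integrable lborel (h j)" "integral\<^sup>L lborel (h j) = (if k $ j = 0 then 1 else 0)" for j
      unfolding h_def using laguerre_moment[OF kj[of j]] by auto
    show "integrable lborel (\<lambda>z. mpow z k * (mpow (mconj z) k * \<Psi> z))"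
      unfolding e by (rule lborel_vec_prod(1)[OF hi(1)])
    have "integral\<^sup>L lborel (\<lambda>z. mpow z k * (mpow (mconj z) k * \<Psi> z)) = (\<Prod>j\<in>UNIV. if k $ j = 0 then 1 else 0)"
      unfolding e lborel_vec_prod(2)[OF hi(1)] hi(2) ..
    also have "\<dots> = (if k = 0 then 1 else 0)"
      by (auto simp: vec_eq_iff)
    finally show "integral\<^sup>L lborel (\<lambda>z. mpow z k * (mpow (mconj z) k * \<Psi> z)) = (if k = 0 then 1 else 0)" .
  qed
  moreover have "F 0 = \<phi> 0 0"
  proof -
    have "mpow (mconj 0) k = (if k = 0 then 1 else 0)" for k :: "nat ^ 'd"
      by (auto simp: mpow_def mconj_def vec_eq_iff)
    moreover have "0 \<in> Kset n" using n by (auto simp: Kset_def Suc_le_eq)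
    ultimately show ?thesis by (simp add: \<phi>(2) if_distrib[of "\<lambda>x. x * _"] cong: if_cong)
  qed
  ultimately show ?thesis
    unfolding ip_def eq by (simp add: wt_def)
qed

lemma tau_kap: "tau l (kap n 0) = kap n l"
  by (rule ext) (simp only: tau_def kap_shift[of n l])

text \<open>The formula at the origin is transported by the unitary translations, under which the
  polyanalytic space is invariant.\<close>

lemma wt_reproducing:
  fixes n :: "nat ^ 'd"
  assumes n: "\<forall>j. n $ j \<ge> 1" and F: "F \<in> polyfock n"
  shows "wt F l = ip (wt F) (kap n l)"
proof -
  have m: "wt F \<in> borel_measurable borel" "kap n 0 \<in> borel_measurable borel"
    using polyfock_wt_l2f[OF F] gb_measurable[OF gb_kap_0] by (auto simp: l2f_def)
  have "wt F l = wt (beta_op (- l) F) 0" by (simp add: wt_beta tau_def)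
  also have "\<dots> = ip (tau (- l) (wt F)) (kap n 0)"
    using wt_reproducing_0[OF n polyfock_beta[OF F]] by (simp add: wt_beta)
  also have "\<dots> = ip (wt F) (tau l (kap n 0))" by (rule ip_tau_right[OF m, symmetric])
  finally show ?thesis by (simp add: tau_kap)
qed

lemma gb_kap: "gb (kap n l)"
  using gb_tau[OF gb_kap_0[of n], of l] by (simp only: tau_kap)

section \<open>Coherent states and holomorphic reproduction\<close>

abbreviation g0 :: "complex ^ 'd \<Rightarrow> complex" where
  "g0 \<equiv> gk 0"

lemma g0_eq: "g0 x = of_real (exp (- pi / 2 * (norm x)\<^sup>2))"
  by (simp add: wt_def ek_def mabs_def mfact_def)

lemma integral_g0_square: "integral\<^sup>L lborel (\<lambda>x :: complex ^ 'd. (cmod (g0 x))\<^sup>2) = 1"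
proof -
  have "(cmod (g0 x))\<^sup>2 = exp (- pi * (norm x)\<^sup>2)" for x :: "complex ^ 'd"
    by (simp add: g0_eq power2_eq_square[of "exp _"] exp_add[symmetric])
  then show ?thesis using integral_gauss[of pi, where 'a="complex ^ 'd"] by simp
qed

text \<open>Translation by \<open>s\<close> turns the kernel into a centred Gaussian times an entire
  factor, so the mean value property with the single index 0 applies. Integrability is required of
  the product rather than of \<open>F\<close>, because the formula is later applied to a function
  multiplied by an exponential, which may leave the Fock space.\<close>

lemma entire_reproducing:
  assumes F: "entire_fun F"
    and int: "integrable lborel (\<lambda>y. F y * exp (of_real pi * cdot_conj y s) * complex_of_real (exp (- pi * (norm y)\<^sup>2)))"
  shows "integral\<^sup>L lborel (\<lambda>y. F y * exp (of_real pi * cdot_conj y s) * complex_of_real (exp (- pi * (norm y)\<^sup>2))) = F s"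
proof -
  let ?f = "\<lambda>y. F y * exp (of_real pi * cdot_conj y s) * complex_of_real (exp (- pi * (norm y)\<^sup>2))"
  define H where "H x = F (x + s) * exp (- (of_real pi * cdot_conj s x))" for x
  define \<Psi> where "\<Psi> x = complex_of_real (exp (- pi * (norm x)\<^sup>2))" for x :: "complex ^ 'a"
  have eq: "?f (x + s) = H x * \<Psi> x" for x
  proof -
    have n: "(norm (x + s))\<^sup>2 = (norm x)\<^sup>2 + (norm s)\<^sup>2 + 2 * (s \<bullet> x)"
      by (simp add: power2_norm_eq_inner inner_add_left inner_add_right inner_commute)
    have c1: "cdot_conj (x + s) s = Complex (s \<bullet> x + (norm s)\<^sup>2) (- sy s x)"
      by (simp add: cdot_conj_eq complex_eq_iff inner_add_left inner_add_right inner_commute power2_norm_eq_inner sy_add_left sy_commute[of x s])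
    have "exp (of_real pi * cdot_conj (x + s) s) * complex_of_real (exp (- pi * (norm (x + s))\<^sup>2))
        = exp (of_real pi * cdot_conj (x + s) s + complex_of_real (- pi * (norm (x + s))\<^sup>2))"
      by (simp only: exp_add exp_of_real)
    also have "of_real pi * cdot_conj (x + s) s + complex_of_real (- pi * (norm (x + s))\<^sup>2)
        = - (of_real pi * cdot_conj s x) + complex_of_real (- pi * (norm x)\<^sup>2)"
      unfolding c1 n cdot_conj_eq[of s x] by (simp add: complex_eq_iff algebra_simps)
    also have "exp \<dots> = exp (- (of_real pi * cdot_conj s x)) * \<Psi> x"
      by (simp only: exp_add exp_of_real \<Psi>_def)
    finally show ?thesis by (simp only: H_def mult.assoc)
  qed
  have He: "entire_fun H"
  proof -
    have "entire_fun (\<lambda>x. F (x + s) * exp ((- of_real pi) * cdot_conj s x))"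
      by (rule entire_mult[OF entire_translate[OF F] entire_exp[OF entire_mult[OF entire_const entire_cdot]]])
    then show ?thesis unfolding H_def[abs_def] by simp
  qed
  have [measurable]: "?f \<in> borel_measurable borel" using int by auto
  have "integral\<^sup>L lborel ?f = integral\<^sup>L lborel (\<lambda>x. ?f (x + s))"
    by (rule integral_lborel_translate[symmetric]) measurable
  also have "\<dots> = integral\<^sup>L lborel (\<lambda>x. H x * \<Psi> x)" by (simp only: eq)
  also have "\<dots> = (\<lambda>_. H) 0 0"
  proof (rule polyanalytic_mean[where K="{0}" and \<phi>="\<lambda>_. H"])
    show "continuous_on UNIV \<Psi>" unfolding \<Psi>_def by (intro continuous_intros)
    show "radial \<Psi>"
      unfolding \<Psi>_def exp_norm_vec by (rule radial_norm[of "\<lambda>r. complex_of_real (\<Prod>j\<in>UNIV. exp (- pi * (r j)\<^sup>2))"])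
    show "integrable lborel (\<lambda>z. H z * \<Psi> z)"
      unfolding eq[symmetric] by (rule integrable_lborel_translate[OF int])
    have "integrable lborel \<Psi>"
      unfolding \<Psi>_def by (rule integrable_of_real[OF integrable_gauss]) simp
    moreover have "integral\<^sup>L lborel \<Psi> = 1"
      unfolding \<Psi>_def integral_complex_of_real by (subst integral_gauss) auto
    ultimately show "integrable lborel (\<lambda>z. mpow z k * (mpow (mconj z) k * \<Psi> z))"
      "integral\<^sup>L lborel (\<lambda>z. mpow z k * (mpow (mconj z) k * \<Psi> z)) = (if k = 0 then 1 else 0)" if "k \<in> {0}" for k
      using that by auto
  qed (auto intro: circ_entire He)
  finally show ?thesis by (simp add: H_def cdot_conj_def)
qed

section \<open>The weighted Fock space\<close>

definition FW :: "(complex ^ 'd \<Rightarrow> complex) set" where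
  "FW = wt ` fock_space"

lemma FW_l2f: "f \<in> FW \<Longrightarrow> l2f f"
  using borel_measurable_continuous_onI[OF continuous_on_wt[OF entire_continuous]]
  by (auto simp: FW_def fock_space_def l2f_def gauss_L2_wt)

lemma FW_continuous: "f \<in> FW \<Longrightarrow> continuous_on UNIV f"
  using continuous_on_wt[OF entire_continuous] by (auto simp: FW_def fock_space_def)

lemma FW_gk: "gk k \<in> FW"
  using gb_l2f[OF gb_gk[of k]] by (auto simp: FW_def fock_space_def entire_ek l2f_def gauss_L2_wt)

lemma FW_tau: "f \<in> FW \<Longrightarrow> tau a f \<in> FW"
proof -
  assume "f \<in> FW"
  then obtain F where F: "F \<in> fock_space" "f = wt F" by (auto simp: FW_def)
  have "l2f (tau a f)" using \<open>f \<in> FW\<close> by (intro l2f_tau FW_l2f)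
  then have "beta_op a F \<in> fock_space"
    using F by (auto simp: fock_space_def gauss_L2_wt wt_beta l2f_def intro: entire_beta)
  then show ?thesis unfolding FW_def F(2) wt_beta[symmetric] by (rule imageI)
qed

lemma FW_lincomb:
  assumes S: "finite S" and f: "\<And>i. i \<in> S \<Longrightarrow> f i \<in> FW"
  shows "(\<lambda>x. \<Sum>i\<in>S. a i * f i x) \<in> FW"
proof -
  have "\<forall>i\<in>S. \<exists>F. F \<in> fock_space \<and> f i = wt F" using f by (auto simp: FW_def)
  then obtain F where F: "\<And>i. i \<in> S \<Longrightarrow> F i \<in> fock_space" "\<And>i. i \<in> S \<Longrightarrow> f i = wt (F i)" by metis
  define G where "G x = (\<Sum>i\<in>S. a i * F i x)" for x
  have w: "wt G = (\<lambda>x. \<Sum>i\<in>S. a i * f i x)"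
    using F(2) by (simp add: wt_def G_def sum_distrib_left sum_distrib_right fun_eq_iff mult_ac)
  have "entire_fun G" unfolding G_def using F(1) S by (intro entire_sum entire_mult entire_const) (auto simp: fock_space_def)
  moreover have "l2f (wt G)" unfolding w by (intro l2f_sum l2f_cmult FW_l2f f S)
  ultimately have "G \<in> fock_space" by (simp add: fock_space_def gauss_L2_wt l2f_def)
  then show ?thesis unfolding FW_def w[symmetric] by (rule imageI)
qed

lemma cnj_tau_g0: "cnj (tau s g0 y) = tau y g0 s"
  by (simp add: tau_def g0_eq cis_cnj sy_commute[of y s] norm_minus_commute)

text \<open>Modulating by \<open>v\<close> and pairing with a coherent state amounts, for the holomorphic \<open>F\<close>
  behind \<open>f\<close>, to evaluating \<open>F(y) exp (\<pi> \<langle>v, y\<rangle>)\<close> at \<open>s - v\<close>.\<close>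

lemma ip_modulated_coherent:
  assumes f: "f \<in> FW"
  shows "ip (\<lambda>y. f y * cis (2 * pi * sy v y)) (tau s g0) = of_real (exp (- pi / 2 * (norm v)\<^sup>2)) * tau v f s"
proof -
  obtain F where F: "F \<in> fock_space" "f = wt F" using f by (auto simp: FW_def)
  have Fe: "entire_fun F" using F by (simp add: fock_space_def)
  define F' where "F' y = F y * exp (of_real pi * cdot_conj v y)" for y
  have F'e: "entire_fun F'" unfolding F'_def by (intro entire_mult Fe entire_exp entire_const entire_cdot)
  let ?f = "\<lambda>y. F' y * exp (of_real pi * cdot_conj y (s - v)) * complex_of_real (exp (- pi * (norm y)\<^sup>2))"
  define c where "c = complex_of_real (exp (- pi / 2 * (norm s)\<^sup>2))"
  have c0: "c \<noteq> 0" by (simp add: c_def)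
  have eq: "f y * cis (2 * pi * sy v y) * cnj (tau s g0 y) = c * ?f y" for y
  proof -
    have n: "(norm (s - y))\<^sup>2 = (norm s)\<^sup>2 + (norm y)\<^sup>2 - 2 * (y \<bullet> s)"
      by (simp add: power2_norm_eq_inner inner_diff_left inner_diff_right inner_commute)
    have "f y * cis (2 * pi * sy v y) * cnj (tau s g0 y)
        = F y * exp (complex_of_real (- pi / 2 * (norm y)\<^sup>2) + \<i> * complex_of_real (2 * pi * sy v y)
            + (\<i> * complex_of_real (pi * sy y s) + complex_of_real (- pi / 2 * (norm (s - y))\<^sup>2)))"
      unfolding cnj_tau_g0 unfolding F(2) wt_def[of F] tau_def g0_eq by (simp only: exp_add exp_of_real cis_conv_exp mult_ac)
    also have "complex_of_real (- pi / 2 * (norm y)\<^sup>2) + \<i> * complex_of_real (2 * pi * sy v y)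
            + (\<i> * complex_of_real (pi * sy y s) + complex_of_real (- pi / 2 * (norm (s - y))\<^sup>2))
        = complex_of_real (- pi / 2 * (norm s)\<^sup>2) + (of_real pi * cdot_conj v y + (of_real pi * cdot_conj y (s - v) + complex_of_real (- pi * (norm y)\<^sup>2)))"
      unfolding n cdot_conj_eq
      by (simp add: complex_eq_iff algebra_simps inner_diff_right inner_commute sy_diff_right sy_commute[of y v])
    finally show ?thesis unfolding c_def F'_def by (simp only: exp_add exp_of_real mult_ac)
  qed
  \<comment> \<open>The modulated function is no longer holomorphic after unweighting, but it
    remains in L2; paired with a coherent state this supplies the integrability required for
    reproduction.\<close>
  have l2: "l2f (\<lambda>y. f y * cis (2 * pi * sy v y))"
  proof -
    have [measurable]: "f \<in> borel_measurable borel" using FW_l2f[OF f] by (rule l2f_measurable)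
    have "(\<lambda>y. f y * cis (2 * pi * sy v y)) \<in> borel_measurable borel" by measurable
    then show ?thesis using FW_l2f[OF f] by (simp add: l2f_def norm_mult)
  qed
  have "integrable lborel (\<lambda>y. c * ?f y)"
    unfolding eq[symmetric] by (intro l2f_mult_integrable l2 gb_l2f gb_tau gb_gk)
  from integrable_mult_right[OF this, of "inverse c"]
  have "integrable lborel (\<lambda>y. inverse c * (c * ?f y))" .
  moreover have "(\<lambda>y. inverse c * (c * ?f y)) = ?f" using c0 by (simp add: fun_eq_iff)
  ultimately have int: "integrable lborel ?f" by (simp only:)
  have "ip (\<lambda>y. f y * cis (2 * pi * sy v y)) (tau s g0) = c * integral\<^sup>L lborel ?f"
    unfolding ip_def eq by (rule integral_mult_right_zero)
  also have "\<dots> = c * F' (s - v)"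
    by (simp only: entire_reproducing[OF F'e int])
  also have "\<dots> = of_real (exp (- pi / 2 * (norm v)\<^sup>2)) * tau v f s"
  proof -
    have n: "(norm (s - v))\<^sup>2 = (norm s)\<^sup>2 + (norm v)\<^sup>2 - 2 * (v \<bullet> s)"
      by (simp add: power2_norm_eq_inner inner_diff_left inner_diff_right inner_commute)
    have "c * F' (s - v) = F (s - v) * exp (complex_of_real (- pi / 2 * (norm s)\<^sup>2) + of_real pi * cdot_conj v (s - v))"
      unfolding c_def F'_def by (simp only: exp_add exp_of_real mult_ac)
    also have "complex_of_real (- pi / 2 * (norm s)\<^sup>2) + of_real pi * cdot_conj v (s - v)
        = complex_of_real (- pi / 2 * (norm v)\<^sup>2) + (\<i> * complex_of_real (pi * sy v s) + complex_of_real (- pi / 2 * (norm (s - v))\<^sup>2))"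
      unfolding n cdot_conj_eq
      by (simp add: complex_eq_iff algebra_simps inner_diff_right power2_norm_eq_inner sy_diff_right)
    finally show ?thesis unfolding F(2) tau_def wt_def[of F] by (simp only: exp_add exp_of_real cis_conv_exp mult_ac)
  qed
  finally show ?thesis .
qed

lemma FW_reproducing:
  assumes "f \<in> FW"
  shows "ip f (tau s g0) = f s"
  using ip_modulated_coherent[OF assms, of 0 s] by simp

lemma FW_bounded:
  assumes f: "f \<in> FW"
  shows "(cmod (f s))\<^sup>2 \<le> integral\<^sup>L lborel (\<lambda>x. (cmod (f x))\<^sup>2)"
proof -
  have "integral\<^sup>L lborel (\<lambda>x. (cmod (tau s g0 x))\<^sup>2) = 1"
  proof -
    have "ip (tau s g0) (tau s g0) = ip (g0 :: complex ^ 'a \<Rightarrow> complex) g0"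
      by (intro ip_tau_tau gb_measurable gb_gk)
    then show ?thesis unfolding ip_self integral_g0_square by (metis of_real_eq_iff)
  qed
  then show ?thesis
    using ip_Cauchy_Schwarz[OF FW_l2f[OF f] gb_l2f[OF gb_tau[OF gb_gk[of 0]]], of s]
    by (simp add: FW_reproducing[OF f])
qed

section \<open>Weyl transforms of square integrable functions\<close>

lemma tau_pair_measurable [measurable]:
  assumes [measurable]: "g \<in> borel_measurable borel" "p \<in> borel_measurable M" "q \<in> borel_measurable M"
  shows "(\<lambda>x. tau (p x) g (q x)) \<in> borel_measurable M"
  unfolding tau_def by measurable

text \<open>Joint integrability holds because the inner integrals are bounded by \<open>C\<close>
  uniformly in \<open>s\<close>, translations being isometric on L2, while \<open>h\<close> is
  integrable.\<close>

lemma l2_weyl_Fubini: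
  assumes f: "l2f f" and g: "l2f g" and h: "integrable lborel (h :: complex ^ 'd \<Rightarrow> complex)"
  shows "integral\<^sup>L lborel (\<lambda>s. h s * ip f (tau s g)) = integral\<^sup>L lborel (\<lambda>y. f y * integral\<^sup>L lborel (\<lambda>s. h s * cnj (tau s g y)))"
proof -
  have [measurable]: "f \<in> borel_measurable borel" "g \<in> borel_measurable borel" "h \<in> borel_measurable borel"
    using f g h by (auto simp: l2f_def)
  define G where "G s y = h s * (f y * cnj (tau s g y))" for s y
  define C where "C = integral\<^sup>L lborel (\<lambda>x. (cmod (f x))\<^sup>2) + integral\<^sup>L lborel (\<lambda>x. (cmod (g x))\<^sup>2)"
  have C0: "0 \<le> C" unfolding C_def by (intro add_nonneg_nonneg integral_nonneg_AE) auto
  have bd: "integral\<^sup>L lborel (\<lambda>y. cmod (f y * cnj (tau s g y))) \<le> C" for s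
  proof -
    have tg: "l2f (tau s g)" by (rule l2f_tau[OF g])
    have "integral\<^sup>L lborel (\<lambda>y. cmod (f y * cnj (tau s g y))) \<le> integral\<^sup>L lborel (\<lambda>y. (cmod (f y))\<^sup>2 + (cmod (tau s g y))\<^sup>2)"
    proof (rule integral_mono)
      show "integrable lborel (\<lambda>y. cmod (f y * cnj (tau s g y)))" by (intro integrable_norm l2f_mult_integrable f tg)
      show "integrable lborel (\<lambda>y. (cmod (f y))\<^sup>2 + (cmod (tau s g y))\<^sup>2)" using f tg by (simp add: l2f_def)
      fix y
      have "2 * (cmod (f y) * cmod (tau s g y)) \<le> (cmod (f y))\<^sup>2 + (cmod (tau s g y))\<^sup>2"
        using sum_squares_bound[of "cmod (f y)" "cmod (tau s g y)"] by simp
      moreover have "0 \<le> cmod (f y) * cmod (tau s g y)" by simp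
      ultimately have "cmod (f y) * cmod (tau s g y) \<le> (cmod (f y))\<^sup>2 + (cmod (tau s g y))\<^sup>2" by linarith
      then show "cmod (f y * cnj (tau s g y)) \<le> (cmod (f y))\<^sup>2 + (cmod (tau s g y))\<^sup>2" by (simp add: norm_mult)
    qed
    also have "\<dots> = integral\<^sup>L lborel (\<lambda>y. (cmod (f y))\<^sup>2) + integral\<^sup>L lborel (\<lambda>y. (cmod (tau s g y))\<^sup>2)"
      using f tg by (simp add: l2f_def)
    also have "integral\<^sup>L lborel (\<lambda>y. (cmod (tau s g y))\<^sup>2) = integral\<^sup>L lborel (\<lambda>y. (cmod (g y))\<^sup>2)"
      unfolding norm_tau using integral_lborel_translate[of "\<lambda>y. (cmod (g y))\<^sup>2" "- s"] by simp
    finally show ?thesis by (simp add: C_def)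
  qed
  have Gint: "integrable (lborel \<Otimes>\<^sub>M lborel) (\<lambda>(s, y). G s y)"
  proof (rule lborel_pair.Fubini_integrable)
    show "(\<lambda>(s, y). G s y) \<in> borel_measurable (lborel \<Otimes>\<^sub>M lborel)" unfolding G_def by measurable
    show "AE s in lborel. integrable lborel (\<lambda>y. (\<lambda>(s, y). G s y) (s, y))"
      unfolding G_def by (intro AE_I2, simp, intro integrable_mult_right l2f_mult_integrable f l2f_tau g)
    show "integrable lborel (\<lambda>s. LINT y|lborel. norm ((\<lambda>(s, y). G s y) (s, y)))"
    proof (rule Bochner_Integration.integrable_bound)
      show "integrable lborel (\<lambda>s. C * norm (h s))" using h by (intro integrable_mult_right integrable_norm)
      show "(\<lambda>s. LINT y|lborel. norm ((\<lambda>(s, y). G s y) (s, y))) \<in> borel_measurable lborel"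
        unfolding G_def by measurable
      show "AE s in lborel. norm (LINT y|lborel. norm ((\<lambda>(s, y). G s y) (s, y))) \<le> norm (C * norm (h s))"
      proof (rule AE_I2)
        fix s
        have "(LINT y|lborel. norm ((\<lambda>(s, y). G s y) (s, y))) = norm (h s) * integral\<^sup>L lborel (\<lambda>y. cmod (f y * cnj (tau s g y)))"
          by (simp add: G_def norm_mult)
        moreover have "norm (h s) * integral\<^sup>L lborel (\<lambda>y. cmod (f y * cnj (tau s g y))) \<le> norm (h s) * C"
          by (intro mult_left_mono bd) simp
        moreover have "0 \<le> integral\<^sup>L lborel (\<lambda>y. cmod (f y * cnj (tau s g y)))" by (intro integral_nonneg_AE) auto
        ultimately show "norm (LINT y|lborel. norm ((\<lambda>(s, y). G s y) (s, y))) \<le> norm (C * norm (h s))"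
          using C0 by (simp add: abs_mult mult.commute)
      qed
    qed
  qed
  have "integral\<^sup>L lborel (\<lambda>s. h s * ip f (tau s g)) = integral\<^sup>L lborel (\<lambda>s. integral\<^sup>L lborel (\<lambda>y. G s y))"
    by (simp add: G_def ip_def)
  also have "\<dots> = integral\<^sup>L lborel (\<lambda>y. integral\<^sup>L lborel (\<lambda>s. G s y))"
    using lborel_pair.Fubini_integral[OF Gint] by simp
  also have "\<dots> = integral\<^sup>L lborel (\<lambda>y. f y * integral\<^sup>L lborel (\<lambda>s. h s * cnj (tau s g y)))"
  proof -
    have "(\<lambda>s. G s y) = (\<lambda>s. f y * (h s * cnj (tau s g y)))" for y by (simp add: G_def fun_eq_iff mult_ac)
    then show ?thesis by (simp only: integral_mult_right_zero)
  qed
  finally show ?thesis .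
qed

text \<open>The window is a superposition of coherent states weighted by its own values, so the
  coherent case extends by Fubini. In operator terms, a modulation compressed to the Fock space is a
  translation damped by a Gaussian.\<close>

lemma ip_modulated:
  assumes f: "f \<in> FW" and h: "h \<in> FW" "gb h"
  shows "ip (\<lambda>y. f y * cis (2 * pi * sy v y)) h = of_real (exp (- pi / 2 * (norm v)\<^sup>2)) * ip f (tau (- v) h)"
proof -
  have [measurable]: "f \<in> borel_measurable borel" "h \<in> borel_measurable borel"
    using FW_l2f[OF f] FW_l2f[OF h(1)] by (auto simp: l2f_def)
  have "(\<lambda>y. f y * cis (2 * pi * sy v y)) \<in> borel_measurable borel" by measurable
  then have l2: "l2f (\<lambda>y. f y * cis (2 * pi * sy v y))"
    using FW_l2f[OF f] by (simp add: l2f_def norm_mult)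
  have hi: "integrable lborel (\<lambda>s. cnj (h s))"
    using gb_integrable[OF h(2)] by (subst (asm) integrable_norm_iff) (auto intro: integrable_cnj)
  have rep: "integral\<^sup>L lborel (\<lambda>s. cnj (h s) * cnj (tau s g0 y)) = cnj (h y)" for y
  proof -
    have "h y = integral\<^sup>L lborel (\<lambda>s. h s * cnj (tau y g0 s))"
      using FW_reproducing[OF h(1), of y] by (simp add: ip_def)
    also have "\<dots> = integral\<^sup>L lborel (\<lambda>s. h s * tau s g0 y)" by (simp only: cnj_tau_g0)
    finally have "cnj (h y) = cnj (integral\<^sup>L lborel (\<lambda>s. h s * tau s g0 y))" by (simp only:)
    also have "\<dots> = integral\<^sup>L lborel (\<lambda>s. cnj (h s * tau s g0 y))"
      by (rule Bochner_Integration.integral_cnj[symmetric])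
    finally show ?thesis by simp
  qed
  have "ip (\<lambda>y. f y * cis (2 * pi * sy v y)) h = integral\<^sup>L lborel (\<lambda>s. cnj (h s) * ip (\<lambda>y. f y * cis (2 * pi * sy v y)) (tau s g0))"
    unfolding l2_weyl_Fubini[OF l2 gb_l2f[OF gb_gk] hi] rep unfolding ip_def ..
  also have "\<dots> = integral\<^sup>L lborel (\<lambda>s. of_real (exp (- pi / 2 * (norm v)\<^sup>2)) * (tau v f s * cnj (h s)))"
    unfolding ip_modulated_coherent[OF f] by (simp only: mult_ac)
  also have "\<dots> = of_real (exp (- pi / 2 * (norm v)\<^sup>2)) * ip (tau v f) h"
    unfolding ip_def by (rule integral_mult_right_zero)
  also have "ip (tau v f) h = ip f (tau (- v) h)"
    using ip_tau_right[of f h "- v"] by simp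
  finally show ?thesis .
qed

text \<open>The window is split into two square roots so that one copy of |g| survives as a weight;
  it can then be summed over a lattice or integrated over \<open>z\<close>.\<close>

lemma ip_weighted_Cauchy_Schwarz:
  assumes H: "l2f H" and g: "gb g"
  shows "ennreal ((cmod (ip H (tau z g)))\<^sup>2)
    \<le> ennreal (integral\<^sup>L lborel (\<lambda>x. cmod (g x))) * (\<integral>\<^sup>+x. ennreal ((cmod (H x))\<^sup>2) * ennreal (cmod (g (x - z))) \<partial>lborel)"
proof -
  have [measurable]: "H \<in> borel_measurable borel" "g \<in> borel_measurable borel"
    using l2f_measurable[OF H] gb_measurable[OF g] by auto
  let ?a = "\<lambda>x. ennreal (cmod (H x) * sqrt (cmod (g (x - z))))" and ?b = "\<lambda>x. ennreal (sqrt (cmod (g (x - z))))"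
  have "ennreal (cmod (ip H (tau z g))) \<le> (\<integral>\<^sup>+x. ?a x * ?b x \<partial>lborel)"
  proof -
    have "ennreal (cmod (ip H (tau z g))) \<le> (\<integral>\<^sup>+x. ennreal (cmod (H x * cnj (tau z g x))) \<partial>lborel)"
      unfolding ip_def by (intro integral_norm_bound_ennreal l2f_mult_integrable H gb_l2f gb_tau g)
    also have "\<dots> = (\<integral>\<^sup>+x. ?a x * ?b x \<partial>lborel)"
      by (intro nn_integral_cong) (simp add: norm_mult norm_tau ennreal_mult[symmetric] mult.assoc)
    finally show ?thesis .
  qed
  then have "(ennreal (cmod (ip H (tau z g))))\<^sup>2 \<le> (\<integral>\<^sup>+x. ?a x * ?b x \<partial>lborel)\<^sup>2"
    by (rule power_mono) simp
  also have "\<dots> \<le> (\<integral>\<^sup>+x. (?a x)\<^sup>2 \<partial>lborel) * (\<integral>\<^sup>+x. (?b x)\<^sup>2 \<partial>lborel)"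
    by (rule Cauchy_Schwarz_nn_integral) measurable
  also have "(\<integral>\<^sup>+x. (?a x)\<^sup>2 \<partial>lborel) = (\<integral>\<^sup>+x. ennreal ((cmod (H x))\<^sup>2) * ennreal (cmod (g (x - z))) \<partial>lborel)"
    by (intro nn_integral_cong) (simp add: ennreal_power power_mult_distrib ennreal_mult[symmetric])
  also have "(\<integral>\<^sup>+x. (?b x)\<^sup>2 \<partial>lborel) = (\<integral>\<^sup>+x. ennreal (cmod (g (x + - z))) \<partial>lborel)"
    by (intro nn_integral_cong) (simp add: ennreal_power)
  also have "\<dots> = (\<integral>\<^sup>+x. ennreal (cmod (g x)) \<partial>lborel)"
    by (rule nn_integral_lborel_translate[of "\<lambda>x. ennreal (cmod (g x))"]) measurable
  also have "\<dots> = ennreal (integral\<^sup>L lborel (\<lambda>x. cmod (g x)))"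
    by (rule nn_integral_eq_integral[OF gb_integrable[OF g]]) simp
  finally show ?thesis by (simp add: ennreal_power mult.commute)
qed

lemma ip_tau_measurable [measurable]:
  assumes [measurable]: "H \<in> borel_measurable borel" "g \<in> borel_measurable borel"
  shows "(\<lambda>z. ip H (tau z g)) \<in> borel_measurable borel"
  unfolding ip_def by measurable

text \<open>Integrating the weighted inequality over \<open>z\<close> and exchanging the integrals
  is Young's inequality with an integrable window.\<close>

lemma l2f_weyl_transform:
  assumes H: "l2f H" and g: "gb g"
  shows "l2f (\<lambda>z. ip H (tau z g))"
proof -
  have [measurable]: "H \<in> borel_measurable borel" "g \<in> borel_measurable borel"
    using l2f_measurable[OF H] gb_measurable[OF g] by auto
  define I where "I = ennreal (integral\<^sup>L lborel (\<lambda>x. cmod (g x)))"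
  have sh: "(\<integral>\<^sup>+z. ennreal (cmod (g (x - z))) \<partial>lborel) = I" for x
  proof -
    have "(\<integral>\<^sup>+z. ennreal (cmod (g (x - z))) \<partial>lborel) = (\<integral>\<^sup>+z. (\<lambda>z. ennreal (cmod (g (x + z)))) (- z) \<partial>lborel)"
      by simp
    also have "\<dots> = (\<integral>\<^sup>+z. ennreal (cmod (g (x + z))) \<partial>lborel)"
      by (rule nn_integral_lborel_isometry) (auto intro: linear_uminus)
    also have "\<dots> = (\<integral>\<^sup>+z. ennreal (cmod (g (z + x))) \<partial>lborel)" by (simp add: add.commute)
    also have "\<dots> = (\<integral>\<^sup>+x. ennreal (cmod (g x)) \<partial>lborel)"
      by (rule nn_integral_lborel_translate[of "\<lambda>x. ennreal (cmod (g x))"]) measurable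
    also have "\<dots> = I"
      unfolding I_def by (rule nn_integral_eq_integral[OF gb_integrable[OF g]]) simp
    finally show ?thesis .
  qed
  have "(\<integral>\<^sup>+z. ennreal ((cmod (ip H (tau z g)))\<^sup>2) \<partial>lborel)
      \<le> (\<integral>\<^sup>+z. I * (\<integral>\<^sup>+x. ennreal ((cmod (H x))\<^sup>2) * ennreal (cmod (g (x - z))) \<partial>lborel) \<partial>lborel)"
    unfolding I_def by (intro nn_integral_mono ip_weighted_Cauchy_Schwarz H g)
  also have "\<dots> = I * (\<integral>\<^sup>+z. \<integral>\<^sup>+x. ennreal ((cmod (H x))\<^sup>2) * ennreal (cmod (g (x - z))) \<partial>lborel \<partial>lborel)"
    by (rule nn_integral_cmult) measurable
  also have "(\<integral>\<^sup>+z. \<integral>\<^sup>+x. ennreal ((cmod (H x))\<^sup>2) * ennreal (cmod (g (x - z))) \<partial>lborel \<partial>lborel)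
      = (\<integral>\<^sup>+x. \<integral>\<^sup>+z. ennreal ((cmod (H x))\<^sup>2) * ennreal (cmod (g (x - z))) \<partial>lborel \<partial>lborel)"
    by (rule lborel_pair.Fubini') measurable
  also have "\<dots> = (\<integral>\<^sup>+x. ennreal ((cmod (H x))\<^sup>2) * I \<partial>lborel)"
    by (simp add: nn_integral_cmult sh)
  also have "\<dots> = (\<integral>\<^sup>+x. ennreal ((cmod (H x))\<^sup>2) \<partial>lborel) * I"
    by (rule nn_integral_multc) measurable
  also have "I * \<dots> < \<infinity>"
    using H unfolding I_def by (simp add: l2f_def integrable_iff_bounded ennreal_mult_less_top)
  finally have "(\<integral>\<^sup>+z. ennreal ((cmod (ip H (tau z g)))\<^sup>2) \<partial>lborel) < \<infinity>" .
  then show ?thesis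
    unfolding l2f_def by (auto intro!: integrableI_bounded)
qed

section \<open>Entire integral transforms and polyanalytic synthesis\<close>

lemma norm_exp_remainder: "norm (exp w - 1 - w) \<le> (norm w)\<^sup>2 * exp (norm w)" for w :: complex
proof -
  have "exp w - 1 - w = (\<Sum>n. inverse (fact (n + 2)) *\<^sub>R w ^ (n + 2))"
    using exp_first_two_terms[of w] by simp
  also have "norm \<dots> \<le> (\<Sum>n. (norm w)\<^sup>2 * (norm w ^ n /\<^sub>R fact n))"
  proof (rule norm_suminf_le)
    show "summable (\<lambda>n. (norm w)\<^sup>2 * (norm w ^ n /\<^sub>R fact n))" by (intro summable_mult summable_exp_generic)
    fix n
    have "(fact n :: real) \<le> fact (n + 2)" by (intro fact_mono) simp
    then have "inverse (fact (n + 2) :: real) \<le> inverse (fact n)" by (intro le_imp_inverse_le) auto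
    moreover define a where "a = inverse (fact (n + 2) :: real)"
    ultimately have "a \<le> inverse (fact n)" "0 \<le> a" by simp_all
    then have "a * norm w ^ (n + 2) \<le> inverse (fact n) * norm w ^ (n + 2)"
      by (intro mult_right_mono) auto
    also have "\<dots> = (norm w)\<^sup>2 * (norm w ^ n /\<^sub>R fact n)" by (simp add: power_add power2_eq_square mult_ac)
    finally show "norm (inverse (fact (n + 2)) *\<^sub>R w ^ (n + 2)) \<le> (norm w)\<^sup>2 * (norm w ^ n /\<^sub>R fact n)"
      unfolding a_def[symmetric] norm_scaleR norm_power using \<open>0 \<le> a\<close> by (simp only: abs_of_nonneg)
  qed
  also have "\<dots> = (norm w)\<^sup>2 * exp (norm w)"
    by (simp only: suminf_mult[OF summable_exp_generic] exp_def)
  finally show ?thesis .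
qed

lemma norm_cdot_conj_le: "cmod (cdot_conj x z) \<le> norm x * norm z"
proof -
  have "cmod (cdot_conj x z) \<le> (\<Sum>j\<in>UNIV. cmod (x $ j) * cmod (z $ j))"
    unfolding cdot_conj_def by (rule sum_norm_le) (simp add: norm_mult)
  also have "\<dots> \<le> L2_set (\<lambda>j. cmod (x $ j)) UNIV * L2_set (\<lambda>j. cmod (z $ j)) UNIV"
    using L2_set_mult_ineq[of "\<lambda>j. cmod (x $ j)" "\<lambda>j. cmod (z $ j)" UNIV] by simp
  finally show ?thesis by (simp add: norm_vec_def)
qed

lemma cdot_conj_measurable [measurable]:
  assumes [measurable]: "f \<in> borel_measurable M" "g \<in> borel_measurable M"
  shows "(\<lambda>x. cdot_conj (f x) (g x)) \<in> borel_measurable M"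
  unfolding cdot_conj_def by measurable

lemma cdot_conj_scale_right: "cdot_conj x (c *s h) = c * cdot_conj x h"
  by (simp add: cdot_conj_def sum_distrib_left mult_ac)

lemma cdot_conj_scaleR_right: "cdot_conj x (r *\<^sub>R h) = r *\<^sub>R cdot_conj x h"
  by (simp add: cdot_conj_def scaleR_sum_right)

text \<open>Differentiation under the integral with a quadratic remainder. Exponential moments of
  every order absorb the kernel as well as the powers of |x| created by the derivative and the
  remainder; complex homogeneity of the derivative is inherited from the linearity of
  \<open>cdot_conj x\<close> in its second argument.\<close>

lemma entire_transform:
  fixes Q :: "complex ^ 'd \<Rightarrow> complex"
  assumes [measurable]: "Q \<in> borel_measurable borel" and Q: "\<And>D. integrable lborel (\<lambda>x. exp (D * norm x) * cmod (Q x))"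
  shows "entire_fun (\<lambda>z. integral\<^sup>L lborel (\<lambda>x. Q x * exp (of_real pi * cdot_conj x z)))"
  unfolding entire_fun_def
proof
  fix z :: "complex ^ 'd"
  let ?\<phi> = "\<lambda>z. integral\<^sup>L lborel (\<lambda>x. Q x * exp (of_real pi * cdot_conj x z))"
  define E where "E x = Q x * exp (of_real pi * cdot_conj x z)" for x
  define D where "D h = integral\<^sup>L lborel (\<lambda>x. E x * (of_real pi * cdot_conj x h))" for h
  have [measurable]: "E \<in> borel_measurable borel" unfolding E_def by measurable
  have expb: "cmod (exp (of_real pi * cdot_conj x y)) \<le> exp (pi * norm y * norm x)" for x y :: "complex ^ 'd"
  proof -
    have "cmod (exp (of_real pi * cdot_conj x y)) \<le> exp (cmod (of_real pi * cdot_conj x y))" by (rule norm_exp)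
    also have "\<dots> \<le> exp (pi * norm y * norm x)"
      using norm_cdot_conj_le[of x y] by (simp add: norm_mult mult_ac)
    finally show ?thesis .
  qed
  have Eb: "cmod (E x) \<le> exp (pi * norm z * norm x) * cmod (Q x)" for x
    unfolding E_def norm_mult using mult_left_mono[OF expb[of x z], of "cmod (Q x)"] by (simp add: mult.commute)
  have int0: "integrable lborel (\<lambda>x. Q x * exp (of_real pi * cdot_conj x y))" for y
  proof (rule Bochner_Integration.integrable_bound[OF Q[of "pi * norm y"]])
    show "AE x in lborel. norm (Q x * exp (of_real pi * cdot_conj x y)) \<le> norm (exp (pi * norm y * norm x) * cmod (Q x))"
      using mult_left_mono[OF expb, of "cmod (Q _)"] by (auto simp: norm_mult mult.commute)
  qed measurable
  have int1: "integrable lborel (\<lambda>x. E x * (of_real pi * cdot_conj x h))" for h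
  proof (rule Bochner_Integration.integrable_bound)
    show "integrable lborel (\<lambda>x. (pi * norm h) * (exp ((pi * norm z + 1) * norm x) * cmod (Q x)))"
      by (intro integrable_mult_right Q)
    show "AE x in lborel. norm (E x * (of_real pi * cdot_conj x h)) \<le> norm ((pi * norm h) * (exp ((pi * norm z + 1) * norm x) * cmod (Q x)))"
    proof (rule AE_I2)
      fix x :: "complex ^ 'd"
      have "norm x \<le> exp (norm x)" using exp_ge_add_one_self[of "norm x"] by linarith
      then have "cmod (of_real pi * cdot_conj x h) \<le> pi * (exp (norm x) * norm h)"
        using norm_cdot_conj_le[of x h] mult_right_mono[of "norm x" "exp (norm x)" "norm h"] by (simp add: norm_mult)
      then have "norm (E x * (of_real pi * cdot_conj x h)) \<le> (exp (pi * norm z * norm x) * cmod (Q x)) * (pi * (exp (norm x) * norm h))"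
        unfolding norm_mult[of "E x"] by (intro mult_mono Eb) auto
      also have "\<dots> = (pi * norm h) * (exp ((pi * norm z + 1) * norm x) * cmod (Q x))"
        by (simp add: distrib_right exp_add)
      finally show "norm (E x * (of_real pi * cdot_conj x h)) \<le> norm ((pi * norm h) * (exp ((pi * norm z + 1) * norm x) * cmod (Q x)))" by simp
    qed
  qed measurable
  \<comment> \<open>In the exponent, \<open>pi * norm z\<close> comes from \<open>E\<close>,
    \<open>pi\<close> from the exponential of an increment with |h| < 1, and 2 from |x|^2 <= exp (2
    |x|).\<close>
  define K where "K = integral\<^sup>L lborel (\<lambda>x. exp ((pi * norm z + pi + 2) * norm x) * cmod (Q x))"
  have "bounded_linear D"
  proof (intro linear_conv_bounded_linear[THEN iffD1] linearI)
    show "D (h + k) = D h + D k" for h k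
      unfolding D_def using int1[of h] int1[of k] by (simp add: cdot_conj_add_right distrib_left)
    show "D (r *\<^sub>R h) = r *\<^sub>R D h" for r h
      unfolding D_def cdot_conj_scaleR_right mult_scaleR_right by simp
  qed
  moreover have "norm (?\<phi> y - ?\<phi> z - D (y - z)) / norm (y - z) \<le> pi\<^sup>2 * K * norm (y - z)" if "y \<noteq> z" "dist y z < 1" for y
  proof -
    define h where "h = y - z"
    have h: "norm h < 1" "norm h \<noteq> 0" using that by (auto simp: h_def dist_norm)
    have eq: "Q x * exp (of_real pi * cdot_conj x y) - E x - E x * (of_real pi * cdot_conj x h)
        = E x * (exp (of_real pi * cdot_conj x h) - 1 - of_real pi * cdot_conj x h)" for x
    proof -
      have "cdot_conj x y = cdot_conj x z + cdot_conj x h" unfolding h_def cdot_conj_diff_right by simp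
      then have "exp (of_real pi * cdot_conj x y) = exp (of_real pi * cdot_conj x z) * exp (of_real pi * cdot_conj x h)"
        by (simp add: distrib_left exp_add)
      then show ?thesis by (simp add: E_def algebra_simps)
    qed
    have bd: "cmod (E x * (exp (of_real pi * cdot_conj x h) - 1 - of_real pi * cdot_conj x h))
        \<le> (pi\<^sup>2 * (norm h)\<^sup>2) * (exp ((pi * norm z + pi + 2) * norm x) * cmod (Q x))" for x
    proof -
      define w where "w = of_real pi * cdot_conj x h"
      have w: "cmod w \<le> pi * (norm x * norm h)"
        using norm_cdot_conj_le[of x h] by (simp add: w_def norm_mult)
      also have "\<dots> \<le> pi * (norm x * 1)" using h by (intro mult_left_mono) auto
      finally have w1: "cmod w \<le> pi * norm x" by simp
      have "(norm x)\<^sup>2 \<le> exp (2 * norm x)" using power_le_exp_mult[of "norm x" 2] by simp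
      then have "(pi * (norm x * norm h))\<^sup>2 \<le> pi\<^sup>2 * (norm h)\<^sup>2 * exp (2 * norm x)"
        by (simp add: power_mult_distrib mult_left_mono mult_ac)
      moreover have "(cmod w)\<^sup>2 \<le> (pi * (norm x * norm h))\<^sup>2" using w by (intro power_mono) auto
      ultimately have "(cmod w)\<^sup>2 \<le> pi\<^sup>2 * (norm h)\<^sup>2 * exp (2 * norm x)" by (rule order_trans[rotated])
      then have "(cmod w)\<^sup>2 * exp (cmod w) \<le> (pi\<^sup>2 * (norm h)\<^sup>2 * exp (2 * norm x)) * exp (pi * norm x)"
        using w1 by (intro mult_mono) auto
      with norm_exp_remainder[of w] have "cmod (exp w - 1 - w) \<le> (pi\<^sup>2 * (norm h)\<^sup>2 * exp (2 * norm x)) * exp (pi * norm x)" by linarith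
      then have "cmod (E x * (exp w - 1 - w)) \<le> (exp (pi * norm z * norm x) * cmod (Q x)) * ((pi\<^sup>2 * (norm h)\<^sup>2 * exp (2 * norm x)) * exp (pi * norm x))"
        unfolding norm_mult[of "E x"] by (intro mult_mono Eb) auto
      also have "\<dots> = (pi\<^sup>2 * (norm h)\<^sup>2) * (exp ((pi * norm z + pi + 2) * norm x) * cmod (Q x))"
      proof -
        have "exp ((pi * norm z + pi + 2) * norm x) = exp (pi * norm z * norm x) * (exp (2 * norm x) * exp (pi * norm x))"
          by (simp add: exp_add[symmetric] algebra_simps)
        then show ?thesis by (simp only: mult_ac)
      qed
      finally show ?thesis by (simp add: w_def)
    qed
    have iE: "integrable lborel E" using int0[of z] by (simp add: E_def[abs_def])
    have "?\<phi> y - ?\<phi> z - D h = integral\<^sup>L lborel (\<lambda>x. Q x * exp (of_real pi * cdot_conj x y) - E x - E x * (of_real pi * cdot_conj x h))"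
      using int0[of y] iE int1[of h] by (simp add: D_def E_def[abs_def])
    also have "\<dots> = integral\<^sup>L lborel (\<lambda>x. E x * (exp (of_real pi * cdot_conj x h) - 1 - of_real pi * cdot_conj x h))"
      by (simp only: eq)
    also have "cmod \<dots> \<le> integral\<^sup>L lborel (\<lambda>x. (pi\<^sup>2 * (norm h)\<^sup>2) * (exp ((pi * norm z + pi + 2) * norm x) * cmod (Q x)))"
    proof (rule Bochner_Integration.integral_norm_bound_integral)
      show "integrable lborel (\<lambda>x. E x * (exp (of_real pi * cdot_conj x h) - 1 - of_real pi * cdot_conj x h))"
        unfolding eq[symmetric] by (intro Bochner_Integration.integrable_diff int0 iE int1)
      show "integrable lborel (\<lambda>x. (pi\<^sup>2 * (norm h)\<^sup>2) * (exp ((pi * norm z + pi + 2) * norm x) * cmod (Q x)))"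
        by (intro integrable_mult_right Q)
    qed (rule bd)
    also have "\<dots> = (pi\<^sup>2 * (norm h)\<^sup>2) * K" by (simp add: K_def)
    finally have "cmod (?\<phi> y - ?\<phi> z - D h) / norm h \<le> (pi\<^sup>2 * (norm h)\<^sup>2) * K / norm h"
      by (rule divide_right_mono) simp
    also have "\<dots> = pi\<^sup>2 * K * norm h" using h by (simp add: power2_eq_square)
    finally show ?thesis by (simp only: h_def)
  qed
  moreover have "((\<lambda>y. pi\<^sup>2 * K * norm (y - z)) \<longlongrightarrow> 0) (at z)"
  proof -
    have "((\<lambda>y. pi\<^sup>2 * K * norm (y - z)) \<longlongrightarrow> pi\<^sup>2 * K * norm (z - z)) (at z)" by (intro tendsto_intros)
    then show ?thesis by simp
  qed
  ultimately have "(?\<phi> has_derivative D) (at z)"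
    by (intro has_derivativeI_sandwich[of 1]) auto
  moreover have "D (c *s h) = c * D h" for c h
  proof -
    have "(\<lambda>x. E x * (of_real pi * (c * cdot_conj x h))) = (\<lambda>x. c * (E x * (of_real pi * cdot_conj x h)))"
      by (simp add: fun_eq_iff mult_ac)
    then show ?thesis unfolding D_def cdot_conj_scale_right by (simp only: integral_mult_right_zero)
  qed
  ultimately show "\<exists>D. (?\<phi> has_derivative D) (at z) \<and> (\<forall>c h. D (c *s h) = c * D h)" by blast
qed

text \<open>Removing the weight leaves a conjugated power of x - z times exp (pi
  \<open>cdot_conj x z\<close>), which is holomorphic in \<open>z\<close>. Expanding the power in
  conj(z) over the box exhibits the polyanalytic form with entire transforms as coefficients. Thus
  arbitrary L2 data produce members of the space without a closure argument.\<close>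

lemma polyfock_synthesis:
  fixes n :: "nat ^ 'd"
  assumes H: "\<And>k. k \<in> Kset n \<Longrightarrow> l2f (H k)"
  obtains F where "F \<in> polyfock n" "wt F = (\<lambda>z. \<Sum>k\<in>Kset n. ip (H k) (tau z (gk k)))"
proof -
  define U where "U z = (\<Sum>k\<in>Kset n. ip (H k) (tau z (gk k)))" for z
  define F where "F z = complex_of_real (exp (pi / 2 * (norm z)\<^sup>2)) * U z" for z
  define P where "P k i x = (\<Prod>j\<in>UNIV. (- cnj (x $ j)) ^ (k $ j - i $ j))" for k i :: "nat ^ 'd" and x :: "complex ^ 'd"
  define Q where "Q k i x = H k x * wt (P k i) x" for k i x
  \<comment> \<open>Collects the normalisation of \<open>ek\<close>, the sign from replacing x - z
    by z - x, and the binomial coefficients of the expansion.\<close>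
  define co where "co k i = complex_of_real (sqrt (pi ^ mabs k / real (mfact k))) * (-1) ^ mabs k * (\<Prod>j\<in>UNIV. of_nat ((k $ j) choose (i $ j)))" for k i :: "nat ^ 'd"
  define \<phi> where "\<phi> i z = (\<Sum>k\<in>Kset n. co k i * integral\<^sup>L lborel (\<lambda>x. Q k i x * exp (of_real pi * cdot_conj x z)))" for i z
  have wtF: "wt F = U"
  proof
    fix z :: "complex ^ 'd"
    have "exp (- pi / 2 * (norm z)\<^sup>2) * exp (pi / 2 * (norm z)\<^sup>2) = 1" by (simp add: exp_add[symmetric])
    then have "complex_of_real (exp (- pi / 2 * (norm z)\<^sup>2)) * complex_of_real (exp (pi / 2 * (norm z)\<^sup>2)) = 1"
      by (metis of_real_1 of_real_mult)
    then show "wt F z = U z" unfolding wt_def F_def by (simp only: mult.assoc[symmetric]) simp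
  qed
  have Pc: "continuous_on UNIV (P k i)" for k i unfolding P_def by (intro continuous_intros)
  have Pb: "cmod (P k i x) \<le> exp (real (mabs k) * norm x)" for k i x
  proof -
    have "cmod (P k i x) = (\<Prod>j\<in>UNIV. cmod (x $ j) ^ (k $ j - i $ j))"
      by (simp add: P_def prod_norm[symmetric] norm_power)
    also have "\<dots> \<le> (\<Prod>j\<in>UNIV. exp (real (k $ j) * norm x))"
    proof (intro prod_mono conjI)
      fix j
      have "cmod (x $ j) ^ (k $ j - i $ j) \<le> norm x ^ (k $ j - i $ j)"
        by (intro power_mono Finite_Cartesian_Product.norm_nth_le) auto
      also have "\<dots> \<le> exp (real (k $ j - i $ j) * norm x)" by (rule power_le_exp_mult) simp
      also have "\<dots> \<le> exp (real (k $ j) * norm x)" by (simp add: mult_right_mono)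
      finally show "cmod (x $ j) ^ (k $ j - i $ j) \<le> exp (real (k $ j) * norm x)" .
    qed auto
    also have "\<dots> = exp (real (mabs k) * norm x)"
      by (simp add: exp_sum[symmetric] mabs_def sum_distrib_right)
    finally show ?thesis .
  qed
  have Qint: "integrable lborel (\<lambda>x. exp (D * norm x) * cmod (Q k i x))" if k: "k \<in> Kset n" for D k i
  proof -
    define G where "G x = complex_of_real (exp (D * norm x)) * P k i x" for x
    have "gb (wt G)"
    proof (rule gb_wt)
      show "continuous_on UNIV G" unfolding G_def by (intro continuous_intros Pc)
      show "cmod (G x) \<le> 1 * exp ((D + real (mabs k)) * norm x)" for x
        using mult_left_mono[OF Pb[of k i x], of "exp (D * norm x)"] by (simp add: G_def norm_mult distrib_right exp_add)
    qed
    then have "integrable lborel (\<lambda>x. cmod (H k x * cnj (wt G x)))"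
      by (intro integrable_norm l2f_mult_integrable H k gb_l2f)
    moreover have "cmod (H k x * cnj (wt G x)) = exp (D * norm x) * cmod (Q k i x)" for x
      by (simp add: Q_def wt_def G_def norm_mult)
    ultimately show ?thesis by simp
  qed
  have Qm: "Q k i \<in> borel_measurable borel" if "k \<in> Kset n" for k i
  proof -
    have [measurable]: "H k \<in> borel_measurable borel" using l2f_measurable[OF H[OF that]] .
    have [measurable]: "wt (P k i) \<in> borel_measurable borel"
      by (intro borel_measurable_continuous_onI continuous_on_wt Pc)
    show ?thesis unfolding Q_def[abs_def] by measurable
  qed
  have \<phi>e: "entire_fun (\<phi> i)" for i
    unfolding \<phi>_def by (intro entire_sum entire_mult entire_const entire_transform Qm Qint) auto
  have intQ: "integrable lborel (\<lambda>x. Q k i x * exp (of_real pi * cdot_conj x z))" if k: "k \<in> Kset n" for k i z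
  proof (rule Bochner_Integration.integrable_bound[OF Qint[OF k, of "pi * norm z" i]])
    have [measurable]: "Q k i \<in> borel_measurable borel" by (rule Qm[OF k])
    show "(\<lambda>x. Q k i x * exp (of_real pi * cdot_conj x z)) \<in> borel_measurable lborel" by measurable
    show "AE x in lborel. norm (Q k i x * exp (of_real pi * cdot_conj x z)) \<le> norm (exp (pi * norm z * norm x) * cmod (Q k i x))"
    proof (rule AE_I2)
      fix x
      have "cmod (exp (of_real pi * cdot_conj x z)) \<le> exp (cmod (of_real pi * cdot_conj x z))" by (rule norm_exp)
      also have "\<dots> \<le> exp (pi * norm z * norm x)"
        using norm_cdot_conj_le[of x z] by (simp add: norm_mult mult_ac)
      finally have "cmod (Q k i x) * cmod (exp (of_real pi * cdot_conj x z)) \<le> cmod (Q k i x) * exp (pi * norm z * norm x)"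
        by (rule mult_left_mono) simp
      then show "norm (Q k i x * exp (of_real pi * cdot_conj x z)) \<le> norm (exp (pi * norm z * norm x) * cmod (Q k i x))"
        by (simp add: norm_mult mult.commute)
    qed
  qed
  have expand: "complex_of_real (exp (pi / 2 * (norm z)\<^sup>2)) * ip (H k) (tau z (gk k))
      = (\<Sum>i\<in>Kset n. mpow (mconj z) i * (co k i * integral\<^sup>L lborel (\<lambda>x. Q k i x * exp (of_real pi * cdot_conj x z))))"
    if k: "k \<in> Kset n" for k z
  proof -
    have pt: "complex_of_real (exp (pi / 2 * (norm z)\<^sup>2)) * (H k x * cnj (tau z (gk k) x))
        = (\<Sum>i\<in>Kset n. (mpow (mconj z) i * co k i) * (Q k i x * exp (of_real pi * cdot_conj x z)))" for x
    proof -
      have mp: "cnj (mpow (x - z) k) = (-1) ^ mabs k * mpow (mconj z - mconj x) k"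
      proof -
        have "cnj (mpow (x - z) k) = (\<Prod>j\<in>UNIV. (- 1) ^ (k $ j) * (cnj (z $ j) - cnj (x $ j)) ^ (k $ j))"
          unfolding mpow_def by (simp add: power_mult_distrib[symmetric])
        then show ?thesis by (simp add: prod.distrib mpow_def mconj_def mabs_def power_sum)
      qed
      have t1: "cnj (tau z (gk k) x) = complex_of_real (exp (- pi / 2 * (norm x)\<^sup>2)) *
          (cnj (exp (complex_of_real pi * cdot_conj z x - complex_of_real (pi / 2 * (norm z)\<^sup>2))) *
          (complex_of_real (sqrt (pi ^ mabs k / real (mfact k))) * cnj (mpow (x - z) k)))"
        unfolding wt_beta[symmetric] wt_def beta_op_def ek_def by (simp only: complex_cnj_mult complex_cnj_complex_of_real)
      have t2: "complex_of_real (exp (pi / 2 * (norm z)\<^sup>2)) * cnj (exp (complex_of_real pi * cdot_conj z x - complex_of_real (pi / 2 * (norm z)\<^sup>2)))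
          = exp (of_real pi * cdot_conj x z)"
      proof -
        have "cnj (exp (complex_of_real pi * cdot_conj z x - complex_of_real (pi / 2 * (norm z)\<^sup>2)))
            = exp (complex_of_real pi * cdot_conj x z - complex_of_real (pi / 2 * (norm z)\<^sup>2))"
          by (simp add: exp_cnj cdot_conj_commute[of x z])
        then show ?thesis unfolding exp_of_real[symmetric] by (simp only: exp_add[symmetric]) simp
      qed
      have "complex_of_real (exp (pi / 2 * (norm z)\<^sup>2)) * (H k x * cnj (tau z (gk k) x))
          = (H k x * complex_of_real (exp (- pi / 2 * (norm x)\<^sup>2)) * (complex_of_real (exp (pi / 2 * (norm z)\<^sup>2)) *
              cnj (exp (complex_of_real pi * cdot_conj z x - complex_of_real (pi / 2 * (norm z)\<^sup>2)))))
            * (complex_of_real (sqrt (pi ^ mabs k / real (mfact k))) * cnj (mpow (x - z) k))"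
        unfolding t1 by (simp only: mult_ac)
      also have "\<dots> = (H k x * complex_of_real (exp (- pi / 2 * (norm x)\<^sup>2)) * exp (of_real pi * cdot_conj x z))
            * (complex_of_real (sqrt (pi ^ mabs k / real (mfact k))) * ((-1) ^ mabs k * mpow (mconj z - mconj x) k))"
        unfolding mp t2 ..
      also have "mpow (mconj z - mconj x) k = (\<Sum>i\<in>Kset n. (\<Prod>j\<in>UNIV. of_nat ((k $ j) choose (i $ j))) * P k i x * mpow (mconj z) i)"
        unfolding mpow_diff[OF k] P_def by (simp add: mconj_def)
      finally show ?thesis
        unfolding Q_def co_def wt_def[of "P k _"] by (simp add: sum_distrib_left mult_ac)
    qed
    have "complex_of_real (exp (pi / 2 * (norm z)\<^sup>2)) * ip (H k) (tau z (gk k))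
        = integral\<^sup>L lborel (\<lambda>x. complex_of_real (exp (pi / 2 * (norm z)\<^sup>2)) * (H k x * cnj (tau z (gk k) x)))"
      unfolding ip_def by (rule integral_mult_right_zero[symmetric])
    also have "\<dots> = (\<Sum>i\<in>Kset n. integral\<^sup>L lborel (\<lambda>x. (mpow (mconj z) i * co k i) * (Q k i x * exp (of_real pi * cdot_conj x z))))"
      unfolding pt by (intro Bochner_Integration.integral_sum integrable_mult_right intQ k)
    finally show ?thesis by (simp only: integral_mult_right_zero mult.assoc)
  qed
  have "F z = (\<Sum>i\<in>Kset n. mpow (mconj z) i * \<phi> i z)" for z
  proof -
    have "F z = (\<Sum>k\<in>Kset n. \<Sum>i\<in>Kset n. mpow (mconj z) i * (co k i * integral\<^sup>L lborel (\<lambda>x. Q k i x * exp (of_real pi * cdot_conj x z))))"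
      unfolding F_def U_def sum_distrib_left by (intro sum.cong refl expand)
    also have "\<dots> = (\<Sum>i\<in>Kset n. \<Sum>k\<in>Kset n. mpow (mconj z) i * (co k i * integral\<^sup>L lborel (\<lambda>x. Q k i x * exp (of_real pi * cdot_conj x z))))"
      by (rule sum.swap)
    finally show ?thesis by (simp only: \<phi>_def sum_distrib_left)
  qed
  moreover have "gauss_L2 F"
  proof -
    have "l2f U" unfolding U_def by (intro l2f_sum l2f_weyl_transform H gb_gk) auto
    then show ?thesis by (simp add: gauss_L2_wt wtF l2f_def)
  qed
  ultimately have "F \<in> polyfock n" using \<phi>e unfolding polyfock_def by blast
  with wtF show ?thesis using that by (simp add: U_def[abs_def])
qed

section \<open>Lattice sums of Weyl translates\<close>

lemma suminf_permute:
  fixes f :: "nat \<Rightarrow> complex"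
  assumes "bij p" "summable (\<lambda>n. norm (f n))"
  shows "(\<Sum>n. f (p n)) = (\<Sum>n. f n)"
proof -
  have "(f has_sum (\<Sum>n. f n)) UNIV"
    using assms(2) summable_norm_cancel[OF assms(2)] by (intro norm_summable_imp_has_sum) (auto simp: summable_sums)
  then have "((\<lambda>n. f (p n)) has_sum (\<Sum>n. f n)) UNIV"
    using has_sum_reindex_bij_betw[OF assms(1), of f] by simp
  from has_sum_imp_sums[OF this] show ?thesis by (rule sums_unique[symmetric])
qed

locale weyl_lattice = euclidean_lattice B l
  for B :: "'v::euclidean_space \<Rightarrow> complex ^ 'd" and l :: "nat \<Rightarrow> complex ^ 'd"
begin

lemma gb_sum_bounded:
  assumes "gb g"
  obtains M where "M > 0" "\<And>x. summable (\<lambda>n. cmod (g (x - l n)))" "\<And>x. (\<Sum>n. cmod (g (x - l n))) \<le> M"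
proof -
  obtain C c where C: "C \<ge> 0" "c > 0" "\<And>x. cmod (g x) \<le> C * exp (- c * (norm x)\<^sup>2)" using assms by (auto simp: gb_def)
  obtain M where M: "M > 0" "\<And>z. summable (\<lambda>n. exp (- c * (norm (z - l n))\<^sup>2))"
    "\<And>z. (\<Sum>n. exp (- c * (norm (z - l n))\<^sup>2)) \<le> M" using gauss_sum_bounded[OF C(2)] by blast
  have s: "summable (\<lambda>n. C * exp (- c * (norm (x - l n))\<^sup>2))" for x by (intro summable_mult M)
  have sg: "summable (\<lambda>n. cmod (g (x - l n)))" for x
    by (rule summable_comparison_test'[OF s, of 0]) (use C in auto)
  have "(\<Sum>n. cmod (g (x - l n))) \<le> C * M + 1" for x
  proof -
    have "(\<Sum>n. cmod (g (x - l n))) \<le> (\<Sum>n. C * exp (- c * (norm (x - l n))\<^sup>2))"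
      by (intro suminf_le sg s C)
    also have "\<dots> = C * (\<Sum>n. exp (- c * (norm (x - l n))\<^sup>2))" by (rule suminf_mult[OF M(2)])
    also have "\<dots> \<le> C * M" by (intro mult_left_mono M C)
    finally show ?thesis by simp
  qed
  moreover have "C * M + 1 > 0" using C M by (simp add: add_nonneg_pos)
  ultimately show ?thesis using that sg by blast
qed

text \<open>The weighted Cauchy-Schwarz inequality is summed over the lattice under the integral,
  where the translates of |g| add up to a bounded function. This is the source of the upper bound in
  multiple sampling.\<close>

lemma bessel:
  assumes g: "gb g"
  obtains K where "K > 0"
    "\<And>H. l2f H \<Longrightarrow> summable (\<lambda>n. (cmod (ip H (tau (l n) g)))\<^sup>2)"
    "\<And>H. l2f H \<Longrightarrow> (\<Sum>n. (cmod (ip H (tau (l n) g)))\<^sup>2) \<le> K * integral\<^sup>L lborel (\<lambda>x. (cmod (H x))\<^sup>2)"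
proof -
  obtain M where M: "M > 0" "\<And>x. summable (\<lambda>n. cmod (g (x - l n)))" "\<And>x. (\<Sum>n. cmod (g (x - l n))) \<le> M"
    using gb_sum_bounded[OF g] by blast
  define I where "I = integral\<^sup>L lborel (\<lambda>x. cmod (g x))"
  have I0: "I \<ge> 0" unfolding I_def by (intro integral_nonneg_AE) auto
  define K where "K = I * M + 1"
  have K: "K > 0" using I0 M by (simp add: K_def add_nonneg_pos)
  have main: "(\<Sum>n. ennreal ((cmod (ip H (tau (l n) g)))\<^sup>2)) \<le> ennreal (K * integral\<^sup>L lborel (\<lambda>x. (cmod (H x))\<^sup>2))" if H: "l2f H" for H
  proof -
    have [measurable]: "H \<in> borel_measurable borel" "g \<in> borel_measurable borel"
      using l2f_measurable[OF H] gb_measurable[OF g] by auto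
    have HI: "(\<integral>\<^sup>+x. ennreal ((cmod (H x))\<^sup>2) \<partial>lborel) = ennreal (integral\<^sup>L lborel (\<lambda>x. (cmod (H x))\<^sup>2))"
      using H by (intro nn_integral_eq_integral) (auto simp: l2f_def)
    have H0: "0 \<le> integral\<^sup>L lborel (\<lambda>x. (cmod (H x))\<^sup>2)" by (intro integral_nonneg_AE) auto
    have "(\<Sum>n. ennreal ((cmod (ip H (tau (l n) g)))\<^sup>2))
        \<le> (\<Sum>n. ennreal I * (\<integral>\<^sup>+x. ennreal ((cmod (H x))\<^sup>2) * ennreal (cmod (g (x - l n))) \<partial>lborel))"
      unfolding I_def by (intro suminf_le ip_weighted_Cauchy_Schwarz H g summableI)
    also have "\<dots> = ennreal I * (\<integral>\<^sup>+x. (\<Sum>n. ennreal ((cmod (H x))\<^sup>2) * ennreal (cmod (g (x - l n)))) \<partial>lborel)"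
      by (subst nn_integral_suminf) (auto simp: ennreal_suminf_cmult)
    also have "\<dots> \<le> ennreal I * (\<integral>\<^sup>+x. ennreal ((cmod (H x))\<^sup>2) * ennreal M \<partial>lborel)"
    proof (intro mult_left_mono nn_integral_mono)
      fix x
      have "(\<Sum>n. ennreal (cmod (g (x - l n)))) = ennreal (\<Sum>n. cmod (g (x - l n)))"
        by (rule suminf_ennreal2[OF _ M(2)]) simp
      also have "\<dots> \<le> ennreal M" by (intro ennreal_leI M)
      finally have "ennreal ((cmod (H x))\<^sup>2) * (\<Sum>n. ennreal (cmod (g (x - l n)))) \<le> ennreal ((cmod (H x))\<^sup>2) * ennreal M"
        by (rule mult_left_mono) simp
      then show "(\<Sum>n. ennreal ((cmod (H x))\<^sup>2) * ennreal (cmod (g (x - l n)))) \<le> ennreal ((cmod (H x))\<^sup>2) * ennreal M"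
        by (simp add: ennreal_suminf_cmult)
    qed simp
    also have "\<dots> = ennreal I * (ennreal (integral\<^sup>L lborel (\<lambda>x. (cmod (H x))\<^sup>2)) * ennreal M)"
      by (subst nn_integral_multc) (auto simp: HI)
    also have "\<dots> = ennreal (I * M * integral\<^sup>L lborel (\<lambda>x. (cmod (H x))\<^sup>2))"
      using I0 M H0 by (simp add: ennreal_mult[symmetric] mult_ac)
    also have "\<dots> \<le> ennreal (K * integral\<^sup>L lborel (\<lambda>x. (cmod (H x))\<^sup>2))"
      using H0 by (intro ennreal_leI mult_right_mono) (auto simp: K_def)
    finally show ?thesis .
  qed
  have s: "summable (\<lambda>n. (cmod (ip H (tau (l n) g)))\<^sup>2)" if H: "l2f H" for H
    by (rule summable_suminf_not_top) (use main[OF H] in \<open>auto simp: top_unique\<close>)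
  have "(\<Sum>n. (cmod (ip H (tau (l n) g)))\<^sup>2) \<le> K * integral\<^sup>L lborel (\<lambda>x. (cmod (H x))\<^sup>2)" if H: "l2f H" for H
  proof -
    have "(\<Sum>n. ennreal ((cmod (ip H (tau (l n) g)))\<^sup>2)) = ennreal (\<Sum>n. (cmod (ip H (tau (l n) g)))\<^sup>2)"
      by (rule suminf_ennreal2[OF _ s[OF H]]) simp
    moreover have "0 \<le> K * integral\<^sup>L lborel (\<lambda>x. (cmod (H x))\<^sup>2)"
      using K by (intro mult_nonneg_nonneg integral_nonneg_AE) auto
    ultimately show ?thesis using main[OF H] by (metis ennreal_le_iff)
  qed
  with K s that show ?thesis by blast
qed

text \<open>The series of absolute values is kept as a common majorant for later limits. Splitting
  |g| into square roots bounds its square by \<open>M\<close> times the sum of |b n|^2 |g (x - l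
  n)|, which can be integrated term by term.\<close>

lemma synthesis_majorant:
  assumes g: "gb g" and b: "l2_seq b"
  shows "summable (\<lambda>n. cmod (b n * tau (l n) g x))"
    and "l2f (\<lambda>x. of_real (\<Sum>n. cmod (b n * tau (l n) g x)))"
proof -
  have [measurable]: "g \<in> borel_measurable borel" by (rule gb_measurable[OF g])
  obtain M where M: "M > 0" "\<And>x. summable (\<lambda>n. cmod (g (x - l n)))" "\<And>x. (\<Sum>n. cmod (g (x - l n))) \<le> M"
    using gb_sum_bounded[OF g] by blast
  have gM: "cmod (g (x - l n)) \<le> M" for x n
    using sum_le_suminf[OF M(2)[of x], of "{n}"] M(3)[of x] by simp
  have sq: "summable (\<lambda>n. (cmod (b n))\<^sup>2 * cmod (g (x - l n)))" for x
    by (rule summable_comparison_test'[OF summable_mult2[OF b, of M], of 0]) (auto intro: mult_left_mono gM)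
  show s: "summable (\<lambda>n. cmod (b n * tau (l n) g x))" for x
  proof (rule summable_comparison_test'[OF summable_add[OF sq[of x] M(2)[of x]], of 0])
    fix n
    \<comment> \<open>This crude bound separates each term into two series already known to
      converge: one weighted by |b n|^2, the other the plain lattice sum of |g|.\<close>
    have "cmod (b n) \<le> (cmod (b n))\<^sup>2 + 1"
      using sum_squares_bound[of "cmod (b n)" 1] by (simp add: power2_eq_square) (smt (verit) norm_ge_zero zero_le_square)
    then have "cmod (b n) * cmod (g (x - l n)) \<le> ((cmod (b n))\<^sup>2 + 1) * cmod (g (x - l n))"
      by (rule mult_right_mono) simp
    then show "norm (cmod (b n * tau (l n) g x)) \<le> (cmod (b n))\<^sup>2 * cmod (g (x - l n)) + cmod (g (x - l n))"
      by (simp add: norm_mult norm_tau distrib_right)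
  qed
  define V where "V x = (\<Sum>n. cmod (b n * tau (l n) g x))" for x
  have V0: "V x \<ge> 0" for x unfolding V_def by (intro suminf_nonneg s) simp
  have [measurable]: "V \<in> borel_measurable borel" unfolding V_def[abs_def] by measurable
  have cs: "(V x)\<^sup>2 \<le> M * (\<Sum>n. (cmod (b n))\<^sup>2 * cmod (g (x - l n)))" for x
  proof (rule LIMSEQ_le_const2)
    show "(\<lambda>N. (\<Sum>n<N. cmod (b n * tau (l n) g x))\<^sup>2) \<longlonglongrightarrow> (V x)\<^sup>2"
      unfolding V_def by (intro tendsto_intros summable_LIMSEQ s)
    have "(\<Sum>n<N. cmod (b n * tau (l n) g x))\<^sup>2 \<le> M * (\<Sum>n. (cmod (b n))\<^sup>2 * cmod (g (x - l n)))" for N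
    proof -
      have "(\<Sum>n<N. cmod (b n * tau (l n) g x))\<^sup>2 = (\<Sum>n<N. sqrt (cmod (g (x - l n))) * (sqrt (cmod (g (x - l n))) * cmod (b n)))\<^sup>2"
      proof -
        have key: "sqrt (cmod a) * (sqrt (cmod a) * t) = t * cmod a" for a t
          by (simp add: mult.assoc[symmetric])
        show ?thesis unfolding key by (simp add: norm_mult norm_tau)
      qed
      also have "\<dots> \<le> (\<Sum>n<N. (sqrt (cmod (g (x - l n))))\<^sup>2) * (\<Sum>n<N. (sqrt (cmod (g (x - l n))) * cmod (b n))\<^sup>2)"
        by (rule Cauchy_Schwarz_ineq_sum)
      also have "\<dots> = (\<Sum>n<N. cmod (g (x - l n))) * (\<Sum>n<N. (cmod (b n))\<^sup>2 * cmod (g (x - l n)))"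
        by (simp add: power_mult_distrib mult.commute)
      also have "\<dots> \<le> M * (\<Sum>n. (cmod (b n))\<^sup>2 * cmod (g (x - l n)))"
      proof (intro mult_mono sum_le_suminf sq)
        show "(\<Sum>n<N. cmod (g (x - l n))) \<le> M"
          using sum_le_suminf[OF M(2)[of x], of "{..<N}"] M(3)[of x] by simp
      qed (use M(1) in \<open>auto intro: sum_nonneg\<close>)
      finally show ?thesis .
    qed
    then show "\<exists>N. \<forall>n\<ge>N. (\<Sum>n<n. cmod (b n * tau (l n) g x))\<^sup>2 \<le> M * (\<Sum>n. (cmod (b n))\<^sup>2 * cmod (g (x - l n)))" by blast
  qed
  define I where "I = integral\<^sup>L lborel (\<lambda>x. cmod (g x))"
  have sh: "(\<integral>\<^sup>+x. ennreal (cmod (g (x - l n))) \<partial>lborel) = ennreal I" for n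
  proof -
    have "(\<integral>\<^sup>+x. ennreal (cmod (g (x + - l n))) \<partial>lborel) = (\<integral>\<^sup>+x. ennreal (cmod (g x)) \<partial>lborel)"
      by (rule nn_integral_lborel_translate[of "\<lambda>x. ennreal (cmod (g x))"]) measurable
    then show ?thesis unfolding I_def using nn_integral_eq_integral[OF gb_integrable[OF g]] by simp
  qed
  have "(\<integral>\<^sup>+x. ennreal ((V x)\<^sup>2) \<partial>lborel) \<le> (\<integral>\<^sup>+x. ennreal M * (\<Sum>n. ennreal ((cmod (b n))\<^sup>2) * ennreal (cmod (g (x - l n)))) \<partial>lborel)"
  proof (intro nn_integral_mono)
    fix x
    have "(\<Sum>n. ennreal ((cmod (b n))\<^sup>2 * cmod (g (x - l n)))) = ennreal (\<Sum>n. (cmod (b n))\<^sup>2 * cmod (g (x - l n)))"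
      by (rule suminf_ennreal2[OF _ sq]) simp
    then have "ennreal M * (\<Sum>n. ennreal ((cmod (b n))\<^sup>2) * ennreal (cmod (g (x - l n)))) = ennreal (M * (\<Sum>n. (cmod (b n))\<^sup>2 * cmod (g (x - l n))))"
      using M(1) suminf_nonneg[OF sq[of x]] by (simp add: ennreal_mult)
    then show "ennreal ((V x)\<^sup>2) \<le> ennreal M * (\<Sum>n. ennreal ((cmod (b n))\<^sup>2) * ennreal (cmod (g (x - l n))))"
      using ennreal_leI[OF cs[of x]] by simp
  qed
  also have "\<dots> = ennreal M * (\<Sum>n. ennreal ((cmod (b n))\<^sup>2) * ennreal I)"
  proof -
    have "(\<integral>\<^sup>+x. ennreal M * (\<Sum>n. ennreal ((cmod (b n))\<^sup>2) * ennreal (cmod (g (x - l n)))) \<partial>lborel)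
        = ennreal M * (\<integral>\<^sup>+x. (\<Sum>n. ennreal ((cmod (b n))\<^sup>2) * ennreal (cmod (g (x - l n)))) \<partial>lborel)"
      by (rule nn_integral_cmult) measurable
    also have "(\<integral>\<^sup>+x. (\<Sum>n. ennreal ((cmod (b n))\<^sup>2) * ennreal (cmod (g (x - l n)))) \<partial>lborel)
        = (\<Sum>n. \<integral>\<^sup>+x. ennreal ((cmod (b n))\<^sup>2) * ennreal (cmod (g (x - l n))) \<partial>lborel)"
      by (rule nn_integral_suminf) measurable
    also have "\<dots> = (\<Sum>n. ennreal ((cmod (b n))\<^sup>2) * ennreal I)"
      by (intro suminf_cong) (subst nn_integral_cmult, auto simp: sh)
    finally show ?thesis .
  qed
  also have "\<dots> = ennreal M * (ennreal (\<Sum>n. (cmod (b n))\<^sup>2) * ennreal I)"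
  proof -
    have "(\<Sum>n. ennreal ((cmod (b n))\<^sup>2)) = ennreal (\<Sum>n. (cmod (b n))\<^sup>2)"
      by (rule suminf_ennreal2[OF _ b]) simp
    then show ?thesis by (simp only: ennreal_suminf_multc)
  qed
  also have "\<dots> < \<infinity>" by (simp add: ennreal_mult_less_top)
  finally have "(\<integral>\<^sup>+x. ennreal ((V x)\<^sup>2) \<partial>lborel) < \<infinity>" .
  then have "integrable lborel (\<lambda>x. (V x)\<^sup>2)"
    by (intro integrableI_bounded) auto
  then show "l2f (\<lambda>x. of_real (\<Sum>n. cmod (b n * tau (l n) g x)))"
    unfolding V_def[symmetric] l2f_def using V0 by simp
qed

text \<open>The majorant dominates the sum and all partial sums at once: square integrability
  follows by comparison, both limits by dominated convergence.\<close>

lemma synthesis: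
  assumes g: "gb g" and b: "l2_seq b"
  shows "l2f (\<lambda>x. \<Sum>n. b n * tau (l n) g x)"
    and "gb h \<Longrightarrow> (\<lambda>n. b n * ip (tau (l n) g) h) sums ip (\<lambda>x. \<Sum>n. b n * tau (l n) g x) h"
    and "(\<lambda>N. integral\<^sup>L lborel (\<lambda>x. (cmod (\<Sum>n<N. b n * tau (l n) g x))\<^sup>2)) \<longlonglongrightarrow> integral\<^sup>L lborel (\<lambda>x. (cmod (\<Sum>n. b n * tau (l n) g x))\<^sup>2)"
proof -
  have [measurable]: "g \<in> borel_measurable borel" by (rule gb_measurable[OF g])
  define V where "V x = (\<Sum>n. cmod (b n * tau (l n) g x))" for x
  define S where "S x = (\<Sum>n. b n * tau (l n) g x)" for x
  define T where "T N x = (\<Sum>n<N. b n * tau (l n) g x)" for N x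
  have [measurable]: "V \<in> borel_measurable borel" "S \<in> borel_measurable borel" "T N \<in> borel_measurable borel" for N
    unfolding V_def[abs_def] S_def[abs_def] T_def[abs_def] by measurable
  have s: "summable (\<lambda>n. cmod (b n * tau (l n) g x))" for x by (rule synthesis_majorant(1)[OF g b])
  have V: "l2f (\<lambda>x. of_real (V x))" unfolding V_def by (rule synthesis_majorant(2)[OF g b])
  have V0: "V x \<ge> 0" for x unfolding V_def by (intro suminf_nonneg s) simp
  have SV: "cmod (S x) \<le> V x" for x unfolding S_def V_def by (rule summable_norm[OF s])
  have TV: "cmod (T N x) \<le> V x" for N x
  proof -
    have "cmod (T N x) \<le> (\<Sum>n<N. cmod (b n * tau (l n) g x))" unfolding T_def by (rule norm_sum)
    also have "\<dots> \<le> V x" unfolding V_def by (intro sum_le_suminf s) auto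
    finally show ?thesis .
  qed
  have TS: "(\<lambda>N. T N x) \<longlonglongrightarrow> S x" for x
    unfolding T_def S_def by (intro summable_LIMSEQ summable_norm_cancel[OF s])
  have Vi: "integrable lborel (\<lambda>x. (V x)\<^sup>2)" using V by (simp add: l2f_def)
  have S2: "l2f S"
    unfolding l2f_def
  proof (intro conjI)
    show "integrable lborel (\<lambda>x. (cmod (S x))\<^sup>2)"
      by (rule Bochner_Integration.integrable_bound[OF Vi]) (use SV V0 in \<open>auto intro!: power_mono\<close>)
  qed simp
  then show "l2f (\<lambda>x. \<Sum>n. b n * tau (l n) g x)" by (simp add: S_def[abs_def])
  show "(\<lambda>N. integral\<^sup>L lborel (\<lambda>x. (cmod (\<Sum>n<N. b n * tau (l n) g x))\<^sup>2)) \<longlonglongrightarrow> integral\<^sup>L lborel (\<lambda>x. (cmod (\<Sum>n. b n * tau (l n) g x))\<^sup>2)"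
    unfolding T_def[symmetric] S_def[symmetric]
  proof (rule integral_dominated_convergence[OF _ _ Vi])
    show "AE x in lborel. (\<lambda>N. (cmod (T N x))\<^sup>2) \<longlonglongrightarrow> (cmod (S x))\<^sup>2" by (intro AE_I2 tendsto_intros TS)
    show "AE x in lborel. norm ((cmod (T N x))\<^sup>2) \<le> (V x)\<^sup>2" for N
      using TV by (auto intro!: power_mono)
  qed measurable
  assume h: "gb h"
  have [measurable]: "h \<in> borel_measurable borel" by (rule gb_measurable[OF h])
  have "(\<lambda>N. integral\<^sup>L lborel (\<lambda>x. T N x * cnj (h x))) \<longlonglongrightarrow> integral\<^sup>L lborel (\<lambda>x. S x * cnj (h x))"
  proof (rule integral_dominated_convergence)
    show "integrable lborel (\<lambda>x. cmod (of_real (V x) * cnj (h x)))"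
      by (intro integrable_norm l2f_mult_integrable V gb_l2f h)
    show "AE x in lborel. (\<lambda>N. T N x * cnj (h x)) \<longlonglongrightarrow> S x * cnj (h x)" by (intro AE_I2 tendsto_intros TS)
    show "AE x in lborel. norm (T N x * cnj (h x)) \<le> cmod (of_real (V x) * cnj (h x))" for N
      using TV V0 by (auto simp: norm_mult intro!: mult_right_mono)
  qed measurable
  moreover have "integral\<^sup>L lborel (\<lambda>x. T N x * cnj (h x)) = (\<Sum>n<N. b n * ip (tau (l n) g) h)" for N
    using ip_sum_left[of "{..<N}" "\<lambda>n. tau (l n) g" h b] gb_l2f[OF gb_tau[OF g]] gb_l2f[OF h]
    by (simp add: ip_def T_def)
  ultimately show "(\<lambda>n. b n * ip (tau (l n) g) h) sums ip (\<lambda>x. \<Sum>n. b n * tau (l n) g x) h"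
    unfolding sums_def ip_def S_def by simp
qed

text \<open>On each ball the terms lie below a Gaussian of half the rate at the lattice points, so
  convergence is locally uniform. Adding a lattice vector merely permutes an absolutely convergent
  series.\<close>

lemma periodization:
  assumes p: "gb p"
  shows "continuous_on UNIV (\<lambda>z. \<Sum>n. p (z - l n))" and "periodic (\<lambda>z. \<Sum>n. p (z - l n))"
proof -
  obtain C c where C: "C \<ge> 0" "c > 0" "\<And>x. cmod (p x) \<le> C * exp (- c * (norm x)\<^sup>2)" using p by (auto simp: gb_def)
  have pc: "continuous_on UNIV p" using p by (simp add: gb_def)
  obtain M where M: "\<And>z. summable (\<lambda>n. exp (- (c / 2) * (norm (z - l n))\<^sup>2))"
    using gauss_sum_bounded[of "c / 2"] C(2) by (metis half_gt_zero)
  have cont: "continuous_on (ball 0 R) (\<lambda>z. \<Sum>n. p (z - l n))" if "R > 0" for R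
  proof -
    have le: "norm (p (z - l n)) \<le> (C * exp (c * R\<^sup>2)) * exp (- (c / 2) * (norm (0 - l n))\<^sup>2)" if z: "z \<in> ball 0 R" for z n
    proof -
      have "norm (l n) \<le> norm z + norm (z - l n)" using norm_triangle_ineq4[of z "z - l n"] by simp
      also have "\<dots> \<le> R + norm (z - l n)" using z by simp
      finally have "(norm (l n))\<^sup>2 \<le> (R + norm (z - l n))\<^sup>2" by (rule power_mono) simp
      also have "\<dots> \<le> 2 * R\<^sup>2 + 2 * (norm (z - l n))\<^sup>2"
        using sum_squares_bound[of R "norm (z - l n)"] by (simp add: power2_sum)
      finally have "(c / 2) * (norm (l n))\<^sup>2 \<le> (c / 2) * (2 * R\<^sup>2 + 2 * (norm (z - l n))\<^sup>2)"
        using C by (intro mult_left_mono) auto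
      then have "exp (- c * (norm (z - l n))\<^sup>2) \<le> exp (c * R\<^sup>2) * exp (- (c / 2) * (norm (0 - l n))\<^sup>2)"
        by (simp add: exp_add[symmetric] algebra_simps)
      then have "C * exp (- c * (norm (z - l n))\<^sup>2) \<le> C * (exp (c * R\<^sup>2) * exp (- (c / 2) * (norm (0 - l n))\<^sup>2))"
        by (rule mult_left_mono[OF _ C(1)])
      with C(3)[of "z - l n"] show ?thesis by (simp add: mult.assoc)
    qed
    have "uniform_limit (ball 0 R) (\<lambda>N z. \<Sum>n<N. p (z - l n)) (\<lambda>z. \<Sum>n. p (z - l n)) sequentially"
      by (rule Weierstrass_m_test[OF le summable_mult[OF M]])
    then show ?thesis
    proof (rule uniform_limit_theorem[rotated])
      have "continuous_on (ball 0 R) (\<lambda>z. p (z - l n))" for n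
        by (rule continuous_on_compose2[OF pc]) (auto intro: continuous_intros)
      then show "\<forall>\<^sub>F N in sequentially. continuous_on (ball 0 R) (\<lambda>z. \<Sum>n<N. p (z - l n))"
        by (intro always_eventually allI continuous_intros)
    qed simp
  qed
  show "continuous_on UNIV (\<lambda>z. \<Sum>n. p (z - l n))"
  proof (rule continuous_at_imp_continuous_on, rule ballI)
    fix z :: "complex ^ 'd"
    have "z \<in> ball 0 (norm z + 1)" "0 < norm z + 1" by (auto simp: add_nonneg_pos)
    then show "isCont (\<lambda>z. \<Sum>n. p (z - l n)) z"
      using cont[of "norm z + 1"] by (metis continuous_on_eq_continuous_at open_ball)
  qed
  obtain M' where M': "\<And>x. summable (\<lambda>n. cmod (p (x - l n)))" using gb_sum_bounded[OF p] by metis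
  show "periodic (\<lambda>z. \<Sum>n. p (z - l n))"
    unfolding periodic_def
  proof (intro allI ballI)
    fix z and x :: 'v assume x: "x \<in> int_points"
    \<comment> \<open>The permutation of indices induced by subtracting the lattice vector
      \<open>B x\<close>.\<close>
    define q where "q n = inv_into UNIV l (l n - B x)" for n
    have ln: "l n - B x \<in> B ` int_points" for n
    proof -
      have "l n - B x = B (inv B (l n) - x)" by (simp add: linear_diff[OF linB])
      then show ?thesis using lattice_point(1)[of n] x by (auto intro: int_points_diff)
    qed
    have lq: "l (q n) = l n - B x" for n
      unfolding q_def using ln bij_l by (intro f_inv_into_f) (auto simp: bij_betw_def)
    have "bij q"
    proof (rule bijI)
      show "inj q"
      proof (rule injI)
        fix a b assume "q a = q b"
        then have "l a = l b" using lq[of a] lq[of b] by simp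
        then show "a = b" using bij_l by (auto simp: bij_betw_def inj_def)
      qed
      have "\<exists>a. q a = k" for k
      proof -
        have "l k + B x = B (inv B (l k) + x)" by (simp add: linear_add[OF linB])
        then obtain a where "l a = l k + B x"
          using lattice_ex[OF int_points_add[OF lattice_point(1)[of k] x]] by auto
        then have "l (q a) = l k" using lq[of a] by simp
        then have "q a = k" using bij_l by (auto simp: bij_betw_def inj_def)
        then show ?thesis by blast
      qed
      then show "surj q" by (metis surjI surj_def)
    qed
    have "(\<Sum>n. p (z + B x - l n)) = (\<Sum>n. p (z - l (q n)))" by (simp add: lq algebra_simps)
    also have "\<dots> = (\<Sum>n. p (z - l n))"
      by (rule suminf_permute[OF \<open>bij q\<close>]) (rule M')
    finally show "(\<Sum>n. p (z + B x - l n)) = (\<Sum>n. p (z - l n))" .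
  qed
qed

end

section \<open>Duality\<close>

lemma tau_swap: "tau z (tau w g) = (\<lambda>y. cis (2 * pi * sy z w) * tau w (tau z g) y)"
proof
  fix y
  have "cis (2 * pi * sy z w) * cis (pi * sy w z) = cis (pi * sy z w)"
    by (simp add: cis_mult sy_commute[of w z])
  then show "tau z (tau w g) y = cis (2 * pi * sy z w) * tau w (tau z g) y"
    by (simp add: tau_tau[of z] tau_tau[of w] mult.assoc[symmetric] add.commute)
qed

lemma ip_tau_left:
  assumes "g \<in> borel_measurable borel" "h \<in> borel_measurable borel"
  shows "ip (tau z g) h = ip g (tau (- z) h)"
  using ip_tau_right[OF assms, of "- z"] by simp

lemma gram_form:
  assumes I: "finite I"
  shows "(\<Sum>i\<in>I. cnj (b i) * (\<Sum>j\<in>I. kap n (p j) (p i) * b j))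
    = of_real (\<Sum>k\<in>Kset n. integral\<^sup>L lborel (\<lambda>x. (cmod (\<Sum>j\<in>I. b j * tau (p j) (gk k) x))\<^sup>2))"
proof -
  have l2: "l2f (tau (p i) (gk k))" for i k by (intro gb_l2f gb_tau gb_gk)
  have "of_real (integral\<^sup>L lborel (\<lambda>x. (cmod (\<Sum>j\<in>I. b j * tau (p j) (gk k) x))\<^sup>2))
      = (\<Sum>i\<in>I. \<Sum>j\<in>I. cnj (b i) * (b j * ip (tau (p j) (gk k)) (tau (p i) (gk k))))" for k
  proof -
    have "of_real (integral\<^sup>L lborel (\<lambda>x. (cmod (\<Sum>j\<in>I. b j * tau (p j) (gk k) x))\<^sup>2))
        = ip (\<lambda>x. \<Sum>j\<in>I. b j * tau (p j) (gk k) x) (\<lambda>x. \<Sum>j\<in>I. b j * tau (p j) (gk k) x)"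
      by (rule ip_self[symmetric])
    also have "\<dots> = (\<Sum>i\<in>I. cnj (b i) * ip (\<lambda>x. \<Sum>j\<in>I. b j * tau (p j) (gk k) x) (tau (p i) (gk k)))"
      by (intro ip_sum_right I l2 l2f_sum l2f_cmult)
    also have "\<dots> = (\<Sum>i\<in>I. cnj (b i) * (\<Sum>j\<in>I. b j * ip (tau (p j) (gk k)) (tau (p i) (gk k))))"
      by (simp only: ip_sum_left[OF I l2 l2])
    finally show ?thesis by (simp only: sum_distrib_left)
  qed
  then have "of_real (\<Sum>k\<in>Kset n. integral\<^sup>L lborel (\<lambda>x. (cmod (\<Sum>j\<in>I. b j * tau (p j) (gk k) x))\<^sup>2))
      = (\<Sum>k\<in>Kset n. \<Sum>i\<in>I. \<Sum>j\<in>I. cnj (b i) * (b j * ip (tau (p j) (gk k)) (tau (p i) (gk k))))"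
    by (simp only: of_real_sum)
  also have "\<dots> = (\<Sum>i\<in>I. \<Sum>k\<in>Kset n. \<Sum>j\<in>I. cnj (b i) * (b j * ip (tau (p j) (gk k)) (tau (p i) (gk k))))"
    by (rule sum.swap)
  also have "\<dots> = (\<Sum>i\<in>I. \<Sum>j\<in>I. \<Sum>k\<in>Kset n. cnj (b i) * (b j * ip (tau (p j) (gk k)) (tau (p i) (gk k))))"
    by (intro sum.cong refl sum.swap)
  also have "\<dots> = (\<Sum>i\<in>I. cnj (b i) * (\<Sum>j\<in>I. kap n (p j) (p i) * b j))"
    by (simp add: kap_def sum_distrib_left sum_distrib_right mult_ac)
  finally show ?thesis by simp
qed

text \<open>\<open>B0\<close> carries the basis dual to that of \<open>B\<close> under
  \<open>sy\<close>, so an integer vector indexes both a point of the dual lattice and a frequency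
  of functions periodic under the original one. Both lattices share the enumeration
  \<open>e\<close>.\<close>

locale weyl_dual =
  fixes B B0 :: "'v::euclidean_space \<Rightarrow> complex ^ 'd" and e :: "nat \<Rightarrow> 'v"
  assumes B: "linear B" "bij B" and B0: "linear B0" "bij B0" and e: "bij_betw e UNIV int_points"
    and pairing: "\<And>m x. sy (B0 m) (B x) = m \<bullet> x"
begin

lemma bij_betw_image: "bij f \<Longrightarrow> bij_betw (\<lambda>n. f (e n)) UNIV (f ` int_points)"
  using e by (auto simp: bij_betw_def inj_on_def bij_def image_image[symmetric])

sublocale L: weyl_lattice B "\<lambda>n. B (e n)"
  by (rule weyl_lattice.intro, rule euclidean_lattice.intro) (intro B bij_betw_image)+

sublocale L0: weyl_lattice B0 "\<lambda>n. B0 (e n)"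
  by (rule weyl_lattice.intro, rule euclidean_lattice.intro) (intro B0 bij_betw_image)+

lemma e_int: "e n \<in> int_points"
  using e by (auto simp: bij_betw_def)

lemma character_L: "L.character m z = cis (2 * pi * sy (B0 m) z)"
  using pairing[of m "inv B z"] by (simp add: L.character_def)

lemma character_L0: "L0.character x z = cis (2 * pi * sy z (B x))"
  using pairing[of "inv B0 z" x] by (simp add: L0.character_def inner_commute)

lemma tau_dual_commute:
  assumes "x \<in> int_points" "m \<in> int_points"
  shows "tau (B x) (tau (B0 m) g) = tau (B0 m) (tau (B x) g)"
proof -
  have "m \<bullet> x \<in> \<int>" using int_points_inner[OF assms(2,1)] .
  then have "sy (B x) (B0 m) \<in> \<int>" by (simp add: sy_commute[of "B x"] pairing)
  then have "cis (2 * pi * sy (B x) (B0 m)) = 1" by (rule cis_multiple_2pi)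
  then show ?thesis by (simp add: tau_swap[of "B x"])
qed

text \<open>A sample of \<open>F z\<close> at \<open>B0 m\<close> is the conjugate of the dual
  translate of \<open>H k\<close> at \<open>z\<close>: the two lattices commute, and the coherent
  state evaluates. Summing the samples and integrating over a cell thus unfolds to the full norm of
  \<open>H k\<close>. The reflected points and conjugated coefficients in the conclusion are the
  trace of passing to the adjoint.\<close>

theorem sampling_imp_riesz:
  fixes n :: "nat ^ 'd" and a :: "'v \<Rightarrow> complex"
  assumes A: "A > 0"
    and samp: "\<And>f. f \<in> FW \<Longrightarrow> ennreal (A * integral\<^sup>L lborel (\<lambda>x. (cmod (f x))\<^sup>2))
        \<le> (\<Sum>i. ennreal (\<Sum>k\<in>Kset n. (cmod (ip f (tau (B0 (e i)) (gk k))))\<^sup>2))"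
    and S: "finite S" "S \<subseteq> int_points"
  shows "A * L0.covol * (\<Sum>x\<in>S. (cmod (a x))\<^sup>2)
    \<le> (\<Sum>k\<in>Kset n. integral\<^sup>L lborel (\<lambda>y. (cmod (\<Sum>x\<in>S. cnj (a x) * tau (- B x) (gk k) y))\<^sup>2))"
proof -
  define F where "F z y = (\<Sum>x\<in>S. a x * tau (B x) (tau z g0) y)" for z y
  define H where "H k y = (\<Sum>x\<in>S. cnj (a x) * tau (- B x) (gk k) y)" for k y
  have FF: "F z \<in> FW" for z unfolding F_def[abs_def] by (intro FW_lincomb S FW_tau FW_gk)
  have HF: "H k \<in> FW" for k unfolding H_def[abs_def] by (intro FW_lincomb S FW_tau FW_gk)
  have l2: "l2f (tau x (gk k))" "l2f (tau x (tau y (gk k)))" for x y k by (intro gb_l2f gb_tau gb_gk)+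
  have mg: "gk k \<in> borel_measurable borel" "tau x (gk k) \<in> borel_measurable borel" "tau x (tau y (gk k)) \<in> borel_measurable borel" for x y k
    by (intro gb_measurable gb_tau gb_gk)+
  have sample: "ip (F z) (tau (B0 m) (gk k)) = cnj (tau (B0 m) (H k) z)" if m: "m \<in> int_points" for m k z
  proof -
    have "ip (F z) (tau (B0 m) (gk k)) = (\<Sum>x\<in>S. a x * ip (tau (B x) (tau z g0)) (tau (B0 m) (gk k)))"
      unfolding F_def by (rule ip_sum_left[OF S(1) l2(2) l2(1)])
    also have "\<dots> = (\<Sum>x\<in>S. a x * cnj (tau (B0 m) (tau (- B x) (gk k)) z))"
    proof (intro sum.cong refl arg_cong2[where f="(*)"])
      fix x assume x: "x \<in> S"
      have "- x \<in> int_points" using x S by (auto intro: int_points_minus)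
      from tau_dual_commute[OF this m, of "gk k"]
      have com: "tau (- B x) (tau (B0 m) (gk k)) = tau (B0 m) (tau (- B x) (gk k))"
        by (simp add: linear_neg[OF B(1)])
      have "ip (tau (B x) (tau z g0)) (tau (B0 m) (gk k)) = ip (tau z g0) (tau (- B x) (tau (B0 m) (gk k)))"
        by (rule ip_tau_left[OF mg(2) mg(2)])
      also have "\<dots> = cnj (ip (tau (B0 m) (tau (- B x) (gk k))) (tau z g0))"
        unfolding com by (rule ip_commute)
      also have "ip (tau (B0 m) (tau (- B x) (gk k))) (tau z g0) = tau (B0 m) (tau (- B x) (gk k)) z"
        by (intro FW_reproducing FW_tau FW_gk)
      finally show "ip (tau (B x) (tau z g0)) (tau (B0 m) (gk k)) = cnj (tau (B0 m) (tau (- B x) (gk k)) z)" .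
    qed
    also have "\<dots> = cnj (tau (B0 m) (H k) z)"
      unfolding H_def tau_def by (simp add: sum_distrib_left mult_ac)
    finally show ?thesis .
  qed
  define G where "G x y = ip (tau (B x) g0) (tau (B y) g0)" for x y
  define N where "N z = integral\<^sup>L lborel (\<lambda>y. (cmod (F z y))\<^sup>2)" for z
  have G1: "G x x = 1" for x
  proof -
    have "G x x = ip (g0 :: complex ^ 'd \<Rightarrow> complex) g0" unfolding G_def by (rule ip_tau_tau[OF mg(1) mg(1)])
    then show ?thesis by (simp add: ip_self integral_g0_square)
  qed
  \<comment> \<open>Moving \<open>tau z\<close> outside makes the Gram matrix independent of
    \<open>z\<close>, except for the character of frequency x - y.\<close>
  have Nc: "complex_of_real (N z) = (\<Sum>x\<in>S. \<Sum>y\<in>S. (a y * cnj (a x) * G y x) * L0.character (x - y) z)" for z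
  proof -
    have sw: "ip (tau (B y) (tau z g0)) (tau (B x) (tau z g0)) = G y x * L0.character (x - y) z" for x y
    proof -
      have "ip (tau (B y) (tau z g0)) (tau (B x) (tau z g0))
          = cis (2 * pi * sy (B y) z) * (cnj (cis (2 * pi * sy (B x) z)) * ip (tau z (tau (B y) g0)) (tau z (tau (B x) g0)))"
        unfolding tau_swap[of "B y" z] tau_swap[of "B x" z] ip_cmult_left ip_cmult_right ..
      also have "ip (tau z (tau (B y) g0)) (tau z (tau (B x) g0)) = G y x"
        unfolding G_def by (rule ip_tau_tau[OF mg(2) mg(2)])
      also have "cis (2 * pi * sy (B y) z) * (cnj (cis (2 * pi * sy (B x) z)) * G y x) = G y x * L0.character (x - y) z"
      proof -
        have "2 * pi * sy z (B (x - y)) = 2 * pi * sy (B y) z + - (2 * pi * sy (B x) z)"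
          by (simp add: linear_diff[OF B(1)] sy_diff_right sy_commute[of z] algebra_simps)
        then have "L0.character (x - y) z = cis (2 * pi * sy (B y) z) * cnj (cis (2 * pi * sy (B x) z))"
          unfolding character_L0 cis_cnj cis_mult by (simp only:)
        then show ?thesis by (simp only: mult_ac)
      qed
      finally show ?thesis .
    qed
    have "complex_of_real (N z) = ip (F z) (F z)" unfolding N_def by (rule ip_self[symmetric])
    also have "\<dots> = (\<Sum>x\<in>S. cnj (a x) * ip (F z) (tau (B x) (tau z g0)))"
      unfolding F_def[of z] by (intro ip_sum_right S l2 l2f_sum l2f_cmult)
    also have "\<dots> = (\<Sum>x\<in>S. cnj (a x) * (\<Sum>y\<in>S. a y * ip (tau (B y) (tau z g0)) (tau (B x) (tau z g0))))"
      unfolding F_def[of z] by (simp only: ip_sum_left[OF S(1) l2(2) l2(2)])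
    also have "\<dots> = (\<Sum>x\<in>S. \<Sum>y\<in>S. (a y * cnj (a x) * G y x) * L0.character (x - y) z)"
      unfolding sw sum_distrib_left by (intro sum.cong refl) (simp only: mult_ac)
    finally show ?thesis .
  qed
  have xy: "x - y \<in> int_points" if "x \<in> S" "y \<in> S" for x y using that S by (auto intro: int_points_diff)
  have ich: "integrable lborel (\<lambda>z. indicator L0.cell z *\<^sub>R L0.character (x - y) z)" if "x \<in> S" "y \<in> S" for x y
    by (intro L0.integrable_cell L0.continuous_on_character L0.periodic_character xy that)
  have cell_sum: "(\<lambda>z. indicator L0.cell z *\<^sub>R complex_of_real (N z))
      = (\<lambda>z. \<Sum>x\<in>S. \<Sum>y\<in>S. (a y * cnj (a x) * G y x) * (indicator L0.cell z *\<^sub>R L0.character (x - y) z))"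
    unfolding Nc scaleR_sum_right by (simp only: mult_scaleR_right)
  have iN: "integrable lborel (\<lambda>z. indicator L0.cell z *\<^sub>R complex_of_real (N z))"
    unfolding cell_sum by (intro Bochner_Integration.integrable_sum integrable_mult_right ich)
  have "integral\<^sup>L lborel (\<lambda>z. indicator L0.cell z *\<^sub>R complex_of_real (N z)) = of_real (L0.covol * (\<Sum>x\<in>S. (cmod (a x))\<^sup>2))"
  proof -
    have "integral\<^sup>L lborel (\<lambda>z. indicator L0.cell z *\<^sub>R complex_of_real (N z))
        = (\<Sum>x\<in>S. integral\<^sup>L lborel (\<lambda>z. \<Sum>y\<in>S. (a y * cnj (a x) * G y x) * (indicator L0.cell z *\<^sub>R L0.character (x - y) z)))"
      unfolding cell_sum by (intro Bochner_Integration.integral_sum Bochner_Integration.integrable_sum integrable_mult_right ich)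
    also have "\<dots> = (\<Sum>x\<in>S. \<Sum>y\<in>S. integral\<^sup>L lborel (\<lambda>z. (a y * cnj (a x) * G y x) * (indicator L0.cell z *\<^sub>R L0.character (x - y) z)))"
      by (intro sum.cong refl Bochner_Integration.integral_sum integrable_mult_right ich)
    also have "\<dots> = (\<Sum>x\<in>S. \<Sum>y\<in>S. (a y * cnj (a x) * G y x) * (if x - y = 0 then of_real L0.covol else 0))"
      by (intro sum.cong refl) (simp only: integral_mult_right_zero L0.integral_character[OF xy])
    also have "\<dots> = (\<Sum>x\<in>S. \<Sum>y\<in>S. if x = y then of_real (L0.covol * (cmod (a x))\<^sup>2) else 0)"
      by (intro sum.cong refl) (auto simp: G1 complex_norm_square mult_ac simp del: of_real_power)
    also have "\<dots> = (\<Sum>x\<in>S. of_real (L0.covol * (cmod (a x))\<^sup>2))" using S by simp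
    finally show ?thesis by (simp only: of_real_sum sum_distrib_left of_real_mult)
  qed
  moreover have eqN: "(\<lambda>z. indicator L0.cell z *\<^sub>R complex_of_real (N z)) = (\<lambda>z. complex_of_real (indicator L0.cell z * N z))"
    by (simp add: scaleR_conv_of_real)
  ultimately have intN: "integral\<^sup>L lborel (\<lambda>z. indicator L0.cell z * N z) = L0.covol * (\<Sum>x\<in>S. (cmod (a x))\<^sup>2)"
    unfolding eqN by (simp only: integral_complex_of_real of_real_eq_iff)
  have iN': "integrable lborel (\<lambda>z. indicator L0.cell z * N z)"
    using integrable_Re[OF iN] by (simp add: scaleR_conv_of_real)
  have N0: "N z \<ge> 0" for z unfolding N_def by (intro integral_nonneg_AE) auto
  define h where "h z = (\<Sum>k\<in>Kset n. (cmod (H k z))\<^sup>2)" for z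
  have [measurable]: "H k \<in> borel_measurable borel" for k using l2f_measurable[OF FW_l2f[OF HF]] .
  have [measurable]: "h \<in> borel_measurable borel" unfolding h_def[abs_def] by measurable
  have pt: "ennreal (A * (indicator L0.cell z * N z)) \<le> (\<Sum>i. ennreal (h (z - B0 (e i)))) * indicator L0.cell z" for z
  proof (cases "z \<in> L0.cell")
    case True
    have "(\<Sum>k\<in>Kset n. (cmod (ip (F z) (tau (B0 (e i)) (gk k))))\<^sup>2) = h (z - B0 (e i))" for i
      unfolding sample[OF e_int] complex_mod_cnj norm_tau h_def ..
    then show ?thesis using samp[OF FF[of z]] True by (simp add: N_def)
  qed simp
  have "ennreal (A * (L0.covol * (\<Sum>x\<in>S. (cmod (a x))\<^sup>2))) = (\<integral>\<^sup>+z. ennreal (A * (indicator L0.cell z * N z)) \<partial>lborel)"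
  proof -
    have "(\<integral>\<^sup>+z. ennreal (A * (indicator L0.cell z * N z)) \<partial>lborel) = ennreal (integral\<^sup>L lborel (\<lambda>z. A * (indicator L0.cell z * N z)))"
      using A N0 iN' by (intro nn_integral_eq_integral integrable_mult_right) auto
    then show ?thesis by (simp only: integral_mult_right_zero intN)
  qed
  also have "\<dots> \<le> (\<integral>\<^sup>+z. (\<Sum>i. ennreal (h (z - B0 (e i)))) * indicator L0.cell z \<partial>lborel)"
    by (intro nn_integral_mono pt)
  also have "\<dots> = (\<integral>\<^sup>+z. ennreal (h z) \<partial>lborel)"
    by (rule L0.nn_integral_tiling[symmetric, of "\<lambda>z. ennreal (h z)"]) measurable
  also have "\<dots> = ennreal (integral\<^sup>L lborel h)"
    using FW_l2f[OF HF] unfolding h_def[abs_def]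
    by (intro nn_integral_eq_integral Bochner_Integration.integrable_sum) (auto simp: l2f_def intro!: sum_nonneg)
  also have "integral\<^sup>L lborel h = (\<Sum>k\<in>Kset n. integral\<^sup>L lborel (\<lambda>y. (cmod (H k y))\<^sup>2))"
    using FW_l2f[OF HF] unfolding h_def[abs_def] by (intro Bochner_Integration.integral_sum) (auto simp: l2f_def)
  finally show ?thesis
    unfolding H_def
    by (subst (asm) ennreal_le_iff) (auto intro!: sum_nonneg integral_nonneg_AE simp: mult.assoc)
qed

text \<open>The solution \<open>b\<close> of the Gram system is inserted into the series of
  translated windows rather than of kernels, since \<open>polyfock_synthesis\<close> then yields
  membership in the polyanalytic space; evaluation at the lattice points recombines the windows into
  the Gram matrix applied to \<open>b\<close>.\<close>

theorem riesz_imp_interpolation: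
  fixes n :: "nat ^ 'd"
  assumes c: "c > 0"
    and riesz: "\<And>N b. c * (\<Sum>i<N. (cmod (b i))\<^sup>2)
      \<le> (\<Sum>k\<in>Kset n. integral\<^sup>L lborel (\<lambda>y. (cmod (\<Sum>i<N. b i * tau (B (e i)) (gk k) y))\<^sup>2))"
    and \<alpha>: "l2_seq \<alpha>"
  obtains F where "F \<in> polyfock n" "\<And>i. wt F (B (e i)) = \<alpha> i"
proof -
  define l where "l i = B (e i)" for i
  define G where "G i j = kap n (l j) (l i)" for i j
  obtain C c' where C: "C \<ge> 0" "c' > 0" "\<And>x. cmod (kap n 0 x) \<le> C * exp (- c' * (norm x)\<^sup>2)"
    using gb_kap_0[of n] by (auto simp: gb_def)
  obtain M where M: "M > 0" "\<And>z. summable (\<lambda>j. exp (- c' * (norm (z - l j))\<^sup>2))"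
    "\<And>z. (\<Sum>j. exp (- c' * (norm (z - l j))\<^sup>2)) \<le> M"
    using L.gauss_sum_bounded[OF C(2)] unfolding l_def by blast
  have row: "summable (\<lambda>j. C * exp (- c' * (norm (l i - l j))\<^sup>2))" "(\<Sum>j. C * exp (- c' * (norm (l i - l j))\<^sup>2)) \<le> C * M" for i
    by (intro summable_mult M) (simp only: suminf_mult[OF M(2)] mult_left_mono[OF M(3) C(1)])
  \<comment> \<open>The majorant depends only on the distance of two lattice points, so row and
    column sums share one bound.\<close>
  interpret schur_matrix G "\<lambda>i j. C * exp (- c' * (norm (l i - l j))\<^sup>2)" "C * M"
  proof unfold_locales
    show "cmod (G i j) \<le> C * exp (- c' * (norm (l i - l j))\<^sup>2)" for i j
      unfolding G_def kap_shift[of n "l j" "l i"] norm_mult norm_cis using C(3)[of "l i - l j"] by simp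
    show "summable (\<lambda>i. C * exp (- c' * (norm (l i - l j))\<^sup>2))" "(\<Sum>i. C * exp (- c' * (norm (l i - l j))\<^sup>2)) \<le> C * M" for j
      using row[of j] by (simp_all only: norm_minus_commute[of _ "l j"])
  qed (rule row)+
  have coer: "c * (\<Sum>i<N. (cmod (b i))\<^sup>2) \<le> Re (\<Sum>i<N. cnj (b i) * (\<Sum>j<N. G i j * b j))" for N b
    unfolding G_def gram_form[OF finite_lessThan] Re_complex_of_real l_def by (rule riesz)
  obtain b where b: "l2_seq b" "\<And>i. app b i = \<alpha> i" using coercive_solvable[OF c coer \<alpha>] by blast
  define H where "H k x = (\<Sum>j. b j * tau (l j) (gk k) x)" for k x
  have H: "l2f (H k)" for k
    unfolding H_def[abs_def] l_def by (rule L.synthesis(1)[OF gb_gk b(1)])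
  obtain F where F: "F \<in> polyfock n" "wt F = (\<lambda>z. \<Sum>k\<in>Kset n. ip (H k) (tau z (gk k)))"
    using polyfock_synthesis[of n H] H by blast
  have "wt F (l i) = \<alpha> i" for i
  proof -
    have "(\<lambda>j. \<Sum>k\<in>Kset n. b j * ip (tau (l j) (gk k)) (tau (l i) (gk k))) sums (\<Sum>k\<in>Kset n. ip (H k) (tau (l i) (gk k)))"
      unfolding H_def l_def by (intro sums_sum L.synthesis(2) gb_gk gb_tau b(1))
    moreover have "(\<Sum>k\<in>Kset n. b j * ip (tau (l j) (gk k)) (tau (l i) (gk k))) = G i j * b j" for j
      unfolding G_def kap_def sum_distrib_right by (intro sum.cong refl mult.commute)
    ultimately have "(\<Sum>j. G i j * b j) = wt F (l i)" unfolding F(2) by (simp add: sums_iff)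
    then show ?thesis using b(2)[of i] by (simp add: app_def)
  qed
  with F(1) that show ?thesis by (simp add: l_def)
qed

section \<open>Necessity of the Riesz bound for interpolation\<close>

definition riesz_form :: "nat ^ 'd \<Rightarrow> nat \<Rightarrow> (nat \<Rightarrow> complex) \<Rightarrow> real" where
  "riesz_form n N b = (\<Sum>k\<in>Kset n. integral\<^sup>L lborel (\<lambda>y. (cmod (\<Sum>i<N. b i * tau (B (e i)) (gk k) y))\<^sup>2))"

lemma riesz_form_nonneg: "riesz_form n N b \<ge> 0"
  unfolding riesz_form_def by (intro sum_nonneg integral_nonneg_AE) auto

text \<open>By the reproducing formula the left-hand sum is the inner product of the weighted
  \<open>F\<close> with the kernel combination \<open>V\<close>, whose squared norm is the Riesz
  form; the estimate is Cauchy-Schwarz.\<close>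

lemma polyfock_pairing:
  fixes n :: "nat ^ 'd"
  assumes n: "\<forall>j. n $ j \<ge> 1" and F: "F \<in> polyfock n"
  shows "(cmod (\<Sum>i<N. wt F (B (e i)) * cnj (b i)))\<^sup>2 \<le> integral\<^sup>L lborel (\<lambda>x. (cmod (wt F x))\<^sup>2) * riesz_form n N b"
proof -
  define l where "l i = B (e i)" for i
  define V where "V x = (\<Sum>i<N. b i * kap n (l i) x)" for x
  define H where "H k y = (\<Sum>i<N. b i * tau (l i) (gk k) y)" for k y
  have l2k: "l2f (kap n (l i))" for i by (rule gb_l2f[OF gb_kap])
  have l2t: "l2f (tau x (gk k))" for x k by (intro gb_l2f gb_tau gb_gk)
  have V2: "l2f V" unfolding V_def by (intro l2f_sum l2f_cmult l2k) simp
  have "\<And>k. k \<in> Kset n \<Longrightarrow> l2f (H k)" unfolding H_def by (intro l2f_sum l2f_cmult l2t) simp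
  \<comment> \<open>\<open>V\<close> is recognised as the weighted form of a member of the
    polyanalytic space, so that the reproducing formula can be applied to \<open>V\<close> itself
    when its norm is computed.\<close>
  then obtain F' where F': "F' \<in> polyfock n" "wt F' = (\<lambda>z. \<Sum>k\<in>Kset n. ip (H k) (tau z (gk k)))"
    using polyfock_synthesis[of n H] by blast
  have FV: "wt F' = V"
  proof
    fix z
    have "wt F' z = (\<Sum>k\<in>Kset n. \<Sum>i<N. b i * ip (tau (l i) (gk k)) (tau z (gk k)))"
      unfolding F'(2) H_def by (simp only: ip_sum_left[OF finite_lessThan l2t l2t])
    also have "\<dots> = (\<Sum>i<N. \<Sum>k\<in>Kset n. b i * ip (tau (l i) (gk k)) (tau z (gk k)))" by (rule sum.swap)
    finally show "wt F' z = V z" by (simp only: V_def kap_def sum_distrib_left)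
  qed
  have "of_real (integral\<^sup>L lborel (\<lambda>x. (cmod (V x))\<^sup>2)) = ip V V" by (rule ip_self[symmetric])
  also have "\<dots> = (\<Sum>i<N. cnj (b i) * ip V (kap n (l i)))"
  proof -
    have "ip V (\<lambda>x. \<Sum>i<N. b i * kap n (l i) x) = (\<Sum>i<N. cnj (b i) * ip V (kap n (l i)))"
      by (intro ip_sum_right finite_lessThan l2k V2)
    then show ?thesis by (simp only: V_def[abs_def, symmetric])
  qed
  also have "\<dots> = (\<Sum>i<N. cnj (b i) * V (l i))"
    using wt_reproducing[OF n F'(1)] by (simp only: FV)
  also have "\<dots> = (\<Sum>i<N. cnj (b i) * (\<Sum>j<N. kap n (l j) (l i) * b j))"
    unfolding V_def by (simp only: mult.commute)
  also have "\<dots> = of_real (riesz_form n N b)"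
    unfolding riesz_form_def l_def by (rule gram_form) simp
  finally have Q: "integral\<^sup>L lborel (\<lambda>x. (cmod (V x))\<^sup>2) = riesz_form n N b" by (simp only: of_real_eq_iff)
  have "(\<Sum>i<N. wt F (l i) * cnj (b i)) = (\<Sum>i<N. cnj (b i) * ip (wt F) (kap n (l i)))"
    by (intro sum.cong refl) (simp add: wt_reproducing[OF n F, symmetric])
  also have "\<dots> = ip (wt F) V"
    unfolding V_def using polyfock_wt_l2f[OF F] by (intro ip_sum_right[symmetric] finite_lessThan l2k) simp
  finally have "(\<Sum>i<N. wt F (l i) * cnj (b i)) = ip (wt F) V" .
  then show ?thesis
    using ip_Cauchy_Schwarz[OF conjunct1[OF polyfock_wt_l2f[OF F]] V2] by (simp add: Q l_def)
qed

text \<open>If the bound fails for every constant, there are finite unit vectors with arbitrarily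
  small Riesz form. The gliding hump supplies square summable data whose pairings with them decay
  too slowly for any interpolating function of finite norm.\<close>

theorem interpolation_imp_riesz:
  fixes n :: "nat ^ 'd"
  assumes n: "\<forall>j. n $ j \<ge> 1"
    and interp: "\<And>\<alpha>. l2_seq \<alpha> \<Longrightarrow> \<exists>F\<in>polyfock n. \<forall>i. wt F (B (e i)) = \<alpha> i"
  shows "\<exists>c>0. \<forall>N b. c * (\<Sum>i<N. (cmod (b i))\<^sup>2) \<le> riesz_form n N b"
proof (rule ccontr)
  assume neg0: "\<not> ?thesis"
  have neg: "\<exists>N b. riesz_form n N b < c * (\<Sum>i<N. (cmod (b i))\<^sup>2)" if c: "c > 0" for c
  proof (rule ccontr)
    assume "\<not> ?thesis"
    then have "\<forall>N b. c * (\<Sum>i<N. (cmod (b i))\<^sup>2) \<le> riesz_form n N b" by (simp only: not_ex not_less simp_thms)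
    with c neg0 show False by blast
  qed
  \<comment> \<open>The rate 1/256 beats the squared pairings, which are at least (1/4) (1/16)^j, by
    the factor 16^j; this forces the norm of the interpolating function to be infinite.\<close>
  define Q where "Q j N b \<longleftrightarrow> (\<forall>i\<ge>N. b i = 0) \<and> (\<Sum>i<N. (cmod (b i))\<^sup>2) = 1 \<and> riesz_form n N b \<le> (1/256) ^ j" for j N :: nat and b
  have ex: "\<exists>N b. Q j N b" for j
  proof -
    obtain N b where b: "riesz_form n N b < (1/256) ^ j * (\<Sum>i<N. (cmod (b i))\<^sup>2)"
      using neg[of "(1/256) ^ j"] by auto
    define s where "s = (\<Sum>i<N. (cmod (b i))\<^sup>2)"
    have s: "s > 0"
    proof (rule ccontr)
      assume "\<not> s > 0"
      moreover have "s \<ge> 0" unfolding s_def by (intro sum_nonneg) simp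
      ultimately have "s = 0" by simp
      with b riesz_form_nonneg[of n N b] show False by (simp add: s_def[symmetric])
    qed
    \<comment> \<open>The vector is normalised and set to zero from \<open>N\<close> on, as the
      gliding hump requires.\<close>
    define b' where "b' i = (if i < N then b i / of_real (sqrt s) else 0)" for i
    have "(\<Sum>i<N. (cmod (b' i))\<^sup>2) = (\<Sum>i<N. (cmod (b i))\<^sup>2 / s)"
      using s by (intro sum.cong refl) (auto simp: b'_def norm_divide power_divide)
    also have "\<dots> = 1" using s by (simp add: s_def sum_divide_distrib[symmetric])
    finally have one: "(\<Sum>i<N. (cmod (b' i))\<^sup>2) = 1" .
    have "(\<Sum>i<N. b' i * tau (B (e i)) (gk k) y) = (\<Sum>i<N. b i * tau (B (e i)) (gk k) y) / of_real (sqrt s)" for k y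
      unfolding sum_divide_distrib by (intro sum.cong refl) (simp add: b'_def)
    then have "(cmod (\<Sum>i<N. b' i * tau (B (e i)) (gk k) y))\<^sup>2 = (cmod (\<Sum>i<N. b i * tau (B (e i)) (gk k) y))\<^sup>2 / s" for k y
      using s by (simp only: norm_divide power_divide norm_of_real) simp
    then have "riesz_form n N b' = riesz_form n N b / s"
      unfolding riesz_form_def sum_divide_distrib by simp
    also have "\<dots> \<le> (1/256) ^ j" using b s by (simp add: s_def[symmetric] divide_le_eq)
    finally show ?thesis using one by (intro exI[of _ N] exI[of _ b']) (simp add: Q_def b'_def)
  qed
  obtain N where N: "\<forall>j. \<exists>b. Q j (N j) b" using choice[of "\<lambda>j N. \<exists>b. Q j N b"] ex by blast
  obtain b where "\<forall>j. Q j (N j) (b j)" using choice[OF N] by blast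
  then have b: "\<And>j i. i \<ge> N j \<Longrightarrow> b j i = 0" "\<And>j. (\<Sum>i<N j. (cmod (b j i))\<^sup>2) = 1"
    "\<And>j. riesz_form n (N j) (b j) \<le> (1/256) ^ j" unfolding Q_def by blast+
  obtain \<alpha> where \<alpha>: "l2_seq \<alpha>" "\<And>j. (1/2) * (1/4) ^ j \<le> cmod (\<Sum>i<N j. \<alpha> i * cnj (b j i))"
    by (rule gliding_hump[of N b]) (rule b, assumption, rule b, rule that)
  obtain F where F: "F \<in> polyfock n" "\<And>i. wt F (B (e i)) = \<alpha> i" using interp[OF \<alpha>(1)] by blast
  define U where "U = integral\<^sup>L lborel (\<lambda>x. (cmod (wt F x))\<^sup>2)"
  have U: "U \<ge> 0" unfolding U_def by (intro integral_nonneg_AE) auto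
  have "16 ^ j \<le> 4 * U" for j :: nat
  proof -
    have "((1/2) * (1/4) ^ j)\<^sup>2 \<le> (cmod (\<Sum>i<N j. \<alpha> i * cnj (b j i)))\<^sup>2"
      using \<alpha>(2)[of j] by (intro power_mono) auto
    also have "\<dots> \<le> U * riesz_form n (N j) (b j)"
      using polyfock_pairing[OF n F(1), where N = "N j" and b = "b j"] by (simp add: F(2) U_def)
    also have "\<dots> \<le> U * (1/256) ^ j" by (intro mult_left_mono b(3) U)
    finally have le: "((1/2) * (1/4) ^ j)\<^sup>2 \<le> U * (1/256) ^ j" .
    have "((1/2) * (1/4) ^ j)\<^sup>2 = (1/4) * (1/16 :: real) ^ j"
      by (simp add: power_mult_distrib power2_eq_square power_mult_distrib[symmetric])
    moreover have "(1/16 :: real) ^ j = 16 ^ j * (1/256) ^ j"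
      by (simp add: power_mult_distrib[symmetric])
    ultimately have "(1/4 * 16 ^ j) * (1/256) ^ j \<le> U * (1/256 :: real) ^ j" using le by (simp only: mult.assoc)
    then have "1/4 * 16 ^ j \<le> U" by (rule mult_right_le_imp_le) simp
    then show ?thesis by linarith
  qed
  moreover obtain j where "4 * U < 16 ^ j" using real_arch_pow[of 16 "4 * U"] by auto
  ultimately show False by (meson not_le)
qed

section \<open>From the Riesz bound to sampling on the dual lattice\<close>

lemma riesz_l2:
  assumes riesz: "\<And>N b. c * (\<Sum>i<N. (cmod (b i))\<^sup>2) \<le> riesz_form n N b" and a: "l2_seq a"
  shows "c * (\<Sum>i. (cmod (a i))\<^sup>2) \<le> (\<Sum>k\<in>Kset n. integral\<^sup>L lborel (\<lambda>y. (cmod (\<Sum>i. a i * tau (B (e i)) (gk k) y))\<^sup>2))"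
proof (rule LIMSEQ_le)
  show "(\<lambda>N. c * (\<Sum>i<N. (cmod (a i))\<^sup>2)) \<longlonglongrightarrow> c * (\<Sum>i. (cmod (a i))\<^sup>2)"
    by (intro tendsto_intros summable_LIMSEQ a)
  show "(\<lambda>N. riesz_form n N a) \<longlonglongrightarrow> (\<Sum>k\<in>Kset n. integral\<^sup>L lborel (\<lambda>y. (cmod (\<Sum>i. a i * tau (B (e i)) (gk k) y))\<^sup>2))"
    unfolding riesz_form_def by (intro tendsto_sum L.synthesis(3) gb_gk a)
  show "\<exists>N. \<forall>m\<ge>N. c * (\<Sum>i<m. (cmod (a i))\<^sup>2) \<le> riesz_form n m a"
    using riesz by blast
qed

text \<open>The Riesz bound is applied to the coefficients \<open>cnj (tau (l i) f z)\<close>; after the substitution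
  \<open>w = z + u\<close> their synthesis becomes, up to a phase, the periodization in \<open>z\<close> of the function below.\<close>

definition pfun :: "(complex ^ 'd \<Rightarrow> complex) \<Rightarrow> nat ^ 'd \<Rightarrow> complex ^ 'd \<Rightarrow> complex ^ 'd \<Rightarrow> complex" where
  "pfun f k u y = cnj (f y) * cis (- pi * sy y u) * gk k (y + u)"

text \<open>Members of the weighted Fock space are bounded by their norm, and the translated window
  contributes the Gaussian decay.\<close>

lemma gb_pfun:
  assumes f: "f \<in> FW"
  shows "gb (pfun f k u)"
proof -
  obtain C c where C: "C \<ge> 0" "c > 0" "\<And>x. cmod (tau (- u) (gk k) x) \<le> C * exp (- c * (norm x)\<^sup>2)"
    using gb_tau[OF gb_gk[of k], of "- u"] by (auto simp: gb_def)
  define D where "D = sqrt (integral\<^sup>L lborel (\<lambda>x. (cmod (f x))\<^sup>2))"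
  have D: "cmod (f y) \<le> D" for y
    using real_le_rsqrt[OF FW_bounded[OF f, of y]] by (simp add: D_def)
  have D0: "D \<ge> 0" using D[of 0] norm_ge_zero order_trans by blast
  show ?thesis
  proof (rule gbI)
    have "continuous_on UNIV (\<lambda>y. gk k (y + u))"
      by (rule continuous_on_compose2[OF FW_continuous[OF FW_gk]]) (auto intro: continuous_intros)
    then show "continuous_on UNIV (pfun f k u)"
      unfolding pfun_def[abs_def] using FW_continuous[OF f] by (intro continuous_intros)
    show "cmod (pfun f k u y) \<le> (D * C) * exp (- c * (norm y)\<^sup>2)" for y
    proof -
      have "cmod (pfun f k u y) = cmod (f y) * cmod (tau (- u) (gk k) y)"
        by (simp add: pfun_def norm_mult norm_tau)
      also have "\<dots> \<le> D * (C * exp (- c * (norm y)\<^sup>2))" by (intro mult_mono D C D0) simp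
      finally show ?thesis by (simp add: mult.assoc)
    qed
  qed (use C D0 in auto)
qed

text \<open>Unfolding turns the coefficient into an integral over the whole space, the conjugate of
  a modulated pairing of \<open>f\<close> with the window translated by -u. The modulation
  compresses to a translation by -(B0 m + u), moved to the window with opposite sign: the shifts by
  \<open>u\<close> cancel, leaving the sample at \<open>B0 m\<close>, and \<open>u\<close> survives
  only in the Gaussian factor.\<close>

lemma pfun_coefficient:
  assumes f: "f \<in> FW" and m: "m \<in> int_points"
  shows "(cmod (integral\<^sup>L lborel (\<lambda>z. indicator L.cell z *\<^sub>R ((\<Sum>n. pfun f k u (z - B (e n))) * L.character m z))))\<^sup>2
    = exp (- pi * (norm (u + B0 m))\<^sup>2) * (cmod (ip f (tau (B0 m) (gk k))))\<^sup>2"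
proof -
  note p = gb_pfun[OF f, of k u]
  have pm: "pfun f k u \<in> borel_measurable borel" by (rule gb_measurable[OF p])
  define q where "q y = pfun f k u y * L.character m y" for y
  have qi: "integrable lborel q"
  proof (rule Bochner_Integration.integrable_bound[OF gb_integrable[OF p]])
    show "q \<in> borel_measurable lborel" unfolding q_def[abs_def] using pm by measurable
  qed (auto simp: q_def norm_mult L.character_simps)
  have "integral\<^sup>L lborel q = integral\<^sup>L lborel (\<lambda>z. indicator L.cell z *\<^sub>R (\<Sum>n. q (z - B (e n))))"
    by (rule L.integral_tiling[OF qi])
  also have "(\<lambda>z. \<Sum>n. q (z - B (e n))) = (\<lambda>z. (\<Sum>n. pfun f k u (z - B (e n))) * L.character m z)"
  proof
    fix z
    obtain M where M: "\<And>x. summable (\<lambda>n. cmod (pfun f k u (x - B (e n))))" using L.gb_sum_bounded[OF p] by metis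
    have "(\<lambda>n. q (z - B (e n))) = (\<lambda>n. pfun f k u (z - B (e n)) * L.character m z)"
      unfolding q_def by (simp only: L.periodic_l[OF L.periodic_character[OF m]])
    then show "(\<Sum>n. q (z - B (e n))) = (\<Sum>n. pfun f k u (z - B (e n))) * L.character m z"
      using suminf_mult2[OF summable_norm_cancel[OF M[of z]]] by simp
  qed
  finally have "integral\<^sup>L lborel (\<lambda>z. indicator L.cell z *\<^sub>R ((\<Sum>n. pfun f k u (z - B (e n))) * L.character m z)) = integral\<^sup>L lborel q" ..
  also have "\<dots> = cnj (ip (\<lambda>y. f y * cis (2 * pi * sy (- (B0 m + u)) y)) (tau (- u) (gk k)))"
  proof -
    have "q y = cnj ((f y * cis (2 * pi * sy (- (B0 m + u)) y)) * cnj (tau (- u) (gk k) y))" for y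
    proof -
      have "- pi * sy y u + 2 * pi * sy (B0 m) y = - (2 * pi * sy (- (B0 m + u)) y) + pi * sy (- u) y"
        by (simp add: sy_minus_left sy_add_left sy_diff_left sy_commute[of y u] algebra_simps)
      then have "cis (- pi * sy y u) * cis (2 * pi * sy (B0 m) y) = cis (- (2 * pi * sy (- (B0 m + u)) y)) * cis (pi * sy (- u) y)"
        by (simp only: cis_mult)
      then have "cnj (f y) * gk k (y + u) * (cis (- pi * sy y u) * cis (2 * pi * sy (B0 m) y))
          = cnj (f y) * gk k (y + u) * (cis (- (2 * pi * sy (- (B0 m + u)) y)) * cis (pi * sy (- u) y))"
        by (simp only:)
      then show ?thesis
        unfolding q_def pfun_def character_L tau_def complex_cnj_mult complex_cnj_cnj cis_cnj
        by (simp only: diff_minus_eq_add minus_minus mult_ac)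
    qed
    then show ?thesis unfolding ip_def Bochner_Integration.integral_cnj[symmetric] by (intro Bochner_Integration.integral_cong refl)
  qed
  also have "ip (\<lambda>y. f y * cis (2 * pi * sy (- (B0 m + u)) y)) (tau (- u) (gk k))
      = of_real (exp (- pi / 2 * (norm (- (B0 m + u)))\<^sup>2)) * ip f (tau (- (- (B0 m + u))) (tau (- u) (gk k)))"
    by (rule ip_modulated[OF f FW_tau[OF FW_gk] gb_tau[OF gb_gk]])
  also have "tau (- (- (B0 m + u))) (tau (- u) (gk k)) = (\<lambda>x. cis (pi * sy (B0 m + u) (- u)) * tau (B0 m) (gk k) x)"
    by (rule ext) (simp add: tau_tau add.commute)
  finally have "cmod (integral\<^sup>L lborel (\<lambda>z. indicator L.cell z *\<^sub>R ((\<Sum>n. pfun f k u (z - B (e n))) * L.character m z)))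
      = exp (- pi / 2 * (norm (u + B0 m))\<^sup>2) * cmod (ip f (tau (B0 m) (gk k)))"
  proof -
    have "norm (- (B0 m + u)) = norm (u + B0 m)" by (simp only: norm_minus_cancel add.commute)
    then show "cmod (integral\<^sup>L lborel (\<lambda>z. indicator L.cell z *\<^sub>R ((\<Sum>n. pfun f k u (z - B (e n))) * L.character m z)))
      = exp (- pi / 2 * (norm (u + B0 m))\<^sup>2) * cmod (ip f (tau (B0 m) (gk k)))"
      if "integral\<^sup>L lborel (\<lambda>z. indicator L.cell z *\<^sub>R ((\<Sum>n. pfun f k u (z - B (e n))) * L.character m z))
        = cnj (of_real (exp (- pi / 2 * (norm (- (B0 m + u)))\<^sup>2)) * ip f (\<lambda>x. cis (pi * sy (B0 m + u) (- u)) * tau (B0 m) (gk k) x))"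
      unfolding that ip_cmult_right by (simp add: norm_mult)
  qed
  then show ?thesis
    by (simp only: power_mult_distrib) (simp add: power2_eq_square[of "exp _"] exp_add[symmetric])
qed

theorem riesz_imp_sampling:
  fixes n :: "nat ^ 'd"
  assumes c: "c > 0" and riesz: "\<And>N b. c * (\<Sum>i<N. (cmod (b i))\<^sup>2) \<le> riesz_form n N b" and f: "f \<in> FW"
  shows "ennreal (c * L.covol * integral\<^sup>L lborel (\<lambda>x. (cmod (f x))\<^sup>2))
    \<le> (\<Sum>i. ennreal (\<Sum>k\<in>Kset n. (cmod (ip f (tau (B0 (e i)) (gk k))))\<^sup>2))"
proof -
  define l where "l i = B (e i)" for i
  define P where "P k u z = (\<Sum>i. pfun f k u (z - l i))" for k u z
  have [measurable]: "f \<in> borel_measurable borel" "gk k \<in> borel_measurable borel" for k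
    using l2f_measurable[OF FW_l2f[OF f]] gb_measurable[OF gb_gk[of k]] by auto
  have Pm [measurable]: "(\<lambda>(z, u). P k u z) \<in> borel_measurable (borel \<Otimes>\<^sub>M borel)" for k
    unfolding P_def pfun_def by measurable
  have Pm1 [measurable]: "(\<lambda>z. P k u z) \<in> borel_measurable borel" for k u
    unfolding P_def pfun_def by measurable
  have ps: "summable (\<lambda>i. pfun f k u (z - l i))" for k u z
    using L.gb_sum_bounded[OF gb_pfun[OF f, of k u]] unfolding l_def by (metis summable_norm_cancel)
  have fin: "(\<integral>\<^sup>+z. (\<Sum>i. ennreal ((cmod (f (z - l i)))\<^sup>2)) * indicator L.cell z \<partial>lborel) = (\<integral>\<^sup>+z. ennreal ((cmod (f z))\<^sup>2) \<partial>lborel)"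
    unfolding l_def by (rule L.nn_integral_tiling[symmetric, of "\<lambda>z. ennreal ((cmod (f z))\<^sup>2)"]) measurable
  have fI: "(\<integral>\<^sup>+z. ennreal ((cmod (f z))\<^sup>2) \<partial>lborel) = ennreal (integral\<^sup>L lborel (\<lambda>x. (cmod (f x))\<^sup>2))"
    using FW_l2f[OF f] by (intro nn_integral_eq_integral) (auto simp: l2f_def)
  \<comment> \<open>The values of \<open>f\<close> on the translates of a point form an l2 sequence
    only for almost every point; this suffices, as the Riesz bound is used under an
    integral.\<close>
  have AEfin: "AE z in lborel. (\<Sum>i. ennreal ((cmod (f (z - l i)))\<^sup>2)) * indicator L.cell z \<noteq> \<infinity>"
    by (rule nn_integral_PInf_AE) (use fin fI in auto)
  have syn: "(\<Sum>i. cnj (tau (l i) f z) * tau (l i) (gk k) (u + z)) = cis (pi * sy z u) * P k u z" for k u z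
  proof -
    have "cnj (tau (l i) f z) * tau (l i) (gk k) (u + z) = cis (pi * sy z u) * pfun f k u (z - l i)" for i
    proof -
      have "- (pi * sy (l i) z) + pi * sy (l i) (u + z) = pi * sy z u + - pi * sy (z - l i) u"
        by (simp add: sy_add_right sy_diff_left algebra_simps)
      then have ph: "cis (- (pi * sy (l i) z)) * cis (pi * sy (l i) (u + z)) = cis (pi * sy z u) * cis (- pi * sy (z - l i) u)"
        by (simp only: cis_mult)
      have "u + z - l i = z - l i + u" by simp
      then have "cnj (tau (l i) f z) * tau (l i) (gk k) (u + z)
          = (cis (- (pi * sy (l i) z)) * cis (pi * sy (l i) (u + z))) * (cnj (f (z - l i)) * gk k (z - l i + u))"
        unfolding tau_def complex_cnj_mult cis_cnj by (simp only: mult_ac)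
      then show ?thesis unfolding ph pfun_def by (simp only: mult_ac)
    qed
    then show ?thesis unfolding P_def by (simp only: suminf_mult[OF ps])
  qed
  have pt: "ennreal c * ((\<Sum>i. ennreal ((cmod (f (z - l i)))\<^sup>2)) * indicator L.cell z)
      \<le> (\<Sum>k\<in>Kset n. \<integral>\<^sup>+u. ennreal ((cmod (P k u z))\<^sup>2) * indicator L.cell z \<partial>lborel)"
    if z: "(\<Sum>i. ennreal ((cmod (f (z - l i)))\<^sup>2)) * indicator L.cell z \<noteq> \<infinity>" for z
  proof (cases "z \<in> L.cell")
    case True
    then have s: "summable (\<lambda>i. (cmod (f (z - l i)))\<^sup>2)"
      using z by (intro summable_suminf_not_top) auto
    define a where "a i = cnj (tau (l i) f z)" for i
    have na: "cmod (a i) = cmod (f (z - l i))" for i by (simp add: a_def norm_tau)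
    have a2: "l2_seq a" unfolding na by (rule s)
    have Sk: "l2f (\<lambda>y. \<Sum>i. a i * tau (l i) (gk k) y)" for k
      unfolding l_def by (rule L.synthesis(1)[OF gb_gk a2])
    have [measurable]: "(\<lambda>y. \<Sum>i. a i * tau (l i) (gk k) y) \<in> borel_measurable borel" for k
      by (rule l2f_measurable[OF Sk])
    have "ennreal c * (\<Sum>i. ennreal ((cmod (f (z - l i)))\<^sup>2)) = ennreal (c * (\<Sum>i. (cmod (a i))\<^sup>2))"
    proof -
      have "(\<Sum>i. ennreal ((cmod (f (z - l i)))\<^sup>2)) = ennreal (\<Sum>i. (cmod (f (z - l i)))\<^sup>2)"
        by (rule suminf_ennreal2[OF _ s]) simp
      then show ?thesis using c suminf_nonneg[OF s] by (simp add: na ennreal_mult)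
    qed
    also have "\<dots> \<le> ennreal (\<Sum>k\<in>Kset n. integral\<^sup>L lborel (\<lambda>y. (cmod (\<Sum>i. a i * tau (l i) (gk k) y))\<^sup>2))"
      unfolding l_def by (intro ennreal_leI riesz_l2[OF riesz a2])
    also have "\<dots> = (\<Sum>k\<in>Kset n. ennreal (integral\<^sup>L lborel (\<lambda>y. (cmod (\<Sum>i. a i * tau (l i) (gk k) y))\<^sup>2)))"
      by (rule sum_ennreal[symmetric]) (intro integral_nonneg_AE, auto)
    also have "\<dots> = (\<Sum>k\<in>Kset n. \<integral>\<^sup>+u. ennreal ((cmod (P k u z))\<^sup>2) \<partial>lborel)"
    proof (intro sum.cong refl)
      fix k
      have "ennreal (integral\<^sup>L lborel (\<lambda>y. (cmod (\<Sum>i. a i * tau (l i) (gk k) y))\<^sup>2))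
          = (\<integral>\<^sup>+y. ennreal ((cmod (\<Sum>i. a i * tau (l i) (gk k) y))\<^sup>2) \<partial>lborel)"
        using Sk[of k] by (intro nn_integral_eq_integral[symmetric]) (auto simp: l2f_def)
      also have "\<dots> = (\<integral>\<^sup>+u. ennreal ((cmod (\<Sum>i. a i * tau (l i) (gk k) (u + z)))\<^sup>2) \<partial>lborel)"
        by (rule nn_integral_lborel_translate[symmetric, of "\<lambda>y. ennreal ((cmod (\<Sum>i. a i * tau (l i) (gk k) y))\<^sup>2)"]) measurable
      also have "\<dots> = (\<integral>\<^sup>+u. ennreal ((cmod (P k u z))\<^sup>2) \<partial>lborel)"
        unfolding a_def syn norm_mult norm_cis by simp
      finally show "ennreal (integral\<^sup>L lborel (\<lambda>y. (cmod (\<Sum>i. a i * tau (l i) (gk k) y))\<^sup>2)) = (\<integral>\<^sup>+u. ennreal ((cmod (P k u z))\<^sup>2) \<partial>lborel)" .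
    qed
    finally show ?thesis using True by simp
  qed simp
  \<comment> \<open>For each fixed shift \<open>u\<close>, Parseval for the periodization in
    \<open>z\<close> gives the samples on the dual lattice weighted by a Gaussian centred according
    to \<open>u\<close>.\<close>
  have coef: "ennreal L.covol * (\<integral>\<^sup>+z. ennreal ((cmod (P k u z))\<^sup>2) * indicator L.cell z \<partial>lborel)
      \<le> (\<Sum>i. ennreal (exp (- pi * (norm (u + B0 (e i)))\<^sup>2)) * ennreal ((cmod (ip f (tau (B0 (e i)) (gk k))))\<^sup>2))" for k u
  proof -
    have Pc: "continuous_on UNIV (P k u)" "L.periodic (P k u)"
      unfolding P_def l_def by (rule L.periodization[OF gb_pfun[OF f]])+
    have nonneg: "0 \<le> integral\<^sup>L lborel (\<lambda>z. indicator L.cell z *\<^sub>R (cmod (P k u z))\<^sup>2)"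
      by (intro integral_nonneg_AE) auto
    obtain C where C: "C > 0" "\<And>z. cmod (P k u z) \<le> C" using L.periodic_bounded[OF Pc] by blast
    have "integrable lborel (\<lambda>z. indicator L.cell z *\<^sub>R (cmod (P k u z))\<^sup>2)"
    proof (rule Bochner_Integration.integrable_bound)
      show "integrable lborel (\<lambda>z. indicator L.cell z *\<^sub>R C\<^sup>2)" using L.emeasure_cell_finite by simp
      show "AE z in lborel. norm (indicator L.cell z *\<^sub>R (cmod (P k u z))\<^sup>2) \<le> norm (indicator L.cell z *\<^sub>R C\<^sup>2)"
        using C by (auto simp: indicator_def intro!: power_mono)
    qed measurable
    then have "(\<integral>\<^sup>+z. ennreal (indicator L.cell z *\<^sub>R (cmod (P k u z))\<^sup>2) \<partial>lborel) = ennreal (integral\<^sup>L lborel (\<lambda>z. indicator L.cell z *\<^sub>R (cmod (P k u z))\<^sup>2))"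
      by (intro nn_integral_eq_integral) auto
    moreover have "(\<integral>\<^sup>+z. ennreal (indicator L.cell z *\<^sub>R (cmod (P k u z))\<^sup>2) \<partial>lborel) = (\<integral>\<^sup>+z. ennreal ((cmod (P k u z))\<^sup>2) * indicator L.cell z \<partial>lborel)"
      by (intro nn_integral_cong) (auto simp: indicator_def)
    ultimately have "ennreal L.covol * (\<integral>\<^sup>+z. ennreal ((cmod (P k u z))\<^sup>2) * indicator L.cell z \<partial>lborel)
        = ennreal (L.covol * integral\<^sup>L lborel (\<lambda>z. indicator L.cell z *\<^sub>R (cmod (P k u z))\<^sup>2))"
      using L.covol_pos nonneg by (simp only: ennreal_mult less_imp_le)
    also have "\<dots> \<le> (\<Sum>i. ennreal ((cmod (integral\<^sup>L lborel (\<lambda>z. indicator L.cell z *\<^sub>R (P k u z * L.character (e i) z))))\<^sup>2))"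
      by (rule L.parseval_le[OF Pc e])
    also have "\<dots> = (\<Sum>i. ennreal (exp (- pi * (norm (u + B0 (e i)))\<^sup>2)) * ennreal ((cmod (ip f (tau (B0 (e i)) (gk k))))\<^sup>2))"
      unfolding P_def l_def pfun_coefficient[OF f e_int] by (simp add: ennreal_mult)
    finally show ?thesis .
  qed
  \<comment> \<open>This normalisation removes the Gaussian weights once the estimate is integrated
    over all shifts, so every sample counts with weight one.\<close>
  have gauss1: "(\<integral>\<^sup>+u. ennreal (exp (- pi * (norm (u + w))\<^sup>2)) \<partial>lborel) = 1" for w :: "complex ^ 'd"
  proof -
    have "(\<integral>\<^sup>+u. ennreal (exp (- pi * (norm (u + w))\<^sup>2)) \<partial>lborel) = (\<integral>\<^sup>+(u :: complex ^ 'd). ennreal (exp (- pi * (norm u)\<^sup>2)) \<partial>lborel)"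
      by (rule nn_integral_lborel_translate[of "\<lambda>u. ennreal (exp (- pi * (norm u)\<^sup>2))"]) measurable
    also have "\<dots> = 1" by (subst nn_integral_gauss) auto
    finally show ?thesis .
  qed
  have "ennreal c * ennreal (integral\<^sup>L lborel (\<lambda>x. (cmod (f x))\<^sup>2))
      = (\<integral>\<^sup>+z. ennreal c * ((\<Sum>i. ennreal ((cmod (f (z - l i)))\<^sup>2)) * indicator L.cell z) \<partial>lborel)"
    by (subst nn_integral_cmult) (auto simp: fin fI)
  also have "\<dots> \<le> (\<integral>\<^sup>+z. (\<Sum>k\<in>Kset n. \<integral>\<^sup>+u. ennreal ((cmod (P k u z))\<^sup>2) * indicator L.cell z \<partial>lborel) \<partial>lborel)"
    by (rule nn_integral_mono_AE) (use AEfin in eventually_elim, rule pt)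
  also have "\<dots> = (\<Sum>k\<in>Kset n. \<integral>\<^sup>+z. \<integral>\<^sup>+u. ennreal ((cmod (P k u z))\<^sup>2) * indicator L.cell z \<partial>lborel \<partial>lborel)"
    by (rule nn_integral_sum) measurable
  also have "\<dots> = (\<Sum>k\<in>Kset n. \<integral>\<^sup>+u. \<integral>\<^sup>+z. ennreal ((cmod (P k u z))\<^sup>2) * indicator L.cell z \<partial>lborel \<partial>lborel)"
    by (intro sum.cong refl lborel_pair.Fubini'[symmetric]) measurable
  finally have "ennreal L.covol * (ennreal c * ennreal (integral\<^sup>L lborel (\<lambda>x. (cmod (f x))\<^sup>2)))
      \<le> ennreal L.covol * (\<Sum>k\<in>Kset n. \<integral>\<^sup>+u. \<integral>\<^sup>+z. ennreal ((cmod (P k u z))\<^sup>2) * indicator L.cell z \<partial>lborel \<partial>lborel)"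
    by (rule mult_left_mono) simp
  also have "\<dots> = (\<Sum>k\<in>Kset n. \<integral>\<^sup>+u. ennreal L.covol * (\<integral>\<^sup>+z. ennreal ((cmod (P k u z))\<^sup>2) * indicator L.cell z \<partial>lborel) \<partial>lborel)"
    unfolding sum_distrib_left by (intro sum.cong refl nn_integral_cmult[symmetric]) measurable
  also have "\<dots> \<le> (\<Sum>k\<in>Kset n. \<integral>\<^sup>+u. (\<Sum>i. ennreal (exp (- pi * (norm (u + B0 (e i)))\<^sup>2)) * ennreal ((cmod (ip f (tau (B0 (e i)) (gk k))))\<^sup>2)) \<partial>lborel)"
    by (intro sum_mono nn_integral_mono coef)
  also have "\<dots> = (\<Sum>k\<in>Kset n. \<Sum>i. ennreal ((cmod (ip f (tau (B0 (e i)) (gk k))))\<^sup>2))"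
  proof (intro sum.cong refl)
    fix k
    have "(\<integral>\<^sup>+u. (\<Sum>i. ennreal (exp (- pi * (norm (u + B0 (e i)))\<^sup>2)) * ennreal ((cmod (ip f (tau (B0 (e i)) (gk k))))\<^sup>2)) \<partial>lborel)
        = (\<Sum>i. \<integral>\<^sup>+u. ennreal (exp (- pi * (norm (u + B0 (e i)))\<^sup>2)) * ennreal ((cmod (ip f (tau (B0 (e i)) (gk k))))\<^sup>2) \<partial>lborel)"
      by (rule nn_integral_suminf) measurable
    also have "\<dots> = (\<Sum>i. (\<integral>\<^sup>+u. ennreal (exp (- pi * (norm (u + B0 (e i)))\<^sup>2)) \<partial>lborel) * ennreal ((cmod (ip f (tau (B0 (e i)) (gk k))))\<^sup>2))"
      by (intro suminf_cong nn_integral_multc) measurable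
    finally show "(\<integral>\<^sup>+u. (\<Sum>i. ennreal (exp (- pi * (norm (u + B0 (e i)))\<^sup>2)) * ennreal ((cmod (ip f (tau (B0 (e i)) (gk k))))\<^sup>2)) \<partial>lborel)
        = (\<Sum>i. ennreal ((cmod (ip f (tau (B0 (e i)) (gk k))))\<^sup>2))" by (simp only: gauss1 mult_1)
  qed
  also have "\<dots> = (\<Sum>i. \<Sum>k\<in>Kset n. ennreal ((cmod (ip f (tau (B0 (e i)) (gk k))))\<^sup>2))"
    by (rule suminf_sum[symmetric]) simp
  also have "\<dots> = (\<Sum>i. ennreal (\<Sum>k\<in>Kset n. (cmod (ip f (tau (B0 (e i)) (gk k))))\<^sup>2))"
    by (intro suminf_cong sum_ennreal) simp
  finally show ?thesis
    using c L.covol_pos integral_nonneg_AE[of "\<lambda>x. (cmod (f x))\<^sup>2" lborel]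
    by (simp add: ennreal_mult mult_ac)
qed

end

section \<open>Time-frequency lattices\<close>

lemma infsum_nonneg_reindex_nat:
  fixes f :: "'a \<Rightarrow> real"
  assumes h: "bij_betw h (UNIV :: nat set) X" and f: "\<And>x. f x \<ge> 0"
  shows "f summable_on X \<longleftrightarrow> summable (\<lambda>i. f (h i))"
    and "summable (\<lambda>i. f (h i)) \<Longrightarrow> infsum f X = (\<Sum>i. f (h i))"
proof -
  show "f summable_on X \<longleftrightarrow> summable (\<lambda>i. f (h i))"
    using summable_on_reindex_bij_betw[OF h, of f] summable_on_UNIV_nonneg_real_iff[of "\<lambda>i. f (h i)"] f by simp
  assume "summable (\<lambda>i. f (h i))"
  then have "((\<lambda>i. f (h i)) has_sum (\<Sum>i. f (h i))) UNIV"
    using f by (intro sums_nonneg_imp_has_sum summable_sums)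
  then show "infsum f X = (\<Sum>i. f (h i))"
    using infsum_reindex_bij_betw[OF h, of f] by (simp add: infsumI)
qed

context weyl_dual
begin

text \<open>The upper estimate comes from the Bessel inequality for each of finitely many windows,
  so the property reduces to its lower estimate. In extended reals that estimate carries no separate
  summability claim.\<close>

lemma multiple_sampling_iff:
  fixes n :: "nat ^ 'd"
  shows "multiple_sampling n (B0 ` int_points) \<longleftrightarrow>
    (\<exists>A>0. \<forall>f\<in>FW. ennreal (A * integral\<^sup>L lborel (\<lambda>x. (cmod (f x))\<^sup>2))
      \<le> (\<Sum>i. ennreal (\<Sum>k\<in>Kset n. (cmod (ip f (tau (B0 (e i)) (gk k))))\<^sup>2)))"
    (is "?L \<longleftrightarrow> (\<exists>A>0. \<forall>f\<in>FW. ennreal (A * ?N f) \<le> (\<Sum>i. ennreal (?s f (B0 (e i)))))")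
proof -
  have h: "bij_betw (\<lambda>i. B0 (e i)) UNIV (B0 ` int_points)" by (rule bij_betw_image[OF B0(2)])
  have s0: "?s f z \<ge> 0" for f z by (intro sum_nonneg) simp
  have inner: "(\<Sum>k\<in>Kset n. (cmod (fock_inner F (beta_op z (ek k))))\<^sup>2) = ?s (wt F) z" for F z
    by (simp add: fock_inner_ip wt_beta)
  define bd where "bd k K \<longleftrightarrow> K > 0 \<and> (\<forall>H. l2f H \<longrightarrow> summable (\<lambda>i. (cmod (ip H (tau (B0 (e i)) (gk k))))\<^sup>2) \<and>
      (\<Sum>i. (cmod (ip H (tau (B0 (e i)) (gk k))))\<^sup>2) \<le> K * ?N H)" for k K
  have "\<exists>K. bd k K" for k
    unfolding bd_def by (rule L0.bessel[OF gb_gk[of k]]) blast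
  then obtain K where "\<And>k. bd k (K k)" by metis
  then have K: "\<And>k. K k > 0"
    "\<And>k H. l2f H \<Longrightarrow> summable (\<lambda>i. (cmod (ip H (tau (B0 (e i)) (gk k))))\<^sup>2)"
    "\<And>k H. l2f H \<Longrightarrow> (\<Sum>i. (cmod (ip H (tau (B0 (e i)) (gk k))))\<^sup>2) \<le> K k * ?N H"
    unfolding bd_def by blast+
  have sm: "summable (\<lambda>i. ?s f (B0 (e i)))" if "f \<in> FW" for f
    by (intro summable_sum K(2) FW_l2f that)
  \<comment> \<open>The summand 1 keeps the constant positive also when \<open>Kset n\<close> is
    empty.\<close>
  have up: "(\<Sum>i. ?s f (B0 (e i))) \<le> (1 + (\<Sum>k\<in>Kset n. K k)) * ?N f" if f: "f \<in> FW" for f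
  proof -
    have "(\<Sum>i. ?s f (B0 (e i))) = (\<Sum>k\<in>Kset n. \<Sum>i. (cmod (ip f (tau (B0 (e i)) (gk k))))\<^sup>2)"
      by (intro suminf_sum K(2) FW_l2f f)
    also have "\<dots> \<le> (\<Sum>k\<in>Kset n. K k * ?N f)" by (intro sum_mono K(3) FW_l2f f)
    also have "\<dots> \<le> (1 + (\<Sum>k\<in>Kset n. K k)) * ?N f"
      using integral_nonneg_AE[of "\<lambda>x. (cmod (f x))\<^sup>2" lborel] by (simp add: sum_distrib_right[symmetric] distrib_right)
    finally show ?thesis .
  qed
  have enn: "(\<Sum>i. ennreal (?s f (B0 (e i)))) = ennreal (\<Sum>i. ?s f (B0 (e i)))" if "f \<in> FW" for f
    by (rule suminf_ennreal2[OF s0 sm[OF that]])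
  have low: "ennreal (A * ?N f) \<le> (\<Sum>i. ennreal (?s f (B0 (e i)))) \<longleftrightarrow> A * ?N f \<le> (\<Sum>i. ?s f (B0 (e i)))"
    if "f \<in> FW" for f A
    unfolding enn[OF that] by (rule ennreal_le_iff) (intro suminf_nonneg sm that s0)
  have samp: "multiple_sampling n (B0 ` int_points) \<longleftrightarrow> (\<exists>A M. A > 0 \<and> M > 0 \<and>
      (\<forall>f\<in>FW. A * ?N f \<le> (\<Sum>i. ?s f (B0 (e i))) \<and> (\<Sum>i. ?s f (B0 (e i))) \<le> M * ?N f))"
  proof -
    have "(?s (wt F)) summable_on (B0 ` int_points) \<and> infsum (?s (wt F)) (B0 ` int_points) = (\<Sum>i. ?s (wt F) (B0 (e i)))"
      if "F \<in> fock_space" for F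
      using sm[of "wt F"] that infsum_nonneg_reindex_nat[OF h, of "?s (wt F)", OF s0] by (simp add: FW_def)
    then show ?thesis
      unfolding multiple_sampling_def inner fock_norm2_wt FW_def ball_simps by auto
  qed
  show ?thesis
  proof
    assume ?L
    then show "\<exists>A>0. \<forall>f\<in>FW. ennreal (A * ?N f) \<le> (\<Sum>i. ennreal (?s f (B0 (e i))))"
      unfolding samp using low by blast
  next
    assume "\<exists>A>0. \<forall>f\<in>FW. ennreal (A * ?N f) \<le> (\<Sum>i. ennreal (?s f (B0 (e i))))"
    then obtain A where "A > 0" "\<And>f. f \<in> FW \<Longrightarrow> A * ?N f \<le> (\<Sum>i. ?s f (B0 (e i)))"
      using low by blast
    moreover have "1 + (\<Sum>k\<in>Kset n. K k) > 0"
      using sum_nonneg[of "Kset n" K] K(1) by (simp add: less_imp_le add_pos_nonneg)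
    ultimately show ?L unfolding samp using up by blast
  qed
qed

lemma interpolating_iff:
  fixes n :: "nat ^ 'd"
  shows "interpolating n (B ` int_points) \<longleftrightarrow>
    (\<forall>\<alpha>. l2_seq \<alpha> \<longrightarrow> (\<exists>F\<in>polyfock n. \<forall>i. wt F (B (e i)) = \<alpha> i))"
proof -
  have h: "bij_betw (\<lambda>i. B (e i)) UNIV (B ` int_points)" by (rule bij_betw_image[OF B(2)])
  have rng: "B ` int_points = range (\<lambda>i. B (e i))" using h by (simp add: bij_betw_def)
  have inj: "inj (\<lambda>i. B (e i))" using h by (simp add: bij_betw_def)
  show ?thesis
  proof (intro iffI allI impI)
    fix \<alpha> assume I: "interpolating n (B ` int_points)" and \<alpha>: "l2_seq \<alpha>"
    define a where "a z = \<alpha> (inv (\<lambda>i. B (e i)) z)" for z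
    have a: "a (B (e i)) = \<alpha> i" for i unfolding a_def using inv_f_f[OF inj, of i] by simp
    have "(\<lambda>z. (cmod (a z))\<^sup>2) summable_on B ` int_points"
      using infsum_nonneg_reindex_nat(1)[OF h, of "\<lambda>z. (cmod (a z))\<^sup>2"] \<alpha> by (simp add: a)
    then obtain F where "F \<in> polyfock n" "\<forall>z\<in>B ` int_points. wt F z = a z"
      using I unfolding interpolating_def wt_def by blast
    then show "\<exists>F\<in>polyfock n. \<forall>i. wt F (B (e i)) = \<alpha> i"
      using e_int by (intro bexI[of _ F]) (simp_all add: a)
  next
    assume *: "\<forall>\<alpha>. l2_seq \<alpha> \<longrightarrow> (\<exists>F\<in>polyfock n. \<forall>i. wt F (B (e i)) = \<alpha> i)"
    show "interpolating n (B ` int_points)"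
      unfolding interpolating_def wt_def[symmetric]
    proof (intro allI impI)
      fix a :: "complex ^ 'd \<Rightarrow> complex" assume "(\<lambda>z. (cmod (a z))\<^sup>2) summable_on B ` int_points"
      then have "l2_seq (\<lambda>i. a (B (e i)))"
        using infsum_nonneg_reindex_nat(1)[OF h, of "\<lambda>z. (cmod (a z))\<^sup>2"] by simp
      then obtain F where "F \<in> polyfock n" "\<forall>i. wt F (B (e i)) = a (B (e i))"
        using *[rule_format, of "\<lambda>i. a (B (e i))"] by auto
      then show "\<exists>F\<in>polyfock n. \<forall>z\<in>B ` int_points. wt F z = a z"
        unfolding rng by blast
    qed
  qed
qed

theorem interpolating_iff_multiple_sampling:
  fixes n :: "nat ^ 'd"
  assumes n: "\<forall>j. n $ j \<ge> 1"
  shows "interpolating n (B ` int_points) \<longleftrightarrow> multiple_sampling n (B0 ` int_points)"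
proof
  assume "interpolating n (B ` int_points)"
  then obtain c where c: "c > 0" "\<forall>N b. c * (\<Sum>i<N. (cmod (b i))\<^sup>2) \<le> riesz_form n N b"
    using interpolation_imp_riesz[OF n] unfolding interpolating_iff by blast
  show "multiple_sampling n (B0 ` int_points)"
    unfolding multiple_sampling_iff
  proof (intro exI[of _ "c * L.covol"] conjI ballI)
    show "c * L.covol > 0" using c L.covol_pos by simp
    show "ennreal (c * L.covol * integral\<^sup>L lborel (\<lambda>x. (cmod (f x))\<^sup>2))
      \<le> (\<Sum>i. ennreal (\<Sum>k\<in>Kset n. (cmod (ip f (tau (B0 (e i)) (gk k))))\<^sup>2))" if "f \<in> FW" for f
      using riesz_imp_sampling[OF c(1) _ that] c(2) by blast
  qed
next
  assume "multiple_sampling n (B0 ` int_points)"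
  then obtain A where A: "A > 0" "\<And>f. f \<in> FW \<Longrightarrow> ennreal (A * integral\<^sup>L lborel (\<lambda>x. (cmod (f x))\<^sup>2))
        \<le> (\<Sum>i. ennreal (\<Sum>k\<in>Kset n. (cmod (ip f (tau (B0 (e i)) (gk k))))\<^sup>2))"
    unfolding multiple_sampling_iff by blast
  have inj: "inj e" using e by (simp add: bij_betw_def)
  have riesz: "A * L0.covol * (\<Sum>i<N. (cmod (b i))\<^sup>2)
      \<le> (\<Sum>k\<in>Kset n. integral\<^sup>L lborel (\<lambda>y. (cmod (\<Sum>i<N. b i * tau (B (e i)) (gk k) y))\<^sup>2))" for N b
  proof -
    \<comment> \<open>Negated points and conjugated coefficients undo the reflection in the
      conclusion of \<open>sampling_imp_riesz\<close>.\<close>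
    define S where "S = (\<lambda>i. - e i) ` {..<N}"
    define a where "a x = cnj (b (inv e (- x)))" for x
    have S: "finite S" "S \<subseteq> int_points" unfolding S_def by (auto intro: int_points_minus e_int)
    have "inj_on (\<lambda>i. - e i) {..<N}" using inj by (auto simp: inj_on_def)
    then have re: "(\<Sum>x\<in>S. u x) = (\<Sum>i<N. u (- e i))" for u :: "'v \<Rightarrow> 'w::comm_monoid_add"
      unfolding S_def by (simp add: sum.reindex)
    have "a (- e i) = cnj (b i)" "- B (- e i) = B (e i)" for i
      using inj by (simp_all add: a_def linear_neg[OF B(1)])
    then show ?thesis
      using sampling_imp_riesz[OF A S, of a] by (simp add: re)
  qed
  show "interpolating n (B ` int_points)"
    unfolding interpolating_iff
  proof (intro allI impI)
    fix \<alpha> assume "l2_seq \<alpha>"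
    then obtain F where "F \<in> polyfock n" "\<And>i. wt F (B (e i)) = \<alpha> i"
      using riesz_imp_interpolation[OF _ riesz, of \<alpha>] A(1) L0.covol_pos by (metis mult_pos_pos)
    then show "\<exists>F\<in>polyfock n. \<forall>i. wt F (B (e i)) = \<alpha> i" by blast
  qed
qed

end

section \<open>Phase space and the adjoint lattice\<close>

lemma int_points_enumeration:
  obtains e :: "nat \<Rightarrow> 'v::euclidean_space" where "bij_betw e UNIV int_points"
proof -
  have "(int_points :: 'v set) \<subseteq> (\<lambda>f. \<Sum>b\<in>Basis. of_int (f b) *\<^sub>R b) ` (Basis \<rightarrow>\<^sub>E (UNIV :: int set))" (is "_ \<subseteq> ?g ` _")
  proof
    fix x :: 'v assume x: "x \<in> int_points"
    define f where "f = (\<lambda>b\<in>Basis. \<lfloor>x \<bullet> b\<rfloor>)"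
    have "of_int (f b) = x \<bullet> b" if "b \<in> Basis" for b
      using x that by (auto simp: int_points_def f_def elim!: Ints_cases)
    then have "x = ?g f" by (simp add: euclidean_representation)
    moreover have "f \<in> Basis \<rightarrow>\<^sub>E UNIV" by (simp add: f_def)
    ultimately show "x \<in> ?g ` (Basis \<rightarrow>\<^sub>E UNIV)" by blast
  qed
  then have count: "countable (int_points :: 'v set)"
    by (rule countable_subset) (intro countable_image countable_PiE, auto)
  obtain b :: 'v where b: "b \<in> Basis" by (meson nonempty_Basis ex_in_conv)
  have "inj (\<lambda>n::nat. real n *\<^sub>R b)" using b by (auto simp: inj_def)
  then have "infinite (range (\<lambda>n::nat. real n *\<^sub>R b))" by (rule range_inj_infinite)
  moreover have "range (\<lambda>n::nat. real n *\<^sub>R b) \<subseteq> int_points" using b by (auto simp: int_points_def inner_Basis)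
  ultimately have "infinite (int_points :: 'v set)" by (meson finite_subset)
  with count show thesis by (intro that[of "from_nat_into int_points"] bij_betw_from_nat_into)
qed

definition toC :: "(real ^ 'd) \<times> (real ^ 'd) \<Rightarrow> complex ^ 'd" where
  "toC = (\<lambda>(x, \<omega>). \<chi> j. Complex (x $ j) (\<omega> $ j))"

lemma toC_nth [simp]: "toC p $ j = Complex (fst p $ j) (snd p $ j)"
  by (simp add: toC_def split: prod.split)

lemma linear_toC: "linear toC"
  by (rule linearI) (simp_all add: vec_eq_iff complex_eq_iff)

lemma bij_toC: "bij toC"
proof (rule bijI')
  show "toC p = toC q \<longleftrightarrow> p = q" for p q :: "(real ^ 'd) \<times> (real ^ 'd)"
    by (auto simp: vec_eq_iff complex_eq_iff prod_eq_iff)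
  show "\<exists>p. z = toC p" for z :: "complex ^ 'd"
    by (rule exI[of _ "(\<chi> j. Re (z $ j), \<chi> j. Im (z $ j))"]) (simp add: vec_eq_iff complex_eq_iff)
qed

lemma sy_toC: "sy (toC p) (toC q) = fst p \<bullet> snd q - snd p \<bullet> fst q"
  by (simp add: sy_def cdot_conj_def inner_vec_def sum_subtractf)

lemma int_points_prod: "{(a, b). \<forall>j. a $ j \<in> \<int> \<and> b $ j \<in> \<int>} = (int_points :: ((real ^ 'd) \<times> (real ^ 'd)) set)"
proof -
  have "p \<in> int_points \<longleftrightarrow> (\<forall>j. fst p $ j \<in> \<int>) \<and> (\<forall>j. snd p $ j \<in> \<int>)" for p :: "(real ^ 'd) \<times> (real ^ 'd)"
    unfolding int_points_def Basis_prod_def Basis_vec_def by (simp add: ball_Un inner_prod_def inner_axis)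
  then show ?thesis by auto
qed

lemma Gamma_set_lattice: "Gamma_set (lattice A) = (toC \<circ> A) ` int_points"
  unfolding Gamma_set_def lattice_def int_points_prod toC_def[symmetric] by (simp add: image_image)

text \<open>The two compositions have the same translation part and differ by the scalar with phase
  2 pi times the symplectic form. As the shifts act on arbitrary functions here, the constant
  function 1 can test whether that scalar is 1.\<close>

lemma tf_shift_commute_iff:
  fixes l m :: "(real ^ 'd) \<times> (real ^ 'd)"
  shows "tf_shift l \<circ> tf_shift m = tf_shift m \<circ> tf_shift l \<longleftrightarrow> sy (toC m) (toC l) \<in> \<int>"
proof -
  have E: "(tf_shift l \<circ> tf_shift m) f t = cis (2 * pi * ((snd l + snd m) \<bullet> t - snd m \<bullet> fst l)) * f (t - fst l - fst m)"
    for l m :: "(real ^ 'd) \<times> (real ^ 'd)" and f t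
    by (simp add: tf_shift_def cis_conv_exp exp_add[symmetric] inner_add_left inner_diff_right algebra_simps)
  have "(tf_shift l \<circ> tf_shift m) f t = cis (2 * pi * sy (toC m) (toC l)) * (tf_shift m \<circ> tf_shift l) f t" for f t
  proof -
    have "2 * pi * ((snd l + snd m) \<bullet> t - snd m \<bullet> fst l) = 2 * pi * sy (toC m) (toC l) + 2 * pi * ((snd m + snd l) \<bullet> t - snd l \<bullet> fst m)"
      by (simp add: sy_toC algebra_simps inner_commute)
    then have "cis (2 * pi * ((snd l + snd m) \<bullet> t - snd m \<bullet> fst l)) = cis (2 * pi * sy (toC m) (toC l)) * cis (2 * pi * ((snd m + snd l) \<bullet> t - snd l \<bullet> fst m))"
      by (simp only: cis_mult)
    moreover have "t - fst l - fst m = t - fst m - fst l" by simp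
    ultimately show ?thesis unfolding E by (simp only: mult.assoc)
  qed
  note sw = this
  show ?thesis
  proof
    assume "sy (toC m) (toC l) \<in> \<int>"
    then have "cis (2 * pi * sy (toC m) (toC l)) = 1" by (rule cis_multiple_2pi)
    then show "tf_shift l \<circ> tf_shift m = tf_shift m \<circ> tf_shift l" using sw by (intro ext) simp
  next
    assume eq: "tf_shift l \<circ> tf_shift m = tf_shift m \<circ> tf_shift l"
    have "(tf_shift m \<circ> tf_shift l) (\<lambda>_. 1) 0 \<noteq> 0" unfolding E by simp
    then have "cis (2 * pi * sy (toC m) (toC l)) = 1" using sw[of "\<lambda>_. 1" 0] unfolding eq by simp
    then have "cos (2 * pi * sy (toC m) (toC l)) = 1" by (simp add: cis.ctr complex_eq_iff)
    then obtain k :: int where "2 * pi * sy (toC m) (toC l) = of_int k * 2 * pi" by (auto simp: cos_one_2pi_int)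
    then show "sy (toC m) (toC l) \<in> \<int>" by simp
  qed
qed

theorem theorem5:
  fixes n :: "nat ^ 'd" and A :: "(real ^ 'd) \<times> (real ^ 'd) \<Rightarrow> (real ^ 'd) \<times> (real ^ 'd)"
  assumes "\<forall>j. n $ j \<ge> 1"
    and "linear A" and "bij A"
  shows "interpolating n (Gamma_set (lattice A)) \<longleftrightarrow>
         multiple_sampling n (Gamma_set (adjoint_lattice (lattice A)))"
proof -
  define B where "B = toC \<circ> A"
  have B: "linear B" "bij B"
    unfolding B_def using assms(2,3) linear_toC bij_toC by (auto intro: linear_compose bij_comp)
  have BinvB: "B (inv B z) = z" and invBB: "inv B (B x) = x" for z x
    using B by (simp_all add: bij_is_surj surj_f_inv_f bij_is_inj)
  have invB: "linear (inv B)"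
    by (rule linearI; rule injD[OF bij_is_inj[OF B(2)]]) (simp_all add: BinvB linear_add[OF B(1)] linear_scale[OF B(1)])
  \<comment> \<open>Multiplication by -i turns the symplectic form into the Euclidean inner product,
    so the symplectic dual is -i times the transposed inverse of \<open>B\<close>.\<close>
  define B0 where "B0 m = (\<chi> j. - \<i> * adjoint (inv B) m $ j)" for m
  have rot: "sy (\<chi> j. - \<i> * z $ j) w = z \<bullet> w" for z w :: "complex ^ 'd"
    by (simp add: sy_def cdot_conj_def inner_vec_def inner_complex_def add.commute)
  have pairing: "sy (B0 m) (B x) = m \<bullet> x" for m x
    unfolding B0_def rot using adjoint_works[OF invB, of "B x" m] by (simp add: invBB inner_commute)
  have nondeg: "w = w'" if "\<And>x. sy w (B x) = sy w' (B x)" for w w'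
  proof -
    \<comment> \<open>Testing against this rotated difference makes the symplectic pairing equal to
      |w - w'|^2.\<close>
    define z where "z = (\<chi> j. \<i> * (w - w') $ j)"
    have "(\<chi> j. - \<i> * z $ j) = w - w'" by (simp add: z_def vec_eq_iff)
    then have "z \<bullet> z = sy (w - w') (B (inv B z))" using rot[of z z] by (simp add: BinvB)
    also have "\<dots> = 0" using that by (simp add: sy_diff_left)
    finally show ?thesis by (simp add: z_def vec_eq_iff)
  qed
  have linB0: "linear B0"
    by (rule linearI) (simp_all add: B0_def vec_eq_iff linear_add[OF adjoint_linear[OF invB]] linear_scale[OF adjoint_linear[OF invB]] algebra_simps)
  \<comment> \<open>Coordinates with respect to the dual basis are read off by pairing with the
    basis of the original lattice; nondegeneracy then shows that they recover
    \<open>w\<close>.\<close>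
  define rep where "rep w = (\<Sum>b\<in>Basis. sy w (B b) *\<^sub>R b)" for w
  have rep_b: "rep w \<bullet> b = sy w (B b)" if "b \<in> Basis" for w b
    using that by (simp add: rep_def inner_sum_left inner_Basis if_distrib sum.delta cong: if_cong)
  have B0_rep: "B0 (rep w) = w" for w
  proof (rule nondeg)
    fix x
    have "sy w (B x) = sy w (\<Sum>b\<in>Basis. (x \<bullet> b) *\<^sub>R B b)"
      by (subst euclidean_representation[of x, symmetric]) (simp only: linear_sum[OF B(1)] linear_scale[OF B(1)])
    also have "\<dots> = (\<Sum>b\<in>Basis. (x \<bullet> b) * sy w (B b))"
      by (simp add: linear_sum[OF linear_sy] linear_scale[OF linear_sy])
    also have "\<dots> = rep w \<bullet> x"
      by (subst euclidean_inner) (simp add: rep_b mult.commute)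
    finally show "sy (B0 (rep w)) (B x) = sy w (B x)" by (simp add: pairing)
  qed
  have bijB0: "bij B0"
  proof (rule bijI')
    show "B0 m = B0 m' \<longleftrightarrow> m = m'" for m m'
    proof
      assume "B0 m = B0 m'"
      then have "m \<bullet> x = m' \<bullet> x" for x using pairing[of m x] pairing[of m' x] by simp
      then show "m = m'" by (simp add: euclidean_eq_iff[of m m'])
    qed simp
    show "\<exists>m. w = B0 m" for w using B0_rep[of w] by metis
  qed
  have "Gamma_set (adjoint_lattice (lattice A)) = {w. \<forall>x\<in>int_points. sy w (B x) \<in> \<int>}"
  proof -
    have "adjoint_lattice (lattice A) = {m. \<forall>x\<in>int_points. sy (toC m) (B x) \<in> \<int>}"
      unfolding adjoint_lattice_def tf_shift_commute_iff lattice_def int_points_prod B_def by simp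
    then show ?thesis
      unfolding Gamma_set_def toC_def[symmetric] using bij_is_surj[OF bij_toC] by (auto simp: surj_def image_iff)
  qed
  \<comment> \<open>Integrality of the pairings with all lattice points is tested on the basis
    vectors, where they are the dual coordinates; the converse is integrality of inner products of
    integer vectors.\<close>
  also have "\<dots> = B0 ` int_points"
  proof (intro set_eqI iffI)
    fix w assume w: "w \<in> {w. \<forall>x\<in>int_points. sy w (B x) \<in> \<int>}"
    have "rep w \<in> int_points"
      using w by (auto simp: int_points_def rep_b inner_Basis)
    then show "w \<in> B0 ` int_points" using B0_rep[of w] by (metis image_eqI)
  qed (use pairing int_points_inner in fastforce)
  finally have G0: "Gamma_set (adjoint_lattice (lattice A)) = B0 ` int_points" .
  obtain e :: "nat \<Rightarrow> (real ^ 'd) \<times> (real ^ 'd)" where e: "bij_betw e UNIV int_points"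
    by (rule int_points_enumeration)
  interpret weyl_dual B B0 e
    by (rule weyl_dual.intro) (fact B linB0 bijB0 e pairing)+
  show ?thesis
    unfolding G0 Gamma_set_lattice B_def[symmetric] by (rule interpolating_iff_multiple_sampling[OF assms(1)])
qed

end
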